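(* Let $\alpha\in\mathcal{A}$ and $p\in(2,4)$ be fixed. Then there exists $m_0>0$ such that for every $m>m_0$ the ground states of $$-\Delta u+\alpha^2\partial_\theta^2u+mu=|u|^{p-2}u\ \text{ in }\mathbf{B},\qquad u=0\ \text{ on }\partial\mathbf{B}$$ are nonradial.
   Context: All functions are real-valued. $\mathbb{N}=\{1,2,\dots\}$, $\mathbb{N}_0=\mathbb{N}\cup\{0\}$. $\mathbf{B}\subset\mathbb{R}^2$ is the open unit disk, $(r,\theta)$ polar coordinates, $\partial_\theta=x_1\partial_{x_2}-x_2\partial_{x_1}$. $j_{\ell,k}$ is the $k$-th positive zero of the Bessel function $J_\ell$. The functions $\varphi_{\ell,k}=A_{\ell,k}\cos(\ell\theta)J_\ell(j_{\ell,k}r)$ and $\psi_{\ell,k}=B_{\ell,k}\sin(\ell\theta)J_\ell(j_{\ell,k}r)$ (with $\psi_{0,k}:=0$), normalized in $L^2(\mathbf{B})$ by constants $A_{\ell,k},B_{\ell,k}>0$, form an orthonormal basis of $L^2(\mathbf{B})$ of Dirichlet eigenfunctions of $-\Delta$. Write $\langle\cdot,\cdot\rangle$ for the $L^2(\mathbf{B})$ inner product. For $\alpha>1$, $m\in\mathbb{R}$ let $\mathcal{I}^+_{\alpha,m},\mathcal{I}^0_{\alpha,m},\mathcal{I}^-_{\alpha,m}$ be the sets of $(\ell,k)\in\mathbb{N}_0\times\mathbb{N}$ with $j_{\ell,k}^2-\alpha^2\ell^2+m$ positive, zero, negative, respectively, and $$\mathcal{A}=\Big\{\alpha>1:\ |\mathcal{I}^0_{\alpha,0}|<\infty\text{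 and }\inf_{(\ell,k)\notin\mathcal{I}^0_{\alpha,0}}|j_{\ell,k}-\alpha\ell|>0\Big\}.$$ For $\alpha\in\mathcal{A}$, $m\in\mathbb{R}$ let $$E_{\alpha,m}=\Big\{u\in L^2(\mathbf{B}):\sum_{\ell=0}^\infty\sum_{k=1}^\infty|j_{\ell,k}^2-\alpha^2\ell^2+m|\big(|\langle u,\varphi_{\ell,k}\rangle|^2+|\langle u,\psi_{\ell,k}\rangle|^2\big)<\infty\Big\}$$ with the scalar product $$\langle u,v\rangle_{\alpha,m}=\sum_{\ell,k}|j_{\ell,k}^2-\alpha^2\ell^2+m|\big(\langle u,\varphi_{\ell,k}\rangle\langle v,\varphi_{\ell,k}\rangle+\langle u,\psi_{\ell,k}\rangle\langle v,\psi_{\ell,k}\rangle\big)+\sum_{(\ell,k)\in\mathcal{I}^0_{\alpha,m}}\big(\langle u,\varphi_{\ell,k}\rangle\langle v,\varphi_{\ell,k}\rangle+\langle u,\psi_{\ell,k}\rangle\langle v,\psi_{\ell,k}\rangle\big)$$ and norm $\|\cdot\|_{\alpha,m}$. For $\bullet\in\{+,0,-\}$ let $E^\bullet_{\alpha,m}$ be the subspace of $u\in E_{\alpha,m}$ with $\langle u,\varphi_{\ell,k}\rangle=\langle u,\psi_{\ell,k}\rangle=0$ for all $(\ell,k)\notin\mathcal{I}^\bullet_{\alpha,m}$; then $E_{\alpha,m}=E^+_{\alpha,m}\oplus F_{\alpha,m}$ with $F_{\alpha,m}=E^0_{\alpha,m}\oplus E^-_{\alpha,m}$, and one writes $u=u^++u^0+u^-$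 accordingly. For $p\in(2,4)$, $E_{\alpha,m}\subset L^p(\mathbf{B})$ and $$\Phi_{\alpha,m}:E_{\alpha,m}\to\mathbb{R},\quad\Phi_{\alpha,m}(u)=\tfrac12\|u^+\|_{\alpha,m}^2-\tfrac12\|u^-\|_{\alpha,m}^2-\tfrac1p\int_{\mathbf{B}}|u|^p\,dx.$$ The generalized Nehari manifold is $$\mathcal{N}_{\alpha,m}=\{u\in E_{\alpha,m}\setminus F_{\alpha,m}:\Phi_{\alpha,m}'(u)u=0\text{ and }\Phi_{\alpha,m}'(u)v=0\text{ for all }v\in F_{\alpha,m}\},$$ and $c_{\alpha,m}=\inf_{\mathcal{N}_{\alpha,m}}\Phi_{\alpha,m}$. A ground state (ground state solution) of the boundary value problem is a critical point $u\in E_{\alpha,m}$ of $\Phi_{\alpha,m}$ with $\Phi_{\alpha,m}(u)=c_{\alpha,m}$. Nonradial means not a radially symmetric function. *)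

theory Defs
  imports "HOL-Analysis.Analysis"
begin

subsection \<open>Bessel functions and their zeros\<close>

definition bessel_J :: "nat \<Rightarrow> real \<Rightarrow> real" where
  "bessel_J l x = (\<Sum>n. (-1) ^ n / (fact n * fact (n + l)) * (x / 2) ^ (2 * n + l))"

text \<open>For \<open>k \<ge> 1\<close>, the \<open>k\<close>-th positive zero is the positive zero \<open>x\<close> for which \<open>(0, x]\<close> contains
  exactly \<open>k\<close> zeros. The value at \<open>k = 0\<close> is irrelevant: all index sets below require \<open>k \<ge> 1\<close>.\<close>

definition bessel_zero :: "nat \<Rightarrow> nat \<Rightarrow> real" where
  "bessel_zero l k =
     (THE x. 0 < x \<and> bessel_J l x = 0 \<and> card {y. 0 < y \<and> y \<le> x \<and> bessel_J l y = 0} = k)"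


subsection \<open>The space \<open>L\<^sup>2\<close> on the unit disk\<close>

text \<open>Elements of function spaces on the disk are represented by functions on the whole plane;
  values outside the disk and on null sets play no role.\<close>

abbreviation disk :: "(real^2) set" where
  "disk \<equiv> ball 0 1"

abbreviation disk_measure :: "(real^2) measure" where
  "disk_measure \<equiv> lebesgue_on disk"

definition L2_disk :: "(real^2 \<Rightarrow> real) set" where
  "L2_disk = {u. u \<in> borel_measurable disk_measure \<and> integrable disk_measure (\<lambda>x. (u x)\<^sup>2)}"

definition L2_inner :: "(real^2 \<Rightarrow> real) \<Rightarrow> (real^2 \<Rightarrow> real) \<Rightarrow> real" where
  "L2_inner u v = (\<integral>x. u x * v x \<partial>disk_measure)"

definition L2_normalize :: "(real^2 \<Rightarrow> real) \<Rightarrow> real^2 \<Rightarrow> real" where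
  "L2_normalize u = (\<lambda>x. 1 / sqrt (L2_inner u u) * u x)"

definition radial :: "(real^2 \<Rightarrow> real) \<Rightarrow> bool" where
  "radial u \<longleftrightarrow> (\<exists>f :: real \<Rightarrow> real. AE x in disk_measure. u x = f (norm x))"


subsection \<open>Dirichlet eigenfunctions\<close>

definition polar_angle :: "real^2 \<Rightarrow> real" where
  "polar_angle x = Arg (Complex (x $ 1) (x $ 2))"

definition eig_cos :: "nat \<Rightarrow> nat \<Rightarrow> real^2 \<Rightarrow> real" where
  "eig_cos l k =
     L2_normalize (\<lambda>x. cos (real l * polar_angle x) * bessel_J l (bessel_zero l k * norm x))"

definition eig_sin :: "nat \<Rightarrow> nat \<Rightarrow> real^2 \<Rightarrow> real" where
  "eig_sin l k =
     (if l = 0 then (\<lambda>x. 0)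
      else L2_normalize (\<lambda>x. sin (real l * polar_angle x) * bessel_J l (bessel_zero l k * norm x)))"


subsection \<open>Index sets and admissible \<open>\<alpha>\<close>\<close>

definition modes :: "(nat \<times> nat) set" where
  "modes = UNIV \<times> {1..}"

definition symb :: "real \<Rightarrow> real \<Rightarrow> nat \<Rightarrow> nat \<Rightarrow> real" where
  "symb \<alpha> m l k = (bessel_zero l k)\<^sup>2 - \<alpha>\<^sup>2 * (real l)\<^sup>2 + m"

definition modes_pos :: "real \<Rightarrow> real \<Rightarrow> (nat \<times> nat) set" where
  "modes_pos \<alpha> m = {(l, k) \<in> modes. symb \<alpha> m l k > 0}"

definition modes_zero :: "real \<Rightarrow> real \<Rightarrow> (nat \<times> nat) set" where
  "modes_zero \<alpha> m = {(l, k) \<in> modes. symb \<alpha> m l k = 0}"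

definition modes_neg :: "real \<Rightarrow> real \<Rightarrow> (nat \<times> nat) set" where
  "modes_neg \<alpha> m = {(l, k) \<in> modes. symb \<alpha> m l k < 0}"

definition admissible :: "real set" where
  "admissible = {\<alpha>. 1 < \<alpha> \<and> finite (modes_zero \<alpha> 0) \<and>
     (INF (l, k) \<in> modes - modes_zero \<alpha> 0. \<bar>bessel_zero l k - \<alpha> * real l\<bar>) > 0}"


subsection \<open>The Hilbert space \<open>E\<close> and its decomposition\<close>

definition mode_prod :: "(real^2 \<Rightarrow> real) \<Rightarrow> (real^2 \<Rightarrow> real) \<Rightarrow> nat \<Rightarrow> nat \<Rightarrow> real" where
  "mode_prod u v l k =
     L2_inner u (eig_cos l k) * L2_inner v (eig_cos l k)
     + L2_inner u (eig_sin l k) * L2_inner v (eig_sin l k)"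

definition E_space :: "real \<Rightarrow> real \<Rightarrow> (real^2 \<Rightarrow> real) set" where
  "E_space \<alpha> m =
     {u \<in> L2_disk. (\<lambda>(l, k). \<bar>symb \<alpha> m l k\<bar> * mode_prod u u l k) summable_on modes}"

definition E_inner :: "real \<Rightarrow> real \<Rightarrow> (real^2 \<Rightarrow> real) \<Rightarrow> (real^2 \<Rightarrow> real) \<Rightarrow> real" where
  "E_inner \<alpha> m u v =
     (\<Sum>\<^sub>\<infinity>(l, k)\<in>modes. \<bar>symb \<alpha> m l k\<bar> * mode_prod u v l k)
     + (\<Sum>\<^sub>\<infinity>(l, k)\<in>modes_zero \<alpha> m. mode_prod u v l k)"

definition E_norm :: "real \<Rightarrow> real \<Rightarrow> (real^2 \<Rightarrow> real) \<Rightarrow> real" where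
  "E_norm \<alpha> m u = sqrt (E_inner \<alpha> m u u)"

definition E_part :: "real \<Rightarrow> real \<Rightarrow> (nat \<times> nat) set \<Rightarrow> (real^2 \<Rightarrow> real) set" where
  "E_part \<alpha> m I = {u \<in> E_space \<alpha> m.
     \<forall>(l, k) \<in> modes - I. L2_inner u (eig_cos l k) = 0 \<and> L2_inner u (eig_sin l k) = 0}"

definition E_pos :: "real \<Rightarrow> real \<Rightarrow> (real^2 \<Rightarrow> real) set" where
  "E_pos \<alpha> m = E_part \<alpha> m (modes_pos \<alpha> m)"

definition E_zero :: "real \<Rightarrow> real \<Rightarrow> (real^2 \<Rightarrow> real) set" where
  "E_zero \<alpha> m = E_part \<alpha> m (modes_zero \<alpha> m)"

definition E_neg :: "real \<Rightarrow> real \<Rightarrow> (real^2 \<Rightarrow> real) set" where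
  "E_neg \<alpha> m = E_part \<alpha> m (modes_neg \<alpha> m)"

definition F_space :: "real \<Rightarrow> real \<Rightarrow> (real^2 \<Rightarrow> real) set" where
  "F_space \<alpha> m = {u \<in> E_space \<alpha> m. \<exists>v \<in> E_zero \<alpha> m. \<exists>w \<in> E_neg \<alpha> m.
     AE x in disk_measure. u x = v x + w x}"

definition E_decomp ::
  "real \<Rightarrow> real \<Rightarrow> (real^2 \<Rightarrow> real) \<Rightarrow> (real^2 \<Rightarrow> real) \<Rightarrow> (real^2 \<Rightarrow> real) \<Rightarrow> (real^2 \<Rightarrow> real) \<Rightarrow> bool"
where
  "E_decomp \<alpha> m u a b c \<longleftrightarrow> a \<in> E_pos \<alpha> m \<and> b \<in> E_zero \<alpha> m \<and> c \<in> E_neg \<alpha> m \<and>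
     (AE x in disk_measure. u x = a x + b x + c x)"

text \<open>The components of \<open>u\<close> are determined up to null sets, so that \<open>E_norm\<close> does not depend on the
  representatives chosen here.\<close>

definition pos_part :: "real \<Rightarrow> real \<Rightarrow> (real^2 \<Rightarrow> real) \<Rightarrow> real^2 \<Rightarrow> real" where
  "pos_part \<alpha> m u = (SOME a. \<exists>b c. E_decomp \<alpha> m u a b c)"

definition neg_part :: "real \<Rightarrow> real \<Rightarrow> (real^2 \<Rightarrow> real) \<Rightarrow> real^2 \<Rightarrow> real" where
  "neg_part \<alpha> m u = (SOME c. \<exists>a b. E_decomp \<alpha> m u a b c)"


subsection \<open>Energy functional and ground states\<close>

definition energy :: "real \<Rightarrow> real \<Rightarrow> real \<Rightarrow> (real^2 \<Rightarrow> real) \<Rightarrow> real" where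
  "energy p \<alpha> m u =
     1 / 2 * (E_norm \<alpha> m (pos_part \<alpha> m u))\<^sup>2 - 1 / 2 * (E_norm \<alpha> m (neg_part \<alpha> m u))\<^sup>2
     - 1 / p * (\<integral>x. \<bar>u x\<bar> powr p \<partial>disk_measure)"

text \<open>Frechet differentiability with respect to \<open>E_norm\<close>. The library notion \<open>has_derivative\<close> is not
  applicable because \<open>E_space \<alpha> m\<close> is a set depending on parameters rather than a normed type. Only
  the values of \<open>L\<close> on \<open>E_space \<alpha> m\<close> matter, and there \<open>L\<close> is unique.\<close>

definition has_E_derivative ::
  "real \<Rightarrow> real \<Rightarrow> ((real^2 \<Rightarrow> real) \<Rightarrow> real) \<Rightarrow> (real^2 \<Rightarrow> real) \<Rightarrow> ((real^2 \<Rightarrow> real) \<Rightarrow> real) \<Rightarrow> bool"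
where
  "has_E_derivative \<alpha> m G u L \<longleftrightarrow>
     (\<forall>v \<in> E_space \<alpha> m. \<forall>w \<in> E_space \<alpha> m. L (\<lambda>x. v x + w x) = L v + L w) \<and>
     (\<forall>c. \<forall>v \<in> E_space \<alpha> m. L (\<lambda>x. c * v x) = c * L v) \<and>
     (\<exists>C. \<forall>v \<in> E_space \<alpha> m. \<bar>L v\<bar> \<le> C * E_norm \<alpha> m v) \<and>
     (\<forall>\<epsilon>>0. \<exists>\<delta>>0. \<forall>v \<in> E_space \<alpha> m. E_norm \<alpha> m v < \<delta> \<longrightarrow>
        \<bar>G (\<lambda>x. u x + v x) - G u - L v\<bar> \<le> \<epsilon> * E_norm \<alpha> m v)"

definition nehari :: "real \<Rightarrow> real \<Rightarrow> real \<Rightarrow> (real^2 \<Rightarrow> real) set" where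
  "nehari p \<alpha> m = {u \<in> E_space \<alpha> m - F_space \<alpha> m.
     \<exists>L. has_E_derivative \<alpha> m (energy p \<alpha> m) u L \<and> L u = 0 \<and> (\<forall>v \<in> F_space \<alpha> m. L v = 0)}"

definition ground_level :: "real \<Rightarrow> real \<Rightarrow> real \<Rightarrow> real" where
  "ground_level p \<alpha> m = (INF u \<in> nehari p \<alpha> m. energy p \<alpha> m u)"

definition critical_point :: "real \<Rightarrow> real \<Rightarrow> real \<Rightarrow> (real^2 \<Rightarrow> real) \<Rightarrow> bool" where
  "critical_point p \<alpha> m u \<longleftrightarrow> u \<in> E_space \<alpha> m \<and>
     (\<exists>L. has_E_derivative \<alpha> m (energy p \<alpha> m) u L \<and> (\<forall>v \<in> E_space \<alpha> m. L v = 0))"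

text \<open>Ground states of \<open>- \<Delta>u + \<alpha>\<^sup>2 \<partial>\<^sub>\<theta>\<^sup>2 u + m u = \<bar>u\<bar>\<^bsup>p - 2\<^esup> u\<close> in the unit disk with Dirichlet boundary
  condition; the quadratic form of the left-hand side is diagonal in \<open>eig_cos\<close>, \<open>eig_sin\<close> with
  eigenvalues \<open>symb \<alpha> m l k\<close>.\<close>

definition ground_state :: "real \<Rightarrow> real \<Rightarrow> real \<Rightarrow> (real^2 \<Rightarrow> real) \<Rightarrow> bool" where
  "ground_state p \<alpha> m u \<longleftrightarrow> critical_point p \<alpha> m u \<and> energy p \<alpha> m u = ground_level p \<alpha> m"

end

theory Submission
  imports Defs
begin

text \<open>Write \<open>j\<^bsub>l,k\<^esub>\<^sup>2 - \<alpha>\<^sup>2 l\<^sup>2 + m\<close> for the eigenvalues of the operator. A radial critical point only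
  involves the modes with \<open>l = 0\<close>, on which the quadratic form dominates \<open>\<parallel>\<nabla>u\<parallel>\<^sup>2 + m \<parallel>u\<parallel>\<^sup>2\<close>.
  Since this form equals \<open>S = \<integral>|u|\<^sup>p\<close>, we get \<open>\<integral>u\<^sup>2 \<le> S / m\<close>, and the Ladyzhenskaya inequality gives
  \<open>\<integral>u\<^sup>4 \<le> C S\<^sup>2 / m\<close>. Interpolating \<open>|u|\<^sup>p\<close> between \<open>u\<^sup>2\<close> and \<open>u\<^sup>4\<close> forces \<open>S \<ge> c m\<^bsup>2/(p-2)\<^esup>\<close>, so that
  the energy of \<open>u\<close> is at least of this order.

  On the other hand, the ground level is at most the maximum of the energy over the span of the
  nonpositive modes and any single mode with positive eigenvalue \<open>\<sigma>\<close>, which is at most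
  \<open>C \<sigma>\<^bsup>p/(p-2)\<^esup>\<close>. Since \<open>j\<^bsub>l,1\<^esub> - l = o(l)\<close> and \<open>\<alpha> > 1\<close>, the last value before
  the first sign change of \<open>l \<mapsto> j\<^bsub>l,1\<^esub>\<^sup>2 - \<alpha>\<^sup>2 l\<^sup>2 + m\<close> is \<open>O(\<surd>m)\<close>. Hence the ground level is
  \<open>O(m\<^bsup>p/(2(p-2))\<^esup>)\<close>, and \<open>p / 2 < 2\<close>.

  The Sobolev embedding of the energy space need not be known in advance: it follows from the
  differentiability of the energy at a critical point. The completeness of the modes follows
  from a Green operator argument.\<close>

subsection \<open>Bessel functions\<close>

text \<open>Two points shape the argument. The quadratic form is negative on infinitely many modes,
  so the upper bound for the ground level needs a maximizer over an infinite-dimensional space;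
  Clarkson's inequality makes maximizing sequences Cauchy there. Moreover the ground level is an
  infimum of reals, meaningful only once the Nehari set is nonempty with energies bounded below.
  Both are proved, and the positivity of the lower bound also excludes the radial critical point 0.

  Embedding and completeness are intertwined. The norm of the energy space sees only mode
  coefficients, and the integral of |v|^p is a mere default value 0 when v is not p-integrable.
  Differentiability therefore first controls only functions already known to be p-integrable. A
  bounded function orthogonal to all modes is such a function and has norm 0, so it vanishes; the
  Green operator, which maps L^2 into bounded functions, extends this to L^2. Completeness then
  makes finite sums of modes converge a.e. to a given function, and this removes the
  restriction.\<close>

definition bes :: "nat \<Rightarrow> real \<Rightarrow> real" where
  "bes l y = (\<Sum>n. (-1) ^ n / (fact n * fact (n + l)) * y ^ n)"

lemma summable_bes: "summable (\<lambda>n. (-1) ^ n / (fact n * fact (n + l)) * (y::real) ^ n)"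
proof (rule summable_comparison_test_ev)
  show "summable (\<lambda>n. inverse (fact n) * \<bar>y\<bar> ^ n)"
    using summable_exp[of "\<bar>y\<bar>"] by simp
  show "\<forall>\<^sub>F n in sequentially. norm ((-1) ^ n / (fact n * fact (n + l)) * y ^ n) \<le> inverse (fact n) * \<bar>y\<bar> ^ n"
  proof (rule always_eventually, rule allI)
    fix n
    have "(1::real) \<le> fact (n + l)" by simp
    then have "(1::real) / (fact n * fact (n+l)) \<le> 1 / fact n"
      by (intro divide_left_mono) auto
    from mult_right_mono[OF this, of "\<bar>y\<bar> ^ n"]
    show "norm ((-1) ^ n / (fact n * fact (n + l)) * y ^ n) \<le> inverse (fact n) * \<bar>y\<bar> ^ n"
      by (simp add: abs_mult power_abs inverse_eq_divide)
  qed
qed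

text \<open>Splitting off (x/2)^l leaves an entire function of y = (x/2)^2 that is nonzero at 0 and
  whose derivative is of the same kind: \<open>bes l\<close> has derivative
  \<open>- bes (Suc l)\<close>, without any division by x.\<close>

lemma bessel_J_eq_bes: "bessel_J l x = (x / 2) ^ l * bes l ((x / 2)\<^sup>2)"
proof -
  have "(x / 2) ^ l * bes l ((x / 2)\<^sup>2)
     = (\<Sum>n. (x / 2) ^ l * ((-1) ^ n / (fact n * fact (n + l)) * ((x / 2)\<^sup>2) ^ n))"
    unfolding bes_def by (rule suminf_mult[symmetric, OF summable_bes])
  also have "\<dots> = bessel_J l x"
  proof -
    have "(x / 2) ^ (2 * n + l) = (x / 2) ^ l * ((x / 2)\<^sup>2) ^ n" for n
      by (metis power_add power_mult mult.commute)
    then show ?thesis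
      unfolding bessel_J_def by (intro suminf_cong) (simp only: mult.left_commute)
  qed
  finally show ?thesis ..
qed

lemma has_real_derivative_bes: "(bes l has_real_derivative - bes (Suc l) y) (at y)"
proof -
  let ?c = "\<lambda>n. (-1) ^ n / (fact n * fact (n + l)) :: real"
  have "((\<lambda>y. \<Sum>n. ?c n * y ^ n) has_real_derivative (\<Sum>n. diffs ?c n * y ^ n)) (at y)"
    by (rule termdiffs_strong_converges_everywhere) (rule summable_bes)
  moreover have "(\<Sum>n. diffs ?c n * y ^ n) = - bes (Suc l) y"
  proof -
    have "diffs ?c n * y ^ n = - ((-1) ^ n / (fact n * fact (n + Suc l)) * y ^ n)" for n
      by (simp add: diffs_def field_simps del: of_nat_Suc)
    then show ?thesis
      unfolding bes_def by (simp only: suminf_minus[OF summable_bes[of "Suc l"]])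
  qed
  ultimately show ?thesis
    unfolding bes_def[abs_def] by simp
qed

text \<open>This is J_{l+2} = (2(l+1)/x) J_{l+1} - J_l with the denominators cleared; it holds
  coefficient by coefficient.\<close>

lemma bes_recurrence: "y * bes (Suc (Suc l)) y = (real l + 1) * bes (Suc l) y - bes l y"
proof -
  let ?a = "\<lambda>l n. (-1) ^ n / (fact n * fact (n + l)) * y ^ n :: real"
  have s: "?a l sums bes l y" for l
    unfolding bes_def by (rule summable_sums[OF summable_bes])
  have "(\<lambda>n. (real l + 1) * ?a (Suc l) n - ?a l n) sums ((real l + 1) * bes (Suc l) y - bes l y)"
    by (intro sums_diff sums_mult s)
  moreover have "(\<lambda>n. (real l + 1) * ?a (Suc l) n - ?a l n) sums (y * bes (Suc (Suc l)) y)"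
  proof -
    have "(real l + 1) * ?a (Suc l) (Suc n) - ?a l (Suc n) = y * ?a (Suc (Suc l)) n" for n
    proof -
      have "(fact (Suc n + Suc l) :: real) = (real n + real l + 2) * fact (n + l + 1)"
        by (simp add: algebra_simps)
      moreover have "(fact (Suc n) :: real) = (real n + 1) * fact n" by simp
      moreover have "(fact (Suc n + l) :: real) = fact (n + l + 1)" "(fact (n + Suc (Suc l)) :: real) = (real n + real l + 2) * fact (n + l + 1)"
        by (simp_all add: algebra_simps)
      moreover have "real n + real l + 2 \<noteq> 0" "real n + 1 \<noteq> 0" by linarith+
      ultimately show ?thesis
        by (simp add: divide_simps del: fact_Suc) (simp add: algebra_simps)
    qed
    then have "(\<lambda>n. (real l + 1) * ?a (Suc l) (Suc n) - ?a l (Suc n)) sums (y * bes (Suc (Suc l)) y)"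
      using sums_mult[OF s[of "Suc (Suc l)"], of y] by (simp only:)
    \<comment> \<open>The factor y on the left raises all degrees by one, so the constant term on
      the right has to cancel before the index shift.\<close>
    moreover have "(real l + 1) * ?a (Suc l) 0 - ?a l 0 = 0"
    proof -
      have "fact l + fact l * real l \<noteq> 0"
        by (metis (no_types) add.commute fact_nonzero mult.commute mult.right_neutral mult_eq_0_iff distrib_left of_nat_Suc of_nat_0_eq_iff nat.distinct(1))
      then show ?thesis by (simp add: field_simps)
    qed
    ultimately show ?thesis
      using sums_Suc_iff[of "\<lambda>n. (real l + 1) * ?a (Suc l) n - ?a l n"] by (simp only: add_0_right)
  qed
  ultimately show ?thesis
    by (rule sums_unique2[symmetric])
qed

lemma bes_0_pos: "bes l 0 > 0"
proof -
  have "bes l 0 = 1 / fact l"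
    unfolding bes_def using powser_zero[of "\<lambda>n. (-1) ^ n / (fact n * fact (n + l)) :: real"] by simp
  then show ?thesis by simp
qed

text \<open>The constant term of l! \<open>bes l\<close> is 1, and every later coefficient carries
  an extra factor 1/(l+1). For fixed y and large l the function therefore cannot vanish at
  y.\<close>

lemma bes_abs_le: "\<bar>bes l y - 1 / fact l\<bar> * fact l \<le> \<bar>y\<bar> * exp \<bar>y\<bar> / (real l + 1)"
proof -
  let ?a = "\<lambda>n. (-1) ^ n / (fact n * fact (n + l)) * y ^ n :: real"
  have s: "?a sums bes l y"
    unfolding bes_def by (rule summable_sums[OF summable_bes])
  then have s1: "(\<lambda>n. ?a (Suc n)) sums (bes l y - 1 / fact l)"
    by (subst sums_Suc_iff) simp
  have e: "(\<lambda>n. \<bar>y\<bar> / (real l + 1) * (\<bar>y\<bar> ^ n / fact n)) sums (\<bar>y\<bar> / (real l + 1) * exp \<bar>y\<bar>)"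
    using sums_mult[OF exp_converges[of "\<bar>y\<bar>"], of "\<bar>y\<bar> / (real l + 1)"] by (simp add: divide_inverse mult.commute)
  have le: "norm (fact l * ?a (Suc n)) \<le> \<bar>y\<bar> / (real l + 1) * (\<bar>y\<bar> ^ n / fact n)" for n
  proof -
    have "(fact (Suc l) :: real) \<le> fact (Suc n + l)"
      by (rule fact_mono) simp
    then have "(real l + 1) * fact l \<le> (fact (Suc n + l) :: real)" by (simp add: algebra_simps)
    moreover have "(fact n :: real) \<le> fact (Suc n)" by (rule fact_mono) simp
    ultimately have "((real l + 1) * fact l) * fact n \<le> (fact (Suc n + l) :: real) * fact (Suc n)"
      by (intro mult_mono) auto
    then have "fact l / (fact (Suc n) * fact (Suc n + l)) \<le> 1 / ((real l + 1) * fact n :: real)"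
      by (simp add: divide_simps del: fact_Suc) (simp add: algebra_simps)
    then have "fact l / (fact (Suc n) * fact (Suc n + l)) * \<bar>y\<bar> ^ Suc n \<le> 1 / ((real l + 1) * fact n) * \<bar>y\<bar> ^ Suc n"
      by (rule mult_right_mono) simp
    then show ?thesis
      by (simp add: abs_mult power_abs mult_ac del: fact_Suc)
  qed
  have "\<bar>fact l * (bes l y - 1 / fact l)\<bar> \<le> \<bar>y\<bar> / (real l + 1) * exp \<bar>y\<bar>"
    using norm_sums_le[OF sums_mult[OF s1, of "fact l"] e le] by simp
  then show ?thesis by (simp add: abs_mult mult.commute)
qed

text \<open>The recurrence would pass a common zero on to all higher orders, where l!
  \<open>bes l y\<close> tends to 1. As \<open>bes (Suc l)\<close> is minus the derivative of
  \<open>bes l\<close>, this says that positive zeros are simple.\<close>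

lemma bes_no_common_zero:
  assumes "y > 0" "bes l y = 0" shows "bes (Suc l) y \<noteq> 0"
proof
  assume "bes (Suc l) y = 0"
  have z: "bes (l + n) y = 0 \<and> bes (Suc (l + n)) y = 0" for n
  proof (induction n)
    case 0 show ?case using assms \<open>bes (Suc l) y = 0\<close> by simp
  next
    case (Suc n)
    then show ?case using bes_recurrence[of y "l + n"] assms by simp
  qed
  obtain n :: nat where n: "real n > \<bar>y\<bar> * exp \<bar>y\<bar>"
    using reals_Archimedean2 by blast
  have "1 \<le> \<bar>y\<bar> * exp \<bar>y\<bar> / (real (l + n) + 1)"
    using bes_abs_le[of "l + n" y] z[of n] by simp
  then have "real (l + n) + 1 \<le> \<bar>y\<bar> * exp \<bar>y\<bar>" by (simp add: field_simps)
  then show False using n by simp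
qed

lemma continuous_bes: "continuous_on A (bes l)"
  by (meson DERIV_continuous_on has_field_derivative_at_within has_real_derivative_bes)

lemma continuous_bes' [continuous_intros]: "continuous_on A f \<Longrightarrow> continuous_on A (\<lambda>x. bes l (f x))"
  by (rule continuous_on_compose2[OF continuous_bes[of UNIV]]) auto

lemmas DERIV_bes [derivative_intros] = DERIV_chain2[OF has_real_derivative_bes]

text \<open>The differential equation \<open>(r\<^bsup>2l+1\<^esup> R')' = - 4 b r\<^bsup>2l+1\<^esup> R\<close> of \<open>R r = bes l (b r\<^sup>2)\<close>,
  split into two first-order identities.\<close>

lemma DERIV_bes_radial:
  "((\<lambda>r. bes l (b * r\<^sup>2)) has_real_derivative - (2 * b * r * bes (Suc l) (b * r\<^sup>2))) (at r)"
  by (auto intro!: derivative_eq_intros)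

lemma DERIV_bes_radial_flux:
  "((\<lambda>r. r ^ (2 * l + 2) * bes (Suc l) (b * r\<^sup>2)) has_real_derivative 2 * r ^ (2 * l + 1) * bes l (b * r\<^sup>2)) (at r)"
proof -
  have "((\<lambda>r. r ^ (2 * l + 2) * bes (Suc l) (b * r\<^sup>2)) has_real_derivative
     real (2 * l + 2) * r ^ (2 * l + 1) * bes (Suc l) (b * r\<^sup>2) - r ^ (2 * l + 2) * (2 * b * r * bes (Suc (Suc l)) (b * r\<^sup>2))) (at r)"
  proof -
    have "((\<lambda>r. r ^ (2 * l + 2)) has_real_derivative real (2 * l + 2) * r ^ (2 * l + 1)) (at r)"
      using DERIV_pow[of "2 * l + 2" r] by simp
    from DERIV_mult[OF this DERIV_bes_radial[of "Suc l" b r]] show ?thesis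
      by (simp add: algebra_simps)
  qed
  moreover have "real (2 * l + 2) * r ^ (2 * l + 1) * bes (Suc l) (b * r\<^sup>2) - r ^ (2 * l + 2) * (2 * b * r * bes (Suc (Suc l)) (b * r\<^sup>2))
     = 2 * r ^ (2 * l + 1) * ((real l + 1) * bes (Suc l) (b * r\<^sup>2) - (b * r\<^sup>2) * bes (Suc (Suc l)) (b * r\<^sup>2))"
    by (simp add: algebra_simps power2_eq_square power_add)
  ultimately show ?thesis
    using bes_recurrence[of "b * r\<^sup>2" l] by simp
qed

subsection \<open>Zeros of Bessel functions\<close>

lemma bessel_J_eq_0_iff: "x > 0 \<Longrightarrow> bessel_J l x = 0 \<longleftrightarrow> bes l ((x / 2)\<^sup>2) = 0"
  by (simp add: bessel_J_eq_bes)

lemma DERIV_bessel_J: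
  assumes "x > 0"
  shows "(bessel_J l has_real_derivative real l / x * bessel_J l x - bessel_J (Suc l) x) (at x)"
proof -
  have "((\<lambda>x. (x / 2) ^ l * bes l ((x / 2)\<^sup>2)) has_real_derivative
      real l * (x / 2) ^ (l - 1) / 2 * bes l ((x / 2)\<^sup>2) - (x / 2) ^ l * (x / 2 * bes (Suc l) ((x / 2)\<^sup>2))) (at x)"
    by (auto intro!: derivative_eq_intros)
  moreover have "real l * (x / 2) ^ (l - 1) / 2 * bes l ((x / 2)\<^sup>2) = real l / x * ((x / 2) ^ l * bes l ((x / 2)\<^sup>2))"
    using assms by (cases l) (auto simp: field_simps)
  ultimately show ?thesis
    by (simp add: bessel_J_eq_bes[abs_def] mult_ac)
qed

lemma bessel_J_recurrence:
  assumes "x > 0"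
  shows "bessel_J (Suc (Suc l)) x = 2 * (real l + 1) / x * bessel_J (Suc l) x - bessel_J l x"
proof -
  have "bessel_J (Suc (Suc l)) x = (x / 2) ^ l * ((x / 2)\<^sup>2 * bes (Suc (Suc l)) ((x / 2)\<^sup>2))"
    by (simp add: bessel_J_eq_bes power2_eq_square mult_ac)
  also have "\<dots> = (x / 2) ^ l * ((real l + 1) * bes (Suc l) ((x / 2)\<^sup>2) - bes l ((x / 2)\<^sup>2))"
    by (simp only: bes_recurrence)
  also have "\<dots> = 2 * (real l + 1) / x * bessel_J (Suc l) x - bessel_J l x"
    using assms by (simp add: bessel_J_eq_bes field_simps)
  finally show ?thesis .
qed

lemma DERIV_bessel_J_Suc:
  assumes "x > 0"
  shows "(bessel_J (Suc l) has_real_derivative bessel_J l x - (real l + 1) / x * bessel_J (Suc l) x) (at x)"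
proof -
  have "real (Suc l) / x * bessel_J (Suc l) x - bessel_J (Suc (Suc l)) x = bessel_J l x - (real l + 1) / x * bessel_J (Suc l) x"
    using bessel_J_recurrence[OF assms, of l] assms by (simp add: field_simps)
  then show ?thesis using DERIV_bessel_J[OF assms, of "Suc l"] by simp
qed

lemma continuous_on_bessel_J: "continuous_on A (bessel_J l)"
  unfolding bessel_J_eq_bes[abs_def] by (intro continuous_intros) auto

text \<open>Infinitely many zeros in a compact interval would accumulate at a zero, which is
  positive because \<open>bes l 0 > 0\<close>, and hence simple; but a simple zero is
  isolated.\<close>

lemma finite_bessel_zeros: "finite {y. 0 < y \<and> y \<le> x \<and> bessel_J l y = 0}"
proof -
  define T where "T = {y \<in> {0..(x / 2)\<^sup>2}. bes l y = 0}"
  have "finite T"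
  proof (rule ccontr)
    assume "infinite T"
    moreover have "T \<subseteq> {0..(x / 2)\<^sup>2}" by (auto simp: T_def)
    ultimately obtain a where a: "a \<in> {0..(x / 2)\<^sup>2}" "a islimpt T"
      using compact_eq_Bolzano_Weierstrass[of "{0..(x / 2)\<^sup>2}"] compact_Icc by blast
    have "closed T"
      unfolding T_def by (rule continuous_closed_preimage_constant) (rule continuous_bes, simp)
    then have "a \<in> T" using a(2) closed_limpt by blast
    then have "bes l a = 0" by (simp add: T_def)
    moreover have "a > 0"
      using bes_0_pos[of l] \<open>bes l a = 0\<close> a(1) by (cases "a = 0") auto
    ultimately have "- bes (Suc l) a \<noteq> 0" using bes_no_common_zero by auto
    moreover have "((\<lambda>y. (bes l y - bes l a) / (y - a)) \<longlongrightarrow> - bes (Suc l) a) (at a)"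
      using has_real_derivative_bes[of l a] by (simp add: has_field_derivative_iff)
    ultimately have "\<forall>\<^sub>F y in at a. (bes l y - bes l a) / (y - a) \<noteq> 0"
      by (rule tendsto_imp_eventually_ne[rotated])
    then have "\<forall>\<^sub>F y in at a. y \<notin> T"
      by eventually_elim (use \<open>bes l a = 0\<close> in \<open>auto simp: T_def\<close>)
    with a(2) show False
      by (auto simp: islimpt_iff_eventually)
  qed
  moreover have "inj_on (\<lambda>y. (y / 2)\<^sup>2) {y. 0 < y \<and> y \<le> x \<and> bessel_J l y = 0}"
    by (rule inj_onI) (simp add: power2_eq_iff_nonneg)
  moreover have "(\<lambda>y. (y / 2)\<^sup>2) ` {y. 0 < y \<and> y \<le> x \<and> bessel_J l y = 0} \<subseteq> T"
  proof clarify
    fix y assume y: "0 < y" "y \<le> x" "bessel_J l y = 0"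
    then have "(y / 2)\<^sup>2 \<le> (x / 2)\<^sup>2" by (intro power_mono) auto
    then show "(y / 2)\<^sup>2 \<in> T" using y bessel_J_eq_0_iff[of y l] unfolding T_def by simp
  qed
  ultimately show ?thesis
    using finite_imageD finite_subset by blast
qed

text \<open>The second derivative of sqrt(x) J_l, with s = sqrt x and with J, K standing for J_l(x),
  J_{l+1}(x). Treating them as free reals leaves an algebraic identity in s and t = 1/s.\<close>

lemma sturm_identity:
  fixes s x l J K \<sigma> :: real
  assumes s: "s > 0" "x = s\<^sup>2"
  shows "\<sigma> * ((l + 1 / 2) * (- (inverse s / 2 * inverse (s\<^sup>2)) * J + (l / x * J - K) * inverse s)
        - (inverse s / 2 * K + (J - (l + 1) / x * K) * s))
      = - (1 - (l\<^sup>2 - 1 / 4) / x\<^sup>2) * (\<sigma> * (s * J))"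
proof -
  define t where "t = inverse s"
  have t: "t\<^sup>2 * s = t" "t ^ 4 * s = t ^ 3"
    using s(1) by (simp_all add: t_def power2_eq_square power3_eq_cube power4_eq_xxxx)
  have "\<sigma> * ((l + 1 / 2) * (- (t / 2 * t\<^sup>2) * J + (l * t\<^sup>2 * J - K) * t)
    - (t / 2 * K + (J - (l + 1) * t\<^sup>2 * K) * s))
    = \<sigma> * ((l\<^sup>2 - 1 / 4) * t ^ 3 * J + (l + 1) * K * (t\<^sup>2 * s - t) - s * J)"
    by (simp add: algebra_simps power2_eq_square power3_eq_cube)
  also have "\<dots> = \<sigma> * ((l\<^sup>2 - 1 / 4) * (t ^ 4 * s) * J - s * J)"
    by (simp only: t diff_self mult_zero_right add_0_right)
  also have "\<dots> = - (1 - (l\<^sup>2 - 1 / 4) * t ^ 4) * (\<sigma> * (s * J))"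
    by (simp add: algebra_simps)
  finally have *: "\<sigma> * ((l + 1 / 2) * (- (t / 2 * t\<^sup>2) * J + (l * t\<^sup>2 * J - K) * t)
    - (t / 2 * K + (J - (l + 1) * t\<^sup>2 * K) * s)) = - (1 - (l\<^sup>2 - 1 / 4) * t ^ 4) * (\<sigma> * (s * J))" .
  have e1: "inverse (s\<^sup>2) = t\<^sup>2" by (simp add: t_def power_inverse)
  have e2: "c / x = c * t\<^sup>2" for c by (simp only: s(2) divide_inverse e1)
  have "inverse (x\<^sup>2) = t ^ 4" by (simp add: s(2) t_def power2_eq_square power4_eq_xxxx)
  then have e3: "c / x\<^sup>2 = c * t ^ 4" for c by (simp only: divide_inverse)
  from * show ?thesis by (simp only: e1 e2 e3 t_def[symmetric])
qed

text \<open>Sturm comparison of \<open>\<surd>x J\<^sub>l(x)\<close>, which solves \<open>v'' + (1 - (l\<^sup>2 - 1/4) / x\<^sup>2) v = 0\<close>,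
  with \<open>sin (\<kappa> (x - a))\<close>.\<close>

lemma bessel_J_sturm:
  assumes a: "a > 0" and k: "\<kappa> > 0" "\<kappa>\<^sup>2 \<le> 1 - (real l)\<^sup>2 / a\<^sup>2"
  shows "\<exists>x. a \<le> x \<and> x \<le> a + pi / \<kappa> \<and> bessel_J l x = 0"
proof (rule ccontr)
  assume contra: "\<not> ?thesis"
  define b where "b = a + pi / \<kappa>"
  have ab: "a < b" using k by (simp add: b_def)
  have nz: "bessel_J l x \<noteq> 0" if "x \<in> {a..b}" for x
    using contra that by (auto simp: b_def)
  \<comment> \<open>Without a zero the sign is constant, and multiplying by it makes v positive on
    the whole interval.\<close>
  define \<sigma> where "\<sigma> = sgn (bessel_J l a)"
  have sg: "\<sigma> * bessel_J l x > 0" if "x \<in> {a..b}" for x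
  proof (rule ccontr)
    assume "\<not> ?thesis"
    then have le: "\<sigma> * bessel_J l x \<le> 0" by simp
    have "\<sigma> * bessel_J l a > 0"
      using nz[of a] ab by (simp add: \<sigma>_def abs_sgn[symmetric] mult.commute[of "sgn _"])
    moreover have "continuous_on {a..x} (\<lambda>x. \<sigma> * bessel_J l x)"
      by (intro continuous_intros continuous_on_bessel_J)
    ultimately have "\<exists>y\<ge>a. y \<le> x \<and> \<sigma> * bessel_J l y = 0"
      using le that by (intro IVT2') auto
    then obtain y where y: "a \<le> y" "y \<le> x" "\<sigma> * bessel_J l y = 0" by blast
    then have "bessel_J l y \<noteq> 0" using nz[of y] that by auto
    moreover have "\<sigma> \<noteq> 0" using nz[of a] ab by (simp add: \<sigma>_def sgn_zero_iff)
    ultimately show False using y(3) by simp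
  qed
  define v where "v x = \<sigma> * (sqrt x * bessel_J l x)" for x
  have vpos: "v x > 0" if "x \<in> {a..b}" for x
  proof -
    have "0 < sqrt x * (\<sigma> * bessel_J l x)"
      by (rule mult_pos_pos[OF _ sg[OF that]]) (use that a in simp)
    then show ?thesis by (simp only: v_def mult.left_commute)
  qed
  \<comment> \<open>The derivative of v, expressed by J_{l+1} so that differentiating once more
    needs only the first-order formulas.\<close>
  define v1 where "v1 x = \<sigma> * ((real l + 1 / 2) / sqrt x * bessel_J l x - sqrt x * bessel_J (Suc l) x)" for x
  have dv: "(v has_real_derivative v1 x) (at x)" if "x > 0" for x
  proof -
    have "(v has_real_derivative \<sigma> * (inverse (sqrt x) / 2 * bessel_J l x + (real l / x * bessel_J l x - bessel_J (Suc l) x) * sqrt x)) (at x)"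
      unfolding v_def
      by (rule DERIV_cmult[OF DERIV_mult[OF DERIV_real_sqrt[OF that] DERIV_bessel_J[OF that]]])
    moreover have "inverse (sqrt x) / 2 * bessel_J l x + (real l / x * bessel_J l x - bessel_J (Suc l) x) * sqrt x
       = (real l + 1 / 2) / sqrt x * bessel_J l x - sqrt x * bessel_J (Suc l) x"
    proof -
      have "sqrt x / x = 1 / sqrt x" using that by (simp add: field_simps)
      moreover have "real l / x * bessel_J l x * sqrt x = real l * bessel_J l x * (sqrt x / x)" by simp
      ultimately have "real l / x * bessel_J l x * sqrt x = real l / sqrt x * bessel_J l x" by simp
      then show ?thesis by (simp add: add_divide_distrib algebra_simps inverse_eq_divide)
    qed
    ultimately show ?thesis by (simp add: v1_def)
  qed
  have dv1: "(v1 has_real_derivative - (1 - ((real l)\<^sup>2 - 1 / 4) / x\<^sup>2) * v x) (at x)" if "x > 0" for x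
  proof -
    define s where "s = sqrt x"
    have s: "s > 0" "x = s\<^sup>2" using that by (simp_all add: s_def)
    have i: "((\<lambda>x. inverse (sqrt x)) has_real_derivative - (inverse s / 2 * inverse (s\<^sup>2))) (at x)"
      using DERIV_inverse'[OF DERIV_real_sqrt[OF that]] s(1)
      by (simp add: s_def[symmetric] power2_eq_square mult_ac)
    have r: "(sqrt has_real_derivative inverse s / 2) (at x)"
      using DERIV_real_sqrt[OF that] by (simp add: s_def)
    have v1_eq: "v1 = (\<lambda>x. \<sigma> * ((real l + 1 / 2) * (inverse (sqrt x) * bessel_J l x) - sqrt x * bessel_J (Suc l) x))"
      by (rule ext) (simp only: v1_def divide_inverse mult.assoc)
    have "(v1 has_real_derivative \<sigma> * ((real l + 1 / 2) * (- (inverse s / 2 * inverse (s\<^sup>2)) * bessel_J l x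
        + (real l / x * bessel_J l x - bessel_J (Suc l) x) * inverse s)
        - (inverse s / 2 * bessel_J (Suc l) x + (bessel_J l x - (real l + 1) / x * bessel_J (Suc l) x) * s))) (at x)"
      unfolding v1_eq unfolding s_def
      by (rule DERIV_cmult[OF DERIV_diff[OF DERIV_cmult[OF DERIV_mult[OF i[unfolded s_def] DERIV_bessel_J[OF that]]]
        DERIV_mult[OF r[unfolded s_def] DERIV_bessel_J_Suc[OF that]]]])
    then show ?thesis
      unfolding v_def s_def[symmetric] sturm_identity[OF s] .
  qed
  \<comment> \<open>Wronskian of v and the sine. On this half period it is nonincreasing, because
    the potential is at least \<kappa>^2 and both factors are nonnegative; at the endpoints, where
    the sine vanishes, it equals -\<kappa> v(a) < 0 and \<kappa> v(b) > 0.\<close>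
  define W where "W x = v1 x * sin (\<kappa> * (x - a)) - v x * (\<kappa> * cos (\<kappa> * (x - a)))" for x
  have "W b \<le> W a"
  proof (rule DERIV_nonpos_imp_nonincreasing[where f = W])
    show "a \<le> b" using ab by simp
    fix x assume x: "a \<le> x" "x \<le> b"
    then have "x > 0" using a by simp
    define q where "q = 1 - ((real l)\<^sup>2 - 1 / 4) / x\<^sup>2"
    have "(W has_real_derivative (- q * v x * sin (\<kappa> * (x - a)) + v1 x * (cos (\<kappa> * (x - a)) * \<kappa>))
       - (v1 x * (\<kappa> * cos (\<kappa> * (x - a))) + v x * (\<kappa> * (- sin (\<kappa> * (x - a)) * \<kappa>)))) (at x)"
      unfolding W_def q_def
      by (rule derivative_eq_intros dv[OF \<open>x > 0\<close>] dv1[OF \<open>x > 0\<close>] refl | simp)+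
    moreover have "(- q * v x * sin (\<kappa> * (x - a)) + v1 x * (cos (\<kappa> * (x - a)) * \<kappa>))
       - (v1 x * (\<kappa> * cos (\<kappa> * (x - a))) + v x * (\<kappa> * (- sin (\<kappa> * (x - a)) * \<kappa>)))
       = - ((q - \<kappa>\<^sup>2) * (v x * sin (\<kappa> * (x - a))))"
      by (simp add: algebra_simps power2_eq_square)
    moreover have "0 \<le> (q - \<kappa>\<^sup>2) * (v x * sin (\<kappa> * (x - a)))"
    proof (intro mult_nonneg_nonneg)
      have "\<kappa> * (x - a) \<le> \<kappa> * (pi / \<kappa>)" using x k by (intro mult_left_mono) (auto simp: b_def)
      then show "sin (\<kappa> * (x - a)) \<ge> 0"
        using x k by (intro sin_ge_zero) auto
      show "v x \<ge> 0"
        using vpos[of x] x by simp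
      have "((real l)\<^sup>2 - 1 / 4) / x\<^sup>2 \<le> (real l)\<^sup>2 / x\<^sup>2"
        by (intro divide_right_mono) auto
      also have "\<dots> \<le> (real l)\<^sup>2 / a\<^sup>2"
        using a x by (intro divide_left_mono power_mono) auto
      finally show "q - \<kappa>\<^sup>2 \<ge> 0" using k unfolding q_def by linarith
    qed
    ultimately show "\<exists>y. (W has_real_derivative y) (at x) \<and> y \<le> 0" by auto
  qed
  moreover have "W a = - (\<kappa> * v a)" by (simp add: W_def)
  moreover have "W b = \<kappa> * v b" using k by (simp add: W_def b_def)
  moreover have "v a > 0" "v b > 0"
    using vpos[of a] vpos[of b] ab by simp_all
  ultimately show False
    using mult_pos_pos[OF k(1), of "v a"] mult_pos_pos[OF k(1), of "v b"] by linarith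
qed

text \<open>Makes the definite description in \<open>bessel_zero\<close> meaningful: a locally
  finite, unbounded set of positive reals is enumerated by its counting function.\<close>

lemma ex1_kth_element:
  fixes Z :: "real set"
  assumes fin: "\<And>x. finite {y \<in> Z. y \<le> x}" and pos: "\<And>z. z \<in> Z \<Longrightarrow> z > 0"
    and unb: "\<And>x. \<exists>z\<in>Z. z > x" and k: "k \<ge> 1"
  shows "\<exists>!x. x \<in> Z \<and> card {y \<in> Z. y \<le> x} = k"
proof -
  \<comment> \<open>With t = 0 this also yields the first element, as Z has none at or below
    0.\<close>
  have nxt: "\<exists>x\<in>Z. {y \<in> Z. y \<le> x} = insert x {y \<in> Z. y \<le> t} \<and> x > t" for t
  proof -
    obtain z where z: "z \<in> Z" "z > t" using unb by blast
    define A where "A = {y \<in> Z. t < y \<and> y \<le> z}"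
    have A: "finite A" "A \<noteq> {}"
      using fin[of z] z by (auto simp: A_def intro: rev_finite_subset)
    have "Min A \<in> A" using A by simp
    moreover have "y \<ge> Min A" if "y \<in> Z" "y > t" for y
      using that A \<open>Min A \<in> A\<close> by (cases "y \<le> z") (auto simp: A_def intro!: Min_le)
    ultimately show ?thesis
      by (intro bexI[of _ "Min A"]) (force simp: A_def)+
  qed
  have "\<exists>x\<in>Z. card {y \<in> Z. y \<le> x} = k" using k
  proof (induction k rule: nat_induct_at_least)
    case base
    have "{y \<in> Z. y \<le> 0} = {}" using pos by force
    with nxt[of 0] obtain x where "x \<in> Z" "{y \<in> Z. y \<le> x} = {x}" by metis
    then show ?case by (intro bexI[of _ x]) simp_all
  next
    case (Suc n)
    then obtain t where t: "t \<in> Z" "card {y \<in> Z. y \<le> t} = n" by blast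
    obtain x where x: "x \<in> Z" "{y \<in> Z. y \<le> x} = insert x {y \<in> Z. y \<le> t}" "x > t"
      using nxt[of t] by blast
    then have "card {y \<in> Z. y \<le> x} = Suc n"
      using t fin[of t] by simp
    then show ?case using x by blast
  qed
  moreover have "x = x'" if "x \<in> Z" "x' \<in> Z" "card {y \<in> Z. y \<le> x} = card {y \<in> Z. y \<le> x'}" for x x'
  proof -
    have *: "card {y \<in> Z. y \<le> u} < card {y \<in> Z. y \<le> w}" if "u < w" "w \<in> Z" for u w
    proof (rule psubset_card_mono[OF fin])
      have "w \<in> {y \<in> Z. y \<le> w} - {y \<in> Z. y \<le> u}" "{y \<in> Z. y \<le> u} \<subseteq> {y \<in> Z. y \<le> w}"
        using that by auto
      then show "{y \<in> Z. y \<le> u} \<subset> {y \<in> Z. y \<le> w}" by blast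
    qed
    show ?thesis
      using *[of x x'] *[of x' x] that by (cases x x' rule: linorder_cases) auto
  qed
  ultimately show ?thesis by blast
qed

lemma bessel_J_zero_unbounded: "\<exists>z. 0 < z \<and> bessel_J l z = 0 \<and> z > x"
proof -
  \<comment> \<open>Beyond 2l the Sturm potential is at least 3/4, which leaves room for the
    frequency 1/2.\<close>
  define a where "a = max (2 * real l) (max (x + 1) 1)"
  have a: "a > 0" "a > x" "a \<ge> 2 * real l" by (auto simp: a_def)
  have "(2 * real l)\<^sup>2 \<le> a\<^sup>2" using a by (intro power_mono) auto
  then have "(real l)\<^sup>2 / a\<^sup>2 \<le> 1 / 4" using a by (simp add: field_simps)
  then have "(1/2)\<^sup>2 \<le> 1 - (real l)\<^sup>2 / a\<^sup>2" by (simp add: power2_eq_square)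
  then obtain z where "a \<le> z" "bessel_J l z = 0" using bessel_J_sturm[of a "1/2" l] a by auto
  then show ?thesis using a by (intro exI[of _ z]) auto
qed

lemma bessel_zero:
  assumes "k \<ge> 1"
  shows bessel_zero_pos: "0 < bessel_zero l k" and bessel_J_bessel_zero: "bessel_J l (bessel_zero l k) = 0"
    and card_bessel_zero: "card {y. 0 < y \<and> y \<le> bessel_zero l k \<and> bessel_J l y = 0} = k"
proof -
  have "\<exists>!x. x \<in> {z. 0 < z \<and> bessel_J l z = 0} \<and> card {y \<in> {z. 0 < z \<and> bessel_J l z = 0}. y \<le> x} = k"
  proof (rule ex1_kth_element)
    show "finite {y \<in> {z. 0 < z \<and> bessel_J l z = 0}. y \<le> x}" for x
      by (rule finite_subset[OF _ finite_bessel_zeros[of x l]]) auto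
    show "\<exists>z\<in>{z. 0 < z \<and> bessel_J l z = 0}. z > x" for x
      using bessel_J_zero_unbounded[of l x] by blast
  qed (use assms in simp_all)
  moreover have "{y \<in> {z. 0 < z \<and> bessel_J l z = 0}. y \<le> x} = {y. 0 < y \<and> y \<le> x \<and> bessel_J l y = 0}" for x
    by auto
  ultimately have "\<exists>!x. 0 < x \<and> bessel_J l x = 0 \<and> card {y. 0 < y \<and> y \<le> x \<and> bessel_J l y = 0} = k"
    by simp
  from theI'[OF this]
  show "0 < bessel_zero l k" "bessel_J l (bessel_zero l k) = 0"
    "card {y. 0 < y \<and> y \<le> bessel_zero l k \<and> bessel_J l y = 0} = k"
    unfolding bessel_zero_def by blast+
qed

lemma bes_bessel_zero: "k \<ge> 1 \<Longrightarrow> bes l ((bessel_zero l k / 2)\<^sup>2) = 0"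
  using bessel_J_eq_0_iff bessel_zero_pos bessel_J_bessel_zero by blast

lemma bessel_zero_inject:
  assumes "k \<ge> 1" "k' \<ge> 1" "bessel_zero l k = bessel_zero l k'" shows "k = k'"
  by (metis card_bessel_zero[of k l] card_bessel_zero[of k' l] assms)

lemma bessel_zero_1_le:
  assumes "y > 0" "bessel_J l y = 0" shows "bessel_zero l 1 \<le> y"
proof (rule ccontr)
  assume "\<not> ?thesis"
  then have "{y, bessel_zero l 1} \<subseteq> {z. 0 < z \<and> z \<le> bessel_zero l 1 \<and> bessel_J l z = 0}"
    using assms bessel_zero_pos[of 1 l] bessel_J_bessel_zero[of 1 l] by auto
  from card_mono[OF finite_bessel_zeros this] show False
    using card_bessel_zero[of 1 l] \<open>\<not> bessel_zero l 1 \<le> y\<close> by auto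
qed

text \<open>Rolle's theorem for \<open>x\<^bsup>l+1\<^esup> J\<^bsub>l+1\<^esub>\<close>, whose derivative is \<open>x\<^bsup>l+1\<^esup> J\<^sub>l\<close>.\<close>

lemma bessel_zero_1_mono: "bessel_zero l 1 \<le> bessel_zero (Suc l) 1"
proof -
  define c where "c = bessel_zero (Suc l) 1"
  have c: "c > 0" "bes (Suc l) ((c / 2)\<^sup>2) = 0"
    using bessel_zero_pos[of 1 "Suc l"] bes_bessel_zero[of 1 "Suc l"] by (simp_all add: c_def)
  define h where "h r = r ^ (2 * l + 2) * bes (Suc l) (1/4 * r\<^sup>2)" for r :: real
  have dh: "(h has_real_derivative 2 * r ^ (2 * l + 1) * bes l (1/4 * r\<^sup>2)) (at r)" for r
    unfolding h_def by (rule DERIV_bes_radial_flux)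
  have "h 0 = h c" using c by (simp add: h_def power_divide)
  moreover have "continuous_on {0..c} h"
    using dh by (meson DERIV_isCont continuous_at_imp_continuous_on)
  ultimately obtain z where z: "0 < z" "z < c" "(h has_real_derivative 0) (at z)"
    using Rolle[of 0 c h] c(1) dh by (auto simp: real_differentiable_def)
  then have "2 * z ^ (2 * l + 1) * bes l (1/4 * z\<^sup>2) = 0"
    using DERIV_unique[OF dh z(3)] by simp
  then have "bessel_J l z = 0"
    using z by (simp add: bessel_J_eq_0_iff power_divide)
  then show ?thesis using bessel_zero_1_le[of z l] z by (simp add: c_def)
qed

text \<open>The first sign change of \<open>j\<^bsub>l,1\<^esub>\<^sup>2 - \<alpha>\<^sup>2 l\<^sup>2 + m\<close>: the increments in \<open>l\<close> are \<open>O(l)\<close>, and \<open>l = O(\<surd>m)\<close>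
  because \<open>j\<^bsub>l,1\<^esub> \<le> \<beta> l + O(1)\<close> with \<open>1 < \<beta> < \<alpha>\<close>.\<close>

lemma ex_small_positive_symb:
  assumes \<alpha>: "\<alpha> > 1"
  shows "\<exists>D>0. \<forall>m\<ge>1. \<exists>l. 0 < symb \<alpha> m l 1 \<and> symb \<alpha> m l 1 \<le> D * sqrt m"
proof -
  define j where "j l = bessel_zero l 1" for l
  have j: "j l > 0" for l using bessel_zero_pos[of 1 l] by (simp add: j_def)
  define \<beta> where "\<beta> = (1 + \<alpha>) / 2"
  have \<beta>: "1 < \<beta>" "\<beta> < \<alpha>" using \<alpha> by (auto simp: \<beta>_def)
  have "1 / \<beta>\<^sup>2 < 1" using \<beta> by (simp add: power_gt1 divide_less_eq)
  \<comment> \<open>The largest frequency that the Sturm comparison admits when started at \<beta>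
    l; it is the same for all l, so J_l has a zero within the fixed distance \<pi>/\<kappa> beyond
    \<beta> l.\<close>
  define \<kappa> where "\<kappa> = sqrt (1 - 1 / \<beta>\<^sup>2)"
  have k: "\<kappa> > 0" "\<kappa>\<^sup>2 = 1 - 1 / \<beta>\<^sup>2" using \<open>1 / \<beta>\<^sup>2 < 1\<close> by (auto simp: \<kappa>_def)
  define c where "c = pi / \<kappa>"
  have "c > 0" using k by (simp add: c_def)
  have jle: "j l \<le> \<beta> * l + c" if "l \<ge> 1" for l
  proof -
    have "(real l)\<^sup>2 / (\<beta> * l)\<^sup>2 = 1 / \<beta>\<^sup>2" using that \<beta> by (simp add: field_simps)
    then have *: "\<kappa>\<^sup>2 \<le> 1 - (real l)\<^sup>2 / (\<beta> * l)\<^sup>2" "0 < \<beta> * l" using k(2) \<beta> that by simp_all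
    then obtain x where "\<beta> * l \<le> x" "x \<le> \<beta> * l + c" "bessel_J l x = 0"
      using bessel_J_sturm[OF *(2) k(1) *(1)] unfolding c_def by blast
    moreover have "0 < \<beta> * l" using \<beta> that by simp
    ultimately show ?thesis using bessel_zero_1_le[of x l] by (simp add: j_def)
  qed
  define \<epsilon> where "\<epsilon> = (\<alpha>\<^sup>2 - \<beta>\<^sup>2) / 2"
  have "\<beta>\<^sup>2 < \<alpha>\<^sup>2" using \<beta> by (intro power_strict_mono) auto
  then have \<epsilon>: "\<epsilon> > 0" by (simp add: \<epsilon>_def)
  \<comment> \<open>Results from (\<beta> l + c)^2 by absorbing the mixed term: 2 \<beta> c l \<le>
    \<epsilon> l^2 + \<beta>^2 c^2/\<epsilon>.\<close>
  define C where "C = c\<^sup>2 + \<beta>\<^sup>2 * c\<^sup>2 / \<epsilon>"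
  have C: "C \<ge> 0" using \<epsilon> by (simp add: C_def)
  define f where "f l = \<alpha>\<^sup>2 * (real l)\<^sup>2 - (j l)\<^sup>2" for l
  have symb: "symb \<alpha> m l 1 = m - f l" for m l by (simp add: symb_def f_def j_def)
  have flow: "f l \<ge> \<epsilon> * (real l)\<^sup>2 - C" if "l \<ge> 1" for l
  proof -
    have "(j l)\<^sup>2 \<le> (\<beta> * l + c)\<^sup>2" using jle[OF that] j[of l] by (intro power_mono) auto
    moreover have "0 \<le> (\<epsilon> * l - \<beta> * c)\<^sup>2 / \<epsilon>" using \<epsilon> by simp
    moreover have "(\<epsilon> * l - \<beta> * c)\<^sup>2 / \<epsilon> = \<epsilon> * (real l)\<^sup>2 - 2 * \<beta> * c * l + \<beta>\<^sup>2 * c\<^sup>2 / \<epsilon>"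
      using \<epsilon> by (simp add: field_simps power2_eq_square)
    moreover have "\<alpha>\<^sup>2 = 2 * \<epsilon> + \<beta>\<^sup>2" by (simp add: \<epsilon>_def field_simps)
    ultimately show ?thesis
      unfolding f_def C_def by (simp add: power2_sum power_mult_distrib algebra_simps)
  qed
  \<comment> \<open>The bound \<alpha>^2 (2l + 1) for the increment, with l \<le> sqrt((1 +
    C)/\<epsilon>) sqrt m and 1 \<le> sqrt m inserted.\<close>
  define D where "D = \<alpha>\<^sup>2 * (2 * sqrt ((1 + C) / \<epsilon>) + 1)"
  have "D > 0" using \<alpha> C \<epsilon> unfolding D_def by (intro mult_pos_pos add_nonneg_pos) auto
  moreover have "\<exists>l. 0 < symb \<alpha> m l 1 \<and> symb \<alpha> m l 1 \<le> D * sqrt m" if m: "m \<ge> 1" for m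
  proof -
    obtain n0 :: nat where n0: "real n0 > (m + C) / \<epsilon> + 1" using reals_Archimedean2 by blast
    have "(m + C) / \<epsilon> \<ge> 0" using m C \<epsilon> by simp
    then have n1: "real n0 > 1" using n0 by linarith
    have "(m + C) / \<epsilon> \<le> (real n0)\<^sup>2"
    proof -
      have "real n0 * 1 \<le> real n0 * real n0" using n1 by (intro mult_left_mono) auto
      then show ?thesis using n0 by (simp add: power2_eq_square)
    qed
    then have ex: "f n0 \<ge> m"
      using flow[of n0] n1 \<epsilon> by (simp add: field_simps)
    \<comment> \<open>First index with nonpositive eigenvalue. Its predecessor l is the witness:
      there the eigenvalue is positive, and it is at most the increment of f from l to n.\<close>
    define n where "n = (LEAST n. f n \<ge> m)"
    have n: "f n \<ge> m" unfolding n_def using ex by (rule LeastI)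
    have "f 0 = - (j 0)\<^sup>2" by (simp add: f_def)
    then have "f 0 < m" using m zero_le_power2[of "j 0"] by linarith
    then have "n \<noteq> 0" using n by (intro notI) simp
    then obtain l where l: "n = Suc l" by (cases n) auto
    have fl: "f l < m" using not_less_Least[of l "\<lambda>n. f n \<ge> m"] l by (auto simp: n_def)
    have "(j l)\<^sup>2 \<le> (j (Suc l))\<^sup>2"
      using bessel_zero_1_mono[of l] j[of l] by (intro power_mono) (auto simp: j_def)
    then have "f n - f l \<le> \<alpha>\<^sup>2 * (2 * real l + 1)"
      unfolding f_def l by (simp add: algebra_simps power2_eq_square)
    then have "m - f l \<le> \<alpha>\<^sup>2 * (2 * real l + 1)" using n by simp
    also have "\<dots> \<le> \<alpha>\<^sup>2 * (2 * (sqrt ((1 + C) / \<epsilon>) * sqrt m) + sqrt m)"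
    proof -
      have "real l \<le> sqrt ((1 + C) / \<epsilon>) * sqrt m"
      proof (cases "l = 0")
        case False
        then have "\<epsilon> * (real l)\<^sup>2 - C < m" using flow[of l] fl by simp
        then have "(real l)\<^sup>2 \<le> (m + C) / \<epsilon>" using \<epsilon> by (simp add: field_simps)
        also have "\<dots> \<le> (1 + C) / \<epsilon> * m"
        proof -
          have "C * 1 \<le> C * m" using C m by (intro mult_left_mono)
          then show ?thesis using \<epsilon> by (simp add: divide_right_mono algebra_simps)
        qed
        finally show ?thesis
          by (simp add: real_le_rsqrt flip: real_sqrt_mult)
      qed (use C \<epsilon> m in simp)
      moreover have "1 \<le> sqrt m" using m by simp
      ultimately have "2 * real l + 1 \<le> 2 * (sqrt ((1 + C) / \<epsilon>) * sqrt m) + sqrt m" by linarith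
      then show ?thesis by (intro mult_left_mono) auto
    qed
    also have "\<dots> = D * sqrt m" by (simp add: D_def algebra_simps)
    finally have "symb \<alpha> m l 1 \<le> D * sqrt m" by (simp only: symb)
    moreover have "0 < symb \<alpha> m l 1" using fl by (simp only: symb)
    ultimately show ?thesis by blast
  qed
  ultimately show ?thesis by blast
qed

subsection \<open>Rotation invariance and radial integration on the disk\<close>

interpretation disk: finite_measure disk_measure
  by (rule finite_measure_lebesgue_on) simp

lemma borel_measurable_disk:
  assumes "f \<in> borel_measurable borel" shows "f \<in> borel_measurable disk_measure"
  using assms by (intro measurable_restrict_space1 measurable_completion) simp

lemma continuous_measurable_disk:
  "continuous_on UNIV f \<Longrightarrow> f \<in> borel_measurable disk_measure"
  by (intro borel_measurable_disk borel_measurable_continuous_onI)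

definition cx :: "real^2 \<Rightarrow> complex" where "cx x = Complex (x $ 1) (x $ 2)"

lemma continuous_cx [continuous_intros]: "continuous_on A cx"
  unfolding cx_def Complex_eq by (intro continuous_intros)

lemma norm_cx [simp]: "cmod (cx x) = norm x"
  by (simp add: cx_def cmod_def norm_vec_def L2_set_def sum_2)

definition rot :: "real \<Rightarrow> real^2 \<Rightarrow> real^2" where
  "rot \<phi> x = (\<chi> i. if i = 1 then cos \<phi> * x $ 1 - sin \<phi> * x $ 2 else sin \<phi> * x $ 1 + cos \<phi> * x $ 2)"

lemma cx_rot: "cx (rot \<phi> x) = cis \<phi> * cx x"
  by (simp add: cx_def rot_def complex_eq_iff)

lemma norm_rot [simp]: "norm (rot \<phi> x) = norm x"
  by (simp flip: norm_cx add: cx_rot norm_mult)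

lemma cx_inject: "cx x = cx y \<longleftrightarrow> x = y"
  by (auto simp: cx_def vec_eq_iff forall_2)

lemma rot_rot: "rot \<phi> (rot \<psi> x) = rot (\<phi> + \<psi>) x"
  by (simp flip: cx_inject add: cx_rot cis_mult[symmetric])

lemma rot_0 [simp]: "rot 0 x = x"
  by (simp flip: cx_inject add: cx_rot)

lemma orthogonal_rot: "orthogonal_transformation (rot \<phi>)"
proof -
  have "linear (rot \<phi>)"
    by (rule linearI) (auto simp: rot_def vec_eq_iff algebra_simps)
  then show ?thesis by (simp add: orthogonal_transformation)
qed

lemma rot_vimage: "rot \<phi> -` A = rot (- \<phi>) ` A"
proof (intro set_eqI iffI)
  fix x assume "x \<in> rot \<phi> -` A"
  then show "x \<in> rot (- \<phi>) ` A"
    by (intro image_eqI[of _ _ "rot \<phi> x"]) (auto simp: rot_rot)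
qed (auto simp: rot_rot)

lemma sets_diskD:
  assumes "A \<in> sets disk_measure" shows "A \<in> lmeasurable" "A \<subseteq> disk"
  using assms bounded_set_imp_lmeasurable[of A] bounded_subset[of disk A]
  by (auto simp: sets_restrict_space_iff)

lemma rot_vimage_disk:
  assumes "A \<in> sets disk_measure"
  shows "rot \<phi> -` A \<inter> disk = rot (- \<phi>) ` A" "rot (- \<phi>) ` A \<in> sets disk_measure"
proof -
  have "rot \<phi> -` A \<subseteq> disk" using sets_diskD(2)[OF assms] by (metis mem_ball_0 norm_rot subsetD subsetI vimageD)
  then show *: "rot \<phi> -` A \<inter> disk = rot (- \<phi>) ` A" by (auto simp: rot_vimage)
  have "rot (- \<phi>) ` A \<in> lmeasurable"
    by (intro measurable_orthogonal_image orthogonal_rot sets_diskD(1) assms)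
  moreover have "rot (- \<phi>) ` A \<subseteq> disk" using * by blast
  ultimately show "rot (- \<phi>) ` A \<in> sets disk_measure"
    by (simp add: sets_restrict_space_iff fmeasurableD)
qed

lemma measurable_rot [measurable]: "rot \<phi> \<in> measurable disk_measure disk_measure"
proof (rule measurableI)
  fix A assume "A \<in> sets disk_measure"
  from rot_vimage_disk[OF this, of \<phi>]
  show "rot \<phi> -` A \<inter> space disk_measure \<in> sets disk_measure" by simp
qed simp

text \<open>Stated for the image measure, this serves both the invariance of integrals and the
  transport of null sets.\<close>

lemma distr_rot: "distr disk_measure disk_measure (rot \<phi>) = disk_measure"
proof (rule measure_eqI)
  fix A assume "A \<in> sets (distr disk_measure disk_measure (rot \<phi>))"
  then have A: "A \<in> sets disk_measure" by simp
  note A' = sets_diskD[OF A]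
  have i: "rot (- \<phi>) ` A \<in> lmeasurable" "measure lebesgue (rot (- \<phi>) ` A) = measure lebesgue A"
    by (intro measurable_orthogonal_image measure_orthogonal_image orthogonal_rot A')+
  have "emeasure (distr disk_measure disk_measure (rot \<phi>)) A = emeasure disk_measure (rot (- \<phi>) ` A)"
    using rot_vimage_disk[OF A, of \<phi>] by (subst emeasure_distr) (use A in auto)
  also have "\<dots> = emeasure lebesgue (rot (- \<phi>) ` A)"
    using sets_diskD(2)[OF rot_vimage_disk(2)[OF A]] by (intro emeasure_restrict_space) auto
  also have "\<dots> = emeasure lebesgue A"
    using i A'(1) by (simp add: emeasure_eq_measure2)
  also have "\<dots> = emeasure disk_measure A"
    using A' by (intro emeasure_restrict_space[symmetric]) auto
  finally show "emeasure (distr disk_measure disk_measure (rot \<phi>)) A = emeasure disk_measure A" .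
qed simp

lemma integral_rot:
  fixes f :: "real^2 \<Rightarrow> 'b::{banach, second_countable_topology}"
  assumes "f \<in> borel_measurable disk_measure"
  shows "(\<integral>x. f (rot \<phi> x) \<partial>disk_measure) = (\<integral>x. f x \<partial>disk_measure)"
  using integral_distr[OF measurable_rot[of \<phi>] assms] by (simp add: distr_rot)

section \<open>Integration of radial functions in polar coordinates\<close>

lemma measurable_norm_disk [measurable]: "norm \<in> measurable disk_measure borel"
  by (intro continuous_measurable_disk continuous_intros)

text \<open>Half-lines form an intersection-stable generator, so the areas of centred disks
  determine the distribution of the norm.\<close>

lemma distr_norm_disk:
  "distr disk_measure borel norm = density lborel (\<lambda>r. ennreal (indicator {0<..<1} r * (2 * pi * r)))"
proof (rule measure_eqI_generator_eq)
  let ?E = "range (\<lambda>a. {..<a::real})"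
  show "Int_stable ?E"
  proof (unfold Int_stable_def, safe)
    fix a b :: real
    have "{..<a} \<inter> {..<b} = {..<min a b}" by auto
    then show "{..<a} \<inter> {..<b} \<in> ?E" by blast
  qed
  show "sets (distr disk_measure borel norm) = sigma_sets UNIV ?E"
    "sets (density lborel (\<lambda>r. ennreal (indicator {0<..<1} r * (2 * pi * r)))) = sigma_sets UNIV ?E"
  proof -
    have "sets (borel :: real measure) = sigma_sets UNIV ?E" by (subst borel_Iio) simp
    then show "sets (distr disk_measure borel norm) = sigma_sets UNIV ?E"
      "sets (density lborel (\<lambda>r. ennreal (indicator {0<..<1} r * (2 * pi * r)))) = sigma_sets UNIV ?E"
      by simp_all
  qed
  show "range (\<lambda>i. {..<real i}) \<subseteq> ?E" by auto
  show "(\<Union>i. {..<real i}) = UNIV" using reals_Archimedean2 by auto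
  show "emeasure (distr disk_measure borel norm) {..<real i} \<noteq> \<infinity>" for i
    by (subst emeasure_distr) auto
  fix X assume "X \<in> ?E"
  then obtain a where X: "X = {..<a}" by auto
  \<comment> \<open>Radius of the part of the unit disk on which the norm is below a, for every real
    a.\<close>
  define c where "c = max 0 (min a 1)"
  have c: "0 \<le> c" "c \<le> 1" by (auto simp: c_def)
  have "emeasure (distr disk_measure borel norm) X = emeasure disk_measure (ball 0 c :: (real^2) set)"
  proof -
    have "norm -` {..<a} \<inter> disk = ball (0::real^2) c"
    proof (rule set_eqI)
      fix x :: "real^2"
      show "x \<in> norm -` {..<a} \<inter> disk \<longleftrightarrow> x \<in> ball 0 c"
        by (auto simp: c_def max_def min_def) (use norm_ge_zero[of x] in linarith)+
    qed
    then show ?thesis unfolding X by (subst emeasure_distr) auto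
  qed
  also have "\<dots> = emeasure lebesgue (ball 0 c :: (real^2) set)"
    using c by (intro emeasure_restrict_space) auto
  also have "\<dots> = ennreal (pi * c\<^sup>2)"
    using c circle_area[of c 0] by (simp add: emeasure_eq_measure2 mult.commute)
  also have "\<dots> = (\<integral>\<^sup>+r. ennreal (2 * pi * r) * indicator {0..c} r \<partial>lborel)"
  proof -
    have "((\<lambda>r. pi * r\<^sup>2) has_real_derivative 2 * pi * x) (at x)" for x
      by (auto intro!: derivative_eq_intros)
    then show ?thesis
      using nn_integral_FTC_Icc[of "\<lambda>r. 2 * pi * r" 0 c "\<lambda>r. pi * r\<^sup>2"] c by simp
  qed
  also have "\<dots> = (\<integral>\<^sup>+r. ennreal (indicator {0<..<1} r * (2 * pi * r)) * indicator X r \<partial>lborel)"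
  proof (rule nn_integral_cong_AE)
    show "AE r in lborel. ennreal (2 * pi * r) * indicator {0..c} r
      = ennreal (indicator {0<..<1} r * (2 * pi * r)) * indicator X r"
      using AE_lborel_singleton[of 0] AE_lborel_singleton[of c] AE_lborel_singleton[of 1]
      by eventually_elim (auto simp: X c_def split: split_indicator if_splits)
  qed
  also have "\<dots> = emeasure (density lborel (\<lambda>r. ennreal (indicator {0<..<1} r * (2 * pi * r)))) X"
    unfolding X by (subst emeasure_density) auto
  finally show "emeasure (distr disk_measure borel norm) X
      = emeasure (density lborel (\<lambda>r. ennreal (indicator {0<..<1} r * (2 * pi * r)))) X" .
qed auto

lemma integral_radial:
  fixes f :: "real \<Rightarrow> real"
  assumes [measurable]: "f \<in> borel_measurable borel"
  shows "(\<integral>x. f (norm x) \<partial>disk_measure) = (\<integral>r. indicator {0<..<1} r * (2 * pi * r) * f r \<partial>lborel)"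
    and "integrable disk_measure (\<lambda>x. f (norm x)) \<longleftrightarrow> integrable lborel (\<lambda>r. indicator {0<..<1} r * (2 * pi * r) * f r)"
proof -
  have nn: "0 \<le> indicator {0<..<1} r * (2 * pi * r)" for r :: real
    by (auto split: split_indicator)
  have "(\<integral>x. f (norm x) \<partial>disk_measure) = (\<integral>r. f r \<partial>distr disk_measure borel norm)"
    by (rule integral_distr[symmetric]) measurable
  also have "\<dots> = (\<integral>r. indicator {0<..<1} r * (2 * pi * r) * f r \<partial>lborel)"
    unfolding distr_norm_disk by (subst integral_density) (auto simp: nn)
  finally show "(\<integral>x. f (norm x) \<partial>disk_measure) = (\<integral>r. indicator {0<..<1} r * (2 * pi * r) * f r \<partial>lborel)" .
  have "integrable disk_measure (\<lambda>x. f (norm x)) \<longleftrightarrow> integrable (distr disk_measure borel norm) f"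
    by (rule integrable_distr_eq[symmetric]) measurable
  also have "\<dots> \<longleftrightarrow> integrable lborel (\<lambda>r. indicator {0<..<1} r * (2 * pi * r) * f r)"
    unfolding distr_norm_disk by (subst integrable_density) (auto simp: nn)
  finally show "integrable disk_measure (\<lambda>x. f (norm x)) \<longleftrightarrow> integrable lborel (\<lambda>r. indicator {0<..<1} r * (2 * pi * r) * f r)" .
qed

text \<open>Turns an integral into the search for a primitive of r f(r). The exceptional set S
  admits the kink of the Green kernel.\<close>

lemma integral_radial_FTC:
  fixes f :: "real \<Rightarrow> real"
  assumes f: "continuous_on UNIV f" and S: "finite S" and F: "continuous_on {0..1} F"
    and der: "\<And>r. 0 < r \<Longrightarrow> r < 1 \<Longrightarrow> r \<notin> S \<Longrightarrow> (F has_real_derivative r * f r) (at r)"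
  shows "(\<integral>x. f (norm x) \<partial>disk_measure) = 2 * pi * (F 1 - F 0)"
proof -
  have fb [measurable]: "f \<in> borel_measurable borel" using f by (rule borel_measurable_continuous_onI)
  have c: "continuous_on {0..1} (\<lambda>r. r * f r)"
    by (intro continuous_intros continuous_on_subset[OF f]) auto
  have "((\<lambda>r. r * f r) has_integral (F 1 - F 0)) {0..1}"
  proof (rule fundamental_theorem_of_calculus_interior_strong[OF S])
    show "(F has_vector_derivative r * f r) (at r)" if "r \<in> {0<..<1} - S" for r
      using der[of r] that by (simp add: has_real_derivative_iff_has_vector_derivative)
  qed (use F in auto)
  then have "(LINT r:{0..1}|lborel. r * f r) = F 1 - F 0"
    using set_borel_integral_eq_integral(2)[OF borel_integrable_atLeastAtMost'[OF c]] by (simp add: integral_unique)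
  then have "2 * pi * (F 1 - F 0) = (\<integral>r. 2 * pi * (indicator {0..1} r * (r * f r)) \<partial>lborel)"
    by (simp add: set_lebesgue_integral_def)
  also have "\<dots> = (\<integral>r. indicator {0<..<1} r * (2 * pi * r) * f r \<partial>lborel)"
  proof (rule integral_cong_AE)
    show "AE r in lborel. 2 * pi * (indicator {0..1} r * (r * f r)) = indicator {0<..<1} r * (2 * pi * r) * f r"
      using AE_lborel_singleton[of 0] AE_lborel_singleton[of 1]
      by eventually_elim (simp add: indicator_def, linarith)
  qed measurable
  finally show ?thesis using integral_radial(1)[OF fb] by simp
qed

lemma AE_disk_nonzero: "AE x in disk_measure. x \<noteq> 0"
proof -
  have "AE x in lebesgue. x \<noteq> (0::real^2)" by (rule AE_completion[OF AE_lborel_singleton])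
  then have "AE x in lebesgue. x \<in> disk \<longrightarrow> x \<noteq> (0::real^2)" by eventually_elim simp
  then show ?thesis by (simp add: AE_restrict_space_iff)
qed

text \<open>It makes the kernel bound 2 / sqrt (norm y) square integrable, so that the Green kernel
  can be integrated against every L^2 function.\<close>

lemma integrable_inverse_norm_disk: "integrable disk_measure (\<lambda>x::real^2. 1 / norm x)"
proof -
  have "integrable lborel (\<lambda>r::real. indicator {0<..<1} r * (2 * pi * r) * (1 / r))"
  proof (rule Bochner_Integration.integrable_bound)
    show "integrable lborel (\<lambda>r::real. 2 * pi * indicator {0<..<1} r)" by simp
  qed (auto split: split_indicator)
  then show ?thesis by (subst integral_radial(2)) auto
qed

text \<open>Rotation by \<pi>/(a - b) multiplies z^a conj(z)^b by -1 and preserves h and the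
  measure, so the integral equals its own negative.\<close>

lemma angular_zero:
  fixes h :: "real^2 \<Rightarrow> complex"
  assumes h: "h \<in> borel_measurable disk_measure" and inv: "\<And>\<phi>. AE x in disk_measure. h (rot \<phi> x) = h x"
    and ab: "a \<noteq> b"
  shows "(\<integral>x. cx x ^ a * cnj (cx x) ^ b * h x \<partial>disk_measure) = 0"
proof -
  define \<phi> where "\<phi> = pi / (real a - real b)"
  have [measurable]: "cx \<in> borel_measurable disk_measure" "(\<lambda>x. cnj (cx x)) \<in> borel_measurable disk_measure"
    by (intro continuous_measurable_disk continuous_intros)+
  note h[measurable]
  let ?I = "\<integral>x. cx x ^ a * cnj (cx x) ^ b * h x \<partial>disk_measure"
  have "(real a - real b) * \<phi> = pi" using ab by (simp add: \<phi>_def)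
  then have "real a * \<phi> + real b * - \<phi> = pi" by (simp add: left_diff_distrib)
  then have m: "cis \<phi> ^ a * cnj (cis \<phi>) ^ b = -1"
    by (metis Complex.DeMoivre cis_cnj cis_mult cis_pi)
  have e: "(cis \<phi> * z) ^ a * cnj (cis \<phi> * z) ^ b = - (z ^ a * cnj z ^ b)" for z
  proof -
    have "(cis \<phi> * z) ^ a * cnj (cis \<phi> * z) ^ b = (cis \<phi> ^ a * cnj (cis \<phi>) ^ b) * (z ^ a * cnj z ^ b)"
      by (simp only: power_mult_distrib complex_cnj_mult ac_simps)
    then show ?thesis unfolding m by simp
  qed
  have "?I = (\<integral>x. cx (rot \<phi> x) ^ a * cnj (cx (rot \<phi> x)) ^ b * h (rot \<phi> x) \<partial>disk_measure)"
    by (rule integral_rot[symmetric]) measurable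
  also have "\<dots> = (\<integral>x. - (cx x ^ a * cnj (cx x) ^ b * h x) \<partial>disk_measure)"
  proof (rule integral_cong_AE)
    show "AE x in disk_measure. cx (rot \<phi> x) ^ a * cnj (cx (rot \<phi> x)) ^ b * h (rot \<phi> x)
      = - (cx x ^ a * cnj (cx x) ^ b * h x)"
      using inv[of \<phi>] by eventually_elim (simp only: cx_rot e mult_minus_left)
    show "(\<lambda>x. cx (rot \<phi> x) ^ a * cnj (cx (rot \<phi> x)) ^ b * h (rot \<phi> x)) \<in> borel_measurable disk_measure"
      by (intro borel_measurable_times borel_measurable_power
        measurable_compose[OF measurable_rot] h continuous_measurable_disk continuous_intros)
  qed measurable
  also have "\<dots> = - ?I" by simp
  finally show ?thesis by simp
qed

subsection \<open>Angular modes\<close>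

text \<open>The harmonic polynomials r^l cos(l \<theta>) and, for true b, r^l sin(l \<theta>).
  Powers of a complex variable avoid the branch cut of the angle.\<close>

definition ang :: "bool \<Rightarrow> nat \<Rightarrow> real^2 \<Rightarrow> real" where
  "ang b l x = (if b then Im (cx x ^ l) else Re (cx x ^ l))"

lemma abs_ang_le: "\<bar>ang b l x\<bar> \<le> norm x ^ l"
  using abs_Re_le_cmod[of "cx x ^ l"] abs_Im_le_cmod[of "cx x ^ l"]
  by (simp add: ang_def norm_power)

lemma continuous_ang [continuous_intros]: "continuous_on A (ang b l)"
  unfolding ang_def[abs_def] by (cases b) (auto intro!: continuous_intros)

lemma ang_measurable [measurable]: "ang b l \<in> borel_measurable disk_measure"
  by (intro continuous_measurable_disk continuous_intros)

lemma cx_measurable [measurable]: "cx \<in> borel_measurable disk_measure"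
  by (intro continuous_measurable_disk continuous_intros)

lemma cnj_measurable [measurable]: "cnj \<in> borel_measurable borel"
  by (intro borel_measurable_continuous_onI continuous_intros)

lemma integrable_disk_bounded:
  fixes f :: "real^2 \<Rightarrow> 'b::{banach, second_countable_topology}"
  assumes "f \<in> borel_measurable disk_measure" "\<And>x. x \<in> disk \<Longrightarrow> norm (f x) \<le> C"
  shows "integrable disk_measure f"
  by (rule disk.integrable_const_bound[of _ C]) (use assms in auto)

lemma integrable_disk_continuous:
  fixes f :: "real^2 \<Rightarrow> 'b::{banach, second_countable_topology}"
  assumes "continuous_on UNIV f"
  shows "integrable disk_measure f"
proof -
  have "compact (f ` cball 0 1)"
    by (rule compact_continuous_image) (use assms continuous_on_subset in auto)
  then obtain C where "\<forall>y\<in>f ` cball 0 1. norm y \<le> C"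
    using compact_imp_bounded bounded_iff by metis
  then show ?thesis
    by (intro integrable_disk_bounded[of _ C] continuous_measurable_disk assms) auto
qed

text \<open>Products of real and imaginary parts are half sums or differences of parts of u =
  z^(l+l') g and v = z^l conj(z)^l' g, and rotation kills u and v except v with l = l'. For l = l' =
  0 the functions u and v coincide, which doubles the factor 1/2.\<close>

lemma integral_ang_ang:
  fixes g :: "real \<Rightarrow> real"
  assumes g [measurable]: "g \<in> borel_measurable borel"
    and int: "integrable disk_measure (\<lambda>x. norm x ^ (l + l') * g (norm x))"
    and l: "b \<Longrightarrow> l > 0" "b' \<Longrightarrow> l' > 0"
  shows "(\<integral>x. ang b l x * ang b' l' x * g (norm x) \<partial>disk_measure) =
    (if b = b' \<and> l = l' then (if l = 0 then 1 else 1 / 2) * (\<integral>x. norm x ^ (2 * l) * g (norm x) \<partial>disk_measure) else 0)"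
proof -
  define h where "h x = complex_of_real (g (norm x))" for x :: "real^2"
  have h [measurable]: "h \<in> borel_measurable disk_measure" unfolding h_def by measurable
  have hr: "AE x in disk_measure. h (rot \<phi> x) = h x" for \<phi> by (simp add: h_def)
  define u where "u x = cx x ^ (l + l') * cnj (cx x) ^ 0 * h x" for x
  define v where "v x = cx x ^ l * cnj (cx x) ^ l' * h x" for x
  have um: "u \<in> borel_measurable disk_measure" "v \<in> borel_measurable disk_measure"
    unfolding u_def v_def by measurable
  have iu: "integrable disk_measure u" and iv: "integrable disk_measure v"
    by (rule Bochner_Integration.integrable_bound[OF int]; use um in
      \<open>auto simp: u_def v_def h_def norm_mult norm_power power_add abs_mult\<close>)+
  have U: "integral\<^sup>L disk_measure u = 0" if "l + l' \<noteq> 0"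
    unfolding u_def by (rule angular_zero[OF h hr that])
  have V: "integral\<^sup>L disk_measure v = 0" if "l \<noteq> l'"
    unfolding v_def by (rule angular_zero[OF h hr that])
  have Vl: "integral\<^sup>L disk_measure v = complex_of_real (\<integral>x. norm x ^ (2 * l) * g (norm x) \<partial>disk_measure)" if "l = l'"
  proof -
    have "v = (\<lambda>x. complex_of_real (norm x ^ (2 * l) * g (norm x)))"
    proof
      fix x
      have "cx x ^ l * cnj (cx x) ^ l = (cx x * cnj (cx x)) ^ l" by (simp only: power_mult_distrib)
      also have "\<dots> = complex_of_real (norm x ^ (2 * l))"
        by (simp only: complex_norm_square[symmetric] norm_cx power_mult of_real_power)
      finally show "v x = complex_of_real (norm x ^ (2 * l) * g (norm x))" by (simp add: v_def h_def that)
    qed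
    then show ?thesis by (simp only: integral_complex_of_real)
  qed
  have Re: "integral\<^sup>L disk_measure (\<lambda>x. Re (f x)) = Re (integral\<^sup>L disk_measure f)"
    and Im: "integral\<^sup>L disk_measure (\<lambda>x. Im (f x)) = Im (integral\<^sup>L disk_measure f)"
    if "integrable disk_measure f" for f
    using that integral_Re integral_Im by auto
  have iR: "integrable disk_measure (\<lambda>x. Re (u x))" "integrable disk_measure (\<lambda>x. Re (v x))"
    "integrable disk_measure (\<lambda>x. Im (u x))" "integrable disk_measure (\<lambda>x. Im (v x))"
    using iu iv by auto
  have p: "ang b l x * ang b' l' x * g (norm x) =
    1 / 2 * (if b then (if b' then Re (v x) - Re (u x) else Im (u x) + Im (v x))
      else (if b' then Im (u x) - Im (v x) else Re (u x) + Re (v x)))" for x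
  proof -
    obtain a c where z: "cx x ^ l = Complex a c" by (cases "cx x ^ l") 
    obtain a' c' where z': "cx x ^ l' = Complex a' c'" by (cases "cx x ^ l'")
    have "u x = Complex a c * Complex a' c' * of_real (g (norm x))"
      by (simp add: u_def h_def power_add z z')
    moreover have "v x = Complex a c * cnj (Complex a' c') * of_real (g (norm x))"
      by (simp add: v_def h_def z z'[symmetric])
    ultimately show ?thesis
      by (cases b; cases b') (simp_all add: ang_def z z' algebra_simps)
  qed
  have "(\<integral>x. ang b l x * ang b' l' x * g (norm x) \<partial>disk_measure) =
    1 / 2 * (let U = integral\<^sup>L disk_measure u; V = integral\<^sup>L disk_measure v in
      if b then (if b' then Re V - Re U else Im U + Im V) else (if b' then Im U - Im V else Re U + Re V))"
    unfolding p Let_def using iR by (cases b; cases b') (simp_all add: Re[OF iu] Re[OF iv] Im[OF iu] Im[OF iv])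
  also have "\<dots> = (if b = b' \<and> l = l' then (if l = 0 then 1 else 1 / 2) * (\<integral>x. norm x ^ (2 * l) * g (norm x) \<partial>disk_measure) else 0)"
  proof (cases "l = l'")
    case False
    then show ?thesis using U V by (cases "l + l' = 0") (simp_all add: Let_def)
  next
    case True
    show ?thesis
    proof (cases "l = 0")
      case False
      then show ?thesis using U Vl[OF True] True by (cases b; cases b') simp_all
    next
      case l0: True
      then have "\<not> b" "\<not> b'" using l True by auto
      moreover have "u = v" using l0 True by (simp add: u_def v_def fun_eq_iff)
      ultimately show ?thesis using Vl[OF True] l0 True by simp
    qed
  qed
  finally show ?thesis .
qed

text \<open>Rotation acts on z^l but not on u. This is how radial functions lose all modes with l >
  0.\<close>

lemma integral_ang_invariant:
  assumes u [measurable]: "u \<in> borel_measurable disk_measure" and inv: "\<And>\<phi>. AE x in disk_measure. u (rot \<phi> x) = u x"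
    and int: "integrable disk_measure u" and l: "l > 0"
  shows "(\<integral>x. u x * ang b l x \<partial>disk_measure) = 0"
proof -
  define v where "v x = cx x ^ l * cnj (cx x) ^ 0 * complex_of_real (u x)" for x
  have "integral\<^sup>L disk_measure v = 0"
    unfolding v_def
  proof (rule angular_zero)
    show "AE x in disk_measure. complex_of_real (u (rot \<phi> x)) = complex_of_real (u x)" for \<phi>
      using inv[of \<phi>] by eventually_elim simp
  qed (use l in auto)
  moreover have iv: "integrable disk_measure v"
  proof (rule Bochner_Integration.integrable_bound[OF int])
    show "AE x in disk_measure. norm (v x) \<le> norm (u x)"
    proof (rule AE_I2)
      fix x assume "x \<in> space disk_measure"
      then have "norm x ^ l \<le> 1" by (intro power_le_one) auto
      then show "norm (v x) \<le> norm (u x)"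
        by (simp add: v_def norm_mult norm_power mult_left_le_one_le)
    qed
  qed (unfold v_def, measurable)
  moreover have "u x * ang b l x = (if b then Im (v x) else Re (v x))" for x
    by (simp add: ang_def v_def mult.commute)
  ultimately show ?thesis
    using integral_Re[OF iv] integral_Im[OF iv] by (cases b) auto
qed

subsection \<open>The Green operator of an angular mode\<close>

text \<open>\<open>s\<^sup>l t\<^sup>l gr l (max s t)\<close> is the Green function of \<open>u \<mapsto> - u'' - u' / r + l\<^sup>2 u / r\<^sup>2\<close> with \<open>u 1 = 0\<close>.\<close>

definition gr :: "nat \<Rightarrow> real \<Rightarrow> real" where
  "gr l t = (if l = 0 then - ln t else (1 / t ^ (2 * l) - 1) / (2 * real l))"

lemma gr_1 [simp]: "gr l 1 = 0" by (simp add: gr_def)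

lemma gr_measurable [measurable]: "gr l \<in> borel_measurable borel"
  unfolding gr_def[abs_def] by (cases "l = 0") simp_all

lemma DERIV_gr:
  assumes "t > 0" shows "(gr l has_real_derivative - 1 / t ^ (2 * l + 1)) (at t)"
proof (cases "l = 0")
  case True
  then show ?thesis using assms unfolding gr_def[abs_def] by (auto intro!: derivative_eq_intros)
next
  case False
  have "((\<lambda>t. t ^ (2 * l)) has_real_derivative real (2 * l) * t ^ (2 * l - 1)) (at t)"
    using DERIV_pow[of "2 * l" t] by simp
  from DERIV_inverse'[OF this]
  have "((\<lambda>t. inverse (t ^ (2 * l))) has_real_derivative - (inverse (t ^ (2 * l)) * (real (2 * l) * t ^ (2 * l - 1)) * inverse (t ^ (2 * l)))) (at t)"
    using assms by simp
  moreover have "inverse (t ^ (2 * l)) * (real (2 * l) * t ^ (2 * l - 1)) * inverse (t ^ (2 * l)) = 2 * real l * (1 / t ^ (2 * l + 1))"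
  proof -
    have "t ^ (2 * l) = t ^ (2 * l - 1) * t" using False by (metis power_minus_mult mult_pos_pos neq0_conv zero_less_numeral)
    then have "t ^ (2 * l - 1) * inverse (t ^ (2 * l)) = inverse t" using assms by (simp add: field_simps)
    then have "inverse (t ^ (2 * l)) * (real (2 * l) * t ^ (2 * l - 1)) * inverse (t ^ (2 * l)) = real (2 * l) * (inverse (t ^ (2 * l)) * inverse t)"
      by (simp only: mult.assoc mult.left_commute)
    also have "inverse (t ^ (2 * l)) * inverse t = 1 / t ^ (2 * l + 1)"
      by (simp add: field_simps)
    finally show ?thesis by simp
  qed
  ultimately have "((\<lambda>t. inverse (t ^ (2 * l))) has_real_derivative - (2 * real l * (1 / t ^ (2 * l + 1)))) (at t)"
    by (simp only:)
  then have "((\<lambda>t. (inverse (t ^ (2 * l)) - 1) / (2 * real l)) has_real_derivative (- (2 * real l * (1 / t ^ (2 * l + 1))) - 0) / (2 * real l)) (at t)"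
    by (intro DERIV_cdivide DERIV_diff DERIV_const)
  then show ?thesis using False unfolding gr_def[abs_def] by (simp add: inverse_eq_divide)
qed

lemma continuous_gr: "continuous_on {0<..} (gr l)"
  by (meson DERIV_continuous_on DERIV_gr greaterThan_iff has_field_derivative_at_within)

text \<open>The bound is uniform in l: for l = 0 it is ln s \<le> s - 1 at s = 1/sqrt t, and
  otherwise t^(2l) \<open>gr l t\<close> is at most 1/(2l).\<close>

lemma gr_bound:
  assumes "0 < t" "t \<le> 1" shows "0 \<le> gr l t" "t ^ (2 * l) * gr l t \<le> 2 / sqrt t"
proof -
  have s: "sqrt t > 0" "sqrt t \<le> 1" using assms by auto
  have s2: "1 \<le> 1 / sqrt t" using s by simp
  have p: "0 < t ^ (2 * l)" "t ^ (2 * l) \<le> 1" using assms by (auto intro: power_le_one)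
  show "0 \<le> gr l t" using assms p by (auto simp: gr_def)
  show "t ^ (2 * l) * gr l t \<le> 2 / sqrt t"
  proof (cases "l = 0")
    case True
    have "ln (1 / sqrt t) \<le> 1 / sqrt t - 1" using s by (intro ln_le_minus_one) simp
    then have "- ln t \<le> 2 * (1 / sqrt t) - 2" using assms by (simp add: ln_div ln_sqrt)
    then show ?thesis using True by (simp add: gr_def)
  next
    case False
    then have "t ^ (2 * l) * gr l t = (1 - t ^ (2 * l)) / (2 * real l)"
      using p assms by (simp add: gr_def right_diff_distrib)
    also have "\<dots> \<le> 1" using p False by (simp add: divide_le_eq)
    also have "\<dots> \<le> 2 / sqrt t" using s2 by simp
    finally show ?thesis .
  qed
qed

text \<open>An angular component of the Green function of the Dirichlet Laplacian, up to a constant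
  factor; the powers s^l and t^l of the radial kernel are contained in \<open>ang\<close>.\<close>

definition green :: "bool \<Rightarrow> nat \<Rightarrow> real^2 \<Rightarrow> real^2 \<Rightarrow> real" where
  "green b l x y = ang b l x * ang b l y * gr l (max (norm x) (norm y))"

text \<open>That the bound does not involve x is what makes \<open>greenop b l w\<close> a bounded
  function.\<close>

lemma abs_green_le:
  assumes "x \<in> disk" "y \<in> disk" "y \<noteq> 0" shows "\<bar>green b l x y\<bar> \<le> 2 / sqrt (norm y)"
proof -
  define m where "m = max (norm x) (norm y)"
  have y0: "0 < norm y" using assms by simp
  have m: "0 < m" "m \<le> 1" "norm y \<le> m" "norm x \<le> m"
    using assms less_le_trans[OF y0 max.cobounded2[of "norm y" "norm x"]] by (auto simp: m_def)
  have "\<bar>ang b l x\<bar> * \<bar>ang b l y\<bar> \<le> m ^ l * m ^ l"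
    using m abs_ang_le[of b l x] abs_ang_le[of b l y] power_mono[of "norm x" m l] power_mono[of "norm y" m l]
    by (intro mult_mono) (auto intro: order.trans)
  then have "\<bar>green b l x y\<bar> \<le> m ^ (2 * l) * gr l m"
    using gr_bound(1)[of m l] m
    by (simp add: green_def m_def[symmetric] abs_mult mult_2 power_add mult_right_mono)
  also have "\<dots> \<le> 2 / sqrt m" using gr_bound(2) m by blast
  also have "\<dots> \<le> 2 / sqrt (norm y)" 
  proof (rule divide_left_mono)
    show "0 < sqrt m * sqrt (norm y)" using m(1) y0 by (intro mult_pos_pos) simp_all
  qed (use m in simp_all)
  finally show ?thesis .
qed

text \<open>The function t^l \<kappa>(t) solves the radial problem with right-hand side t^l q(t) and
  value 0 at 1, so integration against the Green kernel must reproduce it. The flux A is -t^(2l+1)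
  \<kappa>'(t).\<close>

lemma integral_gr_radial:
  assumes q: "continuous_on UNIV q"
    and A: "\<And>r. (A has_real_derivative r ^ (2 * l + 1) * q r) (at r)" "A 0 = 0"
    and K: "\<And>r. r > 0 \<Longrightarrow> (\<kappa> has_real_derivative - A r / r ^ (2 * l + 1)) (at r)" "\<kappa> 1 = 0"
    and t: "0 < t" "t < 1"
  shows "(\<integral>x. norm x ^ (2 * l) * q (norm x) * gr l (max (norm x) t) \<partial>disk_measure) = 2 * pi * \<kappa> t"
proof -
  \<comment> \<open>Primitive of r times the radial integrand. Below t the kernel has the constant
    value \<open>gr l t\<close>; above t the term \<kappa> compensates the derivative of
    \<open>gr\<close>. The last bracket makes F vanish at 0.\<close>
  define F where "F r = gr l t * A (min r t) + (A (max r t) * gr l (max r t) - \<kappa> (max r t)) - (A t * gr l t - \<kappa> t)" for r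
  have cA: "continuous_on UNIV A" using A(1) by (meson DERIV_isCont continuous_at_imp_continuous_on)
  have cK: "continuous_on {0<..} \<kappa>"
    using K(1) by (meson DERIV_isCont continuous_at_imp_continuous_on greaterThan_iff)
  have mx: "continuous_on S (\<lambda>r. max r t)" "continuous_on S (\<lambda>r. min r t)" for S by (intro continuous_intros)+
  have cg: "continuous_on S (\<lambda>r. gr l (max r t))" for S
    by (rule continuous_on_compose2[OF continuous_gr mx(1)]) (use t in auto)
  have "(\<integral>x. norm x ^ (2 * l) * q (norm x) * gr l (max (norm x) t) \<partial>disk_measure) = 2 * pi * (F 1 - F 0)"
  proof (rule integral_radial_FTC[of "\<lambda>r. r ^ (2 * l) * q r * gr l (max r t)" "{t}"])
    show "continuous_on UNIV (\<lambda>r. r ^ (2 * l) * q r * gr l (max r t))"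
      by (intro continuous_intros q cg)
    show "continuous_on {0..1} F"
      unfolding F_def
      by (intro continuous_intros cg continuous_on_compose2[OF cA mx(1)] continuous_on_compose2[OF cA mx(2)]
        continuous_on_compose2[OF cK mx(1)]) (use t in auto)
    fix r :: real assume r: "0 < r" "r < 1" "r \<notin> {t}"
    show "(F has_real_derivative r * (r ^ (2 * l) * q r * gr l (max r t))) (at r)"
    proof (cases "r < t")
      case True
      have "((\<lambda>r. gr l t * A r) has_real_derivative gr l t * (r ^ (2 * l + 1) * q r)) (at r)"
        by (intro DERIV_cmult A)
      then have "(F has_real_derivative gr l t * (r ^ (2 * l + 1) * q r)) (at r)"
        by (rule has_field_derivative_transform_within_open[of _ _ _ "{..<t}"]) (use True in \<open>auto simp: F_def\<close>)
      then show ?thesis using True by (simp add: mult_ac)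
    next
      case False
      have "((\<lambda>r. A r * gr l r - \<kappa> r + (gr l t * A t - (A t * gr l t - \<kappa> t))) has_real_derivative
         (r ^ (2 * l + 1) * q r * gr l r + - 1 / r ^ (2 * l + 1) * A r) - (- A r / r ^ (2 * l + 1)) + 0) (at r)"
        by (intro DERIV_add DERIV_diff DERIV_mult A DERIV_gr K r DERIV_const)
      then have "(F has_real_derivative (r ^ (2 * l + 1) * q r * gr l r + - 1 / r ^ (2 * l + 1) * A r) - (- A r / r ^ (2 * l + 1)) + 0) (at r)"
        by (rule has_field_derivative_transform_within_open[of _ _ _ "{t<..}"]) (use False r in \<open>auto simp: F_def\<close>)
      then show ?thesis using False r by (simp add: mult_ac)
    qed
  qed simp
  also have "F 1 - F 0 = \<kappa> t"
    using t A(2) K(2) by (simp add: F_def)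
  finally show ?thesis .
qed

definition greenop :: "bool \<Rightarrow> nat \<Rightarrow> (real^2 \<Rightarrow> real) \<Rightarrow> real^2 \<Rightarrow> real" where
  "greenop b l w x = (\<integral>y. w y * green b l x y \<partial>disk_measure)"

context
  fixes w :: "real^2 \<Rightarrow> real"
  assumes w [measurable]: "w \<in> borel_measurable disk_measure" and w2: "integrable disk_measure (\<lambda>x. (w x)\<^sup>2)"
begin

lemma integrable_weighted: "integrable disk_measure (\<lambda>y. \<bar>w y\<bar> * (2 / sqrt (norm y)))"
proof (rule Bochner_Integration.integrable_bound)
  show "integrable disk_measure (\<lambda>y. (w y)\<^sup>2 + 1 / norm y)"
    by (intro Bochner_Integration.integrable_add w2 integrable_inverse_norm_disk)
  show "AE y in disk_measure. norm (\<bar>w y\<bar> * (2 / sqrt (norm y))) \<le> norm ((w y)\<^sup>2 + 1 / norm y)"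
  proof (rule AE_I2)
    fix y :: "real^2"
    have "0 \<le> (\<bar>w y\<bar> - 1 / sqrt (norm y))\<^sup>2" by simp
    then show "norm (\<bar>w y\<bar> * (2 / sqrt (norm y))) \<le> norm ((w y)\<^sup>2 + 1 / norm y)"
      by (simp add: power2_diff power_divide abs_mult mult.commute)
  qed
qed measurable

lemma green_measurable [measurable]:
  "(\<lambda>(x, y). green b l x y) \<in> borel_measurable (disk_measure \<Otimes>\<^sub>M disk_measure)"
  unfolding green_def by measurable

lemma abs_greenop_le:
  assumes "x \<in> disk" shows "\<bar>greenop b l w x\<bar> \<le> (\<integral>y. \<bar>w y\<bar> * (2 / sqrt (norm y)) \<partial>disk_measure)"
proof -
  have "\<bar>greenop b l w x\<bar> \<le> (\<integral>y. \<bar>w y * green b l x y\<bar> \<partial>disk_measure)"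
    unfolding greenop_def by (rule integral_abs_bound)
  also have "\<dots> \<le> (\<integral>y. \<bar>w y\<bar> * (2 / sqrt (norm y)) \<partial>disk_measure)"
  proof (rule integral_mono_AE')
    show "AE y in disk_measure. \<bar>w y * green b l x y\<bar> \<le> \<bar>w y\<bar> * (2 / sqrt (norm y))"
      using AE_disk_nonzero AE_space
      by eventually_elim (simp only: abs_mult, intro mult_left_mono abs_green_le, use assms in auto)
  qed (rule integrable_weighted, simp)
  finally show ?thesis .
qed

lemma greenop_measurable [measurable]: "greenop b l w \<in> borel_measurable disk_measure"
proof -
  have "(\<lambda>x. \<integral>y. (case (x, y) of (x, y) \<Rightarrow> w y * green b l x y) \<partial>disk_measure) \<in> borel_measurable disk_measure"
    by (rule disk.borel_measurable_lebesgue_integral) measurable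
  then show ?thesis by (simp add: greenop_def[abs_def])
qed

text \<open>Fubini's theorem, with a dominating function of y alone: the kernel acts on the test
  function Y instead of on w.\<close>

lemma integral_greenop:
  assumes Y [measurable]: "Y \<in> borel_measurable disk_measure" and YC: "\<And>x. x \<in> disk \<Longrightarrow> \<bar>Y x\<bar> \<le> C"
  shows "(\<integral>x. greenop b l w x * Y x \<partial>disk_measure)
    = (\<integral>y. w y * ang b l y * (\<integral>x. ang b l x * Y x * gr l (max (norm x) (norm y)) \<partial>disk_measure) \<partial>disk_measure)"
proof -
  interpret P: pair_sigma_finite disk_measure disk_measure ..
  have C: "C \<ge> 0" using YC[of 0] by simp
  let ?f = "\<lambda>x y. w y * green b l x y * Y x"
  let ?B = "\<lambda>y. \<bar>w y\<bar> * (2 / sqrt (norm y)) * C"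
  have m [measurable]: "case_prod ?f \<in> borel_measurable (disk_measure \<Otimes>\<^sub>M disk_measure)" by measurable
  have iB: "integrable disk_measure ?B" by (rule integrable_mult_left) (rule integrable_weighted)
  have bd: "AE y in disk_measure. norm (?f x y) \<le> ?B y" if x: "x \<in> disk" for x
    using AE_disk_nonzero AE_space
  proof eventually_elim
    case (elim y)
    have "\<bar>w y\<bar> * \<bar>green b l x y\<bar> * \<bar>Y x\<bar> \<le> \<bar>w y\<bar> * (2 / sqrt (norm y)) * C"
      by (intro mult_mono mult_left_mono abs_green_le YC) (use elim x C in auto)
    then show ?case by (simp add: abs_mult)
  qed
  have i1: "integrable disk_measure (?f x)" if x: "x \<in> disk" for x
  proof (rule Bochner_Integration.integrable_bound[OF iB])
    show "?f x \<in> borel_measurable disk_measure" unfolding green_def by measurable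
    show "AE y in disk_measure. norm (?f x y) \<le> norm (?B y)"
      using bd[OF x] by eventually_elim (erule order_trans, simp only: real_norm_def abs_ge_self)
  qed
  have "integrable (disk_measure \<Otimes>\<^sub>M disk_measure) (case_prod ?f)"
  proof (rule P.Fubini_integrable[OF m])
    show "AE x in disk_measure. integrable disk_measure (\<lambda>y. case_prod ?f (x, y))"
    proof (rule AE_I2)
      fix x assume "x \<in> space disk_measure"
      then have "integrable disk_measure (?f x)" by (intro i1) simp
      then show "integrable disk_measure (\<lambda>y. case_prod ?f (x, y))" by (simp only: split_conv)
    qed
    show "integrable disk_measure (\<lambda>x. \<integral>y. norm (case_prod ?f (x, y)) \<partial>disk_measure)"
    proof (rule integrable_disk_bounded)
      show "(\<lambda>x. \<integral>y. norm (case_prod ?f (x, y)) \<partial>disk_measure) \<in> borel_measurable disk_measure"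
        by (rule disk.borel_measurable_lebesgue_integral) measurable
      fix x :: "real^2" assume x: "x \<in> disk"
      have "(\<integral>y. norm (?f x y) \<partial>disk_measure) \<le> integral\<^sup>L disk_measure ?B"
        by (rule integral_mono_AE[OF integrable_norm[OF i1[OF x]] iB bd[OF x]])
      moreover have "0 \<le> (\<integral>y. norm (?f x y) \<partial>disk_measure)" by (rule Bochner_Integration.integral_nonneg) simp
      ultimately show "norm (\<integral>y. norm (case_prod ?f (x, y)) \<partial>disk_measure) \<le> integral\<^sup>L disk_measure ?B" by simp
    qed
  qed
  from P.Fubini_integral[OF this]
  have "(\<integral>x. \<integral>y. ?f x y \<partial>disk_measure \<partial>disk_measure) = (\<integral>y. \<integral>x. ?f x y \<partial>disk_measure \<partial>disk_measure)" ..
  moreover have "greenop b l w x * Y x = (\<integral>y. ?f x y \<partial>disk_measure)" for x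
    by (simp add: greenop_def)
  moreover have "(\<integral>x. ?f x y \<partial>disk_measure) = w y * ang b l y * (\<integral>x. ang b l x * Y x * gr l (max (norm x) (norm y)) \<partial>disk_measure)" for y
  proof -
    have "?f x y = w y * ang b l y * (ang b l x * Y x * gr l (max (norm x) (norm y)))" for x
      by (simp add: green_def)
    then show ?thesis by (simp only: integral_mult_right_zero)
  qed
  ultimately show ?thesis by (simp only:)
qed

end

subsection \<open>Completeness\<close>

text \<open>Stone-Weierstrass speaks of polynomials in real coordinates, the hypothesis of monomials
  in z and conj z. The weight h is carried along because in a product one factor is absorbed into h
  before the induction hypothesis of the other is applied.\<close>

lemma real_polynomial_moments_zero:
  fixes w :: "real^2 \<Rightarrow> real"
  assumes w: "integrable disk_measure w" and p: "real_polynomial_function p"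
    and h: "continuous_on UNIV h" and z: "\<And>a c. (\<integral>x. of_real (w x) * (h x * (cx x ^ a * cnj (cx x) ^ c)) \<partial>disk_measure) = 0"
  shows "(\<integral>x. of_real (w x) * (h x * of_real (p x) * (cx x ^ a * cnj (cx x) ^ c)) \<partial>disk_measure) = 0"
  using p h z
proof (induction p arbitrary: h a c rule: real_polynomial_function.induct)
  have int: "integrable disk_measure (\<lambda>x. of_real (w x) * (k x :: complex))" if k: "continuous_on UNIV k" for k
  proof -
    have "compact (k ` cball 0 1)"
      by (rule compact_continuous_image) (use k continuous_on_subset in auto)
    then obtain C where C: "\<And>x. x \<in> cball 0 1 \<Longrightarrow> norm (k x) \<le> C"
      using compact_imp_bounded bounded_iff by (metis image_eqI)
    show ?thesis
    proof (rule Bochner_Integration.integrable_bound)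
      show "integrable disk_measure (\<lambda>x. C * w x)" using w by simp
      show "(\<lambda>x. of_real (w x) * k x) \<in> borel_measurable disk_measure"
        using w continuous_measurable_disk[OF k] by (intro borel_measurable_times) auto
      show "AE x in disk_measure. norm (of_real (w x) * k x) \<le> norm (C * w x)"
      proof (rule AE_I2)
        fix x assume "x \<in> space disk_measure"
        then have "norm (k x) \<le> \<bar>C\<bar>" using C[of x] by simp
        then show "norm (of_real (w x) * k x) \<le> norm (C * w x)"
          using mult_right_mono[OF \<open>norm (k x) \<le> \<bar>C\<bar>\<close>, of "\<bar>w x\<bar>"] by (simp add: norm_mult abs_mult mult.commute)
      qed
    qed
  qed
  {
    case (linear f)
    \<comment> \<open>Every real linear form on the plane is \<alpha> z + conj(\<alpha>)
      conj(z).\<close>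
    define \<alpha> where "\<alpha> = Complex (f (axis 1 1) / 2) (- (f (axis 2 1) / 2))"
    have f: "complex_of_real (f x) = \<alpha> * cx x + cnj \<alpha> * cnj (cx x)" for x
    proof -
      have x: "x = x $ 1 *\<^sub>R axis 1 1 + x $ 2 *\<^sub>R axis 2 1"
        by (simp add: vec_eq_iff forall_2 axis_def)
      have "f x = x $ 1 * f (axis 1 1) + x $ 2 * f (axis 2 1)"
        using linear(1) by (subst x) (simp add: bounded_linear.linear linear_add linear_scale)
      then show ?thesis by (simp add: complex_eq_iff \<alpha>_def cx_def algebra_simps)
    qed
    have e: "of_real (w x) * (h x * of_real (f x) * (cx x ^ a * cnj (cx x) ^ c)) =
      \<alpha> * (of_real (w x) * (h x * (cx x ^ Suc a * cnj (cx x) ^ c)))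
      + cnj \<alpha> * (of_real (w x) * (h x * (cx x ^ a * cnj (cx x) ^ Suc c)))" for x
      unfolding f by (simp add: algebra_simps)
    have i: "integrable disk_measure (\<lambda>x. of_real (w x) * (h x * (cx x ^ a * cnj (cx x) ^ c)))" for a c
      by (intro int continuous_intros linear(2))
    show ?case
      unfolding e by (subst Bochner_Integration.integral_add) (simp_all only: integrable_mult_right i integral_mult_right_zero linear(3), simp)
  next
    case (const k)
    have e: "of_real (w x) * (h x * of_real k * (cx x ^ a * cnj (cx x) ^ c)) =
      of_real k * (of_real (w x) * (h x * (cx x ^ a * cnj (cx x) ^ c)))" for x
      by (simp add: mult_ac)
    show ?case unfolding e integral_mult_right_zero const(2) by simp
  next
    case (add f g)
    have cf: "continuous_on UNIV f" "continuous_on UNIV g"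
      using add(1,2) continuous_on_polymonial_function real_polynomial_function_eq by blast+
    have e: "of_real (w x) * (h x * of_real (f x + g x) * (cx x ^ a * cnj (cx x) ^ c)) =
      of_real (w x) * (h x * of_real (f x) * (cx x ^ a * cnj (cx x) ^ c))
      + of_real (w x) * (h x * of_real (g x) * (cx x ^ a * cnj (cx x) ^ c))" for x
      by (simp add: algebra_simps)
    have "integrable disk_measure (\<lambda>x. of_real (w x) * (h x * of_real (f x) * (cx x ^ a * cnj (cx x) ^ c)))"
      "integrable disk_measure (\<lambda>x. of_real (w x) * (h x * of_real (g x) * (cx x ^ a * cnj (cx x) ^ c)))"
      by (intro int continuous_intros add(5) cf)+
    then show ?case
      unfolding e using add(3)[OF add(5,6)] add(4)[OF add(5,6)] by simp
  next
    case (mult f g)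
    have cf: "continuous_on UNIV f"
      using mult(1) continuous_on_polymonial_function real_polynomial_function_eq by blast
    have "(\<integral>x. of_real (w x) * (h x * of_real (f x) * of_real (g x) * (cx x ^ a * cnj (cx x) ^ c)) \<partial>disk_measure) = 0"
      by (rule mult(4)) (intro continuous_intros mult(5) cf, rule mult(3)[OF mult(5,6)])
    then show ?case by (simp add: mult.assoc)
  }
qed

text \<open>Vanishing against polynomials extends to continuous functions by uniform approximation
  on the closed disk, and from there to a clipped version of w itself by dominated
  convergence.\<close>

lemma moments_zero_imp_AE_zero:
  fixes w :: "real^2 \<Rightarrow> real"
  assumes w: "integrable disk_measure w"
    and z: "\<And>a c. (\<integral>x. of_real (w x) * (cx x ^ a * cnj (cx x) ^ c) \<partial>disk_measure) = 0"
  shows "AE x in disk_measure. w x = 0"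
proof -
  have wm [measurable]: "w \<in> borel_measurable disk_measure" using w by auto
  have poly: "(\<integral>x. w x * p x \<partial>disk_measure) = 0" if "real_polynomial_function p" for p
  proof -
    have "(\<integral>x. complex_of_real (w x * p x) \<partial>disk_measure) = 0"
      using real_polynomial_moments_zero[OF w that, of "\<lambda>_. 1" 0 0] z by simp
    then show ?thesis by (simp only: integral_complex_of_real of_real_eq_0_iff)
  qed
  have intw: "integrable disk_measure (\<lambda>x. w x * f x)"
    if "f \<in> borel_measurable disk_measure" "\<And>x. x \<in> disk \<Longrightarrow> \<bar>f x\<bar> \<le> C" for f C
  proof (rule Bochner_Integration.integrable_bound)
    show "integrable disk_measure (\<lambda>x. C * w x)" using w by simp
    show "AE x in disk_measure. norm (w x * f x) \<le> norm (C * w x)"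
    proof (rule AE_I2)
      fix x assume "x \<in> space disk_measure"
      then have "\<bar>f x\<bar> \<le> \<bar>C\<bar>" using that(2)[of x] by simp
      then show "norm (w x * f x) \<le> norm (C * w x)"
        using mult_right_mono[OF \<open>\<bar>f x\<bar> \<le> \<bar>C\<bar>\<close>, of "\<bar>w x\<bar>"] by (simp add: abs_mult mult.commute)
    qed
  qed (use that(1) in measurable)
  have bdd: "\<exists>C. \<forall>x\<in>disk. \<bar>f x\<bar> \<le> C" if f: "continuous_on UNIV f" for f :: "real^2 \<Rightarrow> real"
  proof -
    have "compact (f ` cball 0 1)"
      by (rule compact_continuous_image) (use f continuous_on_subset in auto)
    then have "bounded (f ` cball 0 1)" by (rule compact_imp_bounded)
    then obtain C where "\<forall>y\<in>f ` cball 0 1. norm y \<le> C" unfolding bounded_iff by blast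
    then show ?thesis by (intro exI[of _ C]) auto
  qed
  have cont: "(\<integral>x. w x * f x \<partial>disk_measure) = 0" if f: "continuous_on UNIV f" for f
  proof -
    define I where "I = (\<integral>x. \<bar>w x\<bar> \<partial>disk_measure)"
    have I0: "I \<ge> 0" unfolding I_def by (rule Bochner_Integration.integral_nonneg) simp
    have "\<bar>\<integral>x. w x * f x \<partial>disk_measure\<bar> \<le> e * I" if e: "e > 0" for e
    proof -
      obtain g where g: "real_polynomial_function g" "\<And>x. x \<in> cball 0 1 \<Longrightarrow> \<bar>f x - g x\<bar> < e"
        using Stone_Weierstrass_real_polynomial_function[OF compact_cball continuous_on_subset[OF f] e, of 0 1] by auto
      have cg: "continuous_on UNIV g"
        using g(1) continuous_on_polymonial_function real_polynomial_function_eq by blast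
      obtain C C' where C: "\<And>x. x \<in> disk \<Longrightarrow> \<bar>f x\<bar> \<le> C" "\<And>x. x \<in> disk \<Longrightarrow> \<bar>g x\<bar> \<le> C'"
        using bdd[OF f] bdd[OF cg] by blast
      have i: "integrable disk_measure (\<lambda>x. w x * f x)" "integrable disk_measure (\<lambda>x. w x * g x)"
        by (rule intw[OF continuous_measurable_disk[OF f] C(1)], assumption)
           (rule intw[OF continuous_measurable_disk[OF cg] C(2)])
      have "(\<integral>x. w x * f x \<partial>disk_measure) = (\<integral>x. w x * f x - w x * g x \<partial>disk_measure)"
        using i poly[OF g(1)] by simp
      also have "\<bar>\<dots>\<bar> \<le> (\<integral>x. \<bar>w x * f x - w x * g x\<bar> \<partial>disk_measure)"
        by (rule integral_abs_bound)
      also have "\<dots> \<le> (\<integral>x. e * \<bar>w x\<bar> \<partial>disk_measure)"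
      proof (rule integral_mono)
        show "\<bar>w x * f x - w x * g x\<bar> \<le> e * \<bar>w x\<bar>" if "x \<in> space disk_measure" for x
        proof -
          have "\<bar>w x * f x - w x * g x\<bar> = \<bar>w x\<bar> * \<bar>f x - g x\<bar>"
            by (simp add: abs_mult flip: right_diff_distrib)
          also have "\<dots> \<le> \<bar>w x\<bar> * e" using g(2)[of x] that by (intro mult_left_mono) auto
          finally show ?thesis by (simp add: mult.commute)
        qed
      qed (use i w in auto)
      finally show ?thesis by (simp add: I_def)
    qed
    then have "\<bar>\<integral>x. w x * f x \<partial>disk_measure\<bar> \<le> 0 + e" if "e > 0" for e
      using \<open>\<And>e. e > 0 \<Longrightarrow> _\<close>[of "e / (I + 1)"] that I0
      by (smt (verit, best) add_0 divide_pos_pos mult.commute mult_left_mono nonzero_mult_div_cancel_left times_divide_eq_left)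
    then have "\<bar>\<integral>x. w x * f x \<partial>disk_measure\<bar> \<le> 0" by (rule field_le_epsilon)
    then show ?thesis by simp
  qed
  define w' where "w' x = (if x \<in> disk then w x else 0)" for x
  have "w' \<in> borel_measurable lebesgue"
    unfolding w'_def by (rule borel_measurable_if_I) (use wm in auto)
  then have "w' measurable_on UNIV" by (rule lebesgue_measurable_imp_measurable_on) simp
  then obtain N g where N: "negligible N" and g: "\<And>n::nat. continuous_on UNIV (g n)"
    and lim: "\<And>x. x \<notin> N \<Longrightarrow> (\<lambda>n. g n x) \<longlonglongrightarrow> w' x"
    unfolding measurable_on_def by auto
  \<comment> \<open>As w is only integrable, w^2 need not be. The clipped w is bounded, has the sign
    of w, and is an a.e. limit of continuous functions.\<close>
  define cl where "cl t = max (-1) (min 1 t)" for t :: real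
  have ccl: "continuous_on UNIV (\<lambda>x. cl (g n x))" for n
    unfolding cl_def by (intro continuous_intros g)
  have "(\<lambda>n. \<integral>x. w x * cl (g n x) \<partial>disk_measure) \<longlonglongrightarrow> (\<integral>x. w x * cl (w x) \<partial>disk_measure)"
  proof (rule integral_dominated_convergence)
    show "integrable disk_measure (\<lambda>x. \<bar>w x\<bar>)" using w by simp
    show "(\<lambda>x. w x * cl (w x)) \<in> borel_measurable disk_measure" unfolding cl_def by measurable
    show "(\<lambda>x. w x * cl (g n x)) \<in> borel_measurable disk_measure" for n
      by (intro borel_measurable_times wm continuous_measurable_disk ccl)
    have "AE x in lebesgue. x \<notin> N"
      using N by (intro AE_not_in) (simp add: negligible_iff_null_sets)
    then have "AE x in disk_measure. x \<notin> N" by (simp add: AE_restrict_space_iff) (auto elim: eventually_mono)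
    then show "AE x in disk_measure. (\<lambda>n. w x * cl (g n x)) \<longlonglongrightarrow> w x * cl (w x)"
      using AE_space
    proof eventually_elim
      case (elim x)
      then have "(\<lambda>n. g n x) \<longlonglongrightarrow> w x" using lim[of x] by (simp add: w'_def)
      then show ?case unfolding cl_def by (intro tendsto_intros)
    qed
    show "AE x in disk_measure. norm (w x * cl (g n x)) \<le> \<bar>w x\<bar>" for n
      by (rule AE_I2) (auto simp: abs_mult cl_def intro!: mult_left_le)
  qed
  then have 0: "(\<integral>x. w x * cl (w x) \<partial>disk_measure) = 0"
    using cont[OF ccl] by (simp add: LIMSEQ_const_iff)
  have "AE x in disk_measure. w x * cl (w x) = 0"
  proof (subst integral_nonneg_eq_0_iff_AE[symmetric])
    show "integrable disk_measure (\<lambda>x. w x * cl (w x))"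
      by (rule intw[of _ 1]) (auto simp: cl_def)
    show "AE x in disk_measure. 0 \<le> w x * cl (w x)"
      by (rule AE_I2) (auto simp: cl_def zero_le_mult_iff max_def min_def)
  qed (rule 0)
  then show ?thesis
    by eventually_elim (auto simp: cl_def max_def min_def split: if_splits)
qed

text \<open>z^a conj(z)^c is a power of z or of conj z, according to the larger exponent, times an
  even power of the norm.\<close>

lemma ang_moments_zero_imp_AE_zero:
  fixes w :: "real^2 \<Rightarrow> real"
  assumes w: "integrable disk_measure w"
    and z: "\<And>b l i. (\<integral>x. w x * ang b l x * norm x ^ (2 * i) \<partial>disk_measure) = 0"
  shows "AE x in disk_measure. w x = 0"
proof (rule moments_zero_imp_AE_zero[OF w])
  have int: "integrable disk_measure (\<lambda>x. of_real (w x) * (k x :: complex))"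
    if k: "k \<in> borel_measurable disk_measure" "\<And>x. x \<in> disk \<Longrightarrow> norm (k x) \<le> 1" for k
    by (rule Bochner_Integration.integrable_bound[OF w])
      (use k w in \<open>auto simp: norm_mult intro!: mult_left_le AE_I2\<close>)
  have *: "(\<integral>x. of_real (w x) * (cx x ^ l * of_real (norm x ^ (2 * i))) \<partial>disk_measure) = 0" for l i
  proof -
    let ?f = "\<lambda>x. of_real (w x) * (cx x ^ l * of_real (norm x ^ (2 * i)))"
    have f: "integrable disk_measure ?f"
      by (rule int, measurable) (auto simp: norm_mult norm_power intro!: mult_le_one power_le_one)
    have "Re (integral\<^sup>L disk_measure ?f) = (\<integral>x. w x * ang False l x * norm x ^ (2 * i) \<partial>disk_measure)"
      unfolding integral_Re[OF f, symmetric] by (rule Bochner_Integration.integral_cong) (simp_all add: ang_def mult.assoc)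
    moreover have "Im (integral\<^sup>L disk_measure ?f) = (\<integral>x. w x * ang True l x * norm x ^ (2 * i) \<partial>disk_measure)"
      unfolding integral_Im[OF f, symmetric] by (rule Bochner_Integration.integral_cong) (simp_all add: ang_def mult.assoc)
    ultimately show ?thesis using z by (simp add: complex_eq_iff)
  qed
  have nn: "cx x * cnj (cx x) = of_real (norm x ^ 2)" for x
    by (simp only: complex_norm_square[symmetric] norm_cx of_real_power)
  fix a c
  show "(\<integral>x. of_real (w x) * (cx x ^ a * cnj (cx x) ^ c) \<partial>disk_measure) = 0"
  proof (cases "c \<le> a")
    case True
    then have "cx x ^ a * cnj (cx x) ^ c = cx x ^ (a - c) * of_real (norm x ^ (2 * c))" for x
    proof -
      have "cx x ^ a = cx x ^ (a - c) * cx x ^ c" using True by (simp flip: power_add)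
      then show ?thesis by (simp only: mult.assoc power_mult_distrib[symmetric] nn power_mult of_real_power)
    qed
    then show ?thesis using * by simp
  next
    case False
    then have e: "cx x ^ a * cnj (cx x) ^ c = cnj (cx x ^ (c - a) * of_real (norm x ^ (2 * a)))" for x
    proof -
      have "cnj (cx x) ^ c = cnj (cx x) ^ a * cnj (cx x) ^ (c - a)" using False by (simp flip: power_add)
      then have "cx x ^ a * cnj (cx x) ^ c = (cx x * cnj (cx x)) ^ a * cnj (cx x) ^ (c - a)"
        by (simp only: mult.assoc power_mult_distrib)
      moreover have "(cx x * cnj (cx x)) ^ a = of_real (norm x ^ (2 * a))"
        by (simp only: nn power_mult of_real_power)
      ultimately show ?thesis
        by (simp only: complex_cnj_mult complex_cnj_power complex_cnj_complex_of_real mult.commute)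
    qed
    have "(\<integral>x. of_real (w x) * (cx x ^ a * cnj (cx x) ^ c) \<partial>disk_measure)
      = (\<integral>x. cnj (of_real (w x) * (cx x ^ (c - a) * of_real (norm x ^ (2 * a)))) \<partial>disk_measure)"
      unfolding e by simp
    also have "\<dots> = 0" by (subst Bochner_Integration.integral_cnj) (simp only: * complex_cnj_zero)
    finally show ?thesis .
  qed
qed


text \<open>The Green operator maps the orthogonal complement of the modes into itself, and its values are
  bounded functions. Testing \<open>greenop b l w = 0\<close> against \<open>r\<^bsup>2i\<^esup>\<close> yields the moments of \<open>w\<close>.\<close>

lemma complete_if_bounded_complete:
  fixes w :: "real^2 \<Rightarrow> real"
  assumes w [measurable]: "w \<in> borel_measurable disk_measure" and w2: "integrable disk_measure (\<lambda>x. (w x)\<^sup>2)"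
    and Z: "\<And>l. Z l \<subseteq> {c. c > 0 \<and> bes l c = 0}"
    and wz: "\<And>b l c. c \<in> Z l \<Longrightarrow> (b \<Longrightarrow> l > 0) \<Longrightarrow> (\<integral>x. w x * (ang b l x * bes l (c * (norm x)\<^sup>2)) \<partial>disk_measure) = 0"
    and bounded_complete: "\<And>W C. W \<in> borel_measurable disk_measure \<Longrightarrow> (\<And>x. x \<in> disk \<Longrightarrow> \<bar>W x\<bar> \<le> C) \<Longrightarrow>
      (\<And>b l c. c \<in> Z l \<Longrightarrow> (b \<Longrightarrow> l > 0) \<Longrightarrow> (\<integral>x. W x * (ang b l x * bes l (c * (norm x)\<^sup>2)) \<partial>disk_measure) = 0) \<Longrightarrow>
      AE x in disk_measure. W x = 0"
  shows "AE x in disk_measure. w x = 0"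
proof -
  have iw: "integrable disk_measure w"
  proof (rule Bochner_Integration.integrable_bound)
    show "integrable disk_measure (\<lambda>x. (w x)\<^sup>2 + 1)" using w2 by simp
    show "AE x in disk_measure. norm (w x) \<le> norm ((w x)\<^sup>2 + 1)"
    proof (rule AE_I2)
      fix x
      have "0 \<le> (\<bar>w x\<bar> - 1)\<^sup>2" by simp
      then have "2 * \<bar>w x\<bar> \<le> (w x)\<^sup>2 + 1" by (simp add: power2_diff)
      then show "norm (w x) \<le> norm ((w x)\<^sup>2 + 1)" by simp
    qed
  qed measurable
  define G where "G l q y = (\<integral>x. norm x ^ (2 * l) * q (norm x) * gr l (max (norm x) (norm y)) \<partial>disk_measure)"
    for l and q :: "real \<Rightarrow> real" and y :: "real^2"
  \<comment> \<open>Pairing with a separated test function: the kernel is moved to the other side,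
    and angular integration leaves only the matching component.\<close>
  have test: "(\<integral>x. greenop b l w x * (ang b' l' x * q (norm x)) \<partial>disk_measure) =
      (if b = b' \<and> l = l' then (if l = 0 then 1 else 1 / 2) * (\<integral>y. w y * ang b l y * G l q y \<partial>disk_measure) else 0)"
    if q: "continuous_on UNIV q" and l: "b \<Longrightarrow> l > 0" "b' \<Longrightarrow> l' > 0" for b l b' l' q
  proof -
    let ?Y = "\<lambda>x. ang b' l' x * q (norm x)"
    let ?k = "if b = b' \<and> l = l' then (if l = 0 then 1 else 1 / 2 :: real) else 0"
    have cY: "continuous_on UNIV ?Y"
      by (intro continuous_intros continuous_on_compose2[OF q]) auto
    have "bounded (?Y ` cball 0 1)"
      by (intro compact_imp_bounded compact_continuous_image continuous_on_subset[OF cY]) auto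
    then obtain C where "\<forall>y\<in>?Y ` cball 0 1. norm y \<le> C" unfolding bounded_iff by blast
    then have C: "\<And>x. x \<in> disk \<Longrightarrow> \<bar>?Y x\<bar> \<le> C" by auto
    have qm [measurable]: "q \<in> borel_measurable borel" by (rule borel_measurable_continuous_onI[OF q])
    have inner: "(\<integral>x. ang b l x * ?Y x * gr l (max (norm x) (norm y)) \<partial>disk_measure) = ?k * G l q y"
      if y: "y \<in> disk" "y \<noteq> 0" for y
    proof -
      define t where "t = norm y"
      have t: "0 < t" "t < 1" using y by (auto simp: t_def)
      have cg: "continuous_on UNIV (\<lambda>r. gr l (max r t))"
        by (rule continuous_on_compose2[OF continuous_gr]) (use t in \<open>auto intro!: continuous_intros\<close>)
      define g where "g r = q r * gr l (max r t)" for r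
      have g: "continuous_on UNIV g" unfolding g_def by (intro continuous_intros q cg)
      have "(\<integral>x. ang b l x * ang b' l' x * g (norm x) \<partial>disk_measure) =
        (if b = b' \<and> l = l' then (if l = 0 then 1 else 1 / 2) * (\<integral>x. norm x ^ (2 * l) * g (norm x) \<partial>disk_measure) else 0)"
      proof (rule integral_ang_ang)
        show "g \<in> borel_measurable borel" using g by (rule borel_measurable_continuous_onI)
        show "integrable disk_measure (\<lambda>x. norm x ^ (l + l') * g (norm x))"
          by (intro integrable_disk_continuous continuous_intros continuous_on_compose2[OF g]) auto
      qed (use l in auto)
      then show ?thesis by (simp add: g_def t_def G_def mult.assoc)
    qed
    have "(\<integral>x. greenop b l w x * ?Y x \<partial>disk_measure)
      = (\<integral>y. w y * ang b l y * (\<integral>x. ang b l x * ?Y x * gr l (max (norm x) (norm y)) \<partial>disk_measure) \<partial>disk_measure)"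
      by (rule integral_greenop[OF w w2 continuous_measurable_disk[OF cY] C])
    also have "\<dots> = (\<integral>y. ?k * (w y * ang b l y * G l q y) \<partial>disk_measure)"
    proof (rule integral_cong_AE)
      show "AE y in disk_measure. w y * ang b l y * (\<integral>x. ang b l x * ?Y x * gr l (max (norm x) (norm y)) \<partial>disk_measure)
        = ?k * (w y * ang b l y * G l q y)"
        using AE_disk_nonzero AE_space
      proof eventually_elim
        case (elim y)
        then have "(\<integral>x. ang b l x * ?Y x * gr l (max (norm x) (norm y)) \<partial>disk_measure) = ?k * G l q y"
          by (intro inner) auto
        then show ?case by (simp only: ac_simps)
      qed
      have [measurable]: "?Y \<in> borel_measurable disk_measure" by (rule continuous_measurable_disk[OF cY])
      have "(\<lambda>y. \<integral>x. (case (y, x) of (y, x) \<Rightarrow> ang b l x * ?Y x * gr l (max (norm x) (norm y))) \<partial>disk_measure) \<in> borel_measurable disk_measure"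
        by (rule disk.borel_measurable_lebesgue_integral) measurable
      then show "(\<lambda>y. w y * ang b l y * (\<integral>x. ang b l x * ?Y x * gr l (max (norm x) (norm y)) \<partial>disk_measure)) \<in> borel_measurable disk_measure"
        by simp
      have "(\<lambda>y. \<integral>x. (case (y, x) of (y, x) \<Rightarrow> norm x ^ (2 * l) * q (norm x) * gr l (max (norm x) (norm y))) \<partial>disk_measure) \<in> borel_measurable disk_measure"
        by (rule disk.borel_measurable_lebesgue_integral) measurable
      then have "G l q \<in> borel_measurable disk_measure" by (simp add: G_def[abs_def])
      then show "(\<lambda>y. ?k * (w y * ang b l y * G l q y)) \<in> borel_measurable disk_measure"
        by (intro borel_measurable_times w ang_measurable borel_measurable_const)
    qed
    also have "\<dots> = ?k * (\<integral>y. w y * ang b l y * G l q y \<partial>disk_measure)"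
      by (rule integral_mult_right_zero)
    finally show ?thesis by simp
  qed
  \<comment> \<open>An explicit value as soon as \<kappa> solves the radial problem with right-hand
    side q.\<close>
  have G: "(\<integral>y. w y * ang b l y * G l q y \<partial>disk_measure) = (\<integral>y. w y * ang b l y * (2 * pi * \<kappa> (norm y)) \<partial>disk_measure)"
    if q: "continuous_on UNIV q"
      and A: "\<And>r. (A has_real_derivative r ^ (2 * l + 1) * q r) (at r)" "A 0 = 0"
      and K: "\<And>r. r > 0 \<Longrightarrow> (\<kappa> has_real_derivative - A r / r ^ (2 * l + 1)) (at r)" "\<kappa> 1 = 0"
      and \<kappa>m: "continuous_on UNIV \<kappa>"
    for b l q A \<kappa>
  proof (rule integral_cong_AE)
    have eq: "AE y in disk_measure. G l q y = 2 * pi * \<kappa> (norm y)"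
      using AE_disk_nonzero AE_space
    proof eventually_elim
      case (elim y)
      then show ?case
        unfolding G_def by (intro integral_gr_radial[OF q A K]) auto
    qed
    then show "AE y in disk_measure. w y * ang b l y * G l q y = w y * ang b l y * (2 * pi * \<kappa> (norm y))"
      by eventually_elim simp
    have [measurable]: "\<kappa> \<in> borel_measurable borel" "q \<in> borel_measurable borel"
      by (rule borel_measurable_continuous_onI, fact)+
    show "(\<lambda>y. w y * ang b l y * (2 * pi * \<kappa> (norm y))) \<in> borel_measurable disk_measure" by measurable
    have "(\<lambda>y. \<integral>x. (case (y, x) of (y, x) \<Rightarrow> norm x ^ (2 * l) * q (norm x) * gr l (max (norm x) (norm y))) \<partial>disk_measure) \<in> borel_measurable disk_measure"
      by (rule disk.borel_measurable_lebesgue_integral) measurable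
    then have "G l q \<in> borel_measurable disk_measure" by (simp add: G_def[abs_def])
    then show "(\<lambda>y. w y * ang b l y * G l q y) \<in> borel_measurable disk_measure"
      by (intro borel_measurable_times w ang_measurable)
  qed
  \<comment> \<open>The modes are eigenfunctions of the Green operator, so
    \<open>greenop b l w\<close> inherits the orthogonality of w to all of them. Being bounded, it
    falls under the hypothesis on bounded functions.\<close>
  have W0: "AE x in disk_measure. greenop b l w x = 0" if l: "b \<Longrightarrow> l > 0" for b l
  proof (rule bounded_complete)
    show "greenop b l w \<in> borel_measurable disk_measure" by (rule greenop_measurable[OF w w2])
    show "\<bar>greenop b l w x\<bar> \<le> (\<integral>y. \<bar>w y\<bar> * (2 / sqrt (norm y)) \<partial>disk_measure)" if "x \<in> disk" for x
      by (rule abs_greenop_le[OF w w2 that])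
    fix b' l' c assume c: "c \<in> Z l'" and l': "b' \<Longrightarrow> l' > 0"
    have c0: "c > 0" "bes l' c = 0" using c Z by auto
    have cq: "continuous_on UNIV (\<lambda>r. bes l' (c * r\<^sup>2))" by (intro continuous_intros)
    show "(\<integral>x. greenop b l w x * (ang b' l' x * bes l' (c * (norm x)\<^sup>2)) \<partial>disk_measure) = 0"
    proof (cases "b = b' \<and> l = l'")
      case False
      then show ?thesis by (subst test[of _ b l b' l', OF cq l l']) auto
    next
      case True
      define A where "A r = 1 / 2 * (r ^ (2 * l + 2) * bes (Suc l) (c * r\<^sup>2))" for r :: real
      \<comment> \<open>The eigenvalue relation: for c = (j/2)^2 the inverse operator multiplies the
        radial factor by 1/j^2 = 1/(4c).\<close>
      define \<kappa> where "\<kappa> r = 1 / (4 * c) * bes l (c * r\<^sup>2)" for r :: real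
      have "(\<integral>y. w y * ang b l y * G l (\<lambda>r. bes l' (c * r\<^sup>2)) y \<partial>disk_measure)
        = (\<integral>y. w y * ang b l y * (2 * pi * \<kappa> (norm y)) \<partial>disk_measure)"
      proof (rule G[OF cq, of A])
        show "(A has_real_derivative r ^ (2 * l + 1) * bes l' (c * r\<^sup>2)) (at r)" for r
        proof -
          have "(A has_real_derivative 1 / 2 * (2 * r ^ (2 * l + 1) * bes l (c * r\<^sup>2))) (at r)"
            unfolding A_def by (intro DERIV_cmult DERIV_bes_radial_flux)
          moreover have "1 / 2 * (2 * r ^ (2 * l + 1) * bes l (c * r\<^sup>2)) = r ^ (2 * l + 1) * bes l (c * r\<^sup>2)" by simp
          ultimately show ?thesis using True by (simp only:)
        qed
        show "(\<kappa> has_real_derivative - A r / r ^ (2 * l + 1)) (at r)" if "r > 0" for r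
        proof -
          have "(\<kappa> has_real_derivative 1 / (4 * c) * - (2 * c * r * bes (Suc l) (c * r\<^sup>2))) (at r)"
            unfolding \<kappa>_def by (intro DERIV_cmult DERIV_bes_radial)
          moreover have "1 / (4 * c) * - (2 * c * r * bes (Suc l) (c * r\<^sup>2)) = - A r / r ^ (2 * l + 1)"
            using c0 that by (simp add: A_def field_simps)
          ultimately show ?thesis by (simp only:)
        qed
        show "continuous_on UNIV \<kappa>"
          unfolding \<kappa>_def by (intro continuous_intros)
      qed (use True c0 in \<open>auto simp: A_def \<kappa>_def\<close>)
      also have "\<dots> = (\<integral>y. 2 * pi / (4 * c) * (w y * (ang b l y * bes l (c * (norm y)\<^sup>2))) \<partial>disk_measure)"
        by (rule Bochner_Integration.integral_cong) (simp_all add: \<kappa>_def)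
      also have "\<dots> = 0"
        using wz[of c l' b', OF c l'] True by simp
      finally have z: "(\<integral>y. w y * ang b l y * G l (\<lambda>r. bes l' (c * r\<^sup>2)) y \<partial>disk_measure) = 0" .
      show ?thesis by (subst test[of _ b l b' l', OF cq l l']) (unfold z, auto)
    qed
  qed
  have iwa: "integrable disk_measure (\<lambda>y. w y * ang b l y * norm y ^ i)" for b l i
  proof (rule Bochner_Integration.integrable_bound[OF iw])
    show "AE y in disk_measure. norm (w y * ang b l y * norm y ^ i) \<le> norm (w y)"
    proof (rule AE_I2)
      fix y :: "real^2" assume "y \<in> space disk_measure"
      then have "\<bar>ang b l y\<bar> \<le> 1" "norm y ^ i \<le> 1"
        using abs_ang_le[of b l y] power_le_one[of "norm y" l] power_le_one[of "norm y" i] by auto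
      then have "\<bar>ang b l y\<bar> * norm y ^ i \<le> 1" by (intro mult_le_one) auto
      then show "norm (w y * ang b l y * norm y ^ i) \<le> norm (w y)"
        by (simp add: abs_mult mult.assoc mult_left_le)
    qed
  qed measurable
  \<comment> \<open>Here \<kappa> is a multiple of 1 - r^(2i+2), so the vanishing of the pairing
    equates the moment of order 2i + 2 with the one of order 0.\<close>
  have step: "(\<integral>y. w y * ang b l y * norm y ^ (2 * i + 2) \<partial>disk_measure) = (\<integral>y. w y * ang b l y * norm y ^ 0 \<partial>disk_measure)"
    if l: "b \<Longrightarrow> l > 0" for b l i
  proof -
    define n where "n = 2 * real l + 2 * real i + 2"
    define k where "k = 2 * real i + 2"
    have n: "n > 0" and k: "k > 0" by (simp_all add: n_def k_def)
    define A where "A r = r ^ (2 * l + 2 * i + 2) / n" for r :: real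
    define \<kappa> where "\<kappa> r = (1 - r ^ (2 * i + 2)) / (k * n)" for r :: real
    have cq: "continuous_on UNIV (\<lambda>r::real. r ^ (2 * i))" by (intro continuous_intros)
    have "(\<integral>x. greenop b l w x * (ang b l x * norm x ^ (2 * i)) \<partial>disk_measure) = 0"
      by (rule integral_eq_zero_AE) (use W0[of b l] l in \<open>auto elim!: eventually_mono\<close>)
    then have "0 = (\<integral>y. w y * ang b l y * G l (\<lambda>r. r ^ (2 * i)) y \<partial>disk_measure)"
      using test[of _ b l b l, OF cq l l] by (simp split: if_splits)
    also have "\<dots> = (\<integral>y. w y * ang b l y * (2 * pi * \<kappa> (norm y)) \<partial>disk_measure)"
    proof (rule G[OF cq, of A])
      show "(A has_real_derivative r ^ (2 * l + 1) * r ^ (2 * i)) (at r)" for r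
      proof -
        have "(A has_real_derivative real (2 * l + 2 * i + 2) * r ^ (2 * l + 2 * i + 1) / n) (at r)"
          unfolding A_def using DERIV_cdivide[OF DERIV_pow[of "2 * l + 2 * i + 2" r], of n] by simp
        moreover have "real (2 * l + 2 * i + 2) = n" by (simp add: n_def)
        moreover have "n * r ^ (2 * l + 2 * i + 1) / n = r ^ (2 * l + 1) * r ^ (2 * i)"
          using n by (simp add: power_add)
        ultimately show ?thesis by (simp only:)
      qed
      show "(\<kappa> has_real_derivative - A r / r ^ (2 * l + 1)) (at r)" if "r > 0" for r
      proof -
        have "(\<kappa> has_real_derivative (0 - real (2 * i + 2) * r ^ (2 * i + 1)) / (k * n)) (at r)"
          unfolding \<kappa>_def using DERIV_pow[of "2 * i + 2" r]
          by (intro DERIV_cdivide DERIV_diff DERIV_const) simp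
        moreover have "real (2 * i + 2) = k" by (simp add: k_def)
        moreover have "(0 - k * r ^ (2 * i + 1)) / (k * n) = - A r / r ^ (2 * l + 1)"
        proof -
          have "r ^ (2 * l + 2 * i + 2) = r ^ (2 * i + 1) * r ^ (2 * l + 1)" by (simp flip: power_add add: algebra_simps)
          then show ?thesis using k n that unfolding A_def by simp
        qed
        ultimately show ?thesis by (simp only:)
      qed
      show "continuous_on UNIV \<kappa>" unfolding \<kappa>_def using k n by (intro continuous_intros) auto
    qed (auto simp: A_def \<kappa>_def)
    also have "\<dots> = (\<integral>y. 2 * pi / (k * n) * (w y * ang b l y * norm y ^ 0 - w y * ang b l y * norm y ^ (2 * i + 2)) \<partial>disk_measure)"
      by (rule Bochner_Integration.integral_cong) (simp_all add: \<kappa>_def algebra_simps diff_divide_distrib)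
    also have "\<dots> = 2 * pi / (k * n) * ((\<integral>y. w y * ang b l y * norm y ^ 0 \<partial>disk_measure) - (\<integral>y. w y * ang b l y * norm y ^ (2 * i + 2) \<partial>disk_measure))"
      unfolding integral_mult_right_zero by (subst Bochner_Integration.integral_diff[OF iwa iwa]) (rule refl)
    finally show ?thesis using k n by simp
  qed
  show ?thesis
  proof (rule ang_moments_zero_imp_AE_zero[OF iw])
    fix b l i
    show "(\<integral>x. w x * ang b l x * norm x ^ (2 * i) \<partial>disk_measure) = 0"
    proof (cases "b \<and> l = 0")
      case True
      then show ?thesis by (simp add: ang_def)
    next
      case False
      then have l: "b \<Longrightarrow> l > 0" by auto
      \<comment> \<open>All these moments agree, yet they tend to 0 because the norm is below 1 on
        the disk; hence they vanish.\<close>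
      have "(\<lambda>i. \<integral>y. w y * ang b l y * norm y ^ (2 * i + 2) \<partial>disk_measure) \<longlonglongrightarrow> (\<integral>y. 0 \<partial>(disk_measure :: (real^2) measure))"
      proof (rule integral_dominated_convergence)
        show "integrable disk_measure (\<lambda>y. \<bar>w y * ang b l y * norm y ^ 0\<bar>)" using iwa[of b l 0] by (rule integrable_abs)
        show "AE y in disk_measure. (\<lambda>i. w y * ang b l y * norm y ^ (2 * i + 2)) \<longlonglongrightarrow> 0"
        proof (rule AE_I2)
          fix y :: "real^2" assume y: "y \<in> space disk_measure"
          have "norm ((norm y)\<^sup>2) < 1" using y by (simp add: power_less_one_iff abs_square_less_1)
          then have "(\<lambda>i. ((norm y)\<^sup>2) ^ i) \<longlonglongrightarrow> 0" by (rule LIMSEQ_power_zero)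
          then have "(\<lambda>i. w y * ang b l y * ((norm y)\<^sup>2 * ((norm y)\<^sup>2) ^ i)) \<longlonglongrightarrow> w y * ang b l y * ((norm y)\<^sup>2 * 0)"
            by (intro tendsto_mult_left)
          moreover have "(norm y)\<^sup>2 * ((norm y)\<^sup>2) ^ i = norm y ^ (2 * i + 2)" for i
            by (metis power_add power_mult mult.commute)
          ultimately show "(\<lambda>i. w y * ang b l y * norm y ^ (2 * i + 2)) \<longlonglongrightarrow> 0"
            by (simp only: mult_zero_right)
        qed
        show "AE y in disk_measure. norm (w y * ang b l y * norm y ^ (2 * i + 2)) \<le> \<bar>w y * ang b l y * norm y ^ 0\<bar>" for i
        proof (rule AE_I2)
          fix y :: "real^2" assume "y \<in> space disk_measure"
          then have "norm y ^ (2 * i + 2) \<le> 1" by (intro power_le_one) auto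
          then show "norm (w y * ang b l y * norm y ^ (2 * i + 2)) \<le> \<bar>w y * ang b l y * norm y ^ 0\<bar>"
            by (simp add: abs_mult mult_left_le del: power_Suc)
        qed
      qed measurable
      then have "(\<integral>y. w y * ang b l y * norm y ^ 0 \<partial>disk_measure) = 0"
      proof -
        have "(\<lambda>i. \<integral>y. w y * ang b l y * norm y ^ (2 * i + 2) \<partial>disk_measure)
          = (\<lambda>i. \<integral>y. w y * ang b l y * norm y ^ 0 \<partial>disk_measure)"
          by (intro ext step l)
        then show ?thesis
          using \<open>_ \<longlonglongrightarrow> (\<integral>y. 0 \<partial>_)\<close> by (simp only: LIMSEQ_const_iff Bochner_Integration.integral_zero)
      qed
      then show ?thesis using step[of b l "i - 1", OF l] by (cases i) simp_all
    qed
  qed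
qed

subsection \<open>Elementary inequalities for powers\<close>

lemma powr_add_le:
  fixes x y q :: real
  assumes "x \<ge> 0" "y \<ge> 0" "q \<ge> 0"
  shows "(x + y) powr q \<le> 2 powr q * (x powr q + y powr q)"
proof -
  have "(x + y) powr q \<le> (2 * max x y) powr q" using assms by (intro powr_mono2) auto
  also have "\<dots> = 2 powr q * max x y powr q" using assms by (simp add: powr_mult)
  also have "max x y powr q \<le> x powr q + y powr q" by (auto simp: max_def)
  finally show ?thesis by (simp add: mult_left_mono)
qed

lemma abs_powr_mult_square: "\<bar>x\<bar> powr (p - 2) * x\<^sup>2 = \<bar>x\<bar> powr (p::real)"
proof (cases "x = 0")
  case False
  have "\<bar>x\<bar> powr p = \<bar>x\<bar> powr (p - 2) * \<bar>x\<bar> powr 2" by (metis powr_add diff_add_cancel)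
  also have "\<bar>x\<bar> powr 2 = x\<^sup>2" using False by (simp add: powr_numeral)
  finally show ?thesis ..
qed simp

lemma abs_powr_DERIV:
  fixes t q :: real
  assumes q: "q > 1"
  shows "((\<lambda>t. \<bar>t\<bar> powr q) has_real_derivative q * (\<bar>t\<bar> powr (q - 2) * t)) (at t)"
proof -
  consider "t > 0" | "t < 0" | "t = 0" by linarith
  then show ?thesis
  proof cases
    case 1
    have "((\<lambda>t. t powr q) has_real_derivative q * t powr (q - 1)) (at t)"
      using has_real_derivative_powr[OF 1] by simp
    then have "((\<lambda>t. \<bar>t\<bar> powr q) has_real_derivative q * t powr (q - 1)) (at t)"
      by (rule has_field_derivative_transform_within_open[of _ _ _ "{0<..}"]) (use 1 in auto)
    moreover have "t powr (q - 1) = t powr (q - 2) * t"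
      using 1 by (simp add: powr_diff powr_numeral field_simps power2_eq_square)
    ultimately show ?thesis using 1 by simp
  next
    case 2
    have "((\<lambda>t. (- t) powr q) has_real_derivative (q * (- t) powr (q - 1)) * - 1) (at t)"
      by (rule DERIV_chain2[of "\<lambda>t. t powr q" _ uminus])
         (use 2 in \<open>auto intro!: derivative_eq_intros has_real_derivative_powr\<close>)
    then have "((\<lambda>t. \<bar>t\<bar> powr q) has_real_derivative (q * (- t) powr (q - 1)) * - 1) (at t)"
      by (rule has_field_derivative_transform_within_open[of _ _ _ "{..<0}"]) (use 2 in auto)
    moreover have "(- t) powr (q - 1) = (- t) powr (q - 2) * (- t)"
      using 2 by (simp add: powr_diff powr_numeral field_simps power2_eq_square)
    ultimately show ?thesis using 2 by simp
  next
    case 3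
    have "((\<lambda>h. \<bar>h\<bar> powr (q - 1)) \<longlongrightarrow> 0) (at 0)"
    proof -
      have "((\<lambda>h::real. \<bar>h\<bar> powr (q - 1)) \<longlongrightarrow> \<bar>0\<bar> powr (q - 1)) (at 0)"
        by (rule tendsto_powr'[OF tendsto_rabs[OF tendsto_ident_at] tendsto_const]) (use q in auto)
      then show ?thesis using q by simp
    qed
    then have "((\<lambda>h. (\<bar>h\<bar> powr q - \<bar>0\<bar> powr q) / (h - 0)) \<longlongrightarrow> 0) (at 0)"
    proof (rule Lim_null_comparison[rotated])
      show "\<forall>\<^sub>F h in at 0. norm ((\<bar>h\<bar> powr q - \<bar>0\<bar> powr q) / (h - 0)) \<le> \<bar>h\<bar> powr (q - 1)"
        unfolding eventually_at_filter
        by (rule always_eventually) (use q in \<open>auto simp: powr_diff\<close>)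
    qed
    then show ?thesis using 3 by (simp add: has_field_derivative_iff)
  qed
qed

lemma signed_powr_DERIV:
  fixes t q :: real
  assumes q: "q > 1"
  shows "((\<lambda>t. \<bar>t\<bar> powr (q - 1) * t) has_real_derivative q * \<bar>t\<bar> powr (q - 1)) (at t)"
proof -
  consider "t > 0" | "t < 0" | "t = 0" by linarith
  then show ?thesis
  proof cases
    case 1
    have "((\<lambda>t. t powr q) has_real_derivative q * t powr (q - 1)) (at t)"
      using has_real_derivative_powr[OF 1] by simp
    then have "((\<lambda>t. \<bar>t\<bar> powr (q - 1) * t) has_real_derivative q * t powr (q - 1)) (at t)"
      by (rule has_field_derivative_transform_within_open[of _ _ _ "{0<..}"])
         (use 1 in \<open>auto simp: powr_diff\<close>)
    then show ?thesis using 1 by simp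
  next
    case 2
    have "((\<lambda>t. - ((- t) powr q)) has_real_derivative - ((q * (- t) powr (q - 1)) * - 1)) (at t)"
      by (intro DERIV_minus, rule DERIV_chain2[of "\<lambda>t. t powr q" _ uminus])
         (use 2 in \<open>auto intro!: derivative_eq_intros has_real_derivative_powr\<close>)
    then have "((\<lambda>t. \<bar>t\<bar> powr (q - 1) * t) has_real_derivative - ((q * (- t) powr (q - 1)) * - 1)) (at t)"
      by (rule has_field_derivative_transform_within_open[of _ _ _ "{..<0}"])
         (use 2 in \<open>auto simp: powr_diff\<close>)
    then show ?thesis using 2 by simp
  next
    case 3
    have "((\<lambda>h::real. \<bar>h\<bar> powr (q - 1)) \<longlongrightarrow> \<bar>0\<bar> powr (q - 1)) (at 0)"
      by (rule tendsto_powr'[OF tendsto_rabs[OF tendsto_ident_at] tendsto_const]) (use q in auto)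
    then have "((\<lambda>h. \<bar>h\<bar> powr (q - 1)) \<longlongrightarrow> 0) (at 0)" using q by simp
    moreover have "((\<lambda>h. (\<bar>h\<bar> powr (q - 1) * h - \<bar>0\<bar> powr (q - 1) * 0) / (h - 0)) \<longlongrightarrow> 0) (at 0)
      \<longleftrightarrow> ((\<lambda>h. \<bar>h\<bar> powr (q - 1)) \<longlongrightarrow> 0) (at (0::real))"
      by (rule filterlim_cong) (auto simp: eventually_at_filter)
    ultimately show ?thesis using 3 q by (simp add: has_field_derivative_iff)
  qed
qed

text \<open>The mean value theorem is applied to |t|^p and then to its derivative; the second
  derivative at the intermediate point is controlled by (|a| + |b|)^(p-2).\<close>

lemma abs_powr_Taylor:
  fixes a b p :: real
  assumes p: "p > 2"
  shows "\<bar>\<bar>a + b\<bar> powr p - \<bar>a\<bar> powr p - p * (\<bar>a\<bar> powr (p - 2) * a * b)\<bar>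
    \<le> p * (p - 1) * 2 powr (p - 2) * (\<bar>a\<bar> powr (p - 2) * b\<^sup>2 + \<bar>b\<bar> powr p)"
proof (cases "b = 0")
  case False
  let ?f = "\<lambda>t::real. \<bar>t\<bar> powr p" and ?g = "\<lambda>t::real. p * (\<bar>t\<bar> powr (p - 2) * t)"
    and ?h = "\<lambda>t::real. p * ((p - 1) * \<bar>t\<bar> powr (p - 2))"
  have df: "(?f has_real_derivative ?g t) (at t)" for t
    using abs_powr_DERIV[of p t] p by simp
  have dg: "(?g has_real_derivative ?h t) (at t)" for t
    using DERIV_cmult[OF signed_powr_DERIV[of "p - 1" t], of p] p by simp
  have mvt: "\<exists>\<xi>. \<bar>\<xi> - x\<bar> \<le> \<bar>y - x\<bar> \<and> F y - F x = (y - x) * F' \<xi>"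
    if d: "\<And>t. (F has_real_derivative F' t) (at t)" for F F' :: "real \<Rightarrow> real" and x y
  proof (cases x y rule: linorder_cases)
    case less
    from MVT2[OF less, of F F'] d obtain z where "x < z" "z < y" "F y - F x = (y - x) * F' z" by auto
    then show ?thesis by (intro exI[of _ z]) auto
  next
    case greater
    from MVT2[OF greater, of F F'] d obtain z where z: "y < z" "z < x" "F x - F y = (x - y) * F' z" by auto
    then have "F y - F x = (y - x) * F' z" by (simp add: algebra_simps)
    then show ?thesis using z by (intro exI[of _ z]) auto
  qed auto
  obtain \<xi> where xi: "\<bar>\<xi> - a\<bar> \<le> \<bar>b\<bar>" "?f (a + b) - ?f a = b * ?g \<xi>"
    using mvt[OF df, of a "a + b"] by auto
  obtain \<zeta> where ze: "\<bar>\<zeta> - a\<bar> \<le> \<bar>\<xi> - a\<bar>" "?g \<xi> - ?g a = (\<xi> - a) * ?h \<zeta>"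
    using mvt[OF dg, of a \<xi>] by auto
  have "?f (a + b) - ?f a - p * (\<bar>a\<bar> powr (p - 2) * a * b) = b * (?g \<xi> - ?g a)"
    using xi(2) by (simp add: algebra_simps)
  also have "\<dots> = b * ((\<xi> - a) * ?h \<zeta>)" by (simp only: ze(2))
  also have "\<bar>\<dots>\<bar> = \<bar>b\<bar> * (\<bar>\<xi> - a\<bar> * ?h \<zeta>)" using p by (simp add: abs_mult)
  also have "\<dots> \<le> \<bar>b\<bar> * (\<bar>b\<bar> * ?h \<zeta>)"
    using xi(1) p by (intro mult_left_mono mult_right_mono) auto
  also have "\<dots> = p * (p - 1) * (b\<^sup>2 * \<bar>\<zeta>\<bar> powr (p - 2))"
    by (simp add: power2_eq_square mult_ac)
  also have "\<dots> \<le> p * (p - 1) * (b\<^sup>2 * (2 powr (p - 2) * (\<bar>a\<bar> powr (p - 2) + \<bar>b\<bar> powr (p - 2))))"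
  proof -
    have "\<bar>\<zeta>\<bar> powr (p - 2) \<le> (\<bar>a\<bar> + \<bar>b\<bar>) powr (p - 2)"
      using xi(1) ze(1) p by (intro powr_mono2) auto
    also have "\<dots> \<le> 2 powr (p - 2) * (\<bar>a\<bar> powr (p - 2) + \<bar>b\<bar> powr (p - 2))"
      using p by (intro powr_add_le) auto
    finally show ?thesis using p by (intro mult_left_mono) auto
  qed
  also have "\<dots> = p * (p - 1) * 2 powr (p - 2) * (\<bar>a\<bar> powr (p - 2) * b\<^sup>2 + \<bar>b\<bar> powr (p - 2) * b\<^sup>2)"
    by (simp add: algebra_simps)
  also have "\<bar>b\<bar> powr (p - 2) * b\<^sup>2 = \<bar>b\<bar> powr p"
    by (rule abs_powr_mult_square)
  finally show ?thesis .
qed simp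

text \<open>The cases |b| \<le> h |a| and |b| > h |a| produce one summand each. The parameter h is
  later taken close to the norm of a perturbation, which makes both integrated terms quadratic in
  that norm.\<close>

lemma powr_split_le:
  fixes a b h p :: real
  assumes p: "p > 2" and h: "h > 0"
  shows "\<bar>a\<bar> powr (p - 2) * b\<^sup>2 \<le> h\<^sup>2 * \<bar>a\<bar> powr p + h powr (2 - p) * \<bar>b\<bar> powr p"
proof -
  show ?thesis
  proof (cases "\<bar>b\<bar> \<le> h * \<bar>a\<bar>")
    case True
    then have "b\<^sup>2 \<le> (h * \<bar>a\<bar>)\<^sup>2" by (metis abs_ge_zero power2_abs power_mono)
    then have "\<bar>a\<bar> powr (p - 2) * b\<^sup>2 \<le> \<bar>a\<bar> powr (p - 2) * (h\<^sup>2 * a\<^sup>2)"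
      by (intro mult_left_mono) (auto simp: power_mult_distrib)
    also have "\<dots> = h\<^sup>2 * \<bar>a\<bar> powr p" by (simp add: abs_powr_mult_square[of a p, symmetric])
    finally show ?thesis using h by (smt (verit) mult_nonneg_nonneg powr_ge_zero)
  next
    case False
    then have "\<bar>a\<bar> powr (p - 2) \<le> (\<bar>b\<bar> / h) powr (p - 2)"
      using h p by (intro powr_mono2) (auto simp: field_simps)
    also have "\<dots> = h powr (2 - p) * \<bar>b\<bar> powr (p - 2)"
      using h by (simp add: powr_divide powr_minus_divide[symmetric] divide_powr_uminus mult.commute)
    finally have "\<bar>a\<bar> powr (p - 2) * b\<^sup>2 \<le> h powr (2 - p) * \<bar>b\<bar> powr (p - 2) * b\<^sup>2"
      by (intro mult_right_mono) auto
    also have "\<dots> = h powr (2 - p) * \<bar>b\<bar> powr p" by (simp add: abs_powr_mult_square[of b p, symmetric])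
    finally show ?thesis using h by (smt (verit) mult_nonneg_nonneg powr_ge_zero zero_le_power2)
  qed
qed

lemma powr_superadditive:
  fixes s t r :: real
  assumes "s \<ge> 0" "t \<ge> 0" "r \<ge> 1"
  shows "s powr r + t powr r \<le> (s + t) powr r"
proof -
  have e: "x powr r = x * x powr (r - 1)" if "x \<ge> 0" for x :: real
    using that by (cases "x = 0") (auto simp: powr_diff)
  have "s powr r + t powr r = s * s powr (r - 1) + t * t powr (r - 1)" using e assms by simp
  also have "\<dots> \<le> s * (s + t) powr (r - 1) + t * (s + t) powr (r - 1)"
    using assms by (intro add_mono mult_left_mono powr_mono2) auto
  also have "\<dots> = (s + t) powr r" using e[of "s + t"] assms by (simp add: distrib_right)
  finally show ?thesis .
qed

text \<open>Superadditivity of s^(p/2), the parallelogram identity and convexity of s^(p/2), in this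
  order. It supplies the uniform convexity behind the convergence of maximizing sequences.\<close>

lemma Clarkson:
  fixes a b p :: real
  assumes p: "p > 2"
  shows "\<bar>(a + b) / 2\<bar> powr p + \<bar>(a - b) / 2\<bar> powr p \<le> (\<bar>a\<bar> powr p + \<bar>b\<bar> powr p) / 2"
proof -
  have sq: "\<bar>x\<bar> powr p = (x\<^sup>2) powr (p / 2)" for x :: real
  proof (cases "x = 0")
    case False
    then have "(x\<^sup>2) powr (p / 2) = (\<bar>x\<bar> powr 2) powr (p / 2)" by (simp add: powr_numeral)
    then show ?thesis by (simp only: powr_powr) simp
  qed simp
  have conv: "((x + y) / 2) powr (p / 2) \<le> (x powr (p / 2) + y powr (p / 2)) / 2" if "x \<ge> 0" "y \<ge> 0" for x y :: real
  proof (cases "x = 0 \<or> y = 0")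
    case True
    have "(z / 2) powr (p / 2) \<le> z powr (p / 2) / 2" if "z \<ge> 0" for z :: real
    proof -
      have "(2::real) powr 1 \<le> 2 powr (p / 2)" using p by (intro powr_mono) auto
      then have "z powr (p / 2) / 2 powr (p / 2) \<le> z powr (p / 2) / 2" by (intro divide_left_mono) auto
      then show ?thesis using that by (simp add: powr_divide)
    qed
    then show ?thesis using True that by auto
  next
    case False
    then have "(\<lambda>x. x powr (p / 2)) ((1 - 1/2) *\<^sub>R x + (1/2) *\<^sub>R y) \<le> (1 - 1/2) * x powr (p / 2) + (1/2) * y powr (p / 2)"
      using that p by (intro convex_onD[OF powr_convex]) auto
    then show ?thesis by (simp add: add_divide_distrib)
  qed
  have "\<bar>(a + b) / 2\<bar> powr p + \<bar>(a - b) / 2\<bar> powr p \<le> (((a + b) / 2)\<^sup>2 + ((a - b) / 2)\<^sup>2) powr (p / 2)"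
    unfolding sq using p by (intro powr_superadditive) auto
  also have "((a + b) / 2)\<^sup>2 + ((a - b) / 2)\<^sup>2 = (a\<^sup>2 + b\<^sup>2) / 2"
    by (simp add: power2_eq_square field_simps)
  also have "((a\<^sup>2 + b\<^sup>2) / 2) powr (p / 2) \<le> (\<bar>a\<bar> powr p + \<bar>b\<bar> powr p) / 2"
    unfolding sq by (rule conv) auto
  finally show ?thesis .
qed

subsection \<open>Square integrable functions and orthonormal families\<close>

definition square_int :: "'a measure \<Rightarrow> ('a \<Rightarrow> real) set" where
  "square_int M = {u \<in> borel_measurable M. integrable M (\<lambda>x. (u x)\<^sup>2)}"

lemma square_intD:
  assumes "u \<in> square_int M"
  shows "u \<in> borel_measurable M" "integrable M (\<lambda>x. (u x)\<^sup>2)"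
  using assms by (auto simp: square_int_def)

lemma square_int_mult_integrable:
  assumes u: "u \<in> square_int M" and v: "v \<in> square_int M"
  shows "integrable M (\<lambda>x. u x * v x)"
proof (rule Bochner_Integration.integrable_bound)
  show "integrable M (\<lambda>x. (u x)\<^sup>2 + (v x)\<^sup>2)" using square_intD[OF u] square_intD[OF v] by auto
  show "AE x in M. norm (u x * v x) \<le> norm ((u x)\<^sup>2 + (v x)\<^sup>2)"
  proof (rule AE_I2)
    fix x
    have "0 \<le> (\<bar>u x\<bar> - \<bar>v x\<bar>)\<^sup>2" by simp
    then have "2 * (\<bar>u x\<bar> * \<bar>v x\<bar>) \<le> (u x)\<^sup>2 + (v x)\<^sup>2" by (simp add: power2_diff)
    moreover have "0 \<le> \<bar>u x\<bar> * \<bar>v x\<bar>" by simp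
    ultimately have "\<bar>u x\<bar> * \<bar>v x\<bar> \<le> (u x)\<^sup>2 + (v x)\<^sup>2" by linarith
    then show "norm (u x * v x) \<le> norm ((u x)\<^sup>2 + (v x)\<^sup>2)" by (simp add: abs_mult)
  qed
qed (use square_intD[OF u] square_intD[OF v] in measurable)

lemma square_int_add: "u \<in> square_int M \<Longrightarrow> v \<in> square_int M \<Longrightarrow> (\<lambda>x. u x + v x) \<in> square_int M"
  using square_int_mult_integrable[of u M v]
  by (auto simp: square_int_def power2_sum mult.assoc)

lemma square_int_scale: "u \<in> square_int M \<Longrightarrow> (\<lambda>x. k * u x) \<in> square_int M"
  by (auto simp: square_int_def power_mult_distrib)

lemma square_int_diff: "u \<in> square_int M \<Longrightarrow> v \<in> square_int M \<Longrightarrow> (\<lambda>x. u x - v x) \<in> square_int M"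
  using square_int_add[of u M "\<lambda>x. (-1) * v x"] square_int_scale[of v M "-1"] by simp

lemma (in finite_measure) square_int_integrable: "u \<in> square_int M \<Longrightarrow> integrable M u"
  using square_int_mult_integrable[of u M "\<lambda>_. 1"] by (simp add: square_int_def)

text \<open>Integrability of the limit is part of the conclusion, so that the bound does not concern
  a default value of the integral.\<close>

lemma Fatou_real:
  fixes h :: "nat \<Rightarrow> 'a \<Rightarrow> real"
  assumes i: "\<And>n. integrable M (h n)" and nn: "\<And>n x. h n x \<ge> 0"
    and lim: "AE x in M. (\<lambda>n. h n x) \<longlonglongrightarrow> g x" and g: "g \<in> borel_measurable M"
    and B: "\<And>n. integral\<^sup>L M (h n) \<le> B n" and BL: "B \<longlonglongrightarrow> L"
  shows "integrable M g" "integral\<^sup>L M g \<le> L"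
proof -
  have [measurable]: "\<And>n. h n \<in> borel_measurable M" using i by auto
  note g [measurable]
  have B0: "B n \<ge> 0" for n
    using B[of n] Bochner_Integration.integral_nonneg[of M "h n"] nn by (meson order.trans)
  then have L0: "L \<ge> 0" using BL by (meson LIMSEQ_le_const)
  have gn: "AE x in M. g x \<ge> 0" using lim by eventually_elim (use nn in \<open>auto intro: LIMSEQ_le_const\<close>)
  have "(\<integral>\<^sup>+x. ennreal (g x) \<partial>M) = (\<integral>\<^sup>+x. liminf (\<lambda>n. ennreal (h n x)) \<partial>M)"
  proof (rule nn_integral_cong_AE)
    show "AE x in M. ennreal (g x) = liminf (\<lambda>n. ennreal (h n x))"
      using lim by eventually_elim (metis lim_imp_Liminf sequentially_bot tendsto_ennrealI)
  qed
  also have "\<dots> \<le> liminf (\<lambda>n. \<integral>\<^sup>+x. ennreal (h n x) \<partial>M)"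
    by (rule nn_integral_liminf) measurable
  also have "\<dots> \<le> liminf (\<lambda>n. ennreal (B n))"
  proof (rule Liminf_mono, rule always_eventually, rule allI)
    fix n
    have "(\<integral>\<^sup>+x. ennreal (h n x) \<partial>M) = ennreal (integral\<^sup>L M (h n))"
      by (rule nn_integral_eq_integral[OF i]) (simp add: nn)
    then show "(\<integral>\<^sup>+x. ennreal (h n x) \<partial>M) \<le> ennreal (B n)" using B[of n] by (simp add: ennreal_leI)
  qed
  also have "\<dots> = ennreal L"
    using BL by (intro lim_imp_Liminf tendsto_ennrealI) auto
  finally have le: "(\<integral>\<^sup>+x. ennreal (g x) \<partial>M) \<le> ennreal L" .
  show ig: "integrable M g"
  proof (rule integrableI_bounded[OF g])
    have "(\<integral>\<^sup>+x. ennreal (norm (g x)) \<partial>M) = (\<integral>\<^sup>+x. ennreal (g x) \<partial>M)"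
      by (rule nn_integral_cong_AE) (use gn in \<open>eventually_elim, simp\<close>)
    then show "(\<integral>\<^sup>+x. ennreal (norm (g x)) \<partial>M) < \<infinity>" using le by (simp add: le_less_trans)
  qed
  show "integral\<^sup>L M g \<le> L"
    using le nn_integral_eq_integral[OF ig gn] L0 by simp
qed

text \<open>The a.e. convergent subsequence is returned as well, because Fatou's lemma for |u|^p is
  later applied along it.\<close>

lemma (in finite_measure) square_int_complete:
  fixes f :: "nat \<Rightarrow> 'a \<Rightarrow> real"
  assumes f: "\<And>n. f n \<in> square_int M"
    and cauchy: "\<And>\<epsilon>. \<epsilon> > 0 \<Longrightarrow> \<exists>N. \<forall>m\<ge>N. \<forall>n\<ge>N. (\<integral>x. (f m x - f n x)\<^sup>2 \<partial>M) < \<epsilon>"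
  obtains u and r :: "nat \<Rightarrow> nat" where "u \<in> square_int M" "strict_mono r" "AE x in M. (\<lambda>n. f (r n) x) \<longlonglongrightarrow> u x"
    "(\<lambda>n. \<integral>x. (f n x - u x)\<^sup>2 \<partial>M) \<longlonglongrightarrow> 0"
proof -
  have [measurable]: "\<And>n. f n \<in> borel_measurable M" using f by (auto simp: square_int_def)
  have i2: "integrable M (\<lambda>x. (f m x - f n x)\<^sup>2)" for m n
    using square_int_diff[OF f f] by (auto simp: square_int_def)
  obtain N where N: "\<And>k m n. m \<ge> N k \<Longrightarrow> n \<ge> N k \<Longrightarrow> (\<integral>x. (f m x - f n x)\<^sup>2 \<partial>M) < (1 / 4) ^ k"
    using cauchy[of "(1 / 4) ^ _"] by (metis zero_less_divide_1_iff zero_less_numeral zero_less_power)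
  have "\<exists>r. \<forall>k. r k \<ge> N k \<and> r k < r (Suc k)"
  proof (rule dependent_nat_choice)
    show "\<exists>x. N 0 \<le> x" by blast
    show "\<exists>y. N (Suc k) \<le> y \<and> x < y" for x k
      by (intro exI[of _ "Suc (max x (N (Suc k)))"]) auto
  qed
  then obtain r where r: "\<And>k. r k \<ge> N k" "\<And>k. r k < r (Suc k)" by blast
  have sm: "strict_mono r" using r(2) by (simp add: strict_mono_Suc_iff)
  define g where "g k x = \<bar>f (r (Suc k)) x - f (r k) x\<bar>" for k x
  define \<mu> where "\<mu> = measure M (space M)"
  have \<mu>: "\<mu> \<ge> 0" by (simp add: \<mu>_def)
  have gi: "integrable M (g k)" for k
    unfolding g_def by (intro integrable_abs square_int_integrable square_int_diff f)
  \<comment> \<open>The inequality |d| \<le> 2^k d^2 + 2^(-k) converts the L^2 bound 4^(-k) into a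
    summable L^1 bound.\<close>
  have g_le: "integral\<^sup>L M (g k) \<le> (1 + \<mu>) * (1 / 2) ^ k" for k
  proof -
    have "integral\<^sup>L M (g k) \<le> (\<integral>x. 2 ^ k * (f (r (Suc k)) x - f (r k) x)\<^sup>2 + (1 / 2) ^ k \<partial>M)"
    proof (rule integral_mono)
      fix x
      define d where "d = f (r (Suc k)) x - f (r k) x"
      define A where "A = (2::real) ^ k"
      have A: "A > 0" "(1 / 2) ^ k = 1 / A" by (simp_all add: A_def power_one_over)
      have "0 \<le> (A * \<bar>d\<bar> - 1)\<^sup>2" by simp
      then have "2 * (A * \<bar>d\<bar>) \<le> A\<^sup>2 * d\<^sup>2 + 1" by (simp add: power2_diff power_mult_distrib)
      moreover have "0 \<le> A * \<bar>d\<bar>" using A by simp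
      ultimately have "A * \<bar>d\<bar> \<le> A\<^sup>2 * d\<^sup>2 + 1" by linarith
      then have "\<bar>d\<bar> \<le> (A\<^sup>2 * d\<^sup>2 + 1) / A" using A(1) by (simp add: pos_le_divide_eq mult.commute)
      also have "\<dots> = A * d\<^sup>2 + 1 / A" using A(1) by (simp add: add_divide_distrib power2_eq_square)
      finally have "\<bar>d\<bar> \<le> 2 ^ k * d\<^sup>2 + (1 / 2) ^ k" unfolding A(2) A_def[symmetric] .
      then show "g k x \<le> 2 ^ k * (f (r (Suc k)) x - f (r k) x)\<^sup>2 + (1 / 2) ^ k"
        by (simp add: g_def d_def)
    qed (use gi i2 in auto)
    also have "\<dots> = 2 ^ k * (\<integral>x. (f (r (Suc k)) x - f (r k) x)\<^sup>2 \<partial>M) + \<mu> * (1 / 2) ^ k"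
      using i2 by (simp add: \<mu>_def)
    also have "\<dots> \<le> 2 ^ k * (1 / 4) ^ k + \<mu> * (1 / 2) ^ k"
      using N[of k "r (Suc k)" "r k"] r(1)[of k] r(2)[of k] \<mu> by (intro add_mono mult_left_mono) auto
    also have "2 ^ k * (1 / 4) ^ k = (1 / 2 :: real) ^ k" by (simp flip: power_mult_distrib)
    finally show ?thesis by (simp add: algebra_simps)
  qed
  have "(\<integral>\<^sup>+x. (\<Sum>k. ennreal (g k x)) \<partial>M) = (\<Sum>k. \<integral>\<^sup>+x. ennreal (g k x) \<partial>M)"
    by (rule nn_integral_suminf) (use gi in auto)
  also have "\<dots> \<le> (\<Sum>k. ennreal ((1 + \<mu>) * (1 / 2) ^ k))"
  proof (rule suminf_le)
    fix k
    have "(\<integral>\<^sup>+x. ennreal (g k x) \<partial>M) = ennreal (integral\<^sup>L M (g k))"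
      by (rule nn_integral_eq_integral[OF gi]) (simp add: g_def)
    then show "(\<integral>\<^sup>+x. ennreal (g k x) \<partial>M) \<le> ennreal ((1 + \<mu>) * (1 / 2) ^ k)"
      using g_le[of k] by (simp add: ennreal_leI)
  qed auto
  also have "\<dots> = ennreal (\<Sum>k. (1 + \<mu>) * (1 / 2) ^ k)"
    using \<mu> by (intro suminf_ennreal2) (auto intro!: summable_mult summable_geometric)
  finally have "(\<integral>\<^sup>+x. (\<Sum>k. ennreal (g k x)) \<partial>M) \<noteq> \<infinity>" by (auto simp: top_unique)
  then have "AE x in M. (\<Sum>k. ennreal (g k x)) \<noteq> \<infinity>"
    by (rule nn_integral_PInf_AE[rotated]) (use gi in measurable)
  then have conv: "AE x in M. convergent (\<lambda>k. f (r k) x)"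
  proof eventually_elim
    case (elim x)
    then have "summable (\<lambda>k. g k x)"
      by (intro summable_suminf_not_top) (auto simp: g_def)
    then have "summable (\<lambda>k. f (r (Suc k)) x - f (r k) x)"
      unfolding g_def by (rule summable_rabs_cancel)
    then have "convergent (\<lambda>n. \<Sum>k<n. f (r (Suc k)) x - f (r k) x)"
      by (simp add: summable_iff_convergent)
    then have "convergent (\<lambda>n. f (r n) x - f (r 0) x)"
      by (simp only: sum_lessThan_telescope[of "\<lambda>k. f (r k) x"])
    then have "convergent (\<lambda>n. (f (r n) x - f (r 0) x) + f (r 0) x)"
      by (intro convergent_add convergent_const)
    then show ?case by simp
  qed
  define u where "u x = lim (\<lambda>k. f (r k) x)" for x
  have um [measurable]: "u \<in> borel_measurable M" unfolding u_def by measurable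
  have lim: "AE x in M. (\<lambda>k. f (r k) x) \<longlonglongrightarrow> u x"
    using conv by eventually_elim (simp add: u_def convergent_LIMSEQ_iff)
  have fat: "integrable M (\<lambda>x. (f n x - u x)\<^sup>2)" "(\<integral>x. (f n x - u x)\<^sup>2 \<partial>M) \<le> \<epsilon>"
    if n: "\<forall>m\<ge>K. (\<integral>x. (f n x - f m x)\<^sup>2 \<partial>M) \<le> \<epsilon>" for n K \<epsilon>
  proof -
    have l: "AE x in M. (\<lambda>k. (f n x - f (r (k + K)) x)\<^sup>2) \<longlonglongrightarrow> (f n x - u x)\<^sup>2"
      using lim
    proof eventually_elim
      case (elim x)
      have "(\<lambda>k. f (r (k + K)) x) \<longlonglongrightarrow> u x" using elim by (rule LIMSEQ_ignore_initial_segment)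
      then show ?case by (intro tendsto_intros)
    qed
    have b: "(\<integral>x. (f n x - f (r (k + K)) x)\<^sup>2 \<partial>M) \<le> \<epsilon>" for k
      using n seq_suble[OF sm, of "k + K"] by auto
    show "integrable M (\<lambda>x. (f n x - u x)\<^sup>2)" "(\<integral>x. (f n x - u x)\<^sup>2 \<partial>M) \<le> \<epsilon>"
      using Fatou_real[OF i2 zero_le_power2 l _ b tendsto_const] by auto
  qed
  have ev: "\<exists>N. \<forall>n\<ge>N. integrable M (\<lambda>x. (f n x - u x)\<^sup>2) \<and> (\<integral>x. (f n x - u x)\<^sup>2 \<partial>M) \<le> \<epsilon>" if eps: "\<epsilon> > 0" for \<epsilon>
  proof -
    obtain N where "\<forall>m\<ge>N. \<forall>n\<ge>N. (\<integral>x. (f m x - f n x)\<^sup>2 \<partial>M) < \<epsilon>" using cauchy[OF eps] by blast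
    then have "\<forall>m\<ge>N. (\<integral>x. (f n x - f m x)\<^sup>2 \<partial>M) \<le> \<epsilon>" if "n \<ge> N" for n
      using that less_imp_le by blast
    then show ?thesis using fat[of N _ \<epsilon>] by blast
  qed
  obtain N1 where N1: "\<forall>n\<ge>N1. integrable M (\<lambda>x. (f n x - u x)\<^sup>2)" using ev[of 1] by auto
  have "(\<lambda>x. f N1 x - u x) \<in> square_int M" using N1 by (auto simp: square_int_def)
  then have "(\<lambda>x. f N1 x - (f N1 x - u x)) \<in> square_int M" by (rule square_int_diff[OF f])
  moreover have "(\<lambda>x. f N1 x - (f N1 x - u x)) = u" by (rule ext) simp
  ultimately have "u \<in> square_int M" by (simp only:)
  moreover have "(\<lambda>n. \<integral>x. (f n x - u x)\<^sup>2 \<partial>M) \<longlonglongrightarrow> 0"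
  proof (rule LIMSEQ_I)
    fix \<epsilon> :: real assume "\<epsilon> > 0"
    then obtain N where N: "\<forall>n\<ge>N. (\<integral>x. (f n x - u x)\<^sup>2 \<partial>M) \<le> \<epsilon> / 2" using ev[of "\<epsilon> / 2"] by auto
    have "0 \<le> (\<integral>x. (f n x - u x)\<^sup>2 \<partial>M)" for n by (rule Bochner_Integration.integral_nonneg) simp
    then show "\<exists>N. \<forall>n\<ge>N. norm ((\<integral>x. (f n x - u x)\<^sup>2 \<partial>M) - 0) < \<epsilon>"
      using N \<open>\<epsilon> > 0\<close> by (intro exI[of _ N]) fastforce
  qed
  ultimately show ?thesis using that sm lim by blast
qed

text \<open>Boundedness of the members puts every finite combination into all L^p, the class on
  which the embedding is first obtained. Countability of the index type provides the exhaustion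
  \<open>exh\<close>.\<close>

locale orthonormal_family = finite_measure M
  for M :: "'a measure" +
  fixes I :: "'i::countable set" and e :: "'i \<Rightarrow> 'a \<Rightarrow> real"
  assumes e_measurable: "i \<in> I \<Longrightarrow> e i \<in> borel_measurable M"
    and e_bounded: "i \<in> I \<Longrightarrow> \<exists>C. \<forall>x\<in>space M. \<bar>e i x\<bar> \<le> C"
    and orthonormal: "i \<in> I \<Longrightarrow> j \<in> I \<Longrightarrow> (\<integral>x. e i x * e j x \<partial>M) = (if i = j then 1 else 0)"
begin

definition coef :: "('a \<Rightarrow> real) \<Rightarrow> 'i \<Rightarrow> real" where "coef u i = (\<integral>x. u x * e i x \<partial>M)"

definition comb :: "'i set \<Rightarrow> ('i \<Rightarrow> real) \<Rightarrow> 'a \<Rightarrow> real" where "comb J a x = (\<Sum>i\<in>J. a i * e i x)"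

definition complete_family :: bool where
  "complete_family \<longleftrightarrow> (\<forall>u\<in>square_int M. (\<forall>i\<in>I. coef u i = 0) \<longrightarrow> (AE x in M. u x = 0))"

lemma bounded_square_int:
  assumes "u \<in> borel_measurable M" "\<And>x. x \<in> space M \<Longrightarrow> \<bar>u x\<bar> \<le> C"
  shows "u \<in> square_int M"
proof -
  have "integrable M (\<lambda>x. (u x)\<^sup>2)"
  proof (rule integrable_const_bound[of _ "C\<^sup>2"])
    show "AE x in M. norm ((u x)\<^sup>2) \<le> C\<^sup>2"
    proof (rule AE_I2)
      fix x assume "x \<in> space M"
      then have "\<bar>u x\<bar>\<^sup>2 \<le> C\<^sup>2" using assms(2) by (intro power_mono) auto
      then show "norm ((u x)\<^sup>2) \<le> C\<^sup>2" by simp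
    qed
  qed (use assms(1) in measurable)
  then show ?thesis using assms(1) by (simp add: square_int_def)
qed

lemma e_square_int:
  assumes "i \<in> I" shows "e i \<in> square_int M"
proof -
  obtain C where "\<forall>x\<in>space M. \<bar>e i x\<bar> \<le> C" using e_bounded[OF assms] by blast
  then show ?thesis by (intro bounded_square_int[OF e_measurable[OF assms]]) blast
qed

lemma comb_measurable: "J \<subseteq> I \<Longrightarrow> comb J a \<in> borel_measurable M"
  unfolding comb_def[abs_def] by (intro borel_measurable_sum borel_measurable_times borel_measurable_const e_measurable) auto

lemma comb_bounded:
  assumes "finite J" "J \<subseteq> I" shows "\<exists>C. \<forall>x\<in>space M. \<bar>comb J a x\<bar> \<le> C"
proof -
  obtain C where C: "\<And>i x. i \<in> J \<Longrightarrow> x \<in> space M \<Longrightarrow> \<bar>e i x\<bar> \<le> C i"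
    using e_bounded assms(2) by (metis subsetD)
  have "\<bar>comb J a x\<bar> \<le> (\<Sum>i\<in>J. \<bar>a i\<bar> * C i)" if "x \<in> space M" for x
  proof -
    have "\<bar>comb J a x\<bar> \<le> (\<Sum>i\<in>J. \<bar>a i * e i x\<bar>)" unfolding comb_def by (rule sum_abs)
    also have "\<dots> \<le> (\<Sum>i\<in>J. \<bar>a i\<bar> * C i)"
    proof (rule sum_mono)
      fix i assume "i \<in> J"
      from C[OF this that] show "\<bar>a i * e i x\<bar> \<le> \<bar>a i\<bar> * C i"
        unfolding abs_mult by (rule mult_left_mono) simp
    qed
    finally show ?thesis .
  qed
  then show ?thesis by blast
qed

lemma comb_square_int:
  assumes "finite J" "J \<subseteq> I" shows "comb J a \<in> square_int M"
proof -
  obtain C where "\<forall>x\<in>space M. \<bar>comb J a x\<bar> \<le> C" using comb_bounded[OF assms, of a] by blast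
  then show ?thesis by (intro bounded_square_int[OF comb_measurable[OF assms(2)]]) blast
qed

lemma coef_add: "u \<in> square_int M \<Longrightarrow> v \<in> square_int M \<Longrightarrow> i \<in> I \<Longrightarrow> coef (\<lambda>x. u x + v x) i = coef u i + coef v i"
  using square_int_mult_integrable[OF _ e_square_int] by (simp add: coef_def distrib_right)

lemma coef_scale: "coef (\<lambda>x. k * u x) i = k * coef u i"
  by (simp add: coef_def mult.assoc)

lemma coef_diff: "u \<in> square_int M \<Longrightarrow> v \<in> square_int M \<Longrightarrow> i \<in> I \<Longrightarrow> coef (\<lambda>x. u x - v x) i = coef u i - coef v i"
  using coef_add[of u "\<lambda>x. (-1) * v x" i] coef_scale[of "-1" v i] square_int_scale[of v M "-1"] by simp

lemma coef_cong_AE: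
  assumes "u \<in> square_int M" "v \<in> square_int M" "AE x in M. u x = v x" "i \<in> I"
  shows "coef u i = coef v i"
  unfolding coef_def
proof (rule integral_cong_AE)
  show "AE x in M. u x * e i x = v x * e i x" using assms(3) by eventually_elim simp
qed (intro borel_measurable_times square_intD(1) assms e_measurable)+

lemma integral_mult_comb:
  assumes "u \<in> square_int M" "finite J" "J \<subseteq> I"
  shows "(\<integral>x. u x * comb J a x \<partial>M) = (\<Sum>i\<in>J. a i * coef u i)"
proof -
  have i: "integrable M (\<lambda>x. u x * e i x)" if "i \<in> J" for i
    using square_int_mult_integrable[OF assms(1) e_square_int] that assms by auto
  have "(\<integral>x. u x * comb J a x \<partial>M) = (\<integral>x. (\<Sum>i\<in>J. a i * (u x * e i x)) \<partial>M)"
    by (simp add: comb_def sum_distrib_left mult_ac)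
  also have "\<dots> = (\<Sum>i\<in>J. \<integral>x. a i * (u x * e i x) \<partial>M)"
    by (rule Bochner_Integration.integral_sum) (use i in auto)
  also have "\<dots> = (\<Sum>i\<in>J. a i * coef u i)" by (simp add: coef_def)
  finally show ?thesis .
qed

lemma coef_comb:
  assumes "finite J" "J \<subseteq> I" "j \<in> I"
  shows "coef (comb J a) j = (if j \<in> J then a j else 0)"
proof -
  have "coef (comb J a) j = (\<integral>x. e j x * comb J a x \<partial>M)" by (simp add: coef_def mult.commute)
  also have "\<dots> = (\<Sum>i\<in>J. a i * coef (e j) i)" by (rule integral_mult_comb[OF e_square_int]) fact+
  also have "\<dots> = (\<Sum>i\<in>J. if j = i then a i else 0)"
    by (intro sum.cong refl) (use assms orthonormal in \<open>auto simp: coef_def\<close>)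
  also have "\<dots> = (if j \<in> J then a j else 0)" using assms(1) by simp
  finally show ?thesis .
qed

lemma integral_comb_square:
  assumes "finite J" "J \<subseteq> I" shows "(\<integral>x. (comb J a x)\<^sup>2 \<partial>M) = (\<Sum>i\<in>J. (a i)\<^sup>2)"
proof -
  have "(\<integral>x. (comb J a x)\<^sup>2 \<partial>M) = (\<integral>x. comb J a x * comb J a x \<partial>M)" by (simp add: power2_eq_square)
  also have "\<dots> = (\<Sum>i\<in>J. a i * coef (comb J a) i)" by (rule integral_mult_comb[OF comb_square_int]) fact+
  also have "\<dots> = (\<Sum>i\<in>J. (a i)\<^sup>2)"
  proof (intro sum.cong refl)
    fix i assume "i \<in> J"
    then show "a i * coef (comb J a) i = (a i)\<^sup>2"
      using coef_comb[OF assms, of i a] assms(2) by (auto simp: power2_eq_square)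
  qed
  finally show ?thesis .
qed

lemma Bessel_finite:
  assumes u: "u \<in> square_int M" and J: "finite J" "J \<subseteq> I"
  shows "(\<Sum>i\<in>J. (coef u i)\<^sup>2) \<le> (\<integral>x. (u x)\<^sup>2 \<partial>M)"
proof -
  let ?S = "comb J (coef u)"
  have S: "?S \<in> square_int M" by (rule comb_square_int[OF J])
  have iu: "integrable M (\<lambda>x. (u x)\<^sup>2)" and iS: "integrable M (\<lambda>x. (?S x)\<^sup>2)"
    and iuS: "integrable M (\<lambda>x. u x * ?S x)"
    using square_intD[OF u] square_intD[OF S] square_int_mult_integrable[OF u S] by auto
  have "0 \<le> (\<integral>x. (u x - ?S x)\<^sup>2 \<partial>M)" by (rule Bochner_Integration.integral_nonneg) simp
  also have "\<dots> = (\<integral>x. (u x)\<^sup>2 + (?S x)\<^sup>2 - 2 * (u x * ?S x) \<partial>M)"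
    by (simp add: power2_diff mult.assoc)
  also have "\<dots> = (\<integral>x. (u x)\<^sup>2 \<partial>M) + (\<integral>x. (?S x)\<^sup>2 \<partial>M) - 2 * (\<integral>x. u x * ?S x \<partial>M)"
    using iu iS iuS by simp
  also have "\<dots> = (\<integral>x. (u x)\<^sup>2 \<partial>M) - (\<Sum>i\<in>J. (coef u i)\<^sup>2)"
    using integral_comb_square[OF J, of "coef u"] integral_mult_comb[OF u J, of "coef u"]
    by (simp add: power2_eq_square)
  finally show ?thesis by simp
qed

lemma coef_square_summable:
  assumes u: "u \<in> square_int M" shows "(\<lambda>i. (coef u i)\<^sup>2) summable_on I"
proof (rule nonneg_bdd_above_summable_on)
  show "bdd_above (sum (\<lambda>i. (coef u i)\<^sup>2) ` {F. F \<subseteq> I \<and> finite F})"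
    by (rule bdd_aboveI[of _ "\<integral>x. (u x)\<^sup>2 \<partial>M"]) (use Bessel_finite[OF u] in auto)
qed simp

lemma coef_square_le:
  assumes "u \<in> square_int M" "i \<in> I" shows "(coef u i)\<^sup>2 \<le> (\<integral>x. (u x)\<^sup>2 \<partial>M)"
  using Bessel_finite[OF assms(1), of "{i}"] assms(2) by simp

lemma coef_tendsto:
  assumes f: "\<And>n. f n \<in> square_int M" and u: "u \<in> square_int M" and i: "i \<in> I"
    and lim: "(\<lambda>n. \<integral>x. (f n x - u x)\<^sup>2 \<partial>M) \<longlonglongrightarrow> 0"
  shows "(\<lambda>n. coef (f n) i) \<longlonglongrightarrow> coef u i"
proof -
  have "(\<lambda>n. (coef (f n) i - coef u i)\<^sup>2) \<longlonglongrightarrow> 0"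
  proof (rule Lim_null_comparison[OF _ lim], rule always_eventually, rule allI)
    fix n
    have "(coef (\<lambda>x. f n x - u x) i)\<^sup>2 \<le> (\<integral>x. (f n x - u x)\<^sup>2 \<partial>M)"
      by (rule coef_square_le[OF square_int_diff[OF f u] i])
    then show "norm ((coef (f n) i - coef u i)\<^sup>2) \<le> (\<integral>x. (f n x - u x)\<^sup>2 \<partial>M)"
      by (simp add: coef_diff[OF f u i])
  qed
  then have "(\<lambda>n. sqrt ((coef (f n) i - coef u i)\<^sup>2)) \<longlonglongrightarrow> sqrt 0" by (rule tendsto_real_sqrt)
  then have "(\<lambda>n. coef (f n) i - coef u i) \<longlonglongrightarrow> 0" by (simp add: tendsto_rabs_zero_iff)
  then show ?thesis by (simp add: LIM_zero_iff)
qed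

definition exh :: "nat \<Rightarrow> 'i set" where "exh n = {i \<in> I. to_nat i < n}"

lemma exh: "finite (exh n)" "exh n \<subseteq> I" "m \<le> n \<Longrightarrow> exh m \<subseteq> exh n" "i \<in> I \<Longrightarrow> i \<in> exh (Suc (to_nat i))"
proof -
  have "finite (to_nat -` {..<n} :: 'i set)" by (rule finite_vimageI) auto
  then show "finite (exh n)" by (rule rev_finite_subset) (auto simp: exh_def)
qed (auto simp: exh_def)

text \<open>The squared distance of two partial sums is a difference of partial sums of squares, and
  each coefficient of the partial sums is eventually constant.\<close>

lemma Riesz_Fischer:
  assumes a: "(\<lambda>i. (a i)\<^sup>2) summable_on I"
  obtains u and r :: "nat \<Rightarrow> nat" where "u \<in> square_int M" "\<And>i. i \<in> I \<Longrightarrow> coef u i = a i" "strict_mono r"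
    "AE x in M. (\<lambda>n. comb (exh (r n)) a x) \<longlonglongrightarrow> u x"
proof -
  define f where "f n = comb (exh n) a" for n
  define S where "S n = (\<Sum>i\<in>exh n. (a i)\<^sup>2)" for n
  have f: "f n \<in> square_int M" for n unfolding f_def by (intro comb_square_int exh)
  have diff: "(\<integral>x. (f m x - f n x)\<^sup>2 \<partial>M) = S m - S n" if "n \<le> m" for m n
  proof -
    have "f m x - f n x = comb (exh m - exh n) a x" for x
      using sum_diff[OF exh(1) exh(3)[OF that], of "\<lambda>i. a i * e i x"] by (simp add: f_def comb_def)
    then have "(\<integral>x. (f m x - f n x)\<^sup>2 \<partial>M) = (\<Sum>i\<in>exh m - exh n. (a i)\<^sup>2)"
      using integral_comb_square[of "exh m - exh n" a] exh by auto
    also have "\<dots> = S m - S n"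
      unfolding S_def by (rule sum_diff[OF exh(1) exh(3)[OF that]])
    finally show ?thesis .
  qed
  have inc: "incseq S" unfolding S_def incseq_def by (intro allI impI sum_mono2 exh(1) exh(3)) simp_all
  have "\<forall>n. S n \<le> infsum (\<lambda>i. (a i)\<^sup>2) I"
    unfolding S_def by (intro allI finite_sum_le_infsum[OF a exh(1,2)]) auto
  then have "convergent S" using incseq_convergent[OF inc] unfolding convergent_def by metis
  then have cS: "Cauchy S" by (rule convergent_Cauchy)
  have cau: "\<exists>N. \<forall>m\<ge>N. \<forall>n\<ge>N. (\<integral>x. (f m x - f n x)\<^sup>2 \<partial>M) < \<epsilon>" if eps: "\<epsilon> > 0" for \<epsilon>
  proof -
    obtain N where N: "\<And>m n. m \<ge> N \<Longrightarrow> n \<ge> N \<Longrightarrow> \<bar>S m - S n\<bar> < \<epsilon>"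
      using CauchyD[OF cS eps] by (auto simp: dist_real_def)
    have "(\<integral>x. (f m x - f n x)\<^sup>2 \<partial>M) < \<epsilon>" if "m \<ge> N" "n \<ge> N" for m n
    proof (cases "n \<le> m")
      case True
      then show ?thesis using diff N[OF that] by simp
    next
      case False
      then have "(\<integral>x. (f n x - f m x)\<^sup>2 \<partial>M) < \<epsilon>" using diff[of m n] N[OF that] by simp
      then show ?thesis by (simp add: power2_commute[of "f m _"])
    qed
    then show ?thesis by blast
  qed
  obtain u and r :: "nat \<Rightarrow> nat" where u: "u \<in> square_int M" "strict_mono r"
    "AE x in M. (\<lambda>n. f (r n) x) \<longlonglongrightarrow> u x" "(\<lambda>n. \<integral>x. (f n x - u x)\<^sup>2 \<partial>M) \<longlonglongrightarrow> 0"
    by (rule square_int_complete[of f, OF f cau])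
  have "coef u i = a i" if i: "i \<in> I" for i
  proof -
    have "\<forall>\<^sub>F n in sequentially. coef (f n) i = a i"
      unfolding eventually_sequentially f_def
      using exh(4)[OF i] exh(3) by (intro exI[of _ "Suc (to_nat i)"]) (auto simp: coef_comb[OF exh(1,2) i])
    then have "(\<lambda>n. coef (f n) i) \<longlonglongrightarrow> a i" by (rule tendsto_eventually)
    moreover have "(\<lambda>n. coef (f n) i) \<longlonglongrightarrow> coef u i" by (rule coef_tendsto[OF f u(1) i u(4)])
    ultimately show ?thesis using LIMSEQ_unique by blast
  qed
  then show ?thesis using that u unfolding f_def by blast
qed

text \<open>Completeness identifies u with the Riesz-Fischer limit, which has the same
  coefficients.\<close>

lemma complete_expansion:
  assumes c: complete_family and u: "u \<in> square_int M"
  obtains r :: "nat \<Rightarrow> nat" where "strict_mono r" "AE x in M. (\<lambda>n. comb (exh (r n)) (coef u) x) \<longlonglongrightarrow> u x"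
proof -
  obtain v r where v: "v \<in> square_int M" "\<And>i. i \<in> I \<Longrightarrow> coef v i = coef u i" "strict_mono (r :: nat \<Rightarrow> nat)"
    "AE x in M. (\<lambda>n. comb (exh (r n)) (coef u) x) \<longlonglongrightarrow> v x"
    by (rule Riesz_Fischer[OF coef_square_summable[OF u]]) blast
  have "AE x in M. u x - v x = 0"
  proof -
    have "\<forall>i\<in>I. coef (\<lambda>x. u x - v x) i = 0" by (simp add: coef_diff[OF u v(1)] v(2))
    then show ?thesis using c square_int_diff[OF u v(1)] unfolding complete_family_def by blast
  qed
  then have "AE x in M. (\<lambda>n. comb (exh (r n)) (coef u) x) \<longlonglongrightarrow> u x" using v(4) by eventually_elim simp
  then show ?thesis using that v(3) by blast
qed

end

lemma real_summable_on_bound: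
  fixes f g :: "'b \<Rightarrow> real"
  assumes f: "f summable_on A" and le: "\<And>x. x \<in> A \<Longrightarrow> \<bar>g x\<bar> \<le> f x"
  shows "g summable_on A"
proof -
  have nn: "f x \<ge> 0" if "x \<in> A" for x using le[OF that] by linarith
  have "(\<lambda>x. norm (g x)) summable_on A"
  proof (rule nonneg_bdd_above_summable_on)
    show "bdd_above (sum (\<lambda>x. norm (g x)) ` {F. F \<subseteq> A \<and> finite F})"
    proof (rule bdd_aboveI2)
      fix F assume "F \<in> {F. F \<subseteq> A \<and> finite F}"
      then have F: "F \<subseteq> A" "finite F" by auto
      have "(\<Sum>x\<in>F. norm (g x)) \<le> sum f F" using le F by (intro sum_mono) auto
      also have "\<dots> \<le> infsum f A" using nn F by (intro finite_sum_le_infsum[OF f]) auto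
      finally show "(\<Sum>x\<in>F. norm (g x)) \<le> infsum f A" .
    qed
  qed simp
  then show ?thesis by (rule abs_summable_summable)
qed

text \<open>Lets bounds valid for all h > s pass to s. It replaces division by a norm, which would
  single out the case of norm 0.\<close>

lemma isCont_le_right_limit:
  fixes f :: "real \<Rightarrow> real"
  assumes "isCont f s" "\<And>h. h > s \<Longrightarrow> x \<le> f h" shows "x \<le> f s"
proof (rule tendsto_lowerbound)
  show "(f \<longlongrightarrow> f s) (at_right s)"
    using assms(1) unfolding isCont_def by (rule tendsto_mono[rotated]) (simp add: at_le)
  show "\<forall>\<^sub>F h in at_right s. x \<le> f h"
    using assms(2) by (auto simp: eventually_at_right_field intro: exI[of _ "s + 1"])
qed simp

subsection \<open>The energy functional of a diagonal quadratic form\<close>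

locale mode_energy = orthonormal_family M I e
  for M :: "'a measure" and I :: "'i::countable set" and e :: "'i \<Rightarrow> 'a \<Rightarrow> real" +
  fixes \<sigma> :: "'i \<Rightarrow> real" and p :: real
  assumes p: "p > 2"
begin

text \<open>Weight of the norm of E. The value 1 on the kernel of the form reproduces the extra sum
  over the zero modes in the scalar product.\<close>

definition \<tau> :: "'i \<Rightarrow> real" where "\<tau> i = (if \<sigma> i = 0 then 1 else \<bar>\<sigma> i\<bar>)"

definition E :: "('a \<Rightarrow> real) set" where
  "E = {u \<in> square_int M. (\<lambda>i. \<tau> i * (coef u i)\<^sup>2) summable_on I}"

definition nsq :: "('a \<Rightarrow> real) \<Rightarrow> real" where "nsq u = (\<Sum>\<^sub>\<infinity>i\<in>I. \<tau> i * (coef u i)\<^sup>2)"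

definition nrm :: "('a \<Rightarrow> real) \<Rightarrow> real" where "nrm u = sqrt (nsq u)"

text \<open>On the diagonal this is the squared norm of the positive part minus that of the negative
  part.\<close>

definition Q :: "('a \<Rightarrow> real) \<Rightarrow> ('a \<Rightarrow> real) \<Rightarrow> real" where
  "Q u v = (\<Sum>\<^sub>\<infinity>i\<in>I. \<sigma> i * (coef u i * coef v i))"

definition Lp :: "('a \<Rightarrow> real) \<Rightarrow> real" where "Lp u = (\<integral>x. \<bar>u x\<bar> powr p \<partial>M)"

definition G :: "('a \<Rightarrow> real) \<Rightarrow> real" where "G u = 1 / 2 * Q u u - 1 / p * Lp u"

definition Fsp :: "('a \<Rightarrow> real) set" where "Fsp = {u \<in> E. \<forall>i\<in>I. \<sigma> i > 0 \<longrightarrow> coef u i = 0}"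

definition has_der :: "('a \<Rightarrow> real) \<Rightarrow> (('a \<Rightarrow> real) \<Rightarrow> real) \<Rightarrow> bool" where
  "has_der u L \<longleftrightarrow>
     (\<forall>v\<in>E. \<forall>w\<in>E. L (\<lambda>x. v x + w x) = L v + L w) \<and>
     (\<forall>c. \<forall>v\<in>E. L (\<lambda>x. c * v x) = c * L v) \<and>
     (\<exists>C. \<forall>v\<in>E. \<bar>L v\<bar> \<le> C * nrm v) \<and>
     (\<forall>\<epsilon>>0. \<exists>\<delta>>0. \<forall>v\<in>E. nrm v < \<delta> \<longrightarrow> \<bar>G (\<lambda>x. u x + v x) - G u - L v\<bar> \<le> \<epsilon> * nrm v)"

definition in_Lp :: "('a \<Rightarrow> real) \<Rightarrow> bool" where "in_Lp u \<longleftrightarrow> integrable M (\<lambda>x. \<bar>u x\<bar> powr p)"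

definition embeds :: "real \<Rightarrow> bool" where
  "embeds K \<longleftrightarrow> K \<ge> 0 \<and> (\<forall>u\<in>E. in_Lp u \<and> Lp u \<le> K * nrm u powr p)"

section \<open>The space E, its norm and its quadratic form\<close>

lemma \<tau>: "\<tau> i > 0" "\<bar>\<sigma> i\<bar> \<le> \<tau> i" by (auto simp: \<tau>_def)

lemma E_sq: "u \<in> E \<Longrightarrow> u \<in> square_int M" by (simp add: E_def)

lemma E_measurable: "u \<in> E \<Longrightarrow> u \<in> borel_measurable M" using E_sq square_intD by blast

lemma E_summable: "u \<in> E \<Longrightarrow> (\<lambda>i. \<tau> i * (coef u i)\<^sup>2) summable_on I" by (simp add: E_def)

lemma abs_mult_le_squares: "\<bar>a * b\<bar> \<le> a\<^sup>2 + (b::real)\<^sup>2"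
proof -
  have "0 \<le> (\<bar>a\<bar> - \<bar>b\<bar>)\<^sup>2" by simp
  then have "2 * (\<bar>a\<bar> * \<bar>b\<bar>) \<le> a\<^sup>2 + b\<^sup>2" by (simp add: power2_diff)
  moreover have "0 \<le> \<bar>a\<bar> * \<bar>b\<bar>" by simp
  ultimately show ?thesis unfolding abs_mult by linarith
qed

lemma weighted_summable:
  assumes "u \<in> E" "v \<in> E" "\<And>i. \<bar>w i\<bar> \<le> \<tau> i"
  shows "(\<lambda>i. w i * (coef u i * coef v i)) summable_on I"
proof (rule real_summable_on_bound)
  show "(\<lambda>i. \<tau> i * (coef u i)\<^sup>2 + \<tau> i * (coef v i)\<^sup>2) summable_on I"
    by (intro summable_on_add E_summable assms)
  show "\<bar>w i * (coef u i * coef v i)\<bar> \<le> \<tau> i * (coef u i)\<^sup>2 + \<tau> i * (coef v i)\<^sup>2" for i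
  proof -
    have "\<bar>w i\<bar> * \<bar>coef u i * coef v i\<bar> \<le> \<tau> i * ((coef u i)\<^sup>2 + (coef v i)\<^sup>2)"
      using \<tau>(1)[of i] by (intro mult_mono assms(3) abs_mult_le_squares) auto
    then show ?thesis by (simp add: abs_mult distrib_left)
  qed
qed

lemma E_add:
  assumes u: "u \<in> E" and v: "v \<in> E"
  shows "(\<lambda>x. u x + v x) \<in> E"
proof -
  have "(\<lambda>i. \<tau> i * (coef u i)\<^sup>2 + \<tau> i * (coef v i)\<^sup>2 + 2 * (\<tau> i * (coef u i * coef v i))) summable_on I"
    by (intro summable_on_add E_summable summable_on_cmult_right weighted_summable u v) (simp add: \<tau>_def)
  moreover have "\<tau> i * (coef u i)\<^sup>2 + \<tau> i * (coef v i)\<^sup>2 + 2 * (\<tau> i * (coef u i * coef v i))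
      = \<tau> i * (coef (\<lambda>x. u x + v x) i)\<^sup>2" if "i \<in> I" for i
    using coef_add[OF E_sq[OF u] E_sq[OF v] that] by (simp add: power2_sum algebra_simps)
  ultimately have "(\<lambda>i. \<tau> i * (coef (\<lambda>x. u x + v x) i)\<^sup>2) summable_on I"
    using summable_on_cong by (metis (no_types, lifting))
  then show ?thesis using square_int_add[OF E_sq[OF u] E_sq[OF v]] by (simp add: E_def)
qed

lemma E_scale:
  assumes u: "u \<in> E" shows "(\<lambda>x. k * u x) \<in> E"
proof -
  have "(\<lambda>i. k\<^sup>2 * (\<tau> i * (coef u i)\<^sup>2)) summable_on I"
    by (intro summable_on_cmult_right E_summable u)
  moreover have "k\<^sup>2 * (\<tau> i * (coef u i)\<^sup>2) = \<tau> i * (coef (\<lambda>x. k * u x) i)\<^sup>2" for i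
    by (simp add: coef_scale power_mult_distrib)
  ultimately show ?thesis using square_int_scale[OF E_sq[OF u], of k] by (simp add: E_def)
qed

lemma E_diff:
  assumes "u \<in> E" "v \<in> E" shows "(\<lambda>x. u x - v x) \<in> E"
  using E_add[OF assms(1) E_scale[OF assms(2), of "-1"]] by simp

lemma nsq_nonneg: "nsq u \<ge> 0"
  unfolding nsq_def by (rule infsum_nonneg) (simp add: less_imp_le[OF \<tau>(1)])

lemma nrm_nonneg: "nrm u \<ge> 0" by (simp add: nrm_def nsq_nonneg)

lemma nrm_square: "(nrm u)\<^sup>2 = nsq u" by (simp add: nrm_def nsq_nonneg)

lemma nsq_scale: "nsq (\<lambda>x. k * u x) = k\<^sup>2 * nsq u"
proof -
  have "nsq (\<lambda>x. k * u x) = (\<Sum>\<^sub>\<infinity>i\<in>I. k\<^sup>2 * (\<tau> i * (coef u i)\<^sup>2))"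
    unfolding nsq_def by (rule infsum_cong) (simp add: coef_scale power_mult_distrib)
  then show ?thesis by (simp add: nsq_def infsum_cmult_right')
qed

lemma nrm_scale: "nrm (\<lambda>x. k * u x) = \<bar>k\<bar> * nrm u"
  by (simp add: nrm_def nsq_scale real_sqrt_mult)

lemma nsq_add_le:
  assumes u: "u \<in> E" and v: "v \<in> E"
  shows "nsq (\<lambda>x. u x + v x) \<le> 2 * nsq u + 2 * nsq v"
proof -
  have "nsq (\<lambda>x. u x + v x) \<le> (\<Sum>\<^sub>\<infinity>i\<in>I. 2 * (\<tau> i * (coef u i)\<^sup>2) + 2 * (\<tau> i * (coef v i)\<^sup>2))"
    unfolding nsq_def
  proof (rule infsum_mono)
    show "(\<lambda>i. \<tau> i * (coef (\<lambda>x. u x + v x) i)\<^sup>2) summable_on I" by (rule E_summable[OF E_add[OF u v]])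
    show "(\<lambda>i. 2 * (\<tau> i * (coef u i)\<^sup>2) + 2 * (\<tau> i * (coef v i)\<^sup>2)) summable_on I"
      by (intro summable_on_add summable_on_cmult_right E_summable u v)
    fix i assume i: "i \<in> I"
    have "0 \<le> (coef u i - coef v i)\<^sup>2" by simp
    then have "(coef u i + coef v i)\<^sup>2 \<le> 2 * (coef u i)\<^sup>2 + 2 * (coef v i)\<^sup>2"
      unfolding power2_diff power2_sum by linarith
    then have "\<tau> i * (coef u i + coef v i)\<^sup>2 \<le> \<tau> i * (2 * (coef u i)\<^sup>2 + 2 * (coef v i)\<^sup>2)"
      using \<tau>(1)[of i] by (intro mult_left_mono) auto
    then show "\<tau> i * (coef (\<lambda>x. u x + v x) i)\<^sup>2 \<le> 2 * (\<tau> i * (coef u i)\<^sup>2) + 2 * (\<tau> i * (coef v i)\<^sup>2)"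
      using coef_add[OF E_sq[OF u] E_sq[OF v] i] by (simp add: algebra_simps)
  qed
  also have "\<dots> = 2 * nsq u + 2 * nsq v"
    unfolding nsq_def
    by (subst infsum_add) (auto intro!: summable_on_cmult_right E_summable u v simp: infsum_cmult_right')
  finally show ?thesis .
qed

lemma Q_summable: "u \<in> E \<Longrightarrow> v \<in> E \<Longrightarrow> (\<lambda>i. \<sigma> i * (coef u i * coef v i)) summable_on I"
  by (rule weighted_summable) (use \<tau> in auto)

lemma Q_add_right:
  assumes "u \<in> E" "v \<in> E" "w \<in> E"
  shows "Q u (\<lambda>x. v x + w x) = Q u v + Q u w"
proof -
  have "Q u (\<lambda>x. v x + w x) = (\<Sum>\<^sub>\<infinity>i\<in>I. \<sigma> i * (coef u i * coef v i) + \<sigma> i * (coef u i * coef w i))"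
    unfolding Q_def
    by (rule infsum_cong) (simp add: coef_add[OF E_sq[OF assms(2)] E_sq[OF assms(3)]] algebra_simps)
  also have "\<dots> = Q u v + Q u w" unfolding Q_def by (intro infsum_add Q_summable assms)
  finally show ?thesis .
qed

lemma Q_scale_right: "Q u (\<lambda>x. k * v x) = k * Q u v"
proof -
  have "Q u (\<lambda>x. k * v x) = (\<Sum>\<^sub>\<infinity>i\<in>I. k * (\<sigma> i * (coef u i * coef v i)))"
    unfolding Q_def by (rule infsum_cong) (simp add: coef_scale)
  then show ?thesis by (simp add: Q_def infsum_cmult_right')
qed

lemma Q_commute: "Q u v = Q v u"
  unfolding Q_def by (rule infsum_cong) simp

lemma Q_add_add:
  assumes "u \<in> E" "v \<in> E"
  shows "Q (\<lambda>x. u x + v x) (\<lambda>x. u x + v x) = Q u u + 2 * Q u v + Q v v"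
  using Q_add_right[OF E_add[OF assms] assms] Q_add_right[OF assms(1) assms] Q_add_right[OF assms(2) assms]
    Q_commute[of "\<lambda>x. u x + v x" u] Q_commute[of "\<lambda>x. u x + v x" v] Q_commute[of v u]
  by simp

lemma abs_Q_le:
  assumes u: "u \<in> E" and v: "v \<in> E" shows "\<bar>Q u v\<bar> \<le> nsq u + nsq v"
proof -
  have le: "Q u v \<le> nsq u + nsq v" if v: "v \<in> E" for v
  proof -
    have "Q u v \<le> (\<Sum>\<^sub>\<infinity>i\<in>I. \<tau> i * (coef u i)\<^sup>2 + \<tau> i * (coef v i)\<^sup>2)"
      unfolding Q_def
    proof (rule infsum_mono[OF Q_summable[OF u v]])
      show "(\<lambda>i. \<tau> i * (coef u i)\<^sup>2 + \<tau> i * (coef v i)\<^sup>2) summable_on I"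
        by (intro summable_on_add E_summable u v)
      fix i
      have "\<bar>\<sigma> i\<bar> * \<bar>coef u i * coef v i\<bar> \<le> \<tau> i * ((coef u i)\<^sup>2 + (coef v i)\<^sup>2)"
        using \<tau>(1)[of i] by (intro mult_mono \<tau>(2) abs_mult_le_squares) auto
      then have "\<bar>\<sigma> i * (coef u i * coef v i)\<bar> \<le> \<tau> i * (coef u i)\<^sup>2 + \<tau> i * (coef v i)\<^sup>2"
        by (simp add: abs_mult distrib_left)
      then show "\<sigma> i * (coef u i * coef v i) \<le> \<tau> i * (coef u i)\<^sup>2 + \<tau> i * (coef v i)\<^sup>2"
        by linarith
    qed
    also have "\<dots> = nsq u + nsq v"
      unfolding nsq_def by (intro infsum_add E_summable u v)
    finally show ?thesis .
  qed
  have "Q u (\<lambda>x. (-1) * v x) \<le> nsq u + nsq (\<lambda>x. (-1) * v x)" by (rule le[OF E_scale[OF v]])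
  then have "- Q u v \<le> nsq u + nsq v" unfolding Q_scale_right nsq_scale by simp
  with le[OF v] show ?thesis by linarith
qed

lemma abs_Q_self_le: "u \<in> E \<Longrightarrow> \<bar>Q u u\<bar> \<le> 2 * nsq u"
  using abs_Q_le[of u u] by simp

text \<open>The norm sees only coefficients, so it might be 0 on a nonzero function. Hence v is
  scaled by 1/h with h > nrm v, and h is sent to nrm v afterwards.\<close>

lemma linear_bound:
  assumes hom: "\<And>k v. v \<in> E \<Longrightarrow> B (\<lambda>x. k * v x) = k * B v"
    and bd: "\<And>v. v \<in> E \<Longrightarrow> nrm v \<le> 1 \<Longrightarrow> \<bar>B v\<bar> \<le> C" and v: "v \<in> E"
  shows "\<bar>B v\<bar> \<le> C * nrm v"
proof -
  have "\<bar>B v\<bar> \<le> C * h" if h: "h > nrm v" for h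
  proof -
    have h0: "h > 0" using h nrm_nonneg[of v] by linarith
    then have "nrm (\<lambda>x. (1 / h) * v x) \<le> 1" using h unfolding nrm_scale by (simp add: pos_divide_le_eq)
    then have "\<bar>B (\<lambda>x. (1 / h) * v x)\<bar> \<le> C" using bd E_scale[OF v] by blast
    then have "\<bar>(1 / h) * B v\<bar> \<le> C" by (simp only: hom[OF v])
    then have "\<bar>B v\<bar> / h \<le> C" using h0 by (simp add: abs_mult)
    then show ?thesis using h0 by (simp add: pos_divide_le_eq)
  qed
  then show ?thesis
  proof (rule isCont_le_right_limit[rotated])
    show "isCont (\<lambda>h. C * h) (nrm v)" by (intro continuous_intros)
  qed
qed

section \<open>Integrability of p-th powers and the embedding of E\<close>

lemma Lp_nonneg: "Lp u \<ge> 0"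
  unfolding Lp_def by (rule Bochner_Integration.integral_nonneg) simp

lemma in_Lp_add:
  assumes "u \<in> borel_measurable M" "v \<in> borel_measurable M" "in_Lp u" "in_Lp v"
  shows "in_Lp (\<lambda>x. u x + v x)" "Lp (\<lambda>x. u x + v x) \<le> 2 powr p * (Lp u + Lp v)"
proof -
  have b: "\<bar>u x + v x\<bar> powr p \<le> 2 powr p * (\<bar>u x\<bar> powr p + \<bar>v x\<bar> powr p)" for x
  proof -
    have "\<bar>u x + v x\<bar> powr p \<le> (\<bar>u x\<bar> + \<bar>v x\<bar>) powr p" using p by (intro powr_mono2) auto
    also have "\<dots> \<le> 2 powr p * (\<bar>u x\<bar> powr p + \<bar>v x\<bar> powr p)" using p by (intro powr_add_le) auto
    finally show ?thesis .
  qed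
  have i: "integrable M (\<lambda>x. 2 powr p * (\<bar>u x\<bar> powr p + \<bar>v x\<bar> powr p))"
    using assms(3,4) by (simp add: in_Lp_def)
  show "in_Lp (\<lambda>x. u x + v x)"
    unfolding in_Lp_def
    by (rule Bochner_Integration.integrable_bound[OF i]) (use assms(1,2) b in \<open>auto intro!: AE_I2\<close>)
  then have "Lp (\<lambda>x. u x + v x) \<le> (\<integral>x. 2 powr p * (\<bar>u x\<bar> powr p + \<bar>v x\<bar> powr p) \<partial>M)"
    unfolding Lp_def in_Lp_def using i b by (intro integral_mono) auto
  also have "\<dots> = 2 powr p * (Lp u + Lp v)"
    unfolding Lp_def using assms(3,4) by (simp add: in_Lp_def)
  finally show "Lp (\<lambda>x. u x + v x) \<le> 2 powr p * (Lp u + Lp v)" .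
qed

lemma in_Lp_scale:
  assumes "in_Lp u" shows "in_Lp (\<lambda>x. k * u x)"
  using assms by (simp add: in_Lp_def abs_mult powr_mult)

lemma Lp_scale: "Lp (\<lambda>x. k * u x) = \<bar>k\<bar> powr p * Lp u"
  by (simp add: Lp_def abs_mult powr_mult)

lemma bounded_in_Lp:
  assumes "u \<in> borel_measurable M" "\<forall>x\<in>space M. \<bar>u x\<bar> \<le> C" shows "in_Lp u"
  unfolding in_Lp_def
proof (rule integrable_const_bound[of _ "C powr p"])
  show "AE x in M. norm (\<bar>u x\<bar> powr p) \<le> C powr p"
    using assms(2) p by (auto intro!: AE_I2 powr_mono2)
qed (use assms(1) in measurable)

lemma comb_in_E:
  assumes "finite J" "J \<subseteq> I" shows "comb J a \<in> E"
proof -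
  have "(\<lambda>i. \<tau> i * (coef (comb J a) i)\<^sup>2) summable_on I \<longleftrightarrow> (\<lambda>i. \<tau> i * (a i)\<^sup>2) summable_on J"
    by (rule summable_on_cong_neutral) (use assms coef_comb in auto)
  then show ?thesis using assms comb_square_int[OF assms] by (simp add: E_def)
qed

lemma comb_in_Lp: "finite J \<Longrightarrow> J \<subseteq> I \<Longrightarrow> in_Lp (comb J a)"
  using bounded_in_Lp[OF comb_measurable] comb_bounded by metis

lemma nsq_comb_le:
  assumes u: "u \<in> E" and J: "finite J" "J \<subseteq> I"
  shows "nsq (comb J (coef u)) \<le> nsq u"
  unfolding nsq_def
proof (rule infsum_mono[OF E_summable[OF comb_in_E[OF J]] E_summable[OF u]])
  fix i assume "i \<in> I"
  then show "\<tau> i * (coef (comb J (coef u)) i)\<^sup>2 \<le> \<tau> i * (coef u i)\<^sup>2"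
    using less_imp_le[OF \<tau>(1)[of i]] by (simp add: coef_comb[OF J])
qed

text \<open>Density in the norm of E is just the convergence of the sum that defines
  \<open>nsq\<close>.\<close>

lemma ex_comb_close:
  assumes u: "u \<in> E" and \<epsilon>: "\<epsilon> > 0"
  obtains J where "finite J" "J \<subseteq> I" "nsq (\<lambda>x. comb J (coef u) x - u x) < \<epsilon>"
proof -
  let ?f = "\<lambda>i. \<tau> i * (coef u i)\<^sup>2"
  have "(?f has_sum nsq u) I" unfolding nsq_def using E_summable[OF u] by (rule has_sum_infsum)
  then obtain J where J: "finite J" "J \<subseteq> I" "\<bar>sum ?f J - nsq u\<bar> < \<epsilon>"
    using \<epsilon> unfolding has_sum_def tendsto_iff eventually_finite_subsets_at_top dist_real_def by blast
  let ?d = "\<lambda>x. comb J (coef u) x - u x"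
  let ?g = "\<lambda>i. if i \<in> J then 0 else ?f i" and ?h = "\<lambda>i. if i \<in> J then ?f i else 0"
  have nd: "nsq ?d = infsum ?g I"
    unfolding nsq_def
    by (rule infsum_cong) (simp add: coef_diff[OF comb_square_int[OF J(1,2)] E_sq[OF u]] coef_comb[OF J(1,2)])
  have g: "?g summable_on I"
    by (rule real_summable_on_bound[OF E_summable[OF u]]) (simp add: less_imp_le[OF \<tau>(1)])
  have "?h summable_on I \<longleftrightarrow> ?f summable_on J"
    by (rule summable_on_cong_neutral) (use J in auto)
  then have h: "?h summable_on I" using J by simp
  have "nsq u = (\<Sum>\<^sub>\<infinity>i\<in>I. ?g i + ?h i)" unfolding nsq_def by (rule infsum_cong) simp
  also have "\<dots> = nsq ?d + infsum ?h I" unfolding nd by (rule infsum_add[OF g h])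
  also have "infsum ?h I = infsum ?f J" by (rule infsum_cong_neutral) (use J in auto)
  also have "\<dots> = sum ?f J" using J by simp
  finally have "nsq u = nsq ?d + sum ?f J" .
  then have "nsq ?d < \<epsilon>" using J(3) by linarith
  then show ?thesis using that J by blast
qed

text \<open>Differentiability of the energy at a single point bounds \<open>Lp\<close> near that point, which by
  homogeneity is an embedding of \<open>E\<close> into the \<open>p\<close>-integrable functions.\<close>

lemma embedding_of_derivative_in_Lp:
  assumes u0: "u0 \<in> E" and der: "has_der u0 L"
  obtains K where "K \<ge> 0" "\<And>v. v \<in> E \<Longrightarrow> in_Lp v \<Longrightarrow> Lp v \<le> K * nrm v powr p"
proof -
  obtain C where C: "\<And>v. v \<in> E \<Longrightarrow> \<bar>L v\<bar> \<le> C * nrm v" using der unfolding has_der_def by blast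
  obtain \<delta> where \<delta>: "\<delta> > 0" "\<And>v. v \<in> E \<Longrightarrow> nrm v < \<delta> \<Longrightarrow> \<bar>G (\<lambda>x. u0 x + v x) - G u0 - L v\<bar> \<le> 1 * nrm v"
    using der unfolding has_der_def by (metis zero_less_one)
  define B where "B = \<bar>G u0\<bar> + (\<bar>C\<bar> + 1) * \<delta>"
  have GB: "\<bar>G (\<lambda>x. u0 x + v x)\<bar> \<le> B" if v: "v \<in> E" "nrm v < \<delta>" for v
  proof -
    have "\<bar>L v\<bar> \<le> \<bar>C\<bar> * nrm v" using C[OF v(1)] mult_right_mono[OF abs_ge_self[of C] nrm_nonneg[of v]] by linarith
    also have "\<dots> \<le> \<bar>C\<bar> * \<delta>" using v by (intro mult_left_mono) auto
    finally show ?thesis using \<delta>(2)[OF v] v(2) unfolding B_def distrib_right by linarith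
  qed
  \<comment> \<open>At this stage p-integrability of u0 is unknown, so u0 cannot be subtracted; a
    nearby finite combination z takes its place as the centre. The constants keep z - u0 + v inside
    the ball of radius \<delta>.\<close>
  have "\<delta>\<^sup>2 / 8 > 0" using \<delta>(1) by simp
  then obtain J where J: "finite J" "J \<subseteq> I" "nsq (\<lambda>x. comb J (coef u0) x - u0 x) < \<delta>\<^sup>2 / 8"
    using ex_comb_close[OF u0] by blast
  define z where "z = comb J (coef u0)"
  have z: "z \<in> E" "in_Lp z" using comb_in_E[OF J(1,2)] comb_in_Lp[OF J(1,2)] by (auto simp: z_def)
  \<comment> \<open>B1 bounds Lp of z + v, obtained by solving the definition of G for Lp; B2 bounds
    Lp of v = (z + v) - z.\<close>
  define B1 where "B1 = p * (B + (2 * nsq z + 2 * \<delta>\<^sup>2))"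
  define B2 where "B2 = 2 powr p * (B1 + Lp z)"
  have small: "Lp v \<le> B2" if v: "v \<in> E" "in_Lp v" "nrm v < \<delta> / 4" for v
  proof -
    have "nsq v < \<delta>\<^sup>2 / 8"
    proof -
      have "(nrm v)\<^sup>2 < (\<delta> / 4)\<^sup>2" using v(3) nrm_nonneg[of v] by (intro power_strict_mono) auto
      then show ?thesis using \<delta>(1) nsq_nonneg[of v] unfolding nrm_square power_divide by simp
    qed
    have d: "(\<lambda>x. z x - u0 x) \<in> E" by (rule E_diff[OF z(1) u0])
    let ?w = "\<lambda>x. (z x - u0 x) + v x"
    have w: "?w \<in> E" by (rule E_add[OF d v(1)])
    have "nsq ?w < \<delta>\<^sup>2"
      using nsq_add_le[OF d v(1)] J(3) \<open>nsq v < \<delta>\<^sup>2 / 8\<close> zero_le_power2[of \<delta>] unfolding z_def[symmetric] by linarith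
    then have "nrm ?w < \<delta>"
      unfolding nrm_def using \<delta>(1) real_less_lsqrt by simp
    from GB[OF w this] have GB': "\<bar>G (\<lambda>x. z x + v x)\<bar> \<le> B" by simp
    let ?y = "\<lambda>x. z x + v x"
    have y: "?y \<in> E" by (rule E_add[OF z(1) v(1)])
    have iy: "in_Lp ?y" by (rule in_Lp_add(1)[OF E_measurable[OF z(1)] E_measurable[OF v(1)] z(2) v(2)])
    have "\<bar>Q ?y ?y\<bar> \<le> 2 * (2 * nsq z + 2 * nsq v)"
    proof (rule order_trans[OF abs_Q_self_le[OF y]])
      show "2 * nsq ?y \<le> 2 * (2 * nsq z + 2 * nsq v)" using nsq_add_le[OF z(1) v(1)] by simp
    qed
    then have "\<bar>1 / 2 * Q ?y ?y\<bar> \<le> 2 * nsq z + 2 * \<delta>\<^sup>2"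
    proof -
      have "\<bar>1 / 2 * Q ?y ?y\<bar> = \<bar>Q ?y ?y\<bar> / 2" by (simp add: abs_mult)
      moreover have "nsq v \<le> \<delta>\<^sup>2" using \<open>nsq v < \<delta>\<^sup>2 / 8\<close> zero_le_power2[of \<delta>] by linarith
      ultimately show ?thesis using \<open>\<bar>Q ?y ?y\<bar> \<le> 2 * (2 * nsq z + 2 * nsq v)\<close> by simp
    qed
    then have "1 / p * Lp ?y \<le> B + (2 * nsq z + 2 * \<delta>\<^sup>2)" using GB' unfolding G_def by linarith
    then have Ly: "Lp ?y \<le> B1" using p unfolding B1_def by (simp add: field_simps)
    have "Lp (\<lambda>x. ?y x + (-1) * z x) \<le> 2 powr p * (Lp ?y + Lp (\<lambda>x. (-1) * z x))"
      by (rule in_Lp_add(2)[OF E_measurable[OF y] _ iy in_Lp_scale[OF z(2)]])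
         (intro borel_measurable_times borel_measurable_const E_measurable z)
    also have "\<dots> \<le> B2" unfolding B2_def Lp_scale using Ly by simp
    finally show ?thesis by simp
  qed
  have B2: "B2 \<ge> 0"
  proof -
    let ?o = "\<lambda>x. 0 * z x"
    have "Lp ?o \<le> B2" by (rule small) (use E_scale[OF z(1), of 0] in_Lp_scale[OF z(2), of 0] \<delta>(1) nrm_scale[of 0 z] in simp_all)
    then show ?thesis using Lp_nonneg[of ?o] by linarith
  qed
  \<comment> \<open>Homogeneity: scaling v by \<delta>/(8h) with h > nrm v brings its norm below
    \<delta>/4, where Lp is at most B2.\<close>
  define K where "K = B2 * (8 / \<delta>) powr p"
  have KL: "Lp v \<le> K * \<bar>nrm v\<bar> powr p" if v: "v \<in> E" "in_Lp v" for v
  proof (rule isCont_le_right_limit[where f = "\<lambda>h. K * \<bar>h\<bar> powr p"])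
    have "isCont (\<lambda>h. \<bar>h\<bar> powr p) (nrm v)"
      using abs_powr_DERIV[of p] p by (intro DERIV_isCont) auto
    then show "isCont (\<lambda>h. K * \<bar>h\<bar> powr p) (nrm v)"
      unfolding isCont_def by (rule tendsto_mult_left)
    fix h assume h: "h > nrm v"
    then have h0: "h > 0" using nrm_nonneg[of v] by linarith
    define k where "k = \<delta> / (8 * h)"
    have k: "k > 0" using h0 \<delta>(1) by (simp add: k_def)
    have "nrm (\<lambda>x. k * v x) \<le> k * h" using k h by (simp add: nrm_scale)
    also have "\<dots> < \<delta> / 4" using h0 \<delta>(1) by (simp add: k_def)
    finally have "Lp (\<lambda>x. k * v x) \<le> B2" by (intro small E_scale in_Lp_scale v)
    then have "k powr p * Lp v \<le> B2" using k by (simp add: Lp_scale)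
    moreover have "k powr p * (8 / \<delta>) powr p * h powr p = 1"
      using k h0 \<delta>(1) by (simp add: k_def flip: powr_mult)
    ultimately have "Lp v \<le> B2 * ((8 / \<delta>) powr p * h powr p)"
    proof -
      assume a: "k powr p * Lp v \<le> B2" and b: "k powr p * (8 / \<delta>) powr p * h powr p = 1"
      have "Lp v = (k powr p * Lp v) * ((8 / \<delta>) powr p * h powr p)"
        using b by (metis mult.assoc mult.commute mult.right_neutral)
      also have "\<dots> \<le> B2 * ((8 / \<delta>) powr p * h powr p)" using a by (intro mult_right_mono) auto
      finally show ?thesis .
    qed
    then show "Lp v \<le> K * \<bar>h\<bar> powr p" using h0 by (simp add: K_def mult.assoc)
  qed
  have "Lp v \<le> K * nrm v powr p" if "v \<in> E" "in_Lp v" for v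
    using KL[OF that] nrm_nonneg[of v] by simp
  moreover have "K \<ge> 0" using B2 by (simp add: K_def)
  ultimately show ?thesis using that by blast
qed

text \<open>Partial sums of the expansion are bounded functions, hence p-integrable, with norms at
  most that of u. By completeness a subsequence converges to u a.e., and Fatou's lemma transfers the
  estimate.\<close>

lemma embedding_of_derivative:
  assumes c: complete_family and u0: "u0 \<in> E" and der: "has_der u0 L"
  shows "\<exists>K. embeds K"
proof -
  obtain K where K: "K \<ge> 0" "\<And>v. v \<in> E \<Longrightarrow> in_Lp v \<Longrightarrow> Lp v \<le> K * nrm v powr p"
    using embedding_of_derivative_in_Lp[OF u0 der] by blast
  have "in_Lp u \<and> Lp u \<le> K * nrm u powr p" if u: "u \<in> E" for u
  proof -
    obtain r :: "nat \<Rightarrow> nat" where r: "AE x in M. (\<lambda>n. comb (exh (r n)) (coef u) x) \<longlonglongrightarrow> u x"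
      using complete_expansion[OF c E_sq[OF u]] by blast
    let ?s = "\<lambda>n. comb (exh (r n)) (coef u)"
    have s: "?s n \<in> E" "in_Lp (?s n)" for n
      using comb_in_E comb_in_Lp exh by auto
    have b: "Lp (?s n) \<le> K * nrm u powr p" for n
    proof -
      have "nrm (?s n) \<le> nrm u" unfolding nrm_def using nsq_comb_le[OF u exh(1,2)] by simp
      then have "K * nrm (?s n) powr p \<le> K * nrm u powr p"
        using K(1) nrm_nonneg p by (intro mult_left_mono powr_mono2) auto
      then show ?thesis using K(2)[OF s[of n]] by linarith
    qed
    have l: "AE x in M. (\<lambda>n. \<bar>?s n x\<bar> powr p) \<longlonglongrightarrow> \<bar>u x\<bar> powr p"
      using r by eventually_elim (rule tendsto_powr', auto intro!: tendsto_rabs simp: p less_trans[OF _ p])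
    have m: "(\<lambda>x. \<bar>u x\<bar> powr p) \<in> borel_measurable M" using E_measurable[OF u] by measurable
    show ?thesis
      using Fatou_real[of M "\<lambda>n x. \<bar>?s n x\<bar> powr p", OF _ _ l m _ tendsto_const[of "K * nrm u powr p"]]
        s(2) b unfolding in_Lp_def Lp_def by auto
  qed
  then show ?thesis unfolding embeds_def using K(1) by blast
qed

section \<open>The derivative of the energy\<close>

definition L0 :: "('a \<Rightarrow> real) \<Rightarrow> ('a \<Rightarrow> real) \<Rightarrow> real" where
  "L0 u v = Q u v - (\<integral>x. \<bar>u x\<bar> powr (p - 2) * u x * v x \<partial>M)"

text \<open>Replacing both |a| and |c| by the larger one gives a pointwise bound that serves as a
  crude Hoelder inequality.\<close>

lemma integrable_pairing:
  assumes "u \<in> borel_measurable M" "v \<in> borel_measurable M" "in_Lp u" "in_Lp v"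
  shows "integrable M (\<lambda>x. \<bar>u x\<bar> powr (p - 2) * u x * v x)"
    and "\<bar>\<integral>x. \<bar>u x\<bar> powr (p - 2) * u x * v x \<partial>M\<bar> \<le> Lp u + Lp v"
proof -
  have b: "\<bar>\<bar>a\<bar> powr (p - 2) * a * c\<bar> \<le> \<bar>a\<bar> powr p + \<bar>c\<bar> powr p" for a c :: real
  proof -
    define m where "m = max \<bar>a\<bar> \<bar>c\<bar>"
    have m0: "\<bar>m\<bar> = m" by (simp add: m_def)
    have "\<bar>a\<bar> powr (p - 2) * (\<bar>a\<bar> * \<bar>c\<bar>) \<le> m powr (p - 2) * (m * m)"
      using p by (intro mult_mono powr_mono2) (auto simp: m_def)
    also have "\<dots> = \<bar>m\<bar> powr p"
      using abs_powr_mult_square[of m p] unfolding m0 by (simp add: power2_eq_square)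
    also have "\<dots> \<le> \<bar>a\<bar> powr p + \<bar>c\<bar> powr p" unfolding m0 by (simp add: m_def max_def)
    finally show ?thesis by (simp add: abs_mult mult.assoc)
  qed
  have i: "integrable M (\<lambda>x. \<bar>u x\<bar> powr p + \<bar>v x\<bar> powr p)"
    using assms(3,4) by (simp add: in_Lp_def)
  show ig: "integrable M (\<lambda>x. \<bar>u x\<bar> powr (p - 2) * u x * v x)"
  proof (rule Bochner_Integration.integrable_bound[OF i])
    show "AE x in M. norm (\<bar>u x\<bar> powr (p - 2) * u x * v x) \<le> norm (\<bar>u x\<bar> powr p + \<bar>v x\<bar> powr p)"
      using b by (intro AE_I2) (simp add: abs_of_nonneg)
  qed (use assms(1,2) in measurable)
  have "\<bar>\<integral>x. \<bar>u x\<bar> powr (p - 2) * u x * v x \<partial>M\<bar> \<le> (\<integral>x. \<bar>\<bar>u x\<bar> powr (p - 2) * u x * v x\<bar> \<partial>M)"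
    by (rule integral_abs_bound)
  also have "\<dots> \<le> (\<integral>x. \<bar>u x\<bar> powr p + \<bar>v x\<bar> powr p \<partial>M)"
    using ig i b by (intro integral_mono) auto
  also have "\<dots> = Lp u + Lp v" unfolding Lp_def using assms(3,4) by (simp add: in_Lp_def)
  finally show "\<bar>\<integral>x. \<bar>u x\<bar> powr (p - 2) * u x * v x \<partial>M\<bar> \<le> Lp u + Lp v" .
qed

lemma pairing_self: "(\<integral>x. \<bar>u x\<bar> powr (p - 2) * u x * u x \<partial>M) = Lp u"
  unfolding Lp_def using abs_powr_mult_square[of _ p] by (simp add: power2_eq_square mult.assoc)

lemma has_der_add: "has_der u L \<Longrightarrow> v \<in> E \<Longrightarrow> w \<in> E \<Longrightarrow> L (\<lambda>x. v x + w x) = L v + L w"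
  and has_der_scale: "has_der u L \<Longrightarrow> v \<in> E \<Longrightarrow> L (\<lambda>x. c * v x) = c * L v"
  by (auto simp: has_der_def)

lemma has_der_approx:
  assumes "has_der u L" "\<epsilon> > 0"
  obtains \<delta> where "\<delta> > 0" "\<And>v. v \<in> E \<Longrightarrow> nrm v < \<delta> \<Longrightarrow> \<bar>G (\<lambda>x. u x + v x) - G u - L v\<bar> \<le> \<epsilon> * nrm v"
  using assms unfolding has_der_def by blast

text \<open>Critical points and the Nehari set only assert that some derivative exists; uniqueness
  allows computing with \<open>L0\<close>.\<close>

lemma has_der_unique:
  assumes d1: "has_der u L1" and d2: "has_der u L2" and v: "v \<in> E"
  shows "L1 v = L2 v"
proof -
  let ?D = "\<lambda>v. L1 v - L2 v"
  have hom: "?D (\<lambda>x. k * v x) = k * ?D v" if "v \<in> E" for k v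
    using has_der_scale[OF d1 that] has_der_scale[OF d2 that] by (simp add: right_diff_distrib)
  have "\<bar>?D v\<bar> \<le> 0 * nrm v"
  proof (rule linear_bound[OF hom _ v])
    fix v assume v: "v \<in> E" "nrm v \<le> 1"
    have "\<bar>?D v\<bar> \<le> 0 + \<epsilon>" if \<epsilon>: "\<epsilon> > 0" for \<epsilon>
    proof -
      have e2: "\<epsilon> / 2 > 0" using \<epsilon> by simp
      obtain \<delta>1 where \<delta>1: "\<delta>1 > 0" "\<And>v. v \<in> E \<Longrightarrow> nrm v < \<delta>1 \<Longrightarrow> \<bar>G (\<lambda>x. u x + v x) - G u - L1 v\<bar> \<le> \<epsilon> / 2 * nrm v"
        using has_der_approx[OF d1 e2] by blast
      obtain \<delta>2 where \<delta>2: "\<delta>2 > 0" "\<And>v. v \<in> E \<Longrightarrow> nrm v < \<delta>2 \<Longrightarrow> \<bar>G (\<lambda>x. u x + v x) - G u - L2 v\<bar> \<le> \<epsilon> / 2 * nrm v"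
        using has_der_approx[OF d2 e2] by blast
      define k where "k = min \<delta>1 \<delta>2 / 2"
      have k: "k > 0" "k < \<delta>1" "k < \<delta>2" using \<delta>1(1) \<delta>2(1) by (auto simp: k_def min_def)
      let ?w = "\<lambda>x. k * v x"
      have w: "?w \<in> E" by (rule E_scale[OF v(1)])
      have nw: "nrm ?w \<le> k" using v(2) k(1) mult_left_mono[of "nrm v" 1 k] by (simp add: nrm_scale)
      have "\<bar>?D ?w\<bar> \<le> \<epsilon> * nrm ?w"
        using \<delta>1(2)[OF w] \<delta>2(2)[OF w] nw k by linarith
      also have "\<dots> \<le> \<epsilon> * k" using nw \<epsilon> by (intro mult_left_mono) auto
      finally have "k * \<bar>?D v\<bar> \<le> k * \<epsilon>" using hom[OF v(1), of k] k(1) by (simp add: abs_mult mult.commute)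
      then show ?thesis using k(1) by simp
    qed
    then show "\<bar>?D v\<bar> \<le> 0" by (rule field_le_epsilon)
  qed
  then show ?thesis by simp
qed

lemma has_der_at_max:
  assumes d: "has_der w L" and v: "v \<in> E" and mx: "\<And>t. G (\<lambda>x. w x + t * v x) \<le> G w"
  shows "L v = 0"
proof -
  have le: "L v \<le> 0" if v: "v \<in> E" and mx: "\<And>t. t > 0 \<Longrightarrow> G (\<lambda>x. w x + t * v x) \<le> G w" for v
  proof -
    have "L v \<le> 0 + \<epsilon>" if \<epsilon>: "\<epsilon> > 0" for \<epsilon>
    proof -
      define \<eta> where "\<eta> = \<epsilon> / (nrm v + 1)"
      have nv: "nrm v + 1 > 0" using nrm_nonneg[of v] by linarith
      have \<eta>: "\<eta> > 0" using \<epsilon> nv by (simp add: \<eta>_def)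
      obtain \<delta> where \<delta>: "\<delta> > 0" "\<And>v. v \<in> E \<Longrightarrow> nrm v < \<delta> \<Longrightarrow> \<bar>G (\<lambda>x. w x + v x) - G w - L v\<bar> \<le> \<eta> * nrm v"
        using has_der_approx[OF d \<eta>] by blast
      define t where "t = \<delta> / (nrm v + 1)"
      have t: "t > 0" using \<delta>(1) nv by (simp add: t_def)
      have "t * nrm v < t * (nrm v + 1)" using t by (intro mult_strict_left_mono) auto
      also have "\<dots> = \<delta>" using nv by (simp add: t_def)
      finally have n: "nrm (\<lambda>x. t * v x) < \<delta>" using t by (simp add: nrm_scale)
      have "\<bar>G (\<lambda>x. w x + t * v x) - G w - L (\<lambda>x. t * v x)\<bar> \<le> \<eta> * nrm (\<lambda>x. t * v x)"
        by (rule \<delta>(2)[OF E_scale[OF v] n])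
      then have "L (\<lambda>x. t * v x) \<le> \<eta> * nrm (\<lambda>x. t * v x)" using mx[OF t] by linarith
      then have "t * L v \<le> t * (\<eta> * nrm v)" using t has_der_scale[OF d v, of t] by (simp add: nrm_scale mult_ac)
      then have "L v \<le> \<eta> * nrm v" using t by simp
      also have "\<dots> \<le> \<eta> * (nrm v + 1)" using \<eta> by (intro mult_left_mono) auto
      also have "\<dots> = \<epsilon>" using nv by (simp add: \<eta>_def)
      finally show ?thesis by simp
    qed
    then show ?thesis by (rule field_le_epsilon)
  qed
  have "L v \<le> 0" by (rule le[OF v mx])
  moreover have "L (\<lambda>x. (-1) * v x) \<le> 0"
  proof (rule le[OF E_scale[OF v]])
    fix t :: real
    show "G (\<lambda>x. w x + t * ((-1) * v x)) \<le> G w" using mx[of "-t"] by simp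
  qed
  then have "- L v \<le> 0" unfolding has_der_scale[OF d v] by simp
  ultimately show ?thesis by simp
qed

text \<open>The remainder is half of Q v v minus 1/p times the integrated Taylor remainder of |u|^p;
  both are of second order in nrm v.\<close>

lemma has_der_L0:
  assumes em: "embeds K" and u: "u \<in> E"
  shows "has_der u (L0 u)"
proof -
  have K: "K \<ge> 0" "\<And>v. v \<in> E \<Longrightarrow> in_Lp v" "\<And>v. v \<in> E \<Longrightarrow> Lp v \<le> K * nrm v powr p"
    using em by (auto simp: embeds_def)
  note um = E_measurable[OF u]
  have pair: "integrable M (\<lambda>x. \<bar>u x\<bar> powr (p - 2) * u x * v x)" if "v \<in> E" for v
    by (rule integrable_pairing(1)[OF um E_measurable[OF that] K(2)[OF u] K(2)[OF that]])
  have add: "L0 u (\<lambda>x. v x + w x) = L0 u v + L0 u w" if "v \<in> E" "w \<in> E" for v w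
    using pair[OF that(1)] pair[OF that(2)] Q_add_right[OF u that] by (simp add: L0_def distrib_left)
  have scale: "L0 u (\<lambda>x. c * v x) = c * L0 u v" for c v
  proof -
    have "(\<integral>x. \<bar>u x\<bar> powr (p - 2) * u x * (c * v x) \<partial>M) = (\<integral>x. c * (\<bar>u x\<bar> powr (p - 2) * u x * v x) \<partial>M)"
      by (simp add: mult_ac)
    then show ?thesis by (simp add: L0_def Q_scale_right right_diff_distrib)
  qed
  have bound: "\<bar>L0 u v\<bar> \<le> (nsq u + 1 + (Lp u + K)) * nrm v" if v: "v \<in> E" for v
  proof (rule linear_bound[OF scale _ v])
    fix v assume v: "v \<in> E" "nrm v \<le> 1"
    have "nsq v \<le> 1" using v(2) nrm_nonneg[of v] nrm_square[of v] by (metis power_le_one)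
    then have "\<bar>Q u v\<bar> \<le> nsq u + 1" using abs_Q_le[OF u v(1)] by linarith
    moreover have "Lp v \<le> K"
    proof -
      have "nrm v powr p \<le> 1 powr p" using v(2) nrm_nonneg p by (intro powr_mono2) auto
      then have "K * nrm v powr p \<le> K" using K(1) mult_left_mono[of "nrm v powr p" 1 K] by simp
      then show ?thesis using K(3)[OF v(1)] by linarith
    qed
    then have "\<bar>\<integral>x. \<bar>u x\<bar> powr (p - 2) * u x * v x \<partial>M\<bar> \<le> Lp u + K"
      using integrable_pairing(2)[OF um E_measurable[OF v(1)] K(2)[OF u] K(2)[OF v(1)]] by linarith
    ultimately show "\<bar>L0 u v\<bar> \<le> nsq u + 1 + (Lp u + K)" unfolding L0_def by linarith
  qed
  define C where "C = p * (p - 1) * 2 powr (p - 2)"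
  have C: "C \<ge> 0" using p by (simp add: C_def)
  define D where "D = 1 + C / p * (Lp u + 2 * K)"
  have D: "D \<ge> 1" using C p K(1) Lp_nonneg[of u] by (simp add: D_def)
  have rem: "\<bar>G (\<lambda>x. u x + v x) - G u - L0 u v\<bar> \<le> D * (nrm v)\<^sup>2" if v: "v \<in> E" "nrm v < 1" for v
  proof -
    note vm = E_measurable[OF v(1)] and vL = K(2)[OF v(1)]
    let ?R = "\<lambda>x. \<bar>u x + v x\<bar> powr p - \<bar>u x\<bar> powr p - p * (\<bar>u x\<bar> powr (p - 2) * u x * v x)"
    have iuv: "in_Lp (\<lambda>x. u x + v x)" by (rule in_Lp_add(1)[OF um vm K(2)[OF u] vL])
    have iR: "integrable M ?R"
      using iuv K(2)[OF u] pair[OF v(1)] unfolding in_Lp_def by auto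
    have eq: "G (\<lambda>x. u x + v x) - G u - L0 u v = 1 / 2 * Q v v - 1 / p * integral\<^sup>L M ?R"
    proof -
      have "integral\<^sup>L M ?R = Lp (\<lambda>x. u x + v x) - Lp u - p * (\<integral>x. \<bar>u x\<bar> powr (p - 2) * u x * v x \<partial>M)"
        using iuv K(2)[OF u] pair[OF v(1)] unfolding in_Lp_def Lp_def by simp
      then have "1 / p * integral\<^sup>L M ?R = 1 / p * Lp (\<lambda>x. u x + v x) - 1 / p * Lp u
          - (\<integral>x. \<bar>u x\<bar> powr (p - 2) * u x * v x \<partial>M)"
        using p by (simp only: right_diff_distrib) simp
      moreover have "q * R = q * l - q * m - P \<Longrightarrow> 1 / 2 * (a + 2 * b + c) - q * l - (1 / 2 * a - q * m) - (b - P) = 1 / 2 * c - q * R"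
        for a b c l m P q R :: real by (simp add: algebra_simps)
      ultimately show ?thesis
        unfolding G_def L0_def Q_add_add[OF u v(1)] by blast
    qed
    \<comment> \<open>The splitting parameter must be positive while nrm v may be 0, so some h > nrm
      v is used and then sent to nrm v. With Lp v \<le> K h^p both terms in v become multiples of
      h^2; h < 1 gives h^p \<le> h^2.\<close>
    have "\<bar>integral\<^sup>L M ?R\<bar> \<le> C * (Lp u + 2 * K) * h\<^sup>2" if h: "h > nrm v" "h < 1" for h
    proof -
      have h0: "h > 0" using h nrm_nonneg[of v] by linarith
      let ?b = "\<lambda>x. C * (h\<^sup>2 * \<bar>u x\<bar> powr p + (h powr (2 - p) + 1) * \<bar>v x\<bar> powr p)"
      have "\<bar>integral\<^sup>L M ?R\<bar> \<le> (\<integral>x. \<bar>?R x\<bar> \<partial>M)" by (rule integral_abs_bound)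
      also have "\<dots> \<le> (\<integral>x. ?b x \<partial>M)"
      proof (rule integral_mono)
        show "integrable M (\<lambda>x. \<bar>?R x\<bar>)" by (rule integrable_abs[OF iR])
        show "integrable M ?b" using K(2)[OF u] vL unfolding in_Lp_def by simp
        fix x
        have "\<bar>?R x\<bar> \<le> C * (\<bar>u x\<bar> powr (p - 2) * (v x)\<^sup>2 + \<bar>v x\<bar> powr p)"
          unfolding C_def by (rule abs_powr_Taylor[OF p])
        also have "\<dots> \<le> ?b x"
          using powr_split_le[OF p h0, of "u x" "v x"] C by (intro mult_left_mono) (auto simp: algebra_simps)
        finally show "\<bar>?R x\<bar> \<le> ?b x" .
      qed
      also have "\<dots> = C * (h\<^sup>2 * Lp u + (h powr (2 - p) + 1) * Lp v)"
        using K(2)[OF u] vL unfolding in_Lp_def Lp_def by simp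
      also have "\<dots> \<le> C * (h\<^sup>2 * Lp u + (h\<^sup>2 * K + h\<^sup>2 * K))"
      proof -
        have "nrm v powr p \<le> h powr p" using h nrm_nonneg p by (intro powr_mono2) auto
        then have Lv: "Lp v \<le> K * h powr p" using K(1) K(3)[OF v(1)] by (meson mult_left_mono order.trans)
        have "h powr (2 - p) * Lp v \<le> h powr (2 - p) * (K * h powr p)" using Lv by (intro mult_left_mono) auto
        also have "\<dots> = K * h powr 2" using h0 by (simp add: mult.left_commute flip: powr_add)
        also have "h powr 2 = h\<^sup>2" using h0 by (simp add: powr_numeral)
        finally have 1: "h powr (2 - p) * Lp v \<le> h\<^sup>2 * K" by (simp add: mult.commute)
        have "h powr p \<le> h powr 2" using p h h0 by (intro powr_mono') auto
        then have "K * h powr p \<le> K * h\<^sup>2" using K(1) h0 by (intro mult_left_mono) (auto simp: powr_numeral)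
        then have 2: "Lp v \<le> h\<^sup>2 * K" using Lv by (simp add: mult.commute)
        have "h powr (2 - p) * Lp v + Lp v \<le> h\<^sup>2 * K + h\<^sup>2 * K" using 1 2 by linarith
        then have "(h powr (2 - p) + 1) * Lp v \<le> h\<^sup>2 * K + h\<^sup>2 * K" by (simp only: distrib_right mult_1)
        then show ?thesis using C by (intro mult_left_mono add_left_mono)
      qed
      also have "\<dots> = C * (Lp u + 2 * K) * h\<^sup>2" by (simp add: algebra_simps)
      finally show ?thesis .
    qed
    then have bR: "\<bar>integral\<^sup>L M ?R\<bar> \<le> C * (Lp u + 2 * K) * (nrm v)\<^sup>2"
    proof -
      assume a: "\<And>h. nrm v < h \<Longrightarrow> h < 1 \<Longrightarrow> \<bar>integral\<^sup>L M ?R\<bar> \<le> C * (Lp u + 2 * K) * h\<^sup>2"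
      show ?thesis
      proof (rule tendsto_lowerbound)
        show "((\<lambda>h. C * (Lp u + 2 * K) * h\<^sup>2) \<longlongrightarrow> C * (Lp u + 2 * K) * (nrm v)\<^sup>2) (at_right (nrm v))"
          by (intro tendsto_intros)
        show "\<forall>\<^sub>F h in at_right (nrm v). \<bar>integral\<^sup>L M ?R\<bar> \<le> C * (Lp u + 2 * K) * h\<^sup>2"
          using a v(2) unfolding eventually_at_right_field by blast
      qed simp
    qed
    have "\<bar>1 / 2 * Q v v\<bar> \<le> (nrm v)\<^sup>2" using abs_Q_self_le[OF v(1)] unfolding nrm_square by (simp add: abs_mult)
    moreover have "\<bar>1 / p * integral\<^sup>L M ?R\<bar> \<le> C / p * (Lp u + 2 * K) * (nrm v)\<^sup>2"
      using bR p by (simp add: abs_mult divide_right_mono)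
    ultimately show ?thesis unfolding eq D_def distrib_right by linarith
  qed
  have "\<exists>\<delta>>0. \<forall>v\<in>E. nrm v < \<delta> \<longrightarrow> \<bar>G (\<lambda>x. u x + v x) - G u - L0 u v\<bar> \<le> \<epsilon> * nrm v" if \<epsilon>: "\<epsilon> > 0" for \<epsilon>
  proof (intro exI[of _ "min 1 (\<epsilon> / D)"] conjI ballI impI)
    show "0 < min 1 (\<epsilon> / D)" using \<epsilon> D by simp
    fix v assume v: "v \<in> E" "nrm v < min 1 (\<epsilon> / D)"
    have "D * (nrm v)\<^sup>2 = (D * nrm v) * nrm v" by (simp add: power2_eq_square)
    also have "\<dots> \<le> \<epsilon> * nrm v"
      using v(2) D by (intro mult_right_mono nrm_nonneg) (simp add: pos_less_divide_eq mult.commute less_imp_le)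
    finally show "\<bar>G (\<lambda>x. u x + v x) - G u - L0 u v\<bar> \<le> \<epsilon> * nrm v" using rem[OF v(1)] v(2) by linarith
  qed
  then show ?thesis unfolding has_der_def using add scale bound by blast
qed

lemma der_eq_L0: "embeds K \<Longrightarrow> u \<in> E \<Longrightarrow> has_der u L \<Longrightarrow> v \<in> E \<Longrightarrow> L v = L0 u v"
  by (rule has_der_unique[OF _ has_der_L0])

section \<open>The Nehari set and a lower bound for its energies\<close>

definition Neh :: "('a \<Rightarrow> real) set" where
  "Neh = {u \<in> E - Fsp. \<exists>L. has_der u L \<and> L u = 0 \<and> (\<forall>v\<in>Fsp. L v = 0)}"

lemma energy_of_L_self_zero:
  assumes "embeds K" "u \<in> E" "has_der u L" "L u = 0"
  shows "Q u u = Lp u" "G u = (1 / 2 - 1 / p) * Lp u"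
proof -
  have "L0 u u = 0" using der_eq_L0[OF assms(1-3,2)] assms(4) by simp
  then show "Q u u = Lp u" by (simp add: L0_def pairing_self)
  then show "G u = (1 / 2 - 1 / p) * Lp u" by (simp add: G_def left_diff_distrib)
qed

text \<open>Testing the derivative at w with the positive part v, which differs from w by an element
  of \<open>Fsp\<close>, gives nsq v = \<integral> |w|^(p-2) w v. A Hoelder-type estimate and the
  embedding bound this by (1 + K) (nsq v)^(1/2) S^((p-1)/p) with S = Lp w. As S \<le> nsq v, S
  cannot be small.\<close>

lemma Neh_energy_ge:
  assumes em: "embeds K"
  shows "\<exists>c>0. \<forall>w\<in>Neh. G w \<ge> c"
proof -
  have K: "K \<ge> 0" "\<And>v. v \<in> E \<Longrightarrow> in_Lp v" "\<And>v. v \<in> E \<Longrightarrow> Lp v \<le> K * nrm v powr p"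
    using em by (auto simp: embeds_def)
  define c where "c = (1 / 2 - 1 / p) * (1 / (1 + K)) powr (2 * p / (p - 2))"
  have c: "c > 0" using p K(1) by (simp add: c_def field_simps)
  moreover have "G w \<ge> c" if w: "w \<in> Neh" for w
  proof -
    obtain L where L: "w \<in> E" "w \<notin> Fsp" "has_der w L" "L w = 0" "\<And>v. v \<in> Fsp \<Longrightarrow> L v = 0"
      using w unfolding Neh_def by blast
    note wE = L(1)
    define S where "S = Lp w"
    have Qw: "Q w w = S" "G w = (1 / 2 - 1 / p) * S"
      using energy_of_L_self_zero[OF em L(1,3,4)] by (simp_all add: S_def)
    let ?a = "\<lambda>i. if \<sigma> i > 0 then coef w i else 0"
    have sa: "(\<lambda>i. (?a i)\<^sup>2) summable_on I"
      by (rule real_summable_on_bound[OF coef_square_summable[OF E_sq[OF wE]]]) auto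
    obtain v and r :: "nat \<Rightarrow> nat" where v: "v \<in> square_int M" "\<And>i. i \<in> I \<Longrightarrow> coef v i = ?a i"
      "strict_mono r" "AE x in M. (\<lambda>n. comb (exh (r n)) ?a x) \<longlonglongrightarrow> v x"
      by (rule Riesz_Fischer[OF sa]) blast
    have "(\<lambda>i. \<tau> i * (coef v i)\<^sup>2) summable_on I"
      by (rule real_summable_on_bound[OF E_summable[OF wE]]) (use v(2) less_imp_le[OF \<tau>(1)] in auto)
    then have vE: "v \<in> E" using v(1) by (simp add: E_def)
    have d: "(\<lambda>x. w x - v x) \<in> Fsp"
      using E_diff[OF wE vE] v(2) by (auto simp: Fsp_def coef_diff[OF E_sq[OF wE] v(1)])
    have "L w = L v + L (\<lambda>x. w x - v x)"
      using has_der_add[OF L(3) vE E_diff[OF wE vE]] by simp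
    then have "L0 w v = 0" using L(4) L(5)[OF d] der_eq_L0[OF em wE L(3) vE] by simp
    then have Qwv: "Q w v = (\<integral>x. \<bar>w x\<bar> powr (p - 2) * w x * v x \<partial>M)" by (simp add: L0_def)
    define A where "A = nsq v"
    have QA: "Q w v = A"
      unfolding Q_def A_def nsq_def
      by (rule infsum_cong) (use v(2) in \<open>auto simp: \<tau>_def power2_eq_square\<close>)
    \<comment> \<open>Passing from w to v drops the terms with nonpositive eigenvalue, which can
      only raise the form.\<close>
    have SA: "S \<le> A"
      unfolding Qw(1)[symmetric] QA[symmetric] Q_def
      by (rule infsum_mono[OF Q_summable[OF wE wE] Q_summable[OF wE vE]])
         (use v(2) in \<open>auto simp: mult_nonpos_nonneg\<close>)
    \<comment> \<open>If S were 0, w would vanish a.e. and lie in \<open>Fsp\<close>, which the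
      Nehari set excludes.\<close>
    have Spos: "S > 0"
    proof (rule ccontr)
      assume "\<not> S > 0"
      then have "S = 0" using Lp_nonneg[of w] by (simp add: S_def)
      then have "AE x in M. \<bar>w x\<bar> powr p = 0"
        using K(2)[OF wE] unfolding S_def Lp_def in_Lp_def
        by (subst (asm) integral_nonneg_eq_0_iff_AE) auto
      then have z: "AE x in M. w x = 0 * w x" by eventually_elim auto
      have "coef w i = 0" if "i \<in> I" for i
        using coef_cong_AE[OF E_sq[OF wE] square_int_scale[OF E_sq[OF wE]] z that] coef_scale[of 0 w i] by simp
      then show False using L(2) wE by (auto simp: Fsp_def)
    qed
    then have Apos: "A > 0" using SA by linarith
    \<comment> \<open>Balances the two terms of the pointwise Young inequality: h S and h^(1-p)
      A^(p/2) are both equal to A^(1/2) S^((p-1)/p).\<close>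
    define h where "h = A powr (1 / 2) * S powr (- (1 / p))"
    have h: "h > 0" using Apos Spos by (simp add: h_def)
    have "A = (\<integral>x. \<bar>w x\<bar> powr (p - 2) * w x * v x \<partial>M)" using QA Qwv by simp
    also have "\<dots> \<le> (\<integral>x. h * \<bar>w x\<bar> powr p + h powr (1 - p) * \<bar>v x\<bar> powr p \<partial>M)"
    proof (rule integral_mono)
      show "integrable M (\<lambda>x. \<bar>w x\<bar> powr (p - 2) * w x * v x)"
        by (rule integrable_pairing(1)[OF E_measurable[OF wE] E_measurable[OF vE] K(2)[OF wE] K(2)[OF vE]])
      show "integrable M (\<lambda>x. h * \<bar>w x\<bar> powr p + h powr (1 - p) * \<bar>v x\<bar> powr p)"
        using K(2)[OF wE] K(2)[OF vE] by (simp add: in_Lp_def)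
      fix x
      have "\<bar>w x\<bar> powr (p - 2) * w x * v x \<le> \<bar>w x\<bar> powr (p - 2) * (\<bar>w x\<bar> * \<bar>v x\<bar>)"
        unfolding mult.assoc by (intro mult_left_mono) (auto simp flip: abs_mult)
      also have "\<dots> \<le> h * \<bar>w x\<bar> powr p + h powr (1 - p) * \<bar>v x\<bar> powr p"
      proof (cases "\<bar>v x\<bar> \<le> h * \<bar>w x\<bar>")
        case True
        then have "\<bar>w x\<bar> powr (p - 2) * (\<bar>w x\<bar> * \<bar>v x\<bar>) \<le> \<bar>w x\<bar> powr (p - 2) * (\<bar>w x\<bar> * (h * \<bar>w x\<bar>))"
          by (intro mult_left_mono) auto
        also have "\<dots> = h * (\<bar>w x\<bar> powr (p - 2) * (\<bar>w x\<bar> * \<bar>w x\<bar>))" by (simp only: mult_ac)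
        also have "\<bar>w x\<bar> * \<bar>w x\<bar> = (w x)\<^sup>2" by (simp add: power2_eq_square)
        also have "h * (\<bar>w x\<bar> powr (p - 2) * (w x)\<^sup>2) = h * \<bar>w x\<bar> powr p"
          by (simp only: abs_powr_mult_square)
        finally show ?thesis by (simp add: add_increasing2)
      next
        case False
        then have wv: "\<bar>w x\<bar> \<le> \<bar>v x\<bar> / h" using h by (simp add: field_simps)
        have vp: "\<bar>v x\<bar> > 0" using False h by (smt (verit) mult_nonneg_nonneg)
        have "\<bar>w x\<bar> powr (p - 2) * (\<bar>w x\<bar> * \<bar>v x\<bar>) \<le> (\<bar>v x\<bar> / h) powr (p - 2) * ((\<bar>v x\<bar> / h) * \<bar>v x\<bar>)"
          using p h wv by (intro mult_mono powr_mono2) auto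
        also have "\<dots> = (\<bar>v x\<bar> powr (p - 2) * (\<bar>v x\<bar> * \<bar>v x\<bar>)) * (1 / (h powr (p - 2) * h))"
          using h by (simp add: powr_divide)
        also have "\<bar>v x\<bar> powr (p - 2) * (\<bar>v x\<bar> * \<bar>v x\<bar>) = \<bar>v x\<bar> powr p"
          using abs_powr_mult_square[of "v x" p] by (simp add: power2_eq_square)
        also have "1 / (h powr (p - 2) * h) = h powr (1 - p)"
        proof -
          have "h powr (p - 2) * h = h powr (p - 1)" using powr_add[of h "p - 2" 1] h by simp
          then show ?thesis using powr_minus_divide[of h "p - 1"] by simp
        qed
        finally show ?thesis using h by (simp add: mult.commute add_increasing)
      qed
      finally show "\<bar>w x\<bar> powr (p - 2) * w x * v x \<le> h * \<bar>w x\<bar> powr p + h powr (1 - p) * \<bar>v x\<bar> powr p" .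
    qed
    also have "\<dots> = h * S + h powr (1 - p) * Lp v"
      using K(2)[OF wE] K(2)[OF vE] by (simp add: in_Lp_def Lp_def S_def)
    also have "\<dots> \<le> h * S + h powr (1 - p) * (K * A powr (p / 2))"
    proof -
      have "nrm v powr p = A powr (p / 2)"
        using Apos by (simp add: nrm_def A_def[symmetric] powr_half_sqrt[symmetric] powr_powr)
      then have "Lp v \<le> K * A powr (p / 2)" using K(3)[OF vE] by simp
      then show ?thesis by (intro add_left_mono mult_left_mono) auto
    qed
    also have "h * S = A powr (1 / 2) * S powr ((p - 1) / p)"
    proof -
      have "h * S = A powr (1 / 2) * (S powr (- (1 / p)) * S powr 1)" using Spos by (simp add: h_def)
      also have "S powr (- (1 / p)) * S powr 1 = S powr ((p - 1) / p)"
        unfolding powr_add[symmetric] using p by (simp add: field_simps)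
      finally show ?thesis .
    qed
    also have "h powr (1 - p) * (K * A powr (p / 2)) = K * (A powr (1 / 2) * S powr ((p - 1) / p))"
    proof -
      have "h powr (1 - p) = A powr ((1 - p) / 2) * S powr ((p - 1) / p)"
        unfolding h_def using Apos Spos p by (simp add: powr_mult powr_powr field_simps) (simp add: minus_divide_left)
      moreover have "A powr ((1 - p) / 2) * A powr (p / 2) = A powr (1 / 2)"
        unfolding powr_add[symmetric] by (simp add: field_simps)
      ultimately show ?thesis by (metis mult.assoc mult.commute)
    qed
    finally have "A \<le> A powr (1 / 2) * ((1 + K) * S powr ((p - 1) / p))" by (simp add: algebra_simps)
    moreover have "A = A powr (1 / 2) * A powr (1 / 2)" using Apos by (simp flip: powr_add)
    ultimately have "A powr (1 / 2) \<le> (1 + K) * S powr ((p - 1) / p)"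
      using Apos by (metis mult_le_cancel_left_pos powr_gt_zero less_irrefl)
    moreover have "S powr (1 / 2) \<le> A powr (1 / 2)" using SA Spos by (intro powr_mono2) auto
    ultimately have "S powr (1 / 2) \<le> (1 + K) * S powr ((p - 1) / p)" by linarith
    also have "S powr ((p - 1) / p) = S powr ((p - 2) / (2 * p)) * S powr (1 / 2)"
    proof -
      have "(p - 2) / (2 * p) + 1 / 2 = (p - 1) / p" using p by (simp add: field_simps)
      then show ?thesis unfolding powr_add[symmetric] by simp
    qed
    finally have "1 * S powr (1 / 2) \<le> ((1 + K) * S powr ((p - 2) / (2 * p))) * S powr (1 / 2)" by simp
    then have "1 \<le> (1 + K) * S powr ((p - 2) / (2 * p))" using Spos by simp
    then have "1 / (1 + K) \<le> S powr ((p - 2) / (2 * p))" using K(1) by (simp add: field_simps)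
    then have "(1 / (1 + K)) powr (2 * p / (p - 2)) \<le> (S powr ((p - 2) / (2 * p))) powr (2 * p / (p - 2))"
      using p K(1) by (intro powr_mono2) auto
    also have "\<dots> = S" using p Spos by (simp add: powr_powr)
    finally show ?thesis unfolding Qw(2) c_def using p by (intro mult_left_mono) (auto simp: field_simps)
  qed
  ultimately show ?thesis by blast
qed

lemma powr_lower_square:
  fixes s t :: real
  assumes "s > 0" shows "s powr (p - 2) * t\<^sup>2 \<le> \<bar>t\<bar> powr p + s powr p"
proof (cases "s \<le> \<bar>t\<bar>")
  case True
  then have "s powr (p - 2) * t\<^sup>2 \<le> \<bar>t\<bar> powr (p - 2) * t\<^sup>2"
    using assms p by (intro mult_right_mono powr_mono2) auto
  also have "\<dots> = \<bar>t\<bar> powr p" by (rule abs_powr_mult_square)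
  finally show ?thesis by (simp add: add_increasing2)
next
  case False
  then have "\<bar>t\<bar>\<^sup>2 \<le> s\<^sup>2" by (intro power_mono) auto
  then have "s powr (p - 2) * t\<^sup>2 \<le> \<bar>s\<bar> powr (p - 2) * s\<^sup>2"
    using assms by (intro mult_mono) auto
  also have "\<dots> = s powr p" using abs_powr_mult_square[of s p] assms by simp
  finally show ?thesis by (simp add: add_increasing)
qed

text \<open>Stands in for Hoelder's inequality on a finite measure space; the free level s is
  adapted to each use.\<close>

lemma square_le_Lp:
  assumes s: "s > 0" and u: "u \<in> square_int M" "in_Lp u"
  shows "s powr (p - 2) * (\<integral>x. (u x)\<^sup>2 \<partial>M) \<le> Lp u + s powr p * measure M (space M)"
proof -
  have "s powr (p - 2) * (\<integral>x. (u x)\<^sup>2 \<partial>M) = (\<integral>x. s powr (p - 2) * (u x)\<^sup>2 \<partial>M)" by simp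
  also have "\<dots> \<le> (\<integral>x. \<bar>u x\<bar> powr p + s powr p \<partial>M)"
    using u s by (intro integral_mono powr_lower_square) (auto simp: square_int_def in_Lp_def)
  also have "\<dots> = Lp u + s powr p * measure M (space M)"
    using u(2) by (simp add: in_Lp_def Lp_def mult.commute)
  finally show ?thesis .
qed

text \<open>The squared norm of the negative part of u.\<close>

definition N :: "('a \<Rightarrow> real) \<Rightarrow> real" where "N u = (\<Sum>\<^sub>\<infinity>i\<in>I. max 0 (- \<sigma> i) * (coef u i)\<^sup>2)"

lemma N_summable: "u \<in> E \<Longrightarrow> (\<lambda>i. max 0 (- \<sigma> i) * (coef u i)\<^sup>2) summable_on I"
  using weighted_summable[of u u "\<lambda>i. max 0 (- \<sigma> i)"] \<tau>(2) \<tau>(1)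
  by (simp add: power2_eq_square max_def \<tau>_def)

lemma N_nonneg: "N u \<ge> 0" unfolding N_def by (rule infsum_nonneg) simp

lemma N_midpoint_le:
  assumes u: "u \<in> E" and v: "v \<in> E"
  shows "N (\<lambda>x. 1 / 2 * (u x + v x)) \<le> (N u + N v) / 2"
proof -
  let ?n = "\<lambda>i. max 0 (- \<sigma> i)"
  have "N (\<lambda>x. 1 / 2 * (u x + v x)) \<le> (\<Sum>\<^sub>\<infinity>i\<in>I. 1 / 2 * (?n i * (coef u i)\<^sup>2) + 1 / 2 * (?n i * (coef v i)\<^sup>2))"
    unfolding N_def
  proof (rule infsum_mono[OF N_summable[OF E_scale[OF E_add[OF u v]]]])
    show "(\<lambda>i. 1 / 2 * (?n i * (coef u i)\<^sup>2) + 1 / 2 * (?n i * (coef v i)\<^sup>2)) summable_on I"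
      by (intro summable_on_add summable_on_cmult_right N_summable u v)
    fix i assume i: "i \<in> I"
    define a b where "a = coef u i" and "b = coef v i"
    have "0 \<le> (a - b)\<^sup>2" by simp
    then have "(1 / 2 * (a + b))\<^sup>2 \<le> 1 / 2 * a\<^sup>2 + 1 / 2 * b\<^sup>2" by (simp add: power2_eq_square field_simps)
    then have "?n i * (1 / 2 * (a + b))\<^sup>2 \<le> ?n i * (1 / 2 * a\<^sup>2 + 1 / 2 * b\<^sup>2)" by (intro mult_left_mono) auto
    moreover have "coef (\<lambda>x. 1 / 2 * (u x + v x)) i = 1 / 2 * (a + b)"
      unfolding coef_scale coef_add[OF E_sq[OF u] E_sq[OF v] i] a_def b_def ..
    ultimately show "?n i * (coef (\<lambda>x. 1 / 2 * (u x + v x)) i)\<^sup>2 \<le> 1 / 2 * (?n i * (coef u i)\<^sup>2) + 1 / 2 * (?n i * (coef v i)\<^sup>2)"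
      unfolding a_def b_def by (simp only: distrib_left mult.left_commute)
  qed
  also have "\<dots> = (N u + N v) / 2"
    unfolding N_def
    by (subst infsum_add) (auto intro!: summable_on_cmult_right N_summable u v simp: infsum_cmult_right' simp del: times_divide_eq_left)
  finally show ?thesis .
qed

text \<open>Maximizing the energy over this space produces a point of the Nehari set.\<close>

definition X :: "'i \<Rightarrow> ('a \<Rightarrow> real) set" where
  "X i0 = {u \<in> E. \<forall>i\<in>I. \<sigma> i > 0 \<and> i \<noteq> i0 \<longrightarrow> coef u i = 0}"

lemma X_E: "u \<in> X i0 \<Longrightarrow> u \<in> E" by (simp add: X_def)

lemma X_add: "u \<in> X i0 \<Longrightarrow> v \<in> X i0 \<Longrightarrow> (\<lambda>x. u x + v x) \<in> X i0"
  unfolding X_def using E_add coef_add E_sq by auto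

lemma X_scale: "u \<in> X i0 \<Longrightarrow> (\<lambda>x. k * u x) \<in> X i0"
  unfolding X_def using E_scale coef_scale by auto

lemma Fsp_X: "u \<in> Fsp \<Longrightarrow> u \<in> X i0" by (simp add: Fsp_def X_def)

lemma infsum_if_single:
  fixes x :: real
  assumes "i0 \<in> I" shows "(\<Sum>\<^sub>\<infinity>i\<in>I. if i = i0 then x else 0) = x"
proof -
  have "(\<Sum>\<^sub>\<infinity>i\<in>I. if i = i0 then x else 0) = (\<Sum>\<^sub>\<infinity>i\<in>{i0}. x)"
    by (rule infsum_cong_neutral) (use assms in auto)
  then show ?thesis by simp
qed

lemma Q_X:
  assumes u: "u \<in> X i0" and i0: "i0 \<in> I" "\<sigma> i0 > 0"
  shows "Q u u = \<sigma> i0 * (coef u i0)\<^sup>2 - N u"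
proof -
  have uE: "u \<in> E" by (rule X_E[OF u])
  have "Q u u + N u = (\<Sum>\<^sub>\<infinity>i\<in>I. \<sigma> i * (coef u i * coef u i) + max 0 (- \<sigma> i) * (coef u i)\<^sup>2)"
    unfolding Q_def N_def by (rule infsum_add[symmetric, OF Q_summable[OF uE uE] N_summable[OF uE]])
  also have "\<dots> = (\<Sum>\<^sub>\<infinity>i\<in>I. if i = i0 then \<sigma> i0 * (coef u i0)\<^sup>2 else 0)"
  proof (rule infsum_cong)
    fix i assume "i \<in> I"
    then show "\<sigma> i * (coef u i * coef u i) + max 0 (- \<sigma> i) * (coef u i)\<^sup>2 = (if i = i0 then \<sigma> i0 * (coef u i0)\<^sup>2 else 0)"
      using u i0 by (cases "\<sigma> i > 0") (auto simp: X_def power2_eq_square max_def)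
  qed
  also have "\<dots> = \<sigma> i0 * (coef u i0)\<^sup>2" by (rule infsum_if_single[OF i0(1)])
  finally show ?thesis by simp
qed

text \<open>A bound on finite sums survives coefficientwise limits; this is how a limit of elements
  of X is seen to lie in E.\<close>

lemma sum_abs_X_le:
  assumes u: "u \<in> X i0" and i0: "i0 \<in> I" "\<sigma> i0 > 0" and J: "finite J" "J \<subseteq> I"
  shows "(\<Sum>i\<in>J. \<bar>\<sigma> i\<bar> * (coef u i)\<^sup>2) \<le> \<sigma> i0 * (coef u i0)\<^sup>2 + N u"
proof -
  have eq: "\<bar>\<sigma> i\<bar> * (coef u i)\<^sup>2 = (if i = i0 then \<sigma> i0 * (coef u i0)\<^sup>2 else 0) + max 0 (- \<sigma> i) * (coef u i)\<^sup>2" if "i \<in> I" for i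
    using u i0 that by (cases "\<sigma> i > 0") (auto simp: X_def max_def)
  have "(\<Sum>i\<in>J. \<bar>\<sigma> i\<bar> * (coef u i)\<^sup>2) = (\<Sum>i\<in>J. (if i = i0 then \<sigma> i0 * (coef u i0)\<^sup>2 else 0) + max 0 (- \<sigma> i) * (coef u i)\<^sup>2)"
    by (rule sum.cong[OF refl], rule eq) (use J in blast)
  also have "\<dots> = (if i0 \<in> J then \<sigma> i0 * (coef u i0)\<^sup>2 else 0) + (\<Sum>i\<in>J. max 0 (- \<sigma> i) * (coef u i)\<^sup>2)"
    using J by (simp add: sum.distrib)
  also have "\<dots> \<le> \<sigma> i0 * (coef u i0)\<^sup>2 + N u"
    unfolding N_def using i0 J
    by (intro add_mono finite_sum_le_infsum N_summable X_E[OF u]) (auto simp: max_def)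
  finally show ?thesis .
qed

section \<open>Maximization of the energy over X\<close>

context
  fixes K and i0
  assumes em: "embeds K" and i0: "i0 \<in> I" "\<sigma> i0 > 0"
begin

lemma X_in_Lp: "u \<in> X i0 \<Longrightarrow> in_Lp u"
  using em X_E by (auto simp: embeds_def)

lemma G_X: "u \<in> X i0 \<Longrightarrow> G u = 1 / 2 * (\<sigma> i0 * (coef u i0)\<^sup>2) - 1 / 2 * N u - 1 / p * Lp u"
  by (simp add: G_def Q_X[OF _ i0] right_diff_distrib)

text \<open>Take s^(p-2) = \<kappa> in \<open>square_le_Lp\<close> and keep a single coefficient: up
  to a constant, Lp dominates any multiple of the square of the one positive coordinate.\<close>

lemma Lp_X_ge:
  assumes u: "u \<in> X i0" and k: "\<kappa> > 0"
  shows "Lp u \<ge> \<kappa> * (coef u i0)\<^sup>2 - \<kappa> powr (p / (p - 2)) * measure M (space M)"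
proof -
  define s where "s = \<kappa> powr (1 / (p - 2))"
  have s: "s > 0" "s powr (p - 2) = \<kappa>" "s powr p = \<kappa> powr (p / (p - 2))"
    using k p by (simp_all add: s_def powr_powr)
  have "\<kappa> * (coef u i0)\<^sup>2 \<le> \<kappa> * (\<integral>x. (u x)\<^sup>2 \<partial>M)"
    using k by (intro mult_left_mono coef_square_le E_sq X_E[OF u] i0) auto
  then show ?thesis
    using square_le_Lp[OF s(1) E_sq[OF X_E[OF u]] X_in_Lp[OF u]] unfolding s(2,3) by linarith
qed

text \<open>The value \<kappa> = p \<sigma>/2, with \<sigma> the eigenvalue at i0, cancels the
  positive quadratic term exactly.\<close>

lemma G_X_le:
  assumes u: "u \<in> X i0"
  shows "G u \<le> measure M (space M) / p * (p * \<sigma> i0 / 2) powr (p / (p - 2))"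
proof -
  have "Lp u \<ge> p * \<sigma> i0 / 2 * (coef u i0)\<^sup>2 - (p * \<sigma> i0 / 2) powr (p / (p - 2)) * measure M (space M)"
    using p i0 by (intro Lp_X_ge u) auto
  then have "1 / p * Lp u \<ge> 1 / p * (p * \<sigma> i0 / 2 * (coef u i0)\<^sup>2 - (p * \<sigma> i0 / 2) powr (p / (p - 2)) * measure M (space M))"
    using p by (intro mult_left_mono) auto
  also have "1 / p * (p * \<sigma> i0 / 2 * (coef u i0)\<^sup>2 - (p * \<sigma> i0 / 2) powr (p / (p - 2)) * measure M (space M))
    = 1 / 2 * (\<sigma> i0 * (coef u i0)\<^sup>2) - measure M (space M) / p * (p * \<sigma> i0 / 2) powr (p / (p - 2))"
    using p by (simp add: right_diff_distrib)
  finally show ?thesis using N_nonneg[of u] unfolding G_X[OF u] by linarith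
qed

text \<open>With \<kappa> = p \<sigma>, twice the cancelling value, a negative quadratic term is
  left over; it bounds the positive coordinate in terms of G u.\<close>

lemma G_X_coercive:
  assumes u: "u \<in> X i0"
  shows "1 / 2 * (\<sigma> i0 * (coef u i0)\<^sup>2) \<le> measure M (space M) / p * (p * \<sigma> i0) powr (p / (p - 2)) - G u"
proof -
  have "Lp u \<ge> p * \<sigma> i0 * (coef u i0)\<^sup>2 - (p * \<sigma> i0) powr (p / (p - 2)) * measure M (space M)"
    using p i0 by (intro Lp_X_ge u) auto
  then have "1 / p * Lp u \<ge> 1 / p * (p * \<sigma> i0 * (coef u i0)\<^sup>2 - (p * \<sigma> i0) powr (p / (p - 2)) * measure M (space M))"
    using p by (intro mult_left_mono) auto
  also have "1 / p * (p * \<sigma> i0 * (coef u i0)\<^sup>2 - (p * \<sigma> i0) powr (p / (p - 2)) * measure M (space M))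
    = \<sigma> i0 * (coef u i0)\<^sup>2 - measure M (space M) / p * (p * \<sigma> i0) powr (p / (p - 2))"
    using p by (simp add: right_diff_distrib)
  finally show ?thesis using N_nonneg[of u] unfolding G_X[OF u] by linarith
qed

text \<open>The midpoint has energy at most S. Apart from the single positive coordinate, whose
  defect in the parallelogram identity is \<sigma>/4 times a square, -G is convex on X, and by
  Clarkson's inequality quantitatively so in L^p.\<close>

lemma Clarkson_X:
  assumes u: "u \<in> X i0" and v: "v \<in> X i0" and S: "\<And>w. w \<in> X i0 \<Longrightarrow> G w \<le> S"
  shows "Lp (\<lambda>x. 1 / 2 * (u x - v x)) \<le> p * (S - (G u + G v) / 2 + \<sigma> i0 / 8 * (coef u i0 - coef v i0)\<^sup>2)"
proof -
  let ?m = "\<lambda>x. 1 / 2 * (u x + v x)" and ?d = "\<lambda>x. 1 / 2 * (u x - v x)"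
  have m: "?m \<in> X i0" by (rule X_scale[OF X_add[OF u v]])
  have d: "?d \<in> X i0" using X_scale[OF X_add[OF u X_scale[OF v, of "-1"]], of "1/2"] by simp
  have iu: "in_Lp u" "in_Lp v" "in_Lp ?m" "in_Lp ?d" using u v m d by (auto intro: X_in_Lp)
  have "Lp ?m + Lp ?d = (\<integral>x. \<bar>?m x\<bar> powr p + \<bar>?d x\<bar> powr p \<partial>M)"
    unfolding Lp_def using iu(3,4) unfolding in_Lp_def by (rule Bochner_Integration.integral_add[symmetric])
  also have "\<dots> \<le> (\<integral>x. 1 / 2 * (\<bar>u x\<bar> powr p + \<bar>v x\<bar> powr p) \<partial>M)"
  proof (rule integral_mono)
    show "integrable M (\<lambda>x. \<bar>?m x\<bar> powr p + \<bar>?d x\<bar> powr p)"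
      using iu(3,4) unfolding in_Lp_def by (rule Bochner_Integration.integrable_add)
    show "integrable M (\<lambda>x. 1 / 2 * (\<bar>u x\<bar> powr p + \<bar>v x\<bar> powr p))"
      using iu(1,2) unfolding in_Lp_def by simp
    show "\<bar>?m x\<bar> powr p + \<bar>?d x\<bar> powr p \<le> 1 / 2 * (\<bar>u x\<bar> powr p + \<bar>v x\<bar> powr p)" for x
      using Clarkson[OF p, of "u x" "v x"] by simp
  qed
  also have "\<dots> = (Lp u + Lp v) / 2" unfolding Lp_def using iu(1,2) unfolding in_Lp_def by simp
  finally have L: "Lp ?m + Lp ?d \<le> (Lp u + Lp v) / 2" .
  have cm: "coef ?m i0 = (coef u i0 + coef v i0) / 2"
    unfolding coef_scale coef_add[OF E_sq[OF X_E[OF u]] E_sq[OF X_E[OF v]] i0(1)] by simp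
  define a b where "a = coef u i0" and "b = coef v i0"
  have pl: "\<sigma> i0 * ((a + b) / 2)\<^sup>2 = \<sigma> i0 * a\<^sup>2 / 2 + \<sigma> i0 * b\<^sup>2 / 2 - \<sigma> i0 / 4 * (a - b)\<^sup>2"
    by (simp add: power2_eq_square field_simps)
  have "Lp ?d \<le> (Lp u + Lp v) / 2 - Lp ?m" using L by linarith
  then have "1 / p * Lp ?d \<le> 1 / p * ((Lp u + Lp v) / 2 - Lp ?m)"
    using p by (intro mult_left_mono) simp_all
  also have "1 / p * ((Lp u + Lp v) / 2 - Lp ?m) = (1 / p * Lp u + 1 / p * Lp v) / 2 - 1 / p * Lp ?m"
    by (simp add: right_diff_distrib add_divide_distrib distrib_left)
  finally have "1 / p * Lp ?d \<le> (1 / p * Lp u + 1 / p * Lp v) / 2 - 1 / p * Lp ?m" .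
  moreover have "G ?m \<le> S" by (rule S[OF m])
  moreover note N_midpoint_le[OF X_E[OF u] X_E[OF v]]
  ultimately have "1 / p * Lp ?d \<le> S - (G u + G v) / 2 + \<sigma> i0 / 8 * (a - b)\<^sup>2"
    using pl unfolding G_X[OF u] G_X[OF v] G_X[OF m] cm a_def[symmetric] b_def[symmetric] by argo
  then show ?thesis using p unfolding a_def b_def by (simp add: pos_divide_le_eq mult.commute)
qed

lemma G_pos_on_X: "\<exists>u\<in>X i0. G u > 0"
proof -
  define c where "c = Lp (e i0)"
  have c: "c \<ge> 0" unfolding c_def by (rule Lp_nonneg)
  \<comment> \<open>D exceeds the p-th power integral c of the mode, also when c = 0. Setting
    t^(p-2) = \<sigma> p/(2D) makes the p-th power term smaller than the quadratic one.\<close>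
  define D where "D = c + 1"
  have D: "D > 0" "c / D < 1" using c by (simp_all add: D_def)
  define q where "q = \<sigma> i0 * p / (2 * D)"
  have q: "q > 0" using p i0 D by (simp add: q_def)
  define t where "t = q powr (1 / (p - 2))"
  have t: "t > 0" "t powr (p - 2) = q" using q p by (simp_all add: t_def powr_powr)
  let ?u = "\<lambda>x. t * e i0 x"
  have ce: "coef (e i0) i = (if i = i0 then 1 else 0)" if "i \<in> I" for i
    using orthonormal[OF i0(1) that] by (auto simp: coef_def)
  have e: "comb {i0} (\<lambda>_. 1) = e i0" by (simp add: comb_def fun_eq_iff)
  have "e i0 \<in> E" using comb_in_E[of "{i0}" "\<lambda>_. 1"] i0 unfolding e by simp
  then have "e i0 \<in> X i0" using ce by (auto simp: X_def)
  then have u: "?u \<in> X i0" by (rule X_scale)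
  have N0: "N ?u = 0"
    unfolding N_def by (rule infsum_0) (use ce i0 in \<open>auto simp: coef_scale\<close>)
  have "t powr p = t\<^sup>2 * q"
    using abs_powr_mult_square[of t p] t by (simp add: mult.commute)
  then have "G ?u = t\<^sup>2 * (\<sigma> i0 / 2 - q * c / p)"
    unfolding G_X[OF u] N0 Lp_scale c_def[symmetric] coef_scale using t(1) ce[OF i0(1)]
    by (simp add: power_mult_distrib algebra_simps)
  moreover have "q * c / p < \<sigma> i0 / 2"
  proof -
    have "q * c / p = \<sigma> i0 / 2 * (c / D)" using p D(1) by (simp add: q_def field_simps)
    also have "\<dots> < \<sigma> i0 / 2 * 1" using i0(2) D(2) by (intro mult_strict_left_mono) auto
    finally show ?thesis by simp
  qed
  ultimately have "G ?u > 0" using t(1) by simp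
  then show ?thesis using u by blast
qed

text \<open>Along a maximizing sequence the positive coordinate, N and Lp stay bounded, and
  Clarkson's inequality gives convergence in L^2. In the limit the coordinate is continuous, while N
  and Lp are lower semicontinuous and enter G with a minus sign.\<close>

lemma ex_maximizer: "\<exists>w\<in>X i0. \<forall>u\<in>X i0. G u \<le> G w"
proof -
  define S where "S = Sup (G ` X i0)"
  have bdd: "bdd_above (G ` X i0)" using G_X_le by (intro bdd_aboveI2) blast
  have S: "\<And>w. w \<in> X i0 \<Longrightarrow> G w \<le> S" unfolding S_def by (rule cSUP_upper[OF _ bdd])
  obtain u00 where "u00 \<in> X i0" "G u00 > 0" using G_pos_on_X by blast
  then have S0: "S > 0" and ne: "G ` X i0 \<noteq> {}" using S by force+
  have "\<exists>u\<in>X i0. G u > S - inverse (real (Suc n))" for n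
    using less_cSup_iff[OF ne bdd, of "S - inverse (real (Suc n))"] unfolding S_def by auto
  then obtain u where u: "\<And>n. u n \<in> X i0" "\<And>n. G (u n) > S - inverse (real (Suc n))" by metis
  have GS: "(\<lambda>n. G (u n)) \<longlonglongrightarrow> S"
  proof (rule tendsto_sandwich)
    show "(\<lambda>n. S - inverse (real (Suc n))) \<longlonglongrightarrow> S"
      using tendsto_diff[OF tendsto_const LIMSEQ_inverse_real_of_nat, of S] by simp
    show "(\<lambda>n. S) \<longlonglongrightarrow> S" by simp
    show "\<forall>\<^sub>F n in sequentially. S - inverse (real (Suc n)) \<le> G (u n)"
      by (intro always_eventually allI less_imp_le u(2))
    show "\<forall>\<^sub>F n in sequentially. G (u n) \<le> S"
      by (intro always_eventually allI S u(1))
  qed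
  have G1: "G (u n) \<ge> - 1" for n
  proof -
    have "inverse (real (Suc n)) \<le> 1" by (simp add: inverse_le_1_iff)
    then show ?thesis using u(2)[of n] S0 by linarith
  qed
  define C where "C = measure M (space M) / p * (p * \<sigma> i0) powr (p / (p - 2)) + 1"
  define a where "a n = coef (u n) i0" for n
  have ba: "1 / 2 * (\<sigma> i0 * (a n)\<^sup>2) \<le> C" for n
    using G_X_coercive[OF u(1)[of n]] G1[of n] unfolding C_def a_def by linarith
  have bN: "1 / 2 * N (u n) + 1 / p * Lp (u n) \<le> C + 1" for n
    using ba[of n] G1[of n] unfolding G_X[OF u(1)] a_def by linarith
  have nl: "1 / p * Lp (u n) \<ge> 0" for n using p Lp_nonneg[of "u n"] by simp
  \<comment> \<open>Only three real quantities have to converge along a common subsequence, so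
    Bolzano-Weierstrass is enough.\<close>
  let ?f = "\<lambda>n. (a n, N (u n), Lp (u n))"
  have "bounded (range ?f)"
  proof -
    have box: "?f n \<in> cbox (- (2 * C / \<sigma> i0 + 1), 0, 0) (2 * C / \<sigma> i0 + 1, 2 * (C + 1), p * (C + 1))" for n
    proof -
      have "(a n)\<^sup>2 \<le> 2 * C / \<sigma> i0" using ba[of n] i0(2) by (simp add: field_simps)
      moreover have "2 * \<bar>a n\<bar> \<le> (a n)\<^sup>2 + 1"
        using zero_le_power2[of "\<bar>a n\<bar> - 1"] unfolding power2_diff by simp
      moreover have "0 \<le> (a n)\<^sup>2" by simp
      ultimately have "\<bar>a n\<bar> \<le> 2 * C / \<sigma> i0 + 1" by linarith
      moreover have gen: "x + y \<le> c \<Longrightarrow> 0 \<le> y \<Longrightarrow> x \<le> c" for x y c :: real by linarith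
      have "1 / 2 * N (u n) \<le> C + 1" by (rule gen[OF bN nl])
      then have "N (u n) \<le> 2 * (C + 1)" by simp
      moreover have "Lp (u n) \<le> p * (C + 1)"
      proof -
        have "1 / p * Lp (u n) \<le> C + 1"
          by (rule gen[OF bN[of n, unfolded add.commute[of "1 / 2 * N (u n)"]]]) (simp add: N_nonneg)
        then show ?thesis using p by (simp add: pos_divide_le_eq mult.commute)
      qed
      ultimately show ?thesis
        using N_nonneg[of "u n"] Lp_nonneg[of "u n"] \<open>N (u n) \<le> 2 * (C + 1)\<close> by (auto simp: cbox_Pair_eq abs_le_iff)
    qed
    show ?thesis by (rule bounded_subset[OF bounded_cbox]) (rule image_subsetI, rule box)
  qed
  then obtain l and r :: "nat \<Rightarrow> nat" where r: "strict_mono r" "(?f \<circ> r) \<longlonglongrightarrow> l"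
    using bounded_imp_convergent_subsequence[of ?f] by blast
  obtain a' N' L' where l: "l = (a', N', L')" by (cases l) auto
  define w where "w n = u (r n)" for n
  have w: "w n \<in> X i0" for n by (simp add: w_def u)
  have lim: "(\<lambda>n. coef (w n) i0) \<longlonglongrightarrow> a'" "(\<lambda>n. N (w n)) \<longlonglongrightarrow> N'" "(\<lambda>n. Lp (w n)) \<longlonglongrightarrow> L'"
    using tendsto_fst[OF r(2)] tendsto_fst[OF tendsto_snd[OF r(2)]] tendsto_snd[OF tendsto_snd[OF r(2)]]
    by (simp_all add: l w_def a_def o_def)
  have GwS: "(\<lambda>n. G (w n)) \<longlonglongrightarrow> S"
    using LIMSEQ_subseq_LIMSEQ[OF GS r(1)] by (simp add: w_def o_def)
  define \<mu> where "\<mu> = measure M (space M)"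
  have \<mu>: "\<mu> \<ge> 0" by (simp add: \<mu>_def)
  have cau: "\<exists>n0. \<forall>m\<ge>n0. \<forall>n\<ge>n0. (\<integral>x. (w m x - w n x)\<^sup>2 \<partial>M) < \<epsilon>" if eps: "\<epsilon> > 0" for \<epsilon>
  proof -
    \<comment> \<open>After division by s^(p-2) the two terms of \<open>square_le_Lp\<close> are at
      most \<epsilon>/8 each: the choice of \<eta> handles Lp, the choice of s handles s^2 \<mu>.
      The function d is half the difference, hence the target \<epsilon>/4.\<close>
    define s where "s = sqrt (\<epsilon> / (8 * (\<mu> + 1)))"
    have s: "s > 0" "s\<^sup>2 = \<epsilon> / (8 * (\<mu> + 1))" using eps \<mu> by (simp_all add: s_def)
    define \<eta> where "\<eta> = s powr (p - 2) * \<epsilon> / 8"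
    have \<eta>: "\<eta> > 0" using s eps by (simp add: \<eta>_def)
    define q where "q = sqrt (\<eta> / (\<sigma> i0 * p))"
    have q: "q > 0" "q\<^sup>2 = \<eta> / (\<sigma> i0 * p)" using \<eta> i0(2) p by (simp_all add: q_def)
    obtain n1 where n1: "\<And>n. n \<ge> n1 \<Longrightarrow> \<bar>G (w n) - S\<bar> < \<eta> / (2 * p)"
      using LIMSEQ_D[OF GwS, of "\<eta> / (2 * p)"] \<eta> p by auto
    obtain n2 where n2: "\<And>n. n \<ge> n2 \<Longrightarrow> \<bar>coef (w n) i0 - a'\<bar> < q"
      using LIMSEQ_D[OF lim(1) q(1)] by auto
    have "(\<integral>x. (w m x - w n x)\<^sup>2 \<partial>M) < \<epsilon>" if mn: "m \<ge> max n1 n2" "n \<ge> max n1 n2" for m n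
    proof -
      let ?d = "\<lambda>x. 1 / 2 * (w m x - w n x)"
      have d: "?d \<in> X i0" using X_scale[OF X_add[OF w[of m] X_scale[OF w[of n], of "-1"]], of "1/2"] by simp
      have "\<bar>coef (w m) i0 - coef (w n) i0\<bar> \<le> 2 * q" using n2[of m] n2[of n] mn by force
      then have "(coef (w m) i0 - coef (w n) i0)\<^sup>2 \<le> (2 * q)\<^sup>2" by (metis abs_ge_zero power2_abs power_mono)
      also have "\<dots> = 4 * (\<eta> / (\<sigma> i0 * p))" by (simp add: power_mult_distrib q(2))
      finally have "\<sigma> i0 / 8 * (coef (w m) i0 - coef (w n) i0)\<^sup>2 \<le> \<sigma> i0 / 8 * (4 * (\<eta> / (\<sigma> i0 * p)))"
        using i0(2) by (intro mult_left_mono) auto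
      also have "\<dots> = \<eta> / (2 * p)" using i0(2) p by (simp add: field_simps)
      finally have "S - (G (w m) + G (w n)) / 2 + \<sigma> i0 / 8 * (coef (w m) i0 - coef (w n) i0)\<^sup>2 < \<eta> / (2 * p) + \<eta> / (2 * p)"
      proof -
        have gen: "x \<le> q \<Longrightarrow> \<bar>y - S\<bar> < q \<Longrightarrow> \<bar>z - S\<bar> < q \<Longrightarrow> S - (y + z) / 2 + x < q + q" for x y z q :: real
          by argo
        assume "\<sigma> i0 / 8 * (coef (w m) i0 - coef (w n) i0)\<^sup>2 \<le> \<eta> / (2 * p)"
        then show ?thesis by (rule gen) (intro n1, use mn in simp)+
      qed
      then have "p * (S - (G (w m) + G (w n)) / 2 + \<sigma> i0 / 8 * (coef (w m) i0 - coef (w n) i0)\<^sup>2) < p * (\<eta> / (2 * p) + \<eta> / (2 * p))"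
        using p by (intro mult_strict_left_mono) auto
      also have "\<dots> = \<eta>" using p by simp
      finally have Ld: "Lp ?d < \<eta>" using Clarkson_X[OF w[of m] w[of n] S] by linarith
      have "s powr (p - 2) * (\<integral>x. (?d x)\<^sup>2 \<partial>M) \<le> Lp ?d + s powr p * \<mu>"
        unfolding \<mu>_def by (rule square_le_Lp[OF s(1) E_sq[OF X_E[OF d]] X_in_Lp[OF d]])
      also have "s powr p = s powr (p - 2) * s\<^sup>2" using abs_powr_mult_square[of s p] s(1) by simp
      finally have "s powr (p - 2) * (\<integral>x. (?d x)\<^sup>2 \<partial>M) < s powr (p - 2) * \<epsilon> / 8 + s powr (p - 2) * s\<^sup>2 * \<mu>"
        using Ld unfolding \<eta>_def by linarith
      then have "s powr (p - 2) * (\<integral>x. (?d x)\<^sup>2 \<partial>M) < s powr (p - 2) * (\<epsilon> / 8 + s\<^sup>2 * \<mu>)"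
        by (simp add: distrib_left mult.assoc)
      then have "(\<integral>x. (?d x)\<^sup>2 \<partial>M) < \<epsilon> / 8 + s\<^sup>2 * \<mu>" using s(1) by simp
      also have "s\<^sup>2 * \<mu> \<le> \<epsilon> / 8"
        unfolding s(2) using \<mu> eps by (simp add: field_simps)
      finally have "(\<integral>x. (?d x)\<^sup>2 \<partial>M) < \<epsilon> / 4" by simp
      moreover have "(\<integral>x. (?d x)\<^sup>2 \<partial>M) = 1 / 4 * (\<integral>x. (w m x - w n x)\<^sup>2 \<partial>M)"
        by (simp add: power_divide)
      ultimately show ?thesis by simp
    qed
    then show ?thesis by blast
  qed
  obtain v and r' :: "nat \<Rightarrow> nat" where v: "v \<in> square_int M" "strict_mono r'"
    "AE x in M. (\<lambda>n. w (r' n) x) \<longlonglongrightarrow> v x" "(\<lambda>n. \<integral>x. (w n x - v x)\<^sup>2 \<partial>M) \<longlonglongrightarrow> 0"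
    by (rule square_int_complete[of w, OF E_sq[OF X_E[OF w]] cau])
  have cv: "(\<lambda>n. coef (w n) i) \<longlonglongrightarrow> coef v i" if "i \<in> I" for i
    by (rule coef_tendsto[OF E_sq[OF X_E[OF w]] v(1) that v(4)])
  have vi0: "coef v i0 = a'" using LIMSEQ_unique[OF cv[OF i0(1)] lim(1)] .
  \<comment> \<open>The limit lies in E because finite weighted sums of squares are bounded by
    quantities that converge along the sequence.\<close>
  have "(\<lambda>i. \<bar>\<sigma> i\<bar> * (coef v i)\<^sup>2) summable_on I"
  proof (rule nonneg_bdd_above_summable_on)
    show "bdd_above (sum (\<lambda>i. \<bar>\<sigma> i\<bar> * (coef v i)\<^sup>2) ` {F. F \<subseteq> I \<and> finite F})"
    proof (rule bdd_aboveI2)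
      fix F assume F: "F \<in> {F. F \<subseteq> I \<and> finite F}"
      show "(\<Sum>i\<in>F. \<bar>\<sigma> i\<bar> * (coef v i)\<^sup>2) \<le> \<sigma> i0 * a'\<^sup>2 + N'"
      proof (rule LIMSEQ_le)
        show "(\<lambda>n. \<Sum>i\<in>F. \<bar>\<sigma> i\<bar> * (coef (w n) i)\<^sup>2) \<longlonglongrightarrow> (\<Sum>i\<in>F. \<bar>\<sigma> i\<bar> * (coef v i)\<^sup>2)"
          by (intro tendsto_sum tendsto_mult tendsto_const tendsto_power cv) (use F in auto)
        show "(\<lambda>n. \<sigma> i0 * (coef (w n) i0)\<^sup>2 + N (w n)) \<longlonglongrightarrow> \<sigma> i0 * a'\<^sup>2 + N'"
          by (intro tendsto_intros lim)
        show "\<exists>n0. \<forall>n\<ge>n0. (\<Sum>i\<in>F. \<bar>\<sigma> i\<bar> * (coef (w n) i)\<^sup>2) \<le> \<sigma> i0 * (coef (w n) i0)\<^sup>2 + N (w n)"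
          using sum_abs_X_le[OF w i0] F by blast
      qed
    qed
  qed simp
  then have "(\<lambda>i. \<bar>\<sigma> i\<bar> * (coef v i)\<^sup>2 + (coef v i)\<^sup>2) summable_on I"
    by (intro summable_on_add coef_square_summable v)
  then have "(\<lambda>i. \<tau> i * (coef v i)\<^sup>2) summable_on I"
    by (rule real_summable_on_bound) (auto simp: \<tau>_def)
  then have vE: "v \<in> E" using v(1) by (simp add: E_def)
  have vX: "v \<in> X i0"
    unfolding X_def
  proof (intro CollectI conjI ballI impI vE)
    fix i assume i: "i \<in> I" "\<sigma> i > 0 \<and> i \<noteq> i0"
    then have "coef (w n) i = 0" for n using w[of n] by (auto simp: X_def)
    then show "coef v i = 0" using cv[OF i(1)] by (simp add: LIMSEQ_const_iff)
  qed
  have Nv: "N v \<le> N'"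
    unfolding N_def
  proof (rule infsum_le_finite_sums[OF N_summable[OF vE]])
    fix F assume F: "finite F" "F \<subseteq> I"
    show "(\<Sum>i\<in>F. max 0 (- \<sigma> i) * (coef v i)\<^sup>2) \<le> N'"
    proof (rule LIMSEQ_le[OF _ lim(2)])
      show "(\<lambda>n. \<Sum>i\<in>F. max 0 (- \<sigma> i) * (coef (w n) i)\<^sup>2) \<longlonglongrightarrow> (\<Sum>i\<in>F. max 0 (- \<sigma> i) * (coef v i)\<^sup>2)"
        by (intro tendsto_sum tendsto_mult tendsto_const tendsto_power cv) (use F in auto)
      show "\<exists>n0. \<forall>n\<ge>n0. (\<Sum>i\<in>F. max 0 (- \<sigma> i) * (coef (w n) i)\<^sup>2) \<le> N (w n)"
        unfolding N_def by (intro exI allI impI finite_sum_le_infsum N_summable X_E[OF w] F) auto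
    qed
  qed
  have Lv: "Lp v \<le> L'"
    unfolding Lp_def
  proof (rule Fatou_real(2))
    show "integrable M (\<lambda>x. \<bar>w (r' n) x\<bar> powr p)" for n using X_in_Lp[OF w] by (simp add: in_Lp_def)
    show "AE x in M. (\<lambda>n. \<bar>w (r' n) x\<bar> powr p) \<longlonglongrightarrow> \<bar>v x\<bar> powr p"
      using v(3) by eventually_elim (rule tendsto_powr', auto intro!: tendsto_rabs simp: p less_trans[OF _ p])
    show "(\<lambda>x. \<bar>v x\<bar> powr p) \<in> borel_measurable M" using E_measurable[OF vE] by measurable
    show "(\<integral>x. \<bar>w (r' n) x\<bar> powr p \<partial>M) \<le> Lp (w (r' n))" for n by (simp add: Lp_def)
    show "(\<lambda>n. Lp (w (r' n))) \<longlonglongrightarrow> L'" using LIMSEQ_subseq_LIMSEQ[OF lim(3) v(2)] by (simp add: o_def)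
  qed simp
  have "(\<lambda>n. 1 / 2 * (\<sigma> i0 * (coef (w n) i0)\<^sup>2) - 1 / 2 * N (w n) - 1 / p * Lp (w n))
      \<longlonglongrightarrow> 1 / 2 * (\<sigma> i0 * a'\<^sup>2) - 1 / 2 * N' - 1 / p * L'"
    by (intro tendsto_intros lim)
  then have "S = 1 / 2 * (\<sigma> i0 * a'\<^sup>2) - 1 / 2 * N' - 1 / p * L'"
    using LIMSEQ_unique[OF GwS] unfolding G_X[OF w] by blast
  also have "\<dots> \<le> G v"
  proof -
    have "1 / p * Lp v \<le> 1 / p * L'" using Lv p by (intro mult_left_mono) auto
    then show ?thesis using Nv unfolding G_X[OF vX] vi0 by linarith
  qed
  finally have "S \<le> G v" .
  then show ?thesis using vX S by (intro bexI[of _ v]) (auto intro: order.trans)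
qed

text \<open>The maximizer is critical in all directions of X, among them w itself and all of
  \<open>Fsp\<close>. It lies outside \<open>Fsp\<close>, where the energy is at most 0, because
  positive values occur on X.\<close>

lemma ex_Neh_energy_le:
  "\<exists>w\<in>Neh. G w \<le> measure M (space M) / p * (p * \<sigma> i0 / 2) powr (p / (p - 2))"
proof -
  obtain w where w: "w \<in> X i0" "\<And>u. u \<in> X i0 \<Longrightarrow> G u \<le> G w" using ex_maximizer by blast
  have wE: "w \<in> E" by (rule X_E[OF w(1)])
  have d: "has_der w (L0 w)" by (rule has_der_L0[OF em wE])
  have L: "L0 w v = 0" if v: "v \<in> X i0" for v
    by (rule has_der_at_max[OF d X_E[OF v]]) (intro w(2) X_add w(1) X_scale v)
  have "w \<notin> Fsp"
  proof
    assume F: "w \<in> Fsp"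
    then have "coef w i0 = 0" using i0 by (simp add: Fsp_def)
    then have "G w = - (1 / 2 * N w) - 1 / p * Lp w" unfolding G_X[OF w(1)] by simp
    moreover have "1 / p * Lp w \<ge> 0" using p Lp_nonneg[of w] by simp
    moreover obtain u where "u \<in> X i0" "G u > 0" using G_pos_on_X by blast
    ultimately show False using w(2)[of u] N_nonneg[of w] by linarith
  qed
  then have "w \<in> Neh"
    unfolding Neh_def using wE d L[OF w(1)] L[OF Fsp_X] by blast
  then show ?thesis using G_X_le[OF w(1)] by blast
qed

end

end

subsection \<open>The Dirichlet modes of the disk\<close>

text \<open>Connects the angle in the definition of the modes with the polynomials
  \<open>ang\<close>. At the origin the angle has the default value 0, and for l = 0 both sides are
  1.\<close>

lemma cx_power_eq: "cx x ^ l = of_real (norm x ^ l) * cis (real l * polar_angle x)"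
proof (cases "cx x = 0")
  case True
  then have n: "norm x = 0" using norm_cx[of x] by simp
  have "Complex (x $ 1) (x $ 2) = 0" using True by (simp add: cx_def)
  then have "polar_angle x = 0" by (simp add: polar_angle_def Arg_zero)
  then show ?thesis using True n by (cases l) auto
next
  case False
  have "cx x = of_real (norm x) * cis (polar_angle x)"
    using Arg_eq[OF False] by (simp add: polar_angle_def cx_def[symmetric] cis_conv_exp)
  then have "cx x ^ l = (of_real (norm x) * cis (polar_angle x)) ^ l" by (rule arg_cong)
  then show ?thesis by (simp only: power_mult_distrib Complex.DeMoivre of_real_power)
qed

definition mode :: "(nat \<times> nat) \<times> bool \<Rightarrow> real^2 \<Rightarrow> real" where
  "mode i = (if snd i then eig_sin (fst (fst i)) (snd (fst i)) else eig_cos (fst (fst i)) (snd (fst i)))"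

text \<open>The flag b selects the sine. Sine modes with l = 0 are identically zero and have to be
  left out of an orthonormal family.\<close>

definition idx :: "((nat \<times> nat) \<times> bool) set" where
  "idx = {((l, k), b). k \<ge> 1 \<and> (b \<longrightarrow> l > 0)}"

text \<open>J_l(j r) without its factor (j r/2)^l; the power r^l is supplied by
  \<open>ang\<close>.\<close>

definition rad :: "nat \<Rightarrow> nat \<Rightarrow> real \<Rightarrow> real" where
  "rad l k r = bes l ((bessel_zero l k / 2)\<^sup>2 * r\<^sup>2)"

lemma continuous_rad [continuous_intros]: "continuous_on A (rad l k)"
  unfolding rad_def[abs_def] by (intro continuous_intros)

lemma continuous_rad': "continuous_on A f \<Longrightarrow> continuous_on A (\<lambda>x. rad l k (f x))"
  by (rule continuous_on_compose2[OF continuous_rad[of UNIV]]) auto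

lemma rad_measurable [measurable]: "rad l k \<in> borel_measurable borel"
  by (intro borel_measurable_continuous_onI continuous_intros)

lemma rad_1: "k \<ge> 1 \<Longrightarrow> rad l k 1 = 0" by (simp add: rad_def bes_bessel_zero)

definition mode_norm :: "nat \<Rightarrow> nat \<Rightarrow> real" where
  "mode_norm l k = (\<integral>x. norm x ^ (2 * l) * (rad l k (norm x) * rad l k (norm x)) \<partial>disk_measure)"

text \<open>Since \<open>bes l 0 > 0\<close>, the radial factor is positive near the origin, on a
  disk of positive area.\<close>

lemma mode_norm_pos: "mode_norm l k > 0"
proof -
  let ?f = "\<lambda>x::real^2. norm x ^ (2 * l) * (rad l k (norm x) * rad l k (norm x))"
  have nn: "?f x \<ge> 0" for x by simp
  have int: "integrable disk_measure ?f"
    by (intro integrable_disk_continuous continuous_intros continuous_rad')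
  have "mode_norm l k \<ge> 0" unfolding mode_norm_def by (rule Bochner_Integration.integral_nonneg) simp
  moreover have "mode_norm l k \<noteq> 0"
  proof
    assume "mode_norm l k = 0"
    then have z: "AE x in disk_measure. ?f x = 0"
      unfolding mode_norm_def using integral_nonneg_eq_0_iff_AE[OF int] nn by auto
    have "rad l k 0 > 0" using bes_0_pos by (simp add: rad_def)
    then have "\<forall>\<^sub>F r in at 0. rad l k r > 0"
      using continuous_rad[of UNIV l k] by (intro order_tendstoD(1)) (auto simp: continuous_on_def)
    then obtain d where d: "d > 0" "\<And>r. r \<noteq> 0 \<Longrightarrow> dist r 0 < d \<Longrightarrow> rad l k r > 0"
      unfolding eventually_at by auto
    define c where "c = min d 1"
    have c: "c > 0" "c \<le> d" "c \<le> 1" using d by (auto simp: c_def)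
    have "AE x in disk_measure. x \<notin> ball (0::real^2) c"
      using z AE_disk_nonzero
    proof eventually_elim
      case (elim x)
      have "rad l k (norm x) > 0" if "x \<in> ball 0 c" using d(2)[of "norm x"] that elim c by auto
      then show ?case using elim by auto
    qed
    then have "emeasure disk_measure (ball (0::real^2) c) = 0"
      using c by (subst (asm) AE_iff_measurable[of "ball 0 c"]) (auto simp: sets_restrict_space_iff)
    moreover have "emeasure disk_measure (ball (0::real^2) c) = emeasure lebesgue (ball (0::real^2) c)"
      using c by (intro emeasure_restrict_space) auto
    moreover have "emeasure lebesgue (ball (0::real^2) c) = ennreal (c\<^sup>2 * pi)"
      using c circle_area[of c 0] by (simp add: emeasure_eq_measure2)
    ultimately show False using c(1) by simp
  qed
  ultimately show ?thesis by simp
qed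

text \<open>Lagrange's identity for two solutions of the radial equation; different indices have
  different zeros, so the eigenvalues differ.\<close>

lemma radial_orthogonal:
  assumes k: "k \<ge> 1" "k' \<ge> 1" "k \<noteq> k'"
  shows "(\<integral>x. norm x ^ (2 * l) * (rad l k (norm x) * rad l k' (norm x)) \<partial>disk_measure) = 0"
proof -
  define b1 where "b1 = (bessel_zero l k / 2)\<^sup>2"
  define b2 where "b2 = (bessel_zero l k' / 2)\<^sup>2"
  have "b1 \<noteq> b2"
    using k bessel_zero_inject[of k k' l] bessel_zero_pos[of k l] bessel_zero_pos[of k' l]
    by (auto simp: b1_def b2_def power2_eq_iff)
  define A where "A b r = r ^ (2 * l + 2) * bes (Suc l) (b * r\<^sup>2)" for b r :: real
  define R where "R b r = bes l (b * r\<^sup>2)" for b r :: real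
  have dA: "(A b has_real_derivative 2 * r ^ (2 * l + 1) * R b r) (at r)" for b r
    unfolding A_def R_def by (rule DERIV_bes_radial_flux)
  have dR: "(R b has_real_derivative - (2 * b * r * bes (Suc l) (b * r\<^sup>2))) (at r)" for b r
    unfolding R_def by (rule DERIV_bes_radial)
  \<comment> \<open>The Wronskian of the two solutions, up to a constant factor. It vanishes at 1 by
    the boundary condition and at 0 by the power r^(2l+2).\<close>
  define F where "F r = (b1 * (A b1 r * R b2 r) - b2 * (A b2 r * R b1 r)) / (2 * (b1 - b2))" for r
  have rad: "rad l k = R b1" "rad l k' = R b2" by (auto simp: rad_def R_def b1_def b2_def fun_eq_iff)
  have dF: "(F has_real_derivative r * (r ^ (2 * l) * (R b1 r * R b2 r))) (at r)" for r
  proof -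
    let ?s1 = "bes (Suc l) (b1 * r\<^sup>2)" and ?s2 = "bes (Suc l) (b2 * r\<^sup>2)"
    have "(F has_real_derivative
       (b1 * (2 * r ^ (2 * l + 1) * R b1 r * R b2 r + - (2 * b2 * r * ?s2) * A b1 r)
        - b2 * (2 * r ^ (2 * l + 1) * R b2 r * R b1 r + - (2 * b1 * r * ?s1) * A b2 r)) / (2 * (b1 - b2))) (at r)"
      unfolding F_def by (intro DERIV_cdivide DERIV_diff DERIV_cmult DERIV_mult dA dR)
    moreover have "b1 * (2 * r ^ (2 * l + 1) * R b1 r * R b2 r + - (2 * b2 * r * ?s2) * A b1 r)
        - b2 * (2 * r ^ (2 * l + 1) * R b2 r * R b1 r + - (2 * b1 * r * ?s1) * A b2 r)
        = (2 * (b1 - b2)) * (r * (r ^ (2 * l) * (R b1 r * R b2 r)))"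
      by (simp add: A_def algebra_simps)
    ultimately show ?thesis using \<open>b1 \<noteq> b2\<close> by simp
  qed
  have "(\<integral>x. norm x ^ (2 * l) * (R b1 (norm x) * R b2 (norm x)) \<partial>disk_measure) = 2 * pi * (F 1 - F 0)"
  proof (rule integral_radial_FTC[of "\<lambda>r. r ^ (2 * l) * (R b1 r * R b2 r)" "{}"])
    show "continuous_on UNIV (\<lambda>r. r ^ (2 * l) * (R b1 r * R b2 r))"
      unfolding R_def by (intro continuous_intros)
    show "continuous_on {0..1} F" using dF by (meson DERIV_isCont continuous_at_imp_continuous_on)
  qed (use dF in auto)
  also have "F 1 = 0" using rad_1[OF k(1), of l] rad_1[OF k(2), of l] by (simp add: F_def rad)
  also have "F 0 = 0" by (simp add: F_def A_def)
  finally show ?thesis by (simp add: rad)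
qed

definition raw :: "(nat \<times> nat) \<times> bool \<Rightarrow> real^2 \<Rightarrow> real" where
  "raw i x = ang (snd i) (fst (fst i)) x * rad (fst (fst i)) (snd (fst i)) (norm x)"

lemma integral_raw_raw:
  assumes i: "i \<in> idx" and j: "j \<in> idx"
  shows "(\<integral>x. raw i x * raw j x \<partial>disk_measure) =
    (if i = j then (if fst (fst i) = 0 then 1 else 1 / 2) * mode_norm (fst (fst i)) (snd (fst i)) else 0)"
proof -
  obtain l k b l' k' b' where ij: "i = ((l, k), b)" "j = ((l', k'), b')" by (metis surj_pair)
  have c: "k \<ge> 1" "k' \<ge> 1" "b \<Longrightarrow> l > 0" "b' \<Longrightarrow> l' > 0" using i j by (auto simp: idx_def ij)
  have "(\<integral>x. raw i x * raw j x \<partial>disk_measure) = (\<integral>x. ang b l x * ang b' l' x * (rad l k (norm x) * rad l' k' (norm x)) \<partial>disk_measure)"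
    by (simp add: raw_def ij mult_ac)
  also have "\<dots> = (if b = b' \<and> l = l' then (if l = 0 then 1 else 1 / 2) *
      (\<integral>x. norm x ^ (2 * l) * (rad l k (norm x) * rad l' k' (norm x)) \<partial>disk_measure) else 0)"
    by (rule integral_ang_ang)
       (use c in \<open>auto intro!: integrable_disk_continuous continuous_intros continuous_rad'\<close>)
  also have "\<dots> = (if i = j then (if l = 0 then 1 else 1 / 2) * mode_norm l k else 0)"
    using radial_orthogonal[OF c(1,2), of l] by (auto simp: ij mode_norm_def)
  finally show ?thesis by (simp add: ij)
qed

lemma integral_scaled_mult:
  fixes f g :: "'a \<Rightarrow> real"
  shows "(\<integral>x. (c * f x) * (d * g x) \<partial>M) = c * d * (\<integral>x. f x * g x \<partial>M)"
proof -
  have "(c * f x) * (d * g x) = (c * d) * (f x * g x)" for x by simp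
  then show ?thesis by (simp only: integral_mult_right_zero)
qed

lemma mode_eq_raw:
  assumes i: "i \<in> idx" shows "\<exists>c>0. mode i = (\<lambda>x. c * raw i x)"
proof -
  obtain l k b where ij: "i = ((l, k), b)" by (metis surj_pair)
  have c: "k \<ge> 1" "b \<Longrightarrow> l > 0" using i by (auto simp: idx_def ij)
  define j where "j = bessel_zero l k"
  have j: "j > 0" using bessel_zero_pos c(1) by (simp add: j_def)
  define h where "h = (\<lambda>x::real^2. (if b then sin (real l * polar_angle x) else cos (real l * polar_angle x)) * bessel_J l (j * norm x))"
  have mode: "mode i = L2_normalize h"
    using c(2) by (auto simp: mode_def ij eig_sin_def eig_cos_def h_def j_def fun_eq_iff)
  have h: "h = (\<lambda>x. (j / 2) ^ l * raw i x)"
  proof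
    fix x :: "real^2"
    have "bessel_J l (j * norm x) = (j / 2) ^ l * norm x ^ l * rad l k (norm x)"
      by (simp add: bessel_J_eq_bes rad_def j_def[symmetric] power_mult_distrib power_divide)
    moreover have "ang b l x = norm x ^ l * (if b then sin (real l * polar_angle x) else cos (real l * polar_angle x))"
      unfolding ang_def cx_power_eq by simp
    ultimately show "h x = (j / 2) ^ l * raw i x" by (simp add: h_def raw_def ij)
  qed
  have "L2_inner h h = (j / 2) ^ l * (j / 2) ^ l * (\<integral>x. raw i x * raw i x \<partial>disk_measure)"
    unfolding L2_inner_def h by (rule integral_scaled_mult)
  moreover have "(\<integral>x. raw i x * raw i x \<partial>disk_measure) > 0"
    unfolding integral_raw_raw[OF i i] using mode_norm_pos[of l k] by (simp add: ij)
  ultimately have "L2_inner h h > 0" using j by simp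
  then show ?thesis
    using j unfolding mode L2_normalize_def h
    by (intro exI[of _ "1 / sqrt (L2_inner h h) * (j / 2) ^ l"]) (auto simp: h mult.assoc)
qed

lemma raw_continuous: "continuous_on UNIV (raw i)"
  unfolding raw_def[abs_def] by (intro continuous_intros continuous_rad')

lemma mode_continuous: "i \<in> idx \<Longrightarrow> continuous_on UNIV (mode i)"
  using mode_eq_raw[of i] raw_continuous[of i] by (auto intro!: continuous_intros)

lemma integral_mode_mode:
  assumes i: "i \<in> idx" and j: "j \<in> idx"
  shows "(\<integral>x. mode i x * mode j x \<partial>disk_measure) = (if i = j then 1 else 0)"
proof -
  obtain c where c: "c > 0" "mode i = (\<lambda>x. c * raw i x)" using mode_eq_raw[OF i] by blast
  obtain d where d: "d > 0" "mode j = (\<lambda>x. d * raw j x)" using mode_eq_raw[OF j] by blast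
  show ?thesis
  proof (cases "i = j")
    case False
    have "(\<integral>x. mode i x * mode j x \<partial>disk_measure) = c * d * (\<integral>x. raw i x * raw j x \<partial>disk_measure)"
      unfolding c d by (rule integral_scaled_mult)
    then show ?thesis using integral_raw_raw[OF i j] False by simp
  next
    case True
    obtain l k b where ij: "i = ((l, k), b)" by (metis surj_pair)
    have b: "b \<Longrightarrow> l > 0" using i by (auto simp: idx_def ij)
    obtain h where h: "mode i = L2_normalize h"
      using b by (cases b) (auto simp: mode_def ij eig_sin_def eig_cos_def)
    define k' where "k' = 1 / sqrt (L2_inner h h)"
    have "mode i = (\<lambda>x. k' * h x)" unfolding h L2_normalize_def k'_def ..
    then have "(\<integral>x. mode i x * mode i x \<partial>disk_measure) = k' * k' * (\<integral>x. h x * h x \<partial>disk_measure)"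
      by (simp only: integral_scaled_mult)
    then have e: "(\<integral>x. mode i x * mode i x \<partial>disk_measure) = (1 / sqrt (L2_inner h h))\<^sup>2 * L2_inner h h"
      by (simp only: k'_def L2_inner_def power2_eq_square)
    have "(\<integral>x. mode i x * mode i x \<partial>disk_measure) = c * c * (\<integral>x. raw i x * raw i x \<partial>disk_measure)"
      unfolding c by (rule integral_scaled_mult)
    moreover have "(\<integral>x. raw i x * raw i x \<partial>disk_measure) > 0"
      unfolding integral_raw_raw[OF i i] using mode_norm_pos[of l k] by (simp add: ij)
    ultimately have "(1 / sqrt (L2_inner h h))\<^sup>2 * L2_inner h h > 0" unfolding e using c(1) by simp
    then have "L2_inner h h > 0" by (simp add: zero_less_mult_iff)
    then show ?thesis using e True by (simp add: power_divide)
  qed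
qed

lemma mode_bounded:
  assumes "i \<in> idx" shows "\<exists>C. \<forall>x\<in>space disk_measure. \<bar>mode i x\<bar> \<le> C"
proof -
  have "bounded (mode i ` cball 0 1)"
    by (intro compact_imp_bounded compact_continuous_image continuous_on_subset[OF mode_continuous[OF assms]]) auto
  then obtain C where "\<forall>y\<in>mode i ` cball 0 1. norm y \<le> C" unfolding bounded_iff by blast
  then show ?thesis by (intro exI[of _ C]) auto
qed

lemma orthonormal_modes: "orthonormal_family disk_measure idx mode"
proof (intro orthonormal_family.intro disk.finite_measure_axioms orthonormal_family_axioms.intro)
  show "mode i \<in> borel_measurable disk_measure" if "i \<in> idx" for i
    by (rule continuous_measurable_disk[OF mode_continuous[OF that]])
qed (rule mode_bounded integral_mode_mode; assumption)+

interpretation modes: orthonormal_family disk_measure idx mode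
  by (rule orthonormal_modes)

lemma coef_zero_iff:
  assumes "i \<in> idx" shows "modes.coef u i = 0 \<longleftrightarrow> (\<integral>x. u x * raw i x \<partial>disk_measure) = 0"
proof -
  obtain c where c: "c > 0" "mode i = (\<lambda>x. c * raw i x)" using mode_eq_raw[OF assms] by blast
  have "modes.coef u i = c * (\<integral>x. u x * raw i x \<partial>disk_measure)"
    using integral_scaled_mult[where c = 1 and f = u and d = c and g = "raw i" and M = disk_measure] unfolding modes.coef_def c by simp
  then show ?thesis using c(1) by simp
qed

text \<open>Feeds the zeros (j/2)^2 into the Green operator argument, so that only bounded functions
  remain to be treated.\<close>

lemma complete_if_bounded:
  assumes bc: "\<And>W C. W \<in> borel_measurable disk_measure \<Longrightarrow> (\<And>x. x \<in> disk \<Longrightarrow> \<bar>W x\<bar> \<le> C) \<Longrightarrow>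
      (\<And>i. i \<in> idx \<Longrightarrow> modes.coef W i = 0) \<Longrightarrow> AE x in disk_measure. W x = 0"
  shows modes.complete_family
  unfolding modes.complete_family_def
proof (intro ballI impI)
  fix w :: "real^2 \<Rightarrow> real"
  assume w: "w \<in> square_int disk_measure" and z: "\<forall>i\<in>idx. modes.coef w i = 0"
  let ?Z = "\<lambda>l. {(bessel_zero l k / 2)\<^sup>2 | k. k \<ge> 1}"
  have raw: "ang b l x * bes l ((bessel_zero l k / 2)\<^sup>2 * (norm x)\<^sup>2) = raw ((l, k), b) x" for b l k x
    by (simp add: raw_def rad_def)
  show "AE x in disk_measure. w x = 0"
  proof (rule complete_if_bounded_complete[where Z = ?Z])
    show "w \<in> borel_measurable disk_measure" "integrable disk_measure (\<lambda>x. (w x)\<^sup>2)"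
      using square_intD[OF w] .
    show "?Z l \<subseteq> {c. c > 0 \<and> bes l c = 0}" for l
    proof
      fix c :: real assume "c \<in> ?Z l"
      then have "\<exists>k. c = (bessel_zero l k / 2)\<^sup>2 \<and> k \<ge> 1" by simp
      then obtain k where "c = (bessel_zero l k / 2)\<^sup>2" "k \<ge> 1" by blast
      then show "c \<in> {c. c > 0 \<and> bes l c = 0}"
        using bes_bessel_zero[of k l] bessel_zero_pos[of k l] by simp
    qed
    show "(\<integral>x. w x * (ang b l x * bes l (c * (norm x)\<^sup>2)) \<partial>disk_measure) = 0"
      if "c \<in> ?Z l" "b \<Longrightarrow> l > 0" for b l c
    proof -
      have "\<exists>k. c = (bessel_zero l k / 2)\<^sup>2 \<and> k \<ge> 1" using that(1) by simp
      then obtain k where k: "c = (bessel_zero l k / 2)\<^sup>2" "k \<ge> 1" by blast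
      then have "((l, k), b) \<in> idx" using that(2) by (auto simp: idx_def)
      then show ?thesis using z coef_zero_iff unfolding k(1) raw by blast
    qed
    fix W :: "real^2 \<Rightarrow> real" and C
    assume W: "W \<in> borel_measurable disk_measure" "\<And>x. x \<in> disk \<Longrightarrow> \<bar>W x\<bar> \<le> C"
      and Wz: "\<And>b l c. c \<in> ?Z l \<Longrightarrow> (b \<Longrightarrow> l > 0) \<Longrightarrow> (\<integral>x. W x * (ang b l x * bes l (c * (norm x)\<^sup>2)) \<partial>disk_measure) = 0"
    show "AE x in disk_measure. W x = 0"
    proof (rule bc[OF W])
      fix i assume i: "i \<in> idx"
      obtain l k b where ij: "i = ((l, k), b)" by (metis surj_pair)
      have "(bessel_zero l k / 2)\<^sup>2 \<in> ?Z l" "b \<Longrightarrow> l > 0" using i by (auto simp: idx_def ij)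
      then have "(\<integral>x. W x * raw i x \<partial>disk_measure) = 0"
        using Wz[of "(bessel_zero l k / 2)\<^sup>2" l b] unfolding raw ij by blast
      then show "modes.coef W i = 0" unfolding coef_zero_iff[OF i] .
    qed
  qed
qed

lemma coef_radial_zero:
  assumes u: "u \<in> square_int disk_measure" and r: "radial u" and i: "i \<in> idx" "fst (fst i) > 0"
  shows "modes.coef u i = 0"
proof -
  obtain l k b where ij: "i = ((l, k), b)" by (metis surj_pair)
  obtain f where f: "AE x in disk_measure. u x = f (norm x)" using r unfolding radial_def by blast
  note um = square_intD(1)[OF u]
  let ?v = "\<lambda>x. u x * rad l k (norm x)"
  have inv: "AE x in disk_measure. u (rot \<phi> x) = u x" for \<phi>
  proof -
    \<comment> \<open>A radial function is rotation invariant only up to null sets; these are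
      preserved because the measure is.\<close>
    have "AE y in distr disk_measure disk_measure (rot \<phi>). u y = f (norm y)" by (subst distr_rot) (rule f)
    then have "AE x in disk_measure. u (rot \<phi> x) = f (norm (rot \<phi> x))"
      by (rule AE_distrD[OF measurable_rot])
    then show ?thesis using f by eventually_elim simp
  qed
  have "(\<integral>x. ?v x * ang b l x \<partial>disk_measure) = 0"
  proof (rule integral_ang_invariant)
    show "?v \<in> borel_measurable disk_measure" using um by measurable
    show "AE x in disk_measure. u (rot \<phi> x) * rad l k (norm (rot \<phi> x)) = u x * rad l k (norm x)" for \<phi>
      using inv[of \<phi>] by eventually_elim simp
    have "(\<lambda>x. rad l k (norm x)) \<in> square_int disk_measure"
      unfolding square_int_def
      by (auto intro!: continuous_measurable_disk integrable_disk_continuous continuous_intros continuous_rad')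
    then show "integrable disk_measure ?v" by (rule square_int_mult_integrable[OF u])
    show "l > 0" using i(2) by (simp add: ij)
  qed
  then show ?thesis unfolding coef_zero_iff[OF i(1)] by (simp add: ij raw_def mult_ac)
qed

subsection \<open>The spaces and functionals in terms of mode coefficients\<close>

lemma L2_disk_eq: "L2_disk = square_int disk_measure"
  by (simp add: L2_disk_def square_int_def)

lemma L2_inner_mode: "L2_inner u (mode i) = modes.coef u i"
  by (simp add: L2_inner_def modes.coef_def)

lemma mode_prod_eq:
  "mode_prod u v l k = modes.coef u ((l, k), False) * modes.coef v ((l, k), False)
     + modes.coef u ((l, k), True) * modes.coef v ((l, k), True)"
  using L2_inner_mode[of u "((l, k), False)"] L2_inner_mode[of u "((l, k), True)"]
    L2_inner_mode[of v "((l, k), False)"] L2_inner_mode[of v "((l, k), True)"]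
  by (simp add: mode_prod_def mode_def)

lemma coef_trivial_mode: "modes.coef u ((0, k), True) = 0"
  by (simp add: modes.coef_def mode_def eig_sin_def)

lemma coef_not_idx:
  assumes "i \<in> (modes \<times> UNIV) - idx" shows "modes.coef u i = 0"
proof -
  obtain l k b where ij: "i = ((l, k), b)" by (metis surj_pair)
  have "l = 0" "b" using assms by (auto simp: ij idx_def modes_def)
  then show ?thesis using coef_trivial_mode[of u k] by (simp add: ij)
qed

lemma summable_idx_iff:
  "(\<lambda>i. a (fst i) * (modes.coef u i * modes.coef v i)) summable_on idx \<longleftrightarrow>
   (\<lambda>i. a (fst i) * (modes.coef u i * modes.coef v i)) summable_on (modes \<times> UNIV)"
  by (rule summable_on_cong_neutral) (simp_all add: coef_not_idx, auto simp: idx_def modes_def)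

lemma modes_times_bool: "modes \<times> UNIV = (\<lambda>m. (m, False)) ` modes \<union> (\<lambda>m. (m, True)) ` modes"
  by (auto simp: image_iff)

text \<open>Passes from sums over (l, k), with cosine and sine terms combined, to sums over single
  modes; the trivial sine modes contribute 0.\<close>

lemma sum_modes:
  fixes a :: "nat \<times> nat \<Rightarrow> real"
  assumes s: "(\<lambda>i. a (fst i) * (modes.coef u i * modes.coef v i)) summable_on idx"
  shows "(\<lambda>m. a m * mode_prod u v (fst m) (snd m)) summable_on modes"
    and "(\<Sum>\<^sub>\<infinity>m\<in>modes. a m * mode_prod u v (fst m) (snd m)) = (\<Sum>\<^sub>\<infinity>i\<in>idx. a (fst i) * (modes.coef u i * modes.coef v i))"
proof -
  let ?g = "\<lambda>i. a (fst i) * (modes.coef u i * modes.coef v i)"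
  let ?A = "\<lambda>b. (\<lambda>m. (m, b)) ` modes"
  have su: "?g summable_on (modes \<times> UNIV)" using s summable_idx_iff[of a u v] by blast
  have sA: "?g summable_on ?A b" for b by (rule summable_on_subset_banach[OF su]) auto
  have inj: "inj_on (\<lambda>m. (m, b)) modes" for b :: bool by (auto intro: inj_onI)
  have r: "(?g \<circ> (\<lambda>m. (m, b))) summable_on modes" "infsum ?g (?A b) = infsum (?g \<circ> (\<lambda>m. (m, b))) modes" for b
    using sA[of b] summable_on_reindex[OF inj[of b], of ?g] infsum_reindex[OF inj[of b], of ?g] by auto
  have e: "a m * mode_prod u v (fst m) (snd m) = (?g \<circ> (\<lambda>m. (m, False))) m + (?g \<circ> (\<lambda>m. (m, True))) m" for m
    by (simp add: mode_prod_eq distrib_left)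
  show "(\<lambda>m. a m * mode_prod u v (fst m) (snd m)) summable_on modes"
    unfolding e by (intro summable_on_add r)
  have "infsum ?g idx = infsum ?g (modes \<times> UNIV)"
    by (rule infsum_cong_neutral) (simp_all add: coef_not_idx, auto simp: idx_def modes_def)
  also have "\<dots> = infsum ?g (?A False) + infsum ?g (?A True)"
    unfolding modes_times_bool by (rule infsum_Un_disjoint[OF sA sA]) auto
  also have "\<dots> = (\<Sum>\<^sub>\<infinity>m\<in>modes. a m * mode_prod u v (fst m) (snd m))"
    unfolding e r(2) by (rule infsum_add[symmetric, OF r(1) r(1)])
  finally show "(\<Sum>\<^sub>\<infinity>m\<in>modes. a m * mode_prod u v (fst m) (snd m)) = infsum ?g idx" ..
qed

text \<open>Nonnegative weights let the combined term dominate the cosine and the sine square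
  separately.\<close>

lemma summable_idx_if_modes:
  fixes a :: "nat \<times> nat \<Rightarrow> real"
  assumes s: "(\<lambda>m. a m * mode_prod u u (fst m) (snd m)) summable_on modes" and a: "\<And>m. a m \<ge> 0"
  shows "(\<lambda>i. a (fst i) * (modes.coef u i * modes.coef u i)) summable_on idx"
proof -
  let ?g = "\<lambda>i. a (fst i) * (modes.coef u i * modes.coef u i)"
  let ?A = "\<lambda>b. (\<lambda>m. (m, b)) ` modes"
  have inj: "inj_on (\<lambda>m. (m, b)) modes" for b :: bool by (auto intro: inj_onI)
  have "?g summable_on ?A b" for b
    unfolding summable_on_reindex[OF inj]
  proof (rule real_summable_on_bound[OF s])
    fix m :: "nat \<times> nat"
    have "mode_prod u u (fst m) (snd m) = modes.coef u (m, False) * modes.coef u (m, False) + modes.coef u (m, True) * modes.coef u (m, True)"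
      by (simp add: mode_prod_eq)
    then have "modes.coef u (m, b) * modes.coef u (m, b) \<le> mode_prod u u (fst m) (snd m)" by (cases b) simp_all
    then have "a m * (modes.coef u (m, b) * modes.coef u (m, b)) \<le> a m * mode_prod u u (fst m) (snd m)"
      by (intro mult_left_mono a)
    moreover have "0 \<le> a m * (modes.coef u (m, b) * modes.coef u (m, b))" using a by simp
    ultimately show "\<bar>(?g \<circ> (\<lambda>m. (m, b))) m\<bar> \<le> a m * mode_prod u u (fst m) (snd m)" by simp
  qed
  then have "?g summable_on (modes \<times> UNIV)"
    unfolding modes_times_bool by (intro summable_on_Un_disjoint) auto
  then show ?thesis using summable_idx_iff[of a u u] by blast
qed

section \<open>Identification with the abstract energy functional\<close>

definition mode_symb :: "real \<Rightarrow> real \<Rightarrow> (nat \<times> nat) \<times> bool \<Rightarrow> real" where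
  "mode_symb \<alpha> m i = symb \<alpha> m (fst (fst i)) (snd (fst i))"

context
  fixes \<alpha> m p :: real
  assumes p: "p > 2"
begin

interpretation me: mode_energy disk_measure idx mode "mode_symb \<alpha> m" p
  by (intro mode_energy.intro orthonormal_modes mode_energy_axioms.intro p)

lemma idx_modes: "i \<in> idx \<Longrightarrow> fst i \<in> modes" by (auto simp: idx_def modes_def)

text \<open>The two weights differ only on modes with eigenvalue 0, where square summability of the
  coefficients covers the difference.\<close>

lemma E_space_eq: "E_space \<alpha> m = me.E"
proof -
  have "(\<lambda>(l, k). \<bar>symb \<alpha> m l k\<bar> * mode_prod u u l k) summable_on modes \<longleftrightarrow> (\<lambda>i. me.\<tau> i * (modes.coef u i)\<^sup>2) summable_on idx"
    if u: "u \<in> square_int disk_measure" for u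
  proof -
    let ?a = "\<lambda>m'. \<bar>symb \<alpha> m (fst m') (snd m')\<bar>"
    have e: "(\<lambda>(l, k). \<bar>symb \<alpha> m l k\<bar> * mode_prod u u l k) = (\<lambda>m'. ?a m' * mode_prod u u (fst m') (snd m'))"
      by (auto simp: fun_eq_iff)
    have "(\<lambda>m'. ?a m' * mode_prod u u (fst m') (snd m')) summable_on modes \<longleftrightarrow>
      (\<lambda>i. ?a (fst i) * (modes.coef u i * modes.coef u i)) summable_on idx"
      using sum_modes(1)[of ?a u u] summable_idx_if_modes[of ?a u] by auto
    also have "\<dots> \<longleftrightarrow> (\<lambda>i. me.\<tau> i * (modes.coef u i)\<^sup>2) summable_on idx"
    proof
      assume "(\<lambda>i. ?a (fst i) * (modes.coef u i * modes.coef u i)) summable_on idx"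
      then have "(\<lambda>i. ?a (fst i) * (modes.coef u i * modes.coef u i) + (modes.coef u i)\<^sup>2) summable_on idx"
        by (intro summable_on_add modes.coef_square_summable u)
      then show "(\<lambda>i. me.\<tau> i * (modes.coef u i)\<^sup>2) summable_on idx"
        by (rule real_summable_on_bound) (auto simp: me.\<tau>_def mode_symb_def power2_eq_square)
    next
      assume "(\<lambda>i. me.\<tau> i * (modes.coef u i)\<^sup>2) summable_on idx"
      then show "(\<lambda>i. ?a (fst i) * (modes.coef u i * modes.coef u i)) summable_on idx"
        by (rule real_summable_on_bound) (auto simp: me.\<tau>_def mode_symb_def power2_eq_square)
    qed
    finally show ?thesis unfolding e .
  qed
  then show ?thesis unfolding E_space_def me.E_def L2_disk_eq by blast
qed

lemma E_norm_eq:
  assumes u: "u \<in> me.E" shows "E_norm \<alpha> m u = me.nrm u"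
proof -
  let ?a = "\<lambda>m'. \<bar>symb \<alpha> m (fst m') (snd m')\<bar>" and ?b = "\<lambda>m'. if symb \<alpha> m (fst m') (snd m') = 0 then 1 else 0 :: real"
  let ?c = "\<lambda>i. modes.coef u i * modes.coef u i"
  have sa: "(\<lambda>i. ?a (fst i) * ?c i) summable_on idx" and sb: "(\<lambda>i. ?b (fst i) * ?c i) summable_on idx"
    by (rule real_summable_on_bound[OF me.E_summable[OF u]]; simp add: me.\<tau>_def mode_symb_def power2_eq_square)+
  have "(\<Sum>\<^sub>\<infinity>(l, k)\<in>modes. \<bar>symb \<alpha> m l k\<bar> * mode_prod u u l k) = (\<Sum>\<^sub>\<infinity>i\<in>idx. ?a (fst i) * ?c i)"
    unfolding sum_modes(2)[OF sa, symmetric] by (rule infsum_cong) auto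
  moreover have "(\<Sum>\<^sub>\<infinity>(l, k)\<in>modes_zero \<alpha> m. mode_prod u u l k) = (\<Sum>\<^sub>\<infinity>i\<in>idx. ?b (fst i) * ?c i)"
    unfolding sum_modes(2)[OF sb, symmetric] by (rule infsum_cong_neutral) (auto simp: modes_zero_def)
  ultimately have "E_inner \<alpha> m u u = (\<Sum>\<^sub>\<infinity>i\<in>idx. ?a (fst i) * ?c i + ?b (fst i) * ?c i)"
    unfolding E_inner_def by (simp only: infsum_add[OF sa sb])
  also have "\<dots> = me.nsq u"
    unfolding me.nsq_def by (rule infsum_cong) (simp add: me.\<tau>_def mode_symb_def power2_eq_square)
  finally show ?thesis by (simp add: E_norm_def me.nrm_def)
qed

lemma E_part_iff: "u \<in> E_part \<alpha> m I \<longleftrightarrow> u \<in> me.E \<and> (\<forall>i\<in>idx. fst i \<notin> I \<longrightarrow> modes.coef u i = 0)"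
proof -
  have "L2_inner u (eig_cos l k) = modes.coef u ((l, k), False)" "L2_inner u (eig_sin l k) = modes.coef u ((l, k), True)" for l k
    using L2_inner_mode[of u "((l, k), False)"] L2_inner_mode[of u "((l, k), True)"] by (simp_all add: mode_def)
  then have "(\<forall>(l, k)\<in>modes - I. L2_inner u (eig_cos l k) = 0 \<and> L2_inner u (eig_sin l k) = 0) \<longleftrightarrow>
    (\<forall>l k. (l, k) \<in> modes - I \<longrightarrow> modes.coef u ((l, k), False) = 0 \<and> modes.coef u ((l, k), True) = 0)" by auto
  also have "\<dots> \<longleftrightarrow> (\<forall>i\<in>idx. fst i \<notin> I \<longrightarrow> modes.coef u i = 0)"
  proof
    assume a: "\<forall>l k. (l, k) \<in> modes - I \<longrightarrow> modes.coef u ((l, k), False) = 0 \<and> modes.coef u ((l, k), True) = 0"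
    show "\<forall>i\<in>idx. fst i \<notin> I \<longrightarrow> modes.coef u i = 0"
    proof (intro ballI impI)
      fix i assume i: "i \<in> idx" "fst i \<notin> I"
      obtain l k b where ij: "i = ((l, k), b)" by (metis surj_pair)
      show "modes.coef u i = 0" using a idx_modes[OF i(1)] i(2) by (cases b) (auto simp: ij)
    qed
  next
    assume a: "\<forall>i\<in>idx. fst i \<notin> I \<longrightarrow> modes.coef u i = 0"
    show "\<forall>l k. (l, k) \<in> modes - I \<longrightarrow> modes.coef u ((l, k), False) = 0 \<and> modes.coef u ((l, k), True) = 0"
    proof (intro allI impI conjI)
      fix l k assume lk: "(l, k) \<in> modes - I"
      then show "modes.coef u ((l, k), False) = 0" using a by (auto simp: idx_def modes_def)
      show "modes.coef u ((l, k), True) = 0"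
        using lk a coef_trivial_mode by (cases "l = 0") (auto simp: idx_def modes_def)
    qed
  qed
  finally show ?thesis unfolding E_part_def E_space_eq by blast
qed

lemma fst_modes_iff:
  assumes "i \<in> idx"
  shows "fst i \<in> modes_pos \<alpha> m \<longleftrightarrow> mode_symb \<alpha> m i > 0" "fst i \<in> modes_zero \<alpha> m \<longleftrightarrow> mode_symb \<alpha> m i = 0" "fst i \<in> modes_neg \<alpha> m \<longleftrightarrow> mode_symb \<alpha> m i < 0"
  using idx_modes[OF assms] by (auto simp: modes_pos_def modes_zero_def modes_neg_def mode_symb_def split: prod.splits)

lemma E_pos_iff: "u \<in> E_pos \<alpha> m \<longleftrightarrow> u \<in> me.E \<and> (\<forall>i\<in>idx. \<not> mode_symb \<alpha> m i > 0 \<longrightarrow> modes.coef u i = 0)"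
  and E_zero_iff: "u \<in> E_zero \<alpha> m \<longleftrightarrow> u \<in> me.E \<and> (\<forall>i\<in>idx. mode_symb \<alpha> m i \<noteq> 0 \<longrightarrow> modes.coef u i = 0)"
  and E_neg_iff: "u \<in> E_neg \<alpha> m \<longleftrightarrow> u \<in> me.E \<and> (\<forall>i\<in>idx. \<not> mode_symb \<alpha> m i < 0 \<longrightarrow> modes.coef u i = 0)"
  unfolding E_pos_def E_zero_def E_neg_def E_part_iff using fst_modes_iff by auto

lemma ex_projection:
  assumes u: "u \<in> me.E"
  obtains v where "v \<in> me.E" "\<And>i. i \<in> idx \<Longrightarrow> modes.coef v i = (if S i then modes.coef u i else 0)"
proof -
  let ?a = "\<lambda>i. if S i then modes.coef u i else 0"
  have sa: "(\<lambda>i. (?a i)\<^sup>2) summable_on idx"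
    by (rule real_summable_on_bound[OF modes.coef_square_summable[OF me.E_sq[OF u]]]) auto
  obtain v and r :: "nat \<Rightarrow> nat" where v: "v \<in> square_int disk_measure" "\<And>i. i \<in> idx \<Longrightarrow> modes.coef v i = ?a i"
    "strict_mono r" "AE x in disk_measure. (\<lambda>n. modes.comb (modes.exh (r n)) ?a x) \<longlonglongrightarrow> v x"
    by (rule modes.Riesz_Fischer[OF sa]) blast
  have "(\<lambda>i. me.\<tau> i * (modes.coef v i)\<^sup>2) summable_on idx"
    by (rule real_summable_on_bound[OF me.E_summable[OF u]]) (use v(2) less_imp_le[OF me.\<tau>(1)] in auto)
  then have "v \<in> me.E" using v(1) by (simp add: me.E_def)
  then show ?thesis using that v(2) by blast
qed

lemma coef_AE_sum:
  assumes "u \<in> me.E" "v \<in> me.E" "w \<in> me.E" "AE x in disk_measure. u x = v x + w x" "i \<in> idx"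
  shows "modes.coef u i = modes.coef v i + modes.coef w i"
proof -
  have vw: "(\<lambda>x. v x + w x) \<in> me.E" by (rule me.E_add[OF assms(2,3)])
  have "modes.coef u i = modes.coef (\<lambda>x. v x + w x) i"
    by (rule modes.coef_cong_AE[OF me.E_sq[OF assms(1)] me.E_sq[OF vw] assms(4,5)])
  then show ?thesis using modes.coef_add[OF me.E_sq[OF assms(2)] me.E_sq[OF assms(3)] assms(5)] by simp
qed

lemma F_space_eq: "F_space \<alpha> m = me.Fsp"
proof (intro set_eqI iffI)
  fix u assume "u \<in> F_space \<alpha> m"
  then obtain v w where u: "u \<in> me.E" and v: "v \<in> E_zero \<alpha> m" and w: "w \<in> E_neg \<alpha> m"
    and e: "AE x in disk_measure. u x = v x + w x"
    unfolding F_space_def E_space_eq by blast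
  have "modes.coef u i = 0" if "i \<in> idx" "mode_symb \<alpha> m i > 0" for i
    using coef_AE_sum[OF u _ _ e that(1)] v w that unfolding E_zero_iff E_neg_iff by force
  then show "u \<in> me.Fsp" using u by (simp add: me.Fsp_def)
next
  fix u assume u: "u \<in> me.Fsp"
  then have uE: "u \<in> me.E" by (simp add: me.Fsp_def)
  obtain c where c: "c \<in> me.E" "\<And>i. i \<in> idx \<Longrightarrow> modes.coef c i = (if mode_symb \<alpha> m i < 0 then modes.coef u i else 0)"
    using ex_projection[OF uE, where S = "\<lambda>i. mode_symb \<alpha> m i < 0"] by blast
  have d: "(\<lambda>x. u x - c x) \<in> me.E" by (rule me.E_diff[OF uE c(1)])
  have "modes.coef (\<lambda>x. u x - c x) i = 0" if "i \<in> idx" "mode_symb \<alpha> m i \<noteq> 0" for i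
    using modes.coef_diff[OF me.E_sq[OF uE] me.E_sq[OF c(1)] that(1)] c(2)[OF that(1)] u that
    by (cases "mode_symb \<alpha> m i < 0") (auto simp: me.Fsp_def)
  then have "(\<lambda>x. u x - c x) \<in> E_zero \<alpha> m" using d unfolding E_zero_iff by blast
  moreover have "c \<in> E_neg \<alpha> m" using c unfolding E_neg_iff by simp
  moreover have "AE x in disk_measure. u x = (u x - c x) + c x" by simp
  ultimately show "u \<in> F_space \<alpha> m" using uE unfolding F_space_def E_space_eq
    by (intro CollectI conjI bexI[of _ "\<lambda>x. u x - c x"] bexI[of _ c])
qed

text \<open>The middle component is the remainder u - a - c rather than a projection: before
  completeness is known it might contain a part orthogonal to all modes, which \<open>E_zero\<close>
  admits.\<close>

lemma ex_E_decomp: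
  assumes u: "u \<in> me.E" shows "\<exists>a b c. E_decomp \<alpha> m u a b c"
proof -
  obtain a where a: "a \<in> me.E" "\<And>i. i \<in> idx \<Longrightarrow> modes.coef a i = (if mode_symb \<alpha> m i > 0 then modes.coef u i else 0)"
    using ex_projection[OF u, where S = "\<lambda>i. mode_symb \<alpha> m i > 0"] by blast
  obtain c where c: "c \<in> me.E" "\<And>i. i \<in> idx \<Longrightarrow> modes.coef c i = (if mode_symb \<alpha> m i < 0 then modes.coef u i else 0)"
    using ex_projection[OF u, where S = "\<lambda>i. mode_symb \<alpha> m i < 0"] by blast
  have ua: "(\<lambda>x. u x - a x) \<in> me.E" by (rule me.E_diff[OF u a(1)])
  have b: "(\<lambda>x. (u x - a x) - c x) \<in> me.E" by (rule me.E_diff[OF ua c(1)])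
  have "modes.coef (\<lambda>x. (u x - a x) - c x) i = 0" if "i \<in> idx" "mode_symb \<alpha> m i \<noteq> 0" for i
    using modes.coef_diff[OF me.E_sq[OF ua] me.E_sq[OF c(1)] that(1)]
      modes.coef_diff[OF me.E_sq[OF u] me.E_sq[OF a(1)] that(1)] a(2)[OF that(1)] c(2)[OF that(1)] that(2)
    by (cases "mode_symb \<alpha> m i < 0") auto
  then have "(\<lambda>x. (u x - a x) - c x) \<in> E_zero \<alpha> m" using b unfolding E_zero_iff by blast
  moreover have "a \<in> E_pos \<alpha> m" "c \<in> E_neg \<alpha> m" using a c unfolding E_pos_iff E_neg_iff by simp_all
  ultimately have "E_decomp \<alpha> m u a (\<lambda>x. (u x - a x) - c x) c" unfolding E_decomp_def by simp
  then show ?thesis by blast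
qed

text \<open>The choices behind \<open>pos_part\<close> and \<open>neg_part\<close> may come from
  different decompositions; their norms are determined nevertheless, because the coefficients
  are.\<close>

lemma E_decomp_coef:
  assumes u: "u \<in> me.E" and d: "E_decomp \<alpha> m u a b c" and i: "i \<in> idx"
  shows "modes.coef a i = (if mode_symb \<alpha> m i > 0 then modes.coef u i else 0)"
    "modes.coef c i = (if mode_symb \<alpha> m i < 0 then modes.coef u i else 0)"
proof -
  have abc: "a \<in> me.E" "b \<in> me.E" "c \<in> me.E"
    and z: "\<not> mode_symb \<alpha> m i > 0 \<Longrightarrow> modes.coef a i = 0" "mode_symb \<alpha> m i \<noteq> 0 \<Longrightarrow> modes.coef b i = 0" "\<not> mode_symb \<alpha> m i < 0 \<Longrightarrow> modes.coef c i = 0"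
    using d i unfolding E_decomp_def E_pos_iff E_zero_iff E_neg_iff by blast+
  have ab: "(\<lambda>x. a x + b x) \<in> me.E" by (rule me.E_add[OF abc(1,2)])
  have "modes.coef u i = modes.coef (\<lambda>x. a x + b x) i + modes.coef c i"
    by (rule coef_AE_sum[OF u ab abc(3) _ i]) (use d in \<open>simp add: E_decomp_def\<close>)
  also have "modes.coef (\<lambda>x. a x + b x) i = modes.coef a i + modes.coef b i"
    by (rule modes.coef_add[OF me.E_sq[OF abc(1)] me.E_sq[OF abc(2)] i])
  finally show "modes.coef a i = (if mode_symb \<alpha> m i > 0 then modes.coef u i else 0)"
    "modes.coef c i = (if mode_symb \<alpha> m i < 0 then modes.coef u i else 0)"
    using z by (auto simp: not_less_iff_gr_or_eq)
qed

lemma energy_eq: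
  assumes u: "u \<in> me.E" shows "energy p \<alpha> m u = me.G u"
proof -
  obtain a0 b0 c0 where d0: "E_decomp \<alpha> m u a0 b0 c0" using ex_E_decomp[OF u] by blast
  have "\<exists>b c. E_decomp \<alpha> m u (pos_part \<alpha> m u) b c"
    unfolding pos_part_def by (rule someI[of "\<lambda>a. \<exists>b c. E_decomp \<alpha> m u a b c" a0]) (intro exI, rule d0)
  then obtain b c where d1: "E_decomp \<alpha> m u (pos_part \<alpha> m u) b c" by blast
  have "\<exists>a b. E_decomp \<alpha> m u a b (neg_part \<alpha> m u)"
    unfolding neg_part_def by (rule someI[of "\<lambda>c. \<exists>a b. E_decomp \<alpha> m u a b c" c0]) (intro exI, rule d0)
  then obtain a' b' where d2: "E_decomp \<alpha> m u a' b' (neg_part \<alpha> m u)" by blast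
  note d = d1 d2
  let ?a = "pos_part \<alpha> m u" and ?c = "neg_part \<alpha> m u"
  have E: "?a \<in> me.E" "?c \<in> me.E"
    using d unfolding E_decomp_def E_pos_iff E_neg_iff by blast+
  have "me.nsq ?a = (\<Sum>\<^sub>\<infinity>i\<in>idx. mode_symb \<alpha> m i * (modes.coef u i * modes.coef u i) + me.\<tau> i * (modes.coef ?c i)\<^sup>2)"
    unfolding me.nsq_def
  proof (rule infsum_cong)
    fix i assume i: "i \<in> idx"
    show "me.\<tau> i * (modes.coef ?a i)\<^sup>2 = mode_symb \<alpha> m i * (modes.coef u i * modes.coef u i) + me.\<tau> i * (modes.coef ?c i)\<^sup>2"
      unfolding E_decomp_coef(1)[OF u d(1) i] E_decomp_coef(2)[OF u d(2) i]
      by (cases "mode_symb \<alpha> m i" "0::real" rule: linorder_cases) (auto simp: me.\<tau>_def power2_eq_square)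
  qed
  also have "\<dots> = me.Q u u + me.nsq ?c"
    unfolding me.Q_def me.nsq_def by (rule infsum_add[OF me.Q_summable[OF u u] me.E_summable[OF E(2)]])
  finally have "me.nsq ?a - me.nsq ?c = me.Q u u" by simp
  then show ?thesis
    unfolding energy_def E_norm_eq[OF E(1)] E_norm_eq[OF E(2)] me.nrm_square me.G_def me.Lp_def by simp
qed

lemma has_E_derivative_iff:
  assumes u: "u \<in> me.E" shows "has_E_derivative \<alpha> m (energy p \<alpha> m) u L \<longleftrightarrow> me.has_der u L"
proof -
  have e: "energy p \<alpha> m (\<lambda>x. u x + v x) = me.G (\<lambda>x. u x + v x)" if "v \<in> me.E" for v
    by (rule energy_eq[OF me.E_add[OF u that]])
  show ?thesis
    unfolding has_E_derivative_def me.has_der_def E_space_eq energy_eq[OF u]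
    by (simp add: e E_norm_eq cong: ball_cong)
qed

lemma nehari_eq: "nehari p \<alpha> m = me.Neh"
  unfolding nehari_def me.Neh_def E_space_eq F_space_eq using has_E_derivative_iff by (auto cong: conj_cong)

text \<open>A critical point yields the embedding on bounded functions, hence completeness of the modes,
  hence the full embedding.\<close>

lemma embedding_of_critical_point:
  assumes u: "critical_point p \<alpha> m u"
  shows "modes.complete_family" "\<exists>K. me.embeds K"
proof -
  obtain L where L: "u \<in> me.E" "me.has_der u L"
    using u has_E_derivative_iff unfolding critical_point_def E_space_eq by blast
  obtain K where K: "K \<ge> 0" "\<And>v. v \<in> me.E \<Longrightarrow> me.in_Lp v \<Longrightarrow> me.Lp v \<le> K * me.nrm v powr p"
    using me.embedding_of_derivative_in_Lp[OF L] by blast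
  show c: "modes.complete_family"
  proof (rule complete_if_bounded)
    fix W :: "real^2 \<Rightarrow> real" and C
    assume W: "W \<in> borel_measurable disk_measure" "\<And>x. x \<in> disk \<Longrightarrow> \<bar>W x\<bar> \<le> C"
      and z: "\<And>i. i \<in> idx \<Longrightarrow> modes.coef W i = 0"
    have b: "\<forall>x\<in>space disk_measure. \<bar>W x\<bar> \<le> C" using W(2) by simp
    have W2: "W \<in> square_int disk_measure" by (rule modes.bounded_square_int[OF W(1)]) (use W(2) in simp)
    have ip: "me.in_Lp W" by (rule me.bounded_in_Lp[OF W(1) b])
    have "(\<lambda>i. me.\<tau> i * (modes.coef W i)\<^sup>2) summable_on idx \<longleftrightarrow> (\<lambda>i. 0 :: real) summable_on idx"
      by (rule summable_on_cong) (simp add: z)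
    then have "W \<in> me.E" using W2 by (simp add: me.E_def)
    \<comment> \<open>A function without coefficients has norm 0, and the embedding estimate forces
      it to vanish; boundedness of W supplies the p-integrability which that estimate
      requires.\<close>
    moreover have "me.nsq W = 0" unfolding me.nsq_def by (rule infsum_0) (simp add: z)
    ultimately have "me.Lp W \<le> 0" using K(2)[OF _ ip] by (simp add: me.nrm_def)
    then have "me.Lp W = 0" using me.Lp_nonneg[of W] by simp
    then have "AE x in disk_measure. \<bar>W x\<bar> powr p = 0"
      using ip unfolding me.Lp_def me.in_Lp_def by (subst (asm) integral_nonneg_eq_0_iff_AE) auto
    then show "AE x in disk_measure. W x = 0" by eventually_elim simp
  qed
  show "\<exists>K. me.embeds K" by (rule me.embedding_of_derivative[OF c L])
qed

text \<open>For an infimum of reals the lower bound needs a nonempty Nehari set and the upper bound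
  needs energies bounded below. Positivity later discards the critical point 0.\<close>

lemma ground_level_bounds:
  assumes u: "critical_point p \<alpha> m u" and l: "symb \<alpha> m l 1 > 0"
  shows "ground_level p \<alpha> m > 0"
    "ground_level p \<alpha> m \<le> pi / p * (p * symb \<alpha> m l 1 / 2) powr (p / (p - 2))"
proof -
  obtain K where em: "me.embeds K" using embedding_of_critical_point(2)[OF u] by blast
  obtain c where c: "c > 0" "\<forall>w\<in>me.Neh. me.G w \<ge> c" using me.Neh_energy_ge[OF em] by blast
  have i0: "((l, 1), False) \<in> idx" "mode_symb \<alpha> m ((l, 1), False) = symb \<alpha> m l 1" by (simp_all add: idx_def mode_symb_def)
  have "measure disk_measure disk = measure lebesgue (disk :: (real^2) set)"
    by (rule measure_restrict_space) auto
  then have mu: "measure disk_measure (space disk_measure) = pi"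
    using circle_area[of 1 "0::real^2"] by simp
  obtain w where w: "w \<in> me.Neh" "me.G w \<le> pi / p * (p * symb \<alpha> m l 1 / 2) powr (p / (p - 2))"
    using me.ex_Neh_energy_le[OF em i0(1)] l unfolding i0(2) mu by blast
  have e: "energy p \<alpha> m v = me.G v" if "v \<in> me.Neh" for v
    using that by (intro energy_eq) (simp add: me.Neh_def)
  have lev: "ground_level p \<alpha> m = (INF v\<in>me.Neh. me.G v)"
    unfolding ground_level_def nehari_eq using e by (intro INF_cong) auto
  have "c \<le> (INF v\<in>me.Neh. me.G v)" using w(1) c(2) by (intro cINF_greatest) auto
  then show "ground_level p \<alpha> m > 0" using c(1) unfolding lev by linarith
  have "(INF v\<in>me.Neh. me.G v) \<le> me.G w" using c(2) by (intro cINF_lower[OF _ w(1)] bdd_belowI2) auto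
  then show "ground_level p \<alpha> m \<le> pi / p * (p * symb \<alpha> m l 1 / 2) powr (p / (p - 2))"
    using w(2) unfolding lev by linarith
qed

lemma critical_point_facts:
  assumes u: "critical_point p \<alpha> m u"
  shows "u \<in> square_int disk_measure" "integrable disk_measure (\<lambda>x. \<bar>u x\<bar> powr p)"
    "(\<lambda>i. mode_symb \<alpha> m i * (modes.coef u i)\<^sup>2) summable_on idx"
    "(\<Sum>\<^sub>\<infinity>i\<in>idx. mode_symb \<alpha> m i * (modes.coef u i)\<^sup>2) = (\<integral>x. \<bar>u x\<bar> powr p \<partial>disk_measure)"
    "energy p \<alpha> m u = (1 / 2 - 1 / p) * (\<integral>x. \<bar>u x\<bar> powr p \<partial>disk_measure)"
proof -
  obtain L where L: "u \<in> me.E" "me.has_der u L" "L u = 0"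
    using u has_E_derivative_iff unfolding critical_point_def E_space_eq by blast
  obtain K where em: "me.embeds K" using embedding_of_critical_point(2)[OF u] by blast
  note E = me.energy_of_L_self_zero[OF em L]
  show "u \<in> square_int disk_measure" by (rule me.E_sq[OF L(1)])
  show "integrable disk_measure (\<lambda>x. \<bar>u x\<bar> powr p)" using em L(1) by (simp add: me.embeds_def me.in_Lp_def)
  show "(\<lambda>i. mode_symb \<alpha> m i * (modes.coef u i)\<^sup>2) summable_on idx"
    using me.Q_summable[OF L(1) L(1)] by (simp add: power2_eq_square)
  show "(\<Sum>\<^sub>\<infinity>i\<in>idx. mode_symb \<alpha> m i * (modes.coef u i)\<^sup>2) = (\<integral>x. \<bar>u x\<bar> powr p \<partial>disk_measure)"
    using E(1) by (simp add: me.Q_def me.Lp_def power2_eq_square)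
  show "energy p \<alpha> m u = (1 / 2 - 1 / p) * (\<integral>x. \<bar>u x\<bar> powr p \<partial>disk_measure)"
    using E(2) energy_eq[OF L(1)] by (simp add: me.Lp_def)
qed

end

subsection \<open>Radial functions\<close>

lemma radial_primitive:
  fixes g :: "real \<Rightarrow> real"
  assumes g: "continuous_on UNIV g"
  defines "J \<equiv> \<lambda>s. integral {0..s} (\<lambda>t. t * g t)"
  shows "continuous_on {0..1} J" "\<And>s. 0 < s \<Longrightarrow> s < 1 \<Longrightarrow> (J has_real_derivative s * g s) (at s)"
    "J 0 = 0" "(\<integral>x. g (norm x) \<partial>disk_measure) = 2 * pi * J 1"
proof -
  have c: "continuous_on {0..1} (\<lambda>t. t * g t)" by (intro continuous_intros continuous_on_subset[OF g]) auto
  have d: "(J has_real_derivative s * g s) (at s within {0..1})" if "s \<in> {0..1}" for s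
    unfolding J_def by (rule integral_has_real_derivative[OF c that])
  show cJ: "continuous_on {0..1} J" using d by (rule DERIV_continuous_on)
  show dJ: "(J has_real_derivative s * g s) (at s)" if "0 < s" "s < 1" for s
    using d[of s] that by (simp add: at_within_Icc_at)
  show J0: "J 0 = 0" by (simp add: J_def)
  show "(\<integral>x. g (norm x) \<partial>disk_measure) = 2 * pi * J 1"
    using integral_radial_FTC[OF g finite.emptyI cJ] dJ J0 by simp
qed

text \<open>A radial Ladyzhenskaya inequality. Since f(1) = 0, the fundamental theorem gives r
  f(r)^2 \<le> P with P = 2 \<integral> s |f f'| ds, and then \<integral> s f^4 \<le> P \<integral>
  f^2 \<le> P^2 after an integration by parts. The constant 2/\<pi> collects the factors 2 \<pi> of
  polar coordinates.\<close>

lemma radial_quartic: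
  fixes f f' :: "real \<Rightarrow> real"
  assumes f: "\<And>r. (f has_real_derivative f' r) (at r)" and f': "continuous_on UNIV f'" and f1: "f 1 = 0"
  shows "(\<integral>x. f (norm x) ^ 4 \<partial>disk_measure) \<le> 2 / pi * (\<integral>x. \<bar>f (norm x) * f' (norm x)\<bar> \<partial>disk_measure)\<^sup>2"
proof -
  have cf: "continuous_on A f" for A
    using f by (meson DERIV_isCont continuous_at_imp_continuous_on)
  have cff: "continuous_on UNIV (\<lambda>r. \<bar>f r * f' r\<bar>)" and cf4: "continuous_on UNIV (\<lambda>r. f r ^ 4)"
    by (intro continuous_intros cf f')+
  define H where "H s = integral {0..s} (\<lambda>t. t * \<bar>f t * f' t\<bar>)" for s
  define T where "T s = integral {0..s} (\<lambda>t. t * f t ^ 4)" for s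
  note H = radial_primitive[OF cff, folded H_def]
  note T = radial_primitive[OF cf4, folded T_def]
  have H0: "H s \<ge> 0" if "0 \<le> s" "s \<le> 1" for s
    unfolding H_def
    by (rule integral_nonneg)
       (use that in \<open>auto intro!: integrable_continuous_real continuous_intros continuous_on_subset[OF cf] continuous_on_subset[OF f']\<close>)
  have 1: "r * (f r)\<^sup>2 \<le> 2 * H 1" if r: "0 \<le> r" "r \<le> 1" for r
  proof (cases "r = 1")
    case False
    then have r1: "r < 1" using r by simp
    define \<psi> where "\<psi> s = r * (f s)\<^sup>2 + 2 * H s" for s
    have "\<psi> r \<le> \<psi> 1"
    proof (rule DERIV_nonneg_imp_increasing_open[of r 1 \<psi>])
      show "r \<le> 1" using r by simp
      show "continuous_on {r..1} \<psi>"
        unfolding \<psi>_def by (intro continuous_intros cf continuous_on_subset[OF H(1)]) (use r in auto)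
      fix s assume s: "r < s" "s < 1"
      have "(\<psi> has_real_derivative r * (2 * f s * f' s) + 2 * (s * \<bar>f s * f' s\<bar>)) (at s)"
        unfolding \<psi>_def using r s by (auto intro!: derivative_eq_intros f H(2))
      moreover have "0 \<le> r * (2 * f s * f' s) + 2 * (s * \<bar>f s * f' s\<bar>)"
      proof -
        have "- (r * (f s * f' s)) \<le> r * \<bar>f s * f' s\<bar>"
          using mult_left_mono[OF abs_ge_minus_self[of "f s * f' s"] r(1)] by simp
        also have "\<dots> \<le> s * \<bar>f s * f' s\<bar>" using s by (intro mult_right_mono) auto
        finally show ?thesis by (simp add: mult.assoc mult.left_commute)
      qed
      ultimately show "\<exists>y. (\<psi> has_real_derivative y) (at s) \<and> 0 \<le> y" by blast
    qed
    then show ?thesis using H0[OF r] f1 by (simp add: \<psi>_def)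
  qed (use f1 H0[of 1] in simp)
  define P where "P = 2 * H 1"
  \<comment> \<open>Its monotonicity performs both integrations at once: the derivative of s f^2 +
    2H is at least f^2, and P f^2 \<ge> s f^4 by the pointwise bound.\<close>
  define w where "w s = P * (s * (f s)\<^sup>2 + 2 * H s) - T s" for s
  have "w 0 \<le> w 1"
  proof (rule DERIV_nonneg_imp_increasing_open[of 0 1 w])
    show "continuous_on {0..1} w"
      unfolding w_def by (intro continuous_intros cf H(1) T(1))
    fix s :: real assume s: "0 < s" "s < 1"
    have "(w has_real_derivative P * ((f s)\<^sup>2 + s * (2 * f s * f' s) + 2 * (s * \<bar>f s * f' s\<bar>)) - s * f s ^ 4) (at s)"
      unfolding w_def using s by (auto intro!: derivative_eq_intros f H(2) T(2))
    moreover have "0 \<le> P * ((f s)\<^sup>2 + s * (2 * f s * f' s) + 2 * (s * \<bar>f s * f' s\<bar>)) - s * f s ^ 4"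
    proof -
      have P: "P \<ge> 0" using H0[of 1] by (simp add: P_def)
      have "s * (- (f s * f' s)) \<le> s * \<bar>f s * f' s\<bar>"
        using s by (intro mult_left_mono abs_ge_minus_self) auto
      then have "(f s)\<^sup>2 \<le> (f s)\<^sup>2 + s * (2 * f s * f' s) + 2 * (s * \<bar>f s * f' s\<bar>)" by (simp add: mult.assoc mult.left_commute)
      then have "P * (f s)\<^sup>2 \<le> P * ((f s)\<^sup>2 + s * (2 * f s * f' s) + 2 * (s * \<bar>f s * f' s\<bar>))"
        by (rule mult_left_mono[OF _ P])
      moreover have "s * f s ^ 4 = (s * (f s)\<^sup>2) * (f s)\<^sup>2" by (simp add: power2_eq_square power4_eq_xxxx)
      moreover have "(s * (f s)\<^sup>2) * (f s)\<^sup>2 \<le> P * (f s)\<^sup>2"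
        using 1[of s] s unfolding P_def by (intro mult_right_mono) auto
      ultimately show ?thesis by linarith
    qed
    ultimately show "\<exists>y. (w has_real_derivative y) (at s) \<and> 0 \<le> y" by blast
  qed simp
  then have "T 1 \<le> P * P" using f1 H(3) T(3) by (simp add: w_def P_def)
  then have "2 * pi * T 1 \<le> 2 * pi * (P * P)" by (intro mult_left_mono) auto
  also have "\<dots> = 2 / pi * (2 * pi * H 1)\<^sup>2" by (simp add: P_def power2_eq_square)
  finally show ?thesis unfolding H(4) T(4) .
qed

text \<open>Green's formula: the Dirichlet integral of f is the integral of f times -\<Delta>f, and
  -\<Delta> multiplies the coefficient of a mode by its squared Bessel zero.\<close>

lemma radial_comb:
  assumes J: "finite J" "J \<subseteq> idx" "\<And>i. i \<in> J \<Longrightarrow> fst (fst i) = 0"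
  obtains f f' where "\<And>x. modes.comb J a x = f (norm x)" "\<And>r. (f has_real_derivative f' r) (at r)"
    "continuous_on UNIV f" "continuous_on UNIV f'" "f 1 = 0"
    "(\<integral>x. (f' (norm x))\<^sup>2 \<partial>disk_measure) = (\<Sum>i\<in>J. (bessel_zero 0 (snd (fst i)))\<^sup>2 * (a i)\<^sup>2)"
proof -
  have "\<forall>i\<in>J. \<exists>c. mode i = (\<lambda>x. c * raw i x)" using mode_eq_raw J(2) by blast
  then obtain c where c: "\<And>i. i \<in> J \<Longrightarrow> mode i = (\<lambda>x. c i * raw i x)" by metis
  have snd: "snd i = False" if "i \<in> J" for i
    using J(3)[OF that] subsetD[OF J(2) that] by (cases i) (auto simp: idx_def)
  define b where "b i = (bessel_zero 0 (snd (fst i)) / 2)\<^sup>2" for i :: "(nat \<times> nat) \<times> bool"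
  have raw: "raw i x = bes 0 (b i * (norm x)\<^sup>2)" if "i \<in> J" for i x
    using J(3)[OF that] snd[OF that] by (simp add: raw_def ang_def rad_def b_def)
  have b1: "bes 0 (b i) = 0" if "i \<in> J" for i
    using J(2) that bes_bessel_zero[of "snd (fst i)" 0] by (auto simp: idx_def b_def)
  define f where "f r = (\<Sum>i\<in>J. a i * c i * bes 0 (b i * r\<^sup>2))" for r
  define f' where "f' r = (\<Sum>i\<in>J. a i * c i * - (2 * b i * r * bes (Suc 0) (b i * r\<^sup>2)))" for r
  \<comment> \<open>l is r f' and g is the negative Laplacian of f, so that l' = - r g. Writing l
    with r^2 makes the flux formula applicable.\<close>
  define l where "l r = (\<Sum>i\<in>J. - 2 * b i * a i * c i * (r\<^sup>2 * bes (Suc 0) (b i * r\<^sup>2)))" for r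
  define g where "g r = (\<Sum>i\<in>J. 4 * b i * a i * c i * bes 0 (b i * r\<^sup>2))" for r
  have comb: "modes.comb J a x = f (norm x)" for x
    unfolding modes.comb_def f_def by (rule sum.cong) (simp_all add: c raw)
  have combg: "modes.comb J (\<lambda>i. 4 * b i * a i) x = g (norm x)" for x
    unfolding modes.comb_def g_def by (rule sum.cong) (simp_all add: c raw)
  have df: "(f has_real_derivative f' r) (at r)" for r
    unfolding f_def f'_def by (intro DERIV_sum DERIV_cmult DERIV_bes_radial)
  have dl: "(l has_real_derivative - (r * g r)) (at r)" for r
  proof -
    have "(l has_real_derivative (\<Sum>i\<in>J. - 2 * b i * a i * c i * (2 * r ^ (2 * 0 + 1) * bes 0 (b i * r\<^sup>2)))) (at r)"
      unfolding l_def using DERIV_bes_radial_flux[of 0] by (intro DERIV_sum DERIV_cmult) (simp add: power2_eq_square)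
    moreover have "(\<Sum>i\<in>J. - 2 * b i * a i * c i * (2 * r ^ (2 * 0 + 1) * bes 0 (b i * r\<^sup>2))) = - (r * g r)"
      unfolding g_def sum_distrib_left sum_negf[symmetric] by (rule sum.cong) simp_all
    ultimately show ?thesis by simp
  qed
  have l: "l r = r * f' r" for r
    unfolding l_def f'_def sum_distrib_left by (rule sum.cong) (simp_all add: power2_eq_square)
  have cf: "continuous_on UNIV f" and cf': "continuous_on UNIV f'" and cg: "continuous_on UNIV g"
    unfolding f_def f'_def g_def by (intro continuous_intros)+
  have f1: "f 1 = 0" unfolding f_def by (rule sum.neutral) (simp add: b1)
  have "(\<integral>x. (f' (norm x))\<^sup>2 - f (norm x) * g (norm x) \<partial>disk_measure) = 2 * pi * (f 1 * l 1 - f 0 * l 0)"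
  proof (rule integral_radial_FTC[of "\<lambda>r. (f' r)\<^sup>2 - f r * g r" "{}" "\<lambda>r. f r * l r"])
    show "continuous_on UNIV (\<lambda>r. (f' r)\<^sup>2 - f r * g r)" by (intro continuous_intros cf cf' cg)
    have d: "((\<lambda>r. f r * l r) has_real_derivative f' r * l r + - (r * g r) * f r) (at r)" for r
      by (intro DERIV_mult df dl)
    show "continuous_on {0..1} (\<lambda>r. f r * l r)" using d by (meson DERIV_isCont continuous_at_imp_continuous_on)
    show "((\<lambda>r. f r * l r) has_real_derivative r * ((f' r)\<^sup>2 - f r * g r)) (at r)" for r
    proof -
      have "f' r * l r + - (r * g r) * f r = r * ((f' r)\<^sup>2 - f r * g r)"
        unfolding l by (simp add: power2_eq_square algebra_simps)
      then show ?thesis using d[of r] by simp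
    qed
  qed simp
  then have z: "(\<integral>x. (f' (norm x))\<^sup>2 - f (norm x) * g (norm x) \<partial>disk_measure) = 0" by (simp add: f1 l)
  have ii: "integrable disk_measure (\<lambda>x. (f' (norm x))\<^sup>2)" "integrable disk_measure (\<lambda>x. f (norm x) * g (norm x))"
    by (intro integrable_disk_continuous continuous_intros continuous_on_compose2[OF cf'] continuous_on_compose2[OF cf]
        continuous_on_compose2[OF cg]; simp)+
  have "(\<integral>x. (f' (norm x))\<^sup>2 \<partial>disk_measure) = (\<integral>x. f (norm x) * g (norm x) \<partial>disk_measure)"
    using z ii by simp
  also have "\<dots> = (\<integral>x. modes.comb J a x * modes.comb J (\<lambda>i. 4 * b i * a i) x \<partial>disk_measure)"
    unfolding comb combg ..
  also have "\<dots> = (\<Sum>i\<in>J. 4 * b i * a i * modes.coef (modes.comb J a) i)"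
    by (rule modes.integral_mult_comb[OF modes.comb_square_int[OF J(1,2)] J(1,2)])
  also have "\<dots> = (\<Sum>i\<in>J. (bessel_zero 0 (snd (fst i)))\<^sup>2 * (a i)\<^sup>2)"
  proof (rule sum.cong[OF refl])
    fix i assume i: "i \<in> J"
    then have "modes.coef (modes.comb J a) i = a i" using modes.coef_comb[OF J(1,2), of i a] J(2) by auto
    then show "4 * b i * a i * modes.coef (modes.comb J a) i = (bessel_zero 0 (snd (fst i)))\<^sup>2 * (a i)\<^sup>2"
      by (simp add: b_def power_divide power2_eq_square)
  qed
  finally show ?thesis using that[OF comb df cf cf' f1] by blast
qed

text \<open>For l = 0 the eigenvalue is j^2 + m, so S splits into a Dirichlet energy and m times the
  squared L^2 norm. The estimates are proved for partial sums and passed to u by Fatou's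
  lemma.\<close>

lemma radial_bounds:
  assumes c: modes.complete_family and u: "u \<in> square_int disk_measure" and rd: "radial u" and m: "m > 0"
    and s: "(\<lambda>i. mode_symb \<alpha> m i * (modes.coef u i)\<^sup>2) summable_on idx"
    and S: "(\<Sum>\<^sub>\<infinity>i\<in>idx. mode_symb \<alpha> m i * (modes.coef u i)\<^sup>2) = S"
  shows "(\<integral>x. (u x)\<^sup>2 \<partial>disk_measure) \<le> S / m" "integrable disk_measure (\<lambda>x. u x ^ 4)"
    "(\<integral>x. u x ^ 4 \<partial>disk_measure) \<le> 2 / pi * (S\<^sup>2 / m)"
proof -
  obtain r :: "nat \<Rightarrow> nat" where r: "strict_mono r"
    "AE x in disk_measure. (\<lambda>n. modes.comb (modes.exh (r n)) (modes.coef u) x) \<longlonglongrightarrow> u x"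
    by (rule modes.complete_expansion[OF c u])
  define J where "J n = {i \<in> modes.exh (r n). fst (fst i) = 0}" for n
  have J: "finite (J n)" "J n \<subseteq> idx" "\<And>i. i \<in> J n \<Longrightarrow> fst (fst i) = 0" for n
    using modes.exh(1,2)[of "r n"] by (auto simp: J_def)
  define z where "z n = modes.comb (J n) (modes.coef u)" for n
  have z0: "modes.coef u i = 0" if "i \<in> idx" "fst (fst i) > 0" for i
    by (rule coef_radial_zero[OF u rd that])
  have z: "modes.comb (modes.exh (r n)) (modes.coef u) = z n" for n
    unfolding z_def modes.comb_def fun_eq_iff
  proof
    fix x
    show "(\<Sum>i\<in>modes.exh (r n). modes.coef u i * mode i x) = (\<Sum>i\<in>J n. modes.coef u i * mode i x)"
      by (rule sum.mono_neutral_right[OF modes.exh(1)]) (use z0 modes.exh(2)[of "r n"] in \<open>auto simp: J_def\<close>)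
  qed
  have lim: "AE x in disk_measure. (\<lambda>n. z n x) \<longlonglongrightarrow> u x" using r(2) unfolding z .
  have sgJ: "mode_symb \<alpha> m i = (bessel_zero 0 (snd (fst i)))\<^sup>2 + m" if "fst (fst i) = 0" for i
    using that by (simp add: mode_symb_def symb_def)
  have le: "(\<Sum>i\<in>J n. ((bessel_zero 0 (snd (fst i)))\<^sup>2 + m) * (modes.coef u i)\<^sup>2) \<le> S" for n
  proof -
    have "(\<Sum>i\<in>J n. ((bessel_zero 0 (snd (fst i)))\<^sup>2 + m) * (modes.coef u i)\<^sup>2) = (\<Sum>i\<in>J n. mode_symb \<alpha> m i * (modes.coef u i)\<^sup>2)"
      by (rule sum.cong) (simp_all add: sgJ J(3))
    also have "\<dots> \<le> S"
      unfolding S[symmetric]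
    proof (rule finite_sum_le_infsum[OF s J(1,2)])
      fix i assume "i \<in> idx - J n"
      then show "0 \<le> mode_symb \<alpha> m i * (modes.coef u i)\<^sup>2"
        using z0[of i] sgJ[of i] m by (cases "fst (fst i) = 0") auto
    qed
    finally show ?thesis .
  qed
  have D: "(\<Sum>i\<in>J n. (bessel_zero 0 (snd (fst i)))\<^sup>2 * (modes.coef u i)\<^sup>2) \<le> S" for n
    by (rule order_trans[OF sum_mono le]) (use m in \<open>simp add: distrib_right\<close>)
  have A: "(\<integral>x. (z n x)\<^sup>2 \<partial>disk_measure) \<le> S / m" for n
  proof -
    have "(\<integral>x. (z n x)\<^sup>2 \<partial>disk_measure) = (\<Sum>i\<in>J n. (modes.coef u i)\<^sup>2)"
      unfolding z_def by (rule modes.integral_comb_square[OF J(1,2)])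
    moreover have "m * (\<Sum>i\<in>J n. (modes.coef u i)\<^sup>2) \<le> S"
      unfolding sum_distrib_left by (rule order_trans[OF sum_mono le]) (simp add: distrib_right)
    ultimately show ?thesis using m by (simp add: pos_le_divide_eq mult.commute)
  qed
  have S0: "S \<ge> 0"
    using order_trans[OF sum_nonneg D, of 0] by simp
  have Q: "integrable disk_measure (\<lambda>x. z n x ^ 4) \<and> (\<integral>x. z n x ^ 4 \<partial>disk_measure) \<le> 2 / pi * (S\<^sup>2 / m)" for n
  proof -
    obtain f f' where f: "\<And>x. z n x = f (norm x)" "\<And>r. (f has_real_derivative f' r) (at r)"
      "continuous_on UNIV f" "continuous_on UNIV f'" "f 1 = 0"
      "(\<integral>x. (f' (norm x))\<^sup>2 \<partial>disk_measure) = (\<Sum>i\<in>J n. (bessel_zero 0 (snd (fst i)))\<^sup>2 * (modes.coef u i)\<^sup>2)"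
      by (rule radial_comb[OF J(1)[of n] J(2) J(3)[of _ n], where a = "modes.coef u", folded z_def]) (assumption, rule that)
    have cn: "continuous_on UNIV (\<lambda>x::real^2. f (norm x))" "continuous_on UNIV (\<lambda>x::real^2. f' (norm x))"
      by (intro continuous_on_compose2[OF f(3)] continuous_on_compose2[OF f(4)] continuous_intros; simp)+
    have i: "integrable disk_measure (\<lambda>x. (f (norm x))\<^sup>2)" "integrable disk_measure (\<lambda>x. (f' (norm x))\<^sup>2)"
      "integrable disk_measure (\<lambda>x. \<bar>f (norm x) * f' (norm x)\<bar>)" "integrable disk_measure (\<lambda>x. z n x ^ 4)"
      unfolding f(1) by (intro integrable_disk_continuous continuous_intros cn)+
    \<comment> \<open>Weight in |f f'| \<le> (q/2) f^2 + f'^2/(2q): for q = sqrt m the bounds S/m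
      and S contribute S/(2q) each.\<close>
    define q where "q = sqrt m"
    have q: "q > 0" "q * q = m" using m by (simp_all add: q_def)
    have "(\<integral>x. \<bar>f (norm x) * f' (norm x)\<bar> \<partial>disk_measure)
      \<le> (\<integral>x. q / 2 * (f (norm x))\<^sup>2 + 1 / (2 * q) * (f' (norm x))\<^sup>2 \<partial>disk_measure)"
    proof (rule integral_mono[OF i(3)])
      show "integrable disk_measure (\<lambda>x. q / 2 * (f (norm x))\<^sup>2 + 1 / (2 * q) * (f' (norm x))\<^sup>2)"
        by (intro Bochner_Integration.integrable_add integrable_mult_right i)
      fix x :: "real^2"
      define A B where "A = \<bar>f (norm x)\<bar>" and "B = \<bar>f' (norm x)\<bar>"
      have "0 \<le> (q * A - B)\<^sup>2" by simp
      then have "2 * (q * (A * B)) \<le> q\<^sup>2 * A\<^sup>2 + B\<^sup>2" by (simp add: power2_diff power_mult_distrib mult.assoc)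
      then have "A * B \<le> (q\<^sup>2 * A\<^sup>2 + B\<^sup>2) / (2 * q)" using q(1) by (simp add: pos_le_divide_eq mult_ac)
      also have "\<dots> = q / 2 * A\<^sup>2 + 1 / (2 * q) * B\<^sup>2" using q(1) by (simp add: add_divide_distrib power2_eq_square)
      finally show "\<bar>f (norm x) * f' (norm x)\<bar> \<le> q / 2 * (f (norm x))\<^sup>2 + 1 / (2 * q) * (f' (norm x))\<^sup>2"
        by (simp add: A_def B_def abs_mult)
    qed
    also have "\<dots> = q / 2 * (\<integral>x. (f (norm x))\<^sup>2 \<partial>disk_measure) + 1 / (2 * q) * (\<integral>x. (f' (norm x))\<^sup>2 \<partial>disk_measure)"
      using i by simp
    also have "\<dots> \<le> q / 2 * (S / m) + 1 / (2 * q) * S"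
      using A[of n] D[of n] q(1) unfolding f(1) f(6) by (intro add_mono mult_left_mono) auto
    also have "\<dots> = S / q" using q(1) unfolding q(2)[symmetric] by (simp add: field_simps)
    finally have "(\<integral>x. \<bar>f (norm x) * f' (norm x)\<bar> \<partial>disk_measure)\<^sup>2 \<le> (S / q)\<^sup>2"
      by (intro power_mono Bochner_Integration.integral_nonneg) auto
    also have "\<dots> = S\<^sup>2 / m" using q(2) by (simp add: power_divide power2_eq_square)
    finally have "2 / pi * (\<integral>x. \<bar>f (norm x) * f' (norm x)\<bar> \<partial>disk_measure)\<^sup>2 \<le> 2 / pi * (S\<^sup>2 / m)"
      by (intro mult_left_mono) auto
    then show ?thesis using radial_quartic[OF f(2,4,5)] i(4) unfolding f(1) by linarith
  qed
  have l2: "AE x in disk_measure. (\<lambda>n. (z n x)\<^sup>2) \<longlonglongrightarrow> (u x)\<^sup>2"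
    and l4: "AE x in disk_measure. (\<lambda>n. z n x ^ 4) \<longlonglongrightarrow> u x ^ 4"
    using lim by (auto elim!: eventually_mono intro: tendsto_power)
  have um [measurable]: "u \<in> borel_measurable disk_measure" by (rule square_intD(1)[OF u])
  have i2: "integrable disk_measure (\<lambda>x. (z n x)\<^sup>2)" for n
    unfolding z_def by (rule square_intD(2)[OF modes.comb_square_int[OF J(1,2)]])
  show "(\<integral>x. (u x)\<^sup>2 \<partial>disk_measure) \<le> S / m"
    by (rule Fatou_real(2)[OF i2 _ l2 _ A tendsto_const]) simp_all
  show "integrable disk_measure (\<lambda>x. u x ^ 4)"
    by (rule Fatou_real(1)[of _ "\<lambda>n x. z n x ^ 4", OF _ _ l4 _ _ tendsto_const]) (use Q in auto)
  show "(\<integral>x. u x ^ 4 \<partial>disk_measure) \<le> 2 / pi * (S\<^sup>2 / m)"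
    by (rule Fatou_real(2)[of _ "\<lambda>n x. z n x ^ 4", OF _ _ l4 _ _ tendsto_const]) (use Q in auto)
qed

lemma radial_critical_point_energy:
  assumes p: "2 < p" "p < 4" and u: "critical_point p \<alpha> m u" and rd: "radial u" and m: "m > 0"
    and pos: "energy p \<alpha> m u > 0"
  shows "energy p \<alpha> m u \<ge> (1 / 2 - 1 / p) * (m / 2) powr (2 / (p - 2))"
proof -
  define S where "S = (\<integral>x. \<bar>u x\<bar> powr p \<partial>disk_measure)"
  note f = critical_point_facts[OF p(1) u, folded S_def]
  note b = radial_bounds[OF embedding_of_critical_point(1)[OF p(1) u] f(1) rd m f(3,4)]
  have p2: "1 / 2 - 1 / p > 0" using p by (simp add: field_simps)
  \<comment> \<open>Positive energy excludes u = 0, for which dividing by S below would be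
    impossible.\<close>
  then have S0: "S > 0" using pos unfolding f(5) by (simp add: zero_less_mult_iff)
  \<comment> \<open>Level of the interpolation |t|^p \<le> s^(p-2) t^2 + s^(p-4) t^4. With s^2 = S
    both terms yield the same power of S; the second term covers |t| > s because p < 4.\<close>
  define s where "s = sqrt S"
  have s: "s > 0" using S0 by (simp add: s_def)
  have pt: "\<bar>t\<bar> powr p \<le> s powr (p - 2) * t\<^sup>2 + s powr (p - 4) * t ^ 4" for t :: real
  proof (cases "\<bar>t\<bar> \<le> s")
    case True
    have "\<bar>t\<bar> powr p = \<bar>t\<bar> powr (p - 2) * t\<^sup>2" by (rule abs_powr_mult_square[symmetric])
    also have "\<dots> \<le> s powr (p - 2) * t\<^sup>2" using True p by (intro mult_right_mono powr_mono2) auto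
    finally show ?thesis by (simp add: add_increasing2)
  next
    case False
    have "\<bar>t\<bar> powr p = \<bar>t\<bar> powr (p - 2) * t\<^sup>2" by (rule abs_powr_mult_square[symmetric])
    also have "\<bar>t\<bar> powr (p - 2) = \<bar>t\<bar> powr (p - 4) * t\<^sup>2" using abs_powr_mult_square[of t "p - 2"] by simp
    also have "\<bar>t\<bar> powr (p - 4) * t\<^sup>2 * t\<^sup>2 = \<bar>t\<bar> powr (p - 4) * t ^ 4" by (simp add: power2_eq_square power4_eq_xxxx)
    also have "\<dots> \<le> s powr (p - 4) * t ^ 4"
      using False s p by (intro mult_right_mono powr_mono2') auto
    finally show ?thesis by (simp add: add_increasing)
  qed
  have "S \<le> (\<integral>x. s powr (p - 2) * (u x)\<^sup>2 + s powr (p - 4) * u x ^ 4 \<partial>disk_measure)"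
    unfolding S_def using f(2) square_intD(2)[OF f(1)] b(2) pt by (intro integral_mono) auto
  also have "\<dots> = s powr (p - 2) * (\<integral>x. (u x)\<^sup>2 \<partial>disk_measure) + s powr (p - 4) * (\<integral>x. u x ^ 4 \<partial>disk_measure)"
    using square_intD(2)[OF f(1)] b(2) by simp
  also have "\<dots> \<le> s powr (p - 2) * (S / m) + s powr (p - 4) * (2 / pi * (S\<^sup>2 / m))"
    by (intro add_mono mult_left_mono b) auto
  also have "\<dots> = (1 + 2 / pi) * (s powr (p - 2) * S / m)"
  proof -
    have "s powr (p - 2) = s powr (p - 4) * s\<^sup>2" using abs_powr_mult_square[of s "p - 2"] s by simp
    also have "s\<^sup>2 = S" using S0 by (simp add: s_def)
    finally have "s powr (p - 4) * S\<^sup>2 = s powr (p - 2) * S" by (simp add: power2_eq_square)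
    then have "s powr (p - 4) * (2 / pi * (S\<^sup>2 / m)) = 2 / pi * (s powr (p - 2) * S / m)"
      by (metis (no_types, opaque_lifting) mult.left_commute times_divide_eq_right)
    then show ?thesis by (simp only: distrib_right mult_1_left times_divide_eq_right add_divide_distrib)
  qed
  \<comment> \<open>1 + 2/\<pi> \<le> 2; this is the origin of m/2 in the bound.\<close>
  also have "\<dots> \<le> 2 * (s powr (p - 2) * S / m)"
    using pi_gt3 S0 m by (intro mult_right_mono) (auto simp: field_simps)
  finally have "S * 1 \<le> S * (2 * s powr (p - 2) / m)" by (simp add: mult_ac)
  then have "1 \<le> 2 * s powr (p - 2) / m" by (rule mult_left_le_imp_le[OF _ S0])
  then have "m / 2 \<le> s powr (p - 2)" using m by (simp add: field_simps)
  then have "(m / 2) powr (2 / (p - 2)) \<le> (s powr (p - 2)) powr (2 / (p - 2))"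
    using p m by (intro powr_mono2) auto
  also have "\<dots> = s powr ((p - 2) * (2 / (p - 2)))" by (rule powr_powr)
  also have "(p - 2) * (2 / (p - 2)) = 2" using p by (simp add: divide_simps)
  also have "s powr 2 = s\<^sup>2" using s by (simp add: powr_numeral)
  also have "\<dots> = S" using S0 by (simp add: s_def)
  finally show ?thesis unfolding f(5) using p2 by (intro mult_left_mono) auto
qed

theorem theorem5p12:
  fixes \<alpha> p :: real
  assumes "\<alpha> \<in> admissible" and "2 < p" and "p < 4"
  shows "\<exists>m0>0. \<forall>m>m0. \<forall>u. ground_state p \<alpha> m u \<longrightarrow> \<not> radial u"
proof -
  note p = assms(2,3)
  have "\<alpha> > 1" using assms(1) by (simp add: admissible_def)
  then obtain D where D: "D > 0" "\<And>m. m \<ge> 1 \<Longrightarrow> \<exists>l. 0 < symb \<alpha> m l 1 \<and> symb \<alpha> m l 1 \<le> D * sqrt m"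
    using ex_small_positive_symb by blast
  define q where "q = 1 / (p - 2)"
  have q: "q > 0" using p by (simp add: q_def)
  define c where "c = (1 / 2 - 1 / p) * (1 / 2) powr (2 * q)"
  have c: "c > 0" using p by (simp add: c_def field_simps)
  define C where "C = pi / p * (p * D / 2) powr (p * q)"
  have C: "C > 0" using p D(1) by (simp add: C_def)
  \<comment> \<open>The gap 2/(p - 2) - p/(2(p - 2)) between the two growth exponents, positive
    precisely because p < 4.\<close>
  define t where "t = (2 - p / 2) * q"
  have t: "t > 0" using p q by (simp add: t_def)
  \<comment> \<open>Beyond this value c m^t > C, which contradicts the combined bounds; the maximum
    with 1 reaches the range in which small positive eigenvalues are provided.\<close>
  define m0 where "m0 = max 1 ((C / c) powr (1 / t))"
  have "\<not> radial u" if m: "m > m0" and gs: "ground_state p \<alpha> m u" for m u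
  proof
    assume rd: "radial u"
    have m1: "m > 1" "m > (C / c) powr (1 / t)" using m by (auto simp: m0_def)
    have cp: "critical_point p \<alpha> m u" "energy p \<alpha> m u = ground_level p \<alpha> m"
      using gs by (auto simp: ground_state_def)
    obtain l where l: "0 < symb \<alpha> m l 1" "symb \<alpha> m l 1 \<le> D * sqrt m" using D(2)[of m] m1 by auto
    note b = ground_level_bounds[OF p(1) cp(1) l(1)]
    have "c * m powr (2 * q) = (1 / 2 - 1 / p) * (m / 2) powr (2 / (p - 2))"
      using m1 by (simp add: c_def q_def powr_divide)
    also have "\<dots> \<le> energy p \<alpha> m u"
      by (rule radial_critical_point_energy[OF p cp(1) rd]) (use m1 b(1) cp(2) in auto)
    also have "\<dots> \<le> pi / p * (p * symb \<alpha> m l 1 / 2) powr (p / (p - 2))" using b(2) cp(2) by simp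
    also have "\<dots> \<le> pi / p * (p * (D * sqrt m) / 2) powr (p / (p - 2))"
      using p l by (intro mult_left_mono powr_mono2 divide_right_mono) auto
    also have "\<dots> = C * m powr (p / 2 * q)"
    proof -
      have "p * (D * sqrt m) / 2 = (p * D / 2) * m powr (1 / 2)" using m1 by (simp add: powr_half_sqrt)
      then have "(p * (D * sqrt m) / 2) powr (p * q) = (p * D / 2) powr (p * q) * (m powr (1 / 2)) powr (p * q)"
        using p D(1) by (simp only: powr_mult)
      also have "(m powr (1 / 2)) powr (p * q) = m powr (p / 2 * q)" by (simp add: powr_powr)
      finally show ?thesis by (simp add: C_def q_def)
    qed
    finally have "c * (m powr t * m powr (p / 2 * q)) \<le> C * m powr (p / 2 * q)"
      by (simp add: t_def left_diff_distrib flip: powr_add)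
    then have "(c * m powr t) * m powr (p / 2 * q) \<le> C * m powr (p / 2 * q)" by (simp only: mult.assoc)
    then have "c * m powr t \<le> C" using m1 by simp
    then have le: "m powr t \<le> C / c" using c by (simp add: pos_le_divide_eq mult.commute)
    have "m = (m powr t) powr (1 / t)" using m1 t by (simp add: powr_powr)
    also have "\<dots> \<le> (C / c) powr (1 / t)" using le t by (intro powr_mono2) auto
    finally show False using m1 by simp
  qed
  moreover have "m0 > 0" by (simp add: m0_def)
  ultimately show ?thesis by blast
qed


end
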